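(* Let $m\ge1$, $1<p<\infty$, $\omega\in A_p(\mathbb{R}^n)$, let $\mathscr{T}$ be a simplicial mesh of $\Omega$ from the shape regular family $\mathbb{T}$, and let $T\in\mathscr{T}$ be such that $\partial T\cap\partial\Omega=\emptyset$. If $v\in W^{m+1}_p(\omega,S_T)$, then $$|v-\Pi_{\mathscr{T}}v|_{W^k_p(\omega,T)}\le C\,h_T^{m+1-k}\,|v|_{W^{m+1}_p(\omega,S_T)},\qquad k=0,1,\dots,m+1,$$ where the constant $C$ depends only on $C_{p,\omega}$, $\sigma$, $\psi$ and $m$ (and on the fixed $n$, $p$).
   Context: $\Omega\subset\mathbb{R}^n$, $n\ge1$, is open, bounded, connected, with polyhedral Lipschitz boundary. A weight is $\omega\in L^1_{\rm loc}(\mathbb{R}^n)$ with $\omega>0$ a.e. For $1<p<\infty$, $\omega\in A_p(\mathbb{R}^n)$ means $C_{p,\omega}=\sup_B\big(\frac1{|B|}\int_B\omega\big)\big(\frac1{|B|}\int_B\omega^{1/(1-p)}\big)^{p-1}<\infty$, the supremum being over all balls $B$. $\|u\|_{L^p(\omega,D)}=(\int_D|u|^p\omega)^{1/p}$; $W^k_p(\omega,D)$ is the set of $u\in L^p(\omega,D)$ with weak derivatives $D^\kappa u\in L^p(\omega,D)$ for $|\kappa|\le k$, and $|u|_{W^k_p(\omega,D)}=(\sum_{|\kappa|=k}\|D^\kappa u\|^p_{L^p(\omega,D)})^{1/p}$. Meshes: $\mathbb{T}$ is a family of conforming meshes $\mathscr{T}=\{T\}$ of $\Omega$ into (closed) simplices,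 shape regular: $h_T/\rho_T\le\sigma$ for all $T\in\mathscr{T}\in\mathbb{T}$, with a fixed $\sigma>1$, $h_T=\mathrm{diam}\,T$, $\rho_T$ the diameter of the ball inscribed in $T$. $\mathbb{V}(\mathscr{T})$ is the space of $W\in C^0(\bar\Omega)$ with $W|_T\in\mathbb{P}_m$ (polynomials of total degree at most $m$) for all $T\in\mathscr{T}$ and $W|_{\partial\Omega}=0$. Nodes are the Lagrange nodes of the degree $m$ elements; a node is interior if it does not lie on $\partial\Omega$; $\phi_z\in\mathbb{V}(\mathscr{T})$ is the nodal basis function of the interior node $z$ ($\phi_z(y)=\delta_{yz}$ for all nodes $y$). For a node $z$, $S_z=\bigcup_{T\ni z}T$ and $h_z=\min\{h_T:z\in T\}$; for $T\in\mathscr{T}$, $S_T=\bigcup_{z\in T}S_z$ (union over nodes $z$ in $T$). Quasi-interpolant: $\psi\in C^\infty(\mathbb{R}^n)$ is fixed with $\int\psi=1$ and support in the ball of radius $r=r(\sigma)$ centered at $0$, and $\psi_z(x)=\frac{(m+1)^n}{h_z^n}\psi\big(\frac{(m+1)(z-x)}{h_z}\big)$, where $r$ is chosen so small that $\mathrm{supp}\,\psi_z\subset S_z$ for every interior node $z$ of every mesh of the family. The averaged Taylor polynomial is $Q^m_zv(y)=\int\sum_{|\alpha|\le m}\frac1{\alpha!}D^\alpha v(x)(y-x)^\alpha\psi_z(x)\,dx$, extended to $v\in L^1$ through integration by parts: $Q_z^mv(y)=\sum_{|\alpha|\le m}\frac{(-1)^{|\alpha|}}{\alpha!}\int v(x)D_x^\alpha[(y-x)^\alpha\psi_z(x)]\,dx$.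 Finally $\Pi_{\mathscr{T}}v=\sum_{z}Q^m_zv(z)\,\phi_z$, the sum being over interior nodes $z$. *)

theory Defs
  imports "HOL-Analysis.Analysis"
begin

subsection \<open>Multi-indices, iterated partial derivatives and polynomials\<close>

type_synonym 'n mindex = "'n \<Rightarrow> nat"

definition mi_size :: "'n::finite mindex \<Rightarrow> nat" where
  "mi_size \<alpha> = (\<Sum>i\<in>UNIV. \<alpha> i)"

definition mi_fact :: "'n::finite mindex \<Rightarrow> real" where
  "mi_fact \<alpha> = (\<Prod>i\<in>UNIV. fact (\<alpha> i))"

definition mi_pow :: "real^'n \<Rightarrow> 'n::finite mindex \<Rightarrow> real" where
  "mi_pow x \<alpha> = (\<Prod>i\<in>UNIV. (x $ i) ^ \<alpha> i)"

definition pderiv_dir :: "'n::finite \<Rightarrow> (real^'n \<Rightarrow> real) \<Rightarrow> real^'n \<Rightarrow> real" where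
  "pderiv_dir i f x = frechet_derivative f (at x) (axis i 1)"

primrec pderiv_list :: "'n::finite list \<Rightarrow> (real^'n \<Rightarrow> real) \<Rightarrow> real^'n \<Rightarrow> real" where
  "pderiv_list [] f = f"
| "pderiv_list (i # js) f = pderiv_dir i (pderiv_list js f)"

text \<open>\<open>C\<^sup>\<infinity>\<close> on the whole space: every iterated partial derivative is differentiable everywhere
  (hence also continuous).\<close>

definition smooth :: "(real^'n \<Rightarrow> real) \<Rightarrow> bool" where
  "smooth f \<longleftrightarrow> (\<forall>js. pderiv_list js f differentiable_on UNIV)"

text \<open>The classical derivative \<open>D\<^sup>\<alpha> f\<close>. It is only applied to smooth functions, for which the order
  of differentiation (the order of the chosen list) is immaterial.\<close>

definition mi_deriv :: "'n::finite mindex \<Rightarrow> (real^'n \<Rightarrow> real) \<Rightarrow> real^'n \<Rightarrow> real" where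
  "mi_deriv \<alpha> f = pderiv_list (SOME js. \<forall>i. count_list js i = \<alpha> i) f"

lemma ex_mi_list: "\<exists>js. \<forall>i. count_list js i = (\<alpha> :: 'n::finite mindex) i"
proof -
  have "\<exists>js. \<forall>i. count_list js i = (if i \<in> A then \<alpha> i else 0)" if "finite A" for A :: "'n set"
    using that
  proof induction
    case empty
    show ?case by (rule exI[of _ "[]"]) simp
  next
    case (insert a A)
    then obtain js where js: "\<forall>i. count_list js i = (if i \<in> A then \<alpha> i else 0)" by blast
    have rep: "count_list (replicate k a) i = (if i = a then k else 0)" for k i
      by (induction k) auto
    show ?case
      by (rule exI[of _ "replicate (\<alpha> a) a @ js"]) (use js insert.hyps in \<open>auto simp: rep\<close>)
  qed
  from this[of UNIV] show ?thesis by simp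
qed

definition poly_on :: "nat \<Rightarrow> (real^'n) set \<Rightarrow> (real^'n \<Rightarrow> real) \<Rightarrow> bool" where
  "poly_on m S f \<longleftrightarrow>
     (\<exists>c. \<forall>x\<in>S. f x = (\<Sum>\<alpha> | mi_size \<alpha> \<le> m. c \<alpha> * mi_pow x \<alpha>))"

definition fsupport :: "(real^'n \<Rightarrow> real) \<Rightarrow> (real^'n) set" where
  "fsupport f = closure {x. f x \<noteq> 0}"

subsection \<open>Weights and weighted Sobolev spaces\<close>

definition locally_integrable_on :: "(real^'n) set \<Rightarrow> (real^'n \<Rightarrow> real) \<Rightarrow> bool" where
  "locally_integrable_on U f \<longleftrightarrow> (\<forall>K. compact K \<and> K \<subseteq> U \<longrightarrow> set_integrable lebesgue K f)"

definition weight :: "(real^'n \<Rightarrow> real) \<Rightarrow> bool" where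
  "weight \<omega> \<longleftrightarrow> locally_integrable_on UNIV \<omega> \<and> (AE x in lebesgue. 0 < \<omega> x)"

definition average_on :: "(real^'n) set \<Rightarrow> (real^'n \<Rightarrow> real) \<Rightarrow> real" where
  "average_on B f = (LINT x:B|lebesgue. f x) / measure lebesgue B"

definition Ap_quotient :: "real \<Rightarrow> (real^'n \<Rightarrow> real) \<Rightarrow> (real^'n) set \<Rightarrow> real" where
  "Ap_quotient p \<omega> B =
     average_on B \<omega> * (average_on B (\<lambda>x. \<omega> x powr (1 / (1 - p)))) powr (p - 1)"

definition balls :: "(real^'n) set set" where
  "balls = {ball c s | c s. 0 < s}"

text \<open>Finiteness of the supremum in \<open>[0,\<infinity>]\<close> amounts to integrability of both functions on every
  ball together with boundedness of the real quotients; it has to be spelled out because a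
  non-integrable function has the Bochner integral \<open>0\<close>.\<close>

definition Ap_weight :: "real \<Rightarrow> (real^'n \<Rightarrow> real) \<Rightarrow> bool" where
  "Ap_weight p \<omega> \<longleftrightarrow> weight \<omega> \<and>
     (\<forall>B\<in>balls. set_integrable lebesgue B (\<lambda>x. \<omega> x powr (1 / (1 - p)))) \<and>
     bdd_above (Ap_quotient p \<omega> ` balls)"

definition Ap_const :: "real \<Rightarrow> (real^'n \<Rightarrow> real) \<Rightarrow> real" where
  "Ap_const p \<omega> = (SUP B\<in>balls. Ap_quotient p \<omega> B)"

definition Lp_space :: "real \<Rightarrow> (real^'n \<Rightarrow> real) \<Rightarrow> (real^'n) set \<Rightarrow> (real^'n \<Rightarrow> real) set" where
  "Lp_space p \<omega> D = {u. set_borel_measurable lebesgue D u \<and>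
     set_integrable lebesgue D (\<lambda>x. \<bar>u x\<bar> powr p * \<omega> x)}"

definition Lp_norm :: "real \<Rightarrow> (real^'n \<Rightarrow> real) \<Rightarrow> (real^'n) set \<Rightarrow> (real^'n \<Rightarrow> real) \<Rightarrow> real" where
  "Lp_norm p \<omega> D u = (LINT x:D|lebesgue. \<bar>u x\<bar> powr p * \<omega> x) powr (1 / p)"

definition test_function :: "(real^'n) set \<Rightarrow> (real^'n \<Rightarrow> real) \<Rightarrow> bool" where
  "test_function U \<phi> \<longleftrightarrow> smooth \<phi> \<and> compact (fsupport \<phi>) \<and> fsupport \<phi> \<subseteq> U"

text \<open>\<open>D\<close> may be a closed set such as a simplex or a patch of simplices; Sobolev regularity on \<open>D\<close>
  then refers to the open set \<open>interior D\<close>.\<close>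

definition is_weak_deriv ::
  "(real^'n) set \<Rightarrow> 'n::finite mindex \<Rightarrow> (real^'n \<Rightarrow> real) \<Rightarrow> (real^'n \<Rightarrow> real) \<Rightarrow> bool" where
  "is_weak_deriv D \<kappa> u g \<longleftrightarrow>
     locally_integrable_on (interior D) u \<and> locally_integrable_on (interior D) g \<and>
     (\<forall>\<phi>. test_function (interior D) \<phi> \<longrightarrow>
        (LINT x:interior D|lebesgue. u x * mi_deriv \<kappa> \<phi> x) =
        (- 1) ^ mi_size \<kappa> * (LINT x:interior D|lebesgue. g x * \<phi> x))"

definition weak_deriv ::
  "(real^'n) set \<Rightarrow> 'n::finite mindex \<Rightarrow> (real^'n \<Rightarrow> real) \<Rightarrow> real^'n \<Rightarrow> real" where
  "weak_deriv D \<kappa> u = (SOME g. is_weak_deriv D \<kappa> u g)"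

definition sobolev ::
  "nat \<Rightarrow> real \<Rightarrow> (real^'n \<Rightarrow> real) \<Rightarrow> (real^'n) set \<Rightarrow> (real^'n \<Rightarrow> real) set" where
  "sobolev k p \<omega> D = {u \<in> Lp_space p \<omega> (interior D).
     \<forall>\<kappa>. mi_size \<kappa> \<le> k \<longrightarrow> (\<exists>g \<in> Lp_space p \<omega> (interior D). is_weak_deriv D \<kappa> u g)}"

definition sobolev_seminorm ::
  "nat \<Rightarrow> real \<Rightarrow> (real^'n \<Rightarrow> real) \<Rightarrow> (real^'n) set \<Rightarrow> (real^'n \<Rightarrow> real) \<Rightarrow> real" where
  "sobolev_seminorm k p \<omega> D u =
     (\<Sum>\<kappa> | mi_size \<kappa> = k. Lp_norm p \<omega> (interior D) (weak_deriv D \<kappa> u) powr p) powr (1 / p)"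

subsection \<open>Domains and simplicial meshes\<close>

text \<open>Near each boundary point the domain is, in suitable orthogonal coordinates with vertical
  direction \<open>e\<close>, the part above the graph of a Lipschitz function on the hyperplane
  orthogonal to \<open>e\<close>.\<close>

definition lipschitz_boundary :: "(real^'n) set \<Rightarrow> bool" where
  "lipschitz_boundary \<Omega> \<longleftrightarrow> (\<forall>x\<in>frontier \<Omega>. \<exists>e U g L.
     norm e = 1 \<and> open U \<and> x \<in> U \<and> L-lipschitz_on {y. y \<bullet> e = 0} g \<and>
     \<Omega> \<inter> U = {y \<in> U. g (y - (y \<bullet> e) *\<^sub>R e) < y \<bullet> e})"

definition polyhedral_boundary :: "(real^'n) set \<Rightarrow> bool" where
  "polyhedral_boundary \<Omega> \<longleftrightarrow>
     (\<exists>P. finite P \<and> (\<forall>K\<in>P. polytope K) \<and> frontier \<Omega> = \<Union>P)"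

definition polyhedral_domain :: "(real^'n) set \<Rightarrow> bool" where
  "polyhedral_domain \<Omega> \<longleftrightarrow> open \<Omega> \<and> bounded \<Omega> \<and> connected \<Omega> \<and> \<Omega> \<noteq> {} \<and>
     polyhedral_boundary \<Omega> \<and> lipschitz_boundary \<Omega>"

definition conforming_mesh :: "(real^'n) set \<Rightarrow> (real^'n) set set \<Rightarrow> bool" where
  "conforming_mesh \<Omega> M \<longleftrightarrow>
     triangulation M \<and> (\<forall>T\<in>M. int CARD('n) simplex T) \<and> \<Union>M = closure \<Omega>"

definition inball_diameter :: "(real^'n) set \<Rightarrow> real" where
  "inball_diameter T = Sup {2 * s | s. 0 \<le> s \<and> (\<exists>c. cball c s \<subseteq> T)}"

definition shape_regular_family :: "real \<Rightarrow> (real^'n) set \<Rightarrow> (real^'n) set set set \<Rightarrow> bool" where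
  "shape_regular_family \<sigma> \<Omega> MM \<longleftrightarrow>
     (\<forall>M\<in>MM. conforming_mesh \<Omega> M \<and> (\<forall>T\<in>M. diameter T / inball_diameter T \<le> \<sigma>))"

subsection \<open>Lagrange finite elements of degree \<open>m\<close>\<close>

text \<open>The principal lattice: points whose barycentric coordinates are multiples of \<open>1/m\<close>.\<close>

definition lagrange_nodes :: "nat \<Rightarrow> (real^'n) set \<Rightarrow> (real^'n) set" where
  "lagrange_nodes m T = {\<Sum>a | a extreme_point_of T. (real (j a) / real m) *\<^sub>R a | j :: real^'n \<Rightarrow> nat.
     (\<Sum>a | a extreme_point_of T. j a) = m}"

definition mesh_nodes :: "nat \<Rightarrow> (real^'n) set set \<Rightarrow> (real^'n) set" where
  "mesh_nodes m M = (\<Union>T\<in>M. lagrange_nodes m T)"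

definition interior_nodes :: "nat \<Rightarrow> (real^'n) set \<Rightarrow> (real^'n) set set \<Rightarrow> (real^'n) set" where
  "interior_nodes m \<Omega> M = mesh_nodes m M - frontier \<Omega>"

definition node_star :: "(real^'n) set set \<Rightarrow> real^'n \<Rightarrow> (real^'n) set" where
  "node_star M z = \<Union>{T \<in> M. z \<in> T}"

definition node_size :: "(real^'n) set set \<Rightarrow> real^'n \<Rightarrow> real" where
  "node_size M z = Min (diameter ` {T \<in> M. z \<in> T})"

definition element_patch :: "nat \<Rightarrow> (real^'n) set set \<Rightarrow> (real^'n) set \<Rightarrow> (real^'n) set" where
  "element_patch m M T = (\<Union>z \<in> mesh_nodes m M \<inter> T. node_star M z)"

text \<open>Functions on \<open>closure \<Omega>\<close> are represented by their extension by \<open>0\<close> to the whole space, so that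
  elements of the finite element space are determined by their values on \<open>closure \<Omega>\<close>.\<close>

definition fe_space ::
  "nat \<Rightarrow> (real^'n) set \<Rightarrow> (real^'n) set set \<Rightarrow> (real^'n \<Rightarrow> real) set" where
  "fe_space m \<Omega> M = {W. continuous_on (closure \<Omega>) W \<and> (\<forall>T\<in>M. poly_on m T W) \<and>
     (\<forall>x\<in>frontier \<Omega>. W x = 0) \<and> (\<forall>x. x \<notin> closure \<Omega> \<longrightarrow> W x = 0)}"

definition nodal_basis ::
  "nat \<Rightarrow> (real^'n) set \<Rightarrow> (real^'n) set set \<Rightarrow> real^'n \<Rightarrow> real^'n \<Rightarrow> real" where
  "nodal_basis m \<Omega> M z = (THE \<phi>. \<phi> \<in> fe_space m \<Omega> M \<and>
     (\<forall>y \<in> mesh_nodes m M. \<phi> y = (if y = z then 1 else 0)))"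

subsection \<open>Averaged Taylor polynomials and the quasi-interpolant\<close>

definition scaled_kernel ::
  "nat \<Rightarrow> (real^'n \<Rightarrow> real) \<Rightarrow> (real^'n) set set \<Rightarrow> real^'n \<Rightarrow> real^'n \<Rightarrow> real" where
  "scaled_kernel m \<psi> M z x =
     real (m + 1) ^ CARD('n) / node_size M z ^ CARD('n) *
     \<psi> ((real (m + 1) / node_size M z) *\<^sub>R (z - x))"

text \<open>The form obtained through integration by parts, which makes sense for \<open>v \<in> L\<^sup>1\<close>; only the
  values of \<open>v\<close> on the support of the scaled kernel matter.\<close>

definition averaged_taylor ::
  "nat \<Rightarrow> (real^'n \<Rightarrow> real) \<Rightarrow> (real^'n) set set \<Rightarrow> real^'n \<Rightarrow> (real^'n \<Rightarrow> real) \<Rightarrow> real^'n \<Rightarrow> real" where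
  "averaged_taylor m \<psi> M z v y =
     (\<Sum>\<alpha> | mi_size \<alpha> \<le> m. (- 1) ^ mi_size \<alpha> / mi_fact \<alpha> *
        (LINT x|lebesgue. v x * mi_deriv \<alpha> (\<lambda>x. mi_pow (y - x) \<alpha> * scaled_kernel m \<psi> M z x) x))"

definition quasi_interpolant ::
  "nat \<Rightarrow> (real^'n \<Rightarrow> real) \<Rightarrow> (real^'n) set \<Rightarrow> (real^'n) set set \<Rightarrow>
     (real^'n \<Rightarrow> real) \<Rightarrow> real^'n \<Rightarrow> real" where
  "quasi_interpolant m \<psi> \<Omega> M v x =
     (\<Sum>z \<in> interior_nodes m \<Omega> M. averaged_taylor m \<psi> M z v z * nodal_basis m \<Omega> M z x)"

end

theory Submission
 imports Defs
begin

text \<open>Let \<open>X\<close> be the union of the elements meeting the vertices of \<open>T\<close>, cut off at a distance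
  comparable to the diameter \<open>h\<close> of \<open>T\<close>. On \<open>X\<close> functions with vanishing mean over a ball in \<open>T\<close> satisfy a weighted
  Poincare inequality: on a convex piece, the fundamental theorem of calculus along segments bounds
  the oscillation of the mollified function by averages of its gradient over balls of one scale at a time,
  and such averaging is bounded on \<open>L\<^sup>p(\<omega>)\<close> by the Muckenhoupt condition; the pieces are then glued
  through balls in their overlaps. Subtract from \<open>v\<close> the polynomial \<open>P\<close> of degree \<open>m\<close> whose derivatives have the same
  means as those of \<open>v\<close>; iterating the Poincare inequality gives
  \<open>\<parallel>D\<^sup>\<nu>(v - P)\<parallel> \<le> C h\<^bsup>m+1-|\<nu>|\<^esup> |v|\<close>. The averaged Taylor polynomials and the Lagrange interpolation reproduce
  \<open>P\<close>, hence \<open>v - \<Pi>v = (v - P) - \<Sum> c\<^sub>z \<phi>\<^sub>z\<close> on \<open>T\<close>, where \<open>c\<^sub>z\<close> is the integral of \<open>v - P\<close> against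
  a kernel of size \<open>h\<^bsup>-n\<^esup>\<close>, which is bounded by the dual weight.
  In one dimension neighbouring elements need not have comparable sizes, and a supremum bound
  takes the place of the scaling argument.\<close>

text \<open>The given kernel \<psi> is itself a mollifier, so it serves twice: at scales tending to
  0 it regularises functions with weak derivatives, at the scale of a node it defines the
  interpolant. It may change sign, hence bounds use its absolute value. The constant must be fixed
  before domain, mesh and weight, so it is an explicit expression in the Muckenhoupt constant A, the
  fatness \<beta> = 1/(4 \<sigma>) of the elements, the cut-off factor R = r + 2 and numbers
  attached to \<psi>. The cut-off keeps the patch in a ball of radius (R + 1) h around a vertex, so
  that the Muckenhoupt condition on one ball compares integrals over the patch with the weight of T;
  r + 2 leaves room for the kernels at the nodes of T. The boundary hypothesis makes the vertices of
  T interior, and then a whole ball around each vertex belongs to its star. In dimension one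
  neighbours meet in a point and share no edge, so nothing bounds the ratio of their lengths; the
  fundamental theorem of calculus bounds oscillations by the total integral of the derivative
  whatever the lengths are, and the power of h comes back through the Muckenhoupt condition.\<close>

abbreviation nn_lborel :: "('a::euclidean_space \<Rightarrow> ennreal) \<Rightarrow> ennreal" (binder \<open>LBNN \<close> 10) where
  "nn_lborel f \<equiv> nn_integral lborel f"

abbreviation lborel_integral :: "('a::euclidean_space \<Rightarrow> real) \<Rightarrow> real" (binder \<open>LBI \<close> 10) where
  "lborel_integral f \<equiv> integral\<^sup>L lborel f"

subsection \<open>Calculus of smooth functions\<close>

lemma pderiv_dir_eqI: "(f has_derivative D) (at x) \<Longrightarrow> pderiv_dir i f x = D (axis i 1)"
 unfolding pderiv_dir_def using frechet_derivative_at by metis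

lemma frechet_pderiv:
 fixes f :: "real^'n \<Rightarrow> real"
 assumes "f differentiable (at x)"
 shows "(f has_derivative (\<lambda>h. \<Sum>i\<in>UNIV. h $ i * pderiv_dir i f x)) (at x)"
proof -
 obtain D where D: "(f has_derivative D) (at x)" using assms by (auto simp: differentiable_def)
 then interpret linear D by (rule has_derivative_linear)
 have "D h = (\<Sum>i\<in>UNIV. h $ i * pderiv_dir i f x)" for h
 proof -
  have "D h = D (\<Sum>i\<in>UNIV. (h $ i) *s axis i 1)" by (simp add: basis_expansion)
  also have "... = (\<Sum>i\<in>UNIV. h $ i * D (axis i 1))" by (simp add: sum scalar_mult_eq_scaleR scale)
  finally show ?thesis using pderiv_dir_eqI[OF D] by simp
 qed
 hence "D = (\<lambda>h. \<Sum>i\<in>UNIV. h $ i * pderiv_dir i f x)" by auto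
 thus ?thesis using D by simp
qed

lemma pderiv_list_append: "pderiv_list (js @ ks) f = pderiv_list js (pderiv_list ks f)" by (induction js) auto

text \<open>Closure under sums, products and substitutions is proved by induction on the order of
  differentiation with the functions left arbitrary; a finite order supplies the quantity that
  decreases.\<close>

definition smooth_upto :: "nat \<Rightarrow> (real^'n::finite \<Rightarrow> real) \<Rightarrow> bool" where
 "smooth_upto k f \<longleftrightarrow> (\<forall>js. length js \<le> k \<longrightarrow> pderiv_list js f differentiable_on UNIV)"

lemma smooth_iff_upto: "smooth f \<longleftrightarrow> (\<forall>k. smooth_upto k f)" by (auto simp: smooth_def smooth_upto_def)

lemma smooth_upto_0: "smooth_upto 0 f \<longleftrightarrow> f differentiable_on UNIV" by (simp add: smooth_upto_def)

text \<open>In \<open>pderiv_list\<close> the last entry of the list acts first. Splitting lists at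
  their right end therefore exposes a derivative of \<open>f\<close> itself, to which the product
  and chain rules apply.\<close>

lemma smooth_upto_Suc:
 "smooth_upto (Suc k) f \<longleftrightarrow> f differentiable_on UNIV \<and> (\<forall>i. smooth_upto k (pderiv_dir i f))"
proof safe
 assume a: "smooth_upto (Suc k) f"
 show "f differentiable_on UNIV" using a[unfolded smooth_upto_def, rule_format, of "[]"] by simp
 show "smooth_upto k (pderiv_dir i f)" for i unfolding smooth_upto_def
 proof (intro allI impI)
  fix js :: "'a list" assume "length js \<le> k"
  thus "pderiv_list js (pderiv_dir i f) differentiable_on UNIV"
   using a[unfolded smooth_upto_def, rule_format, of "js @ [i]"] by (simp add: pderiv_list_append)
 qed
next
 assume a: "f differentiable_on UNIV" "\<forall>i. smooth_upto k (pderiv_dir i f)"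
 show "smooth_upto (Suc k) f" unfolding smooth_upto_def
 proof (intro allI impI)
  fix js :: "'a list" assume l: "length js \<le> Suc k"
  show "pderiv_list js f differentiable_on UNIV"
  proof (cases js rule: rev_cases)
   case Nil thus ?thesis using a by simp
  next
   case (snoc ks i)
   thus ?thesis using a(2)[rule_format, of i] l by (auto simp: smooth_upto_def pderiv_list_append)
  qed
 qed
qed

lemma smooth_upto_differentiable: "smooth_upto k f \<Longrightarrow> f differentiable (at x)"
 unfolding smooth_upto_def differentiable_on_def by (auto dest: spec[of _ "[]"])

lemma smooth_upto_mono: "smooth_upto k f \<Longrightarrow> j \<le> k \<Longrightarrow> smooth_upto j f" unfolding smooth_upto_def by auto

lemma smooth_differentiable: "smooth f \<Longrightarrow> f differentiable (at x)"
 using smooth_iff_upto smooth_upto_differentiable by blast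

lemma smooth_pderiv_list: "smooth f \<Longrightarrow> smooth (pderiv_list js f)"
 unfolding smooth_def by (simp flip: pderiv_list_append)

lemma smooth_pderiv_dir: "smooth f \<Longrightarrow> smooth (pderiv_dir i f)" using smooth_pderiv_list[of f "[i]"] by simp

lemma smooth_mi_deriv: "smooth f \<Longrightarrow> smooth (mi_deriv \<nu> f)" unfolding mi_deriv_def by (rule smooth_pderiv_list)

lemma smooth_continuous: "smooth f \<Longrightarrow> continuous_on S f"
 by (meson continuous_at_imp_continuous_on differentiable_imp_continuous_within smooth_differentiable)

lemma smooth_borel: "smooth f \<Longrightarrow> f \<in> borel_measurable borel"
 using smooth_continuous borel_measurable_continuous_onI by blast

lemma pderiv_dir_const: "pderiv_dir i (\<lambda>x. c) = (\<lambda>x. 0)"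
 by (rule ext) (rule pderiv_dir_eqI, rule has_derivative_const)

lemma pderiv_dir_add:
 assumes "f differentiable (at x)" "g differentiable (at x)"
 shows "pderiv_dir i (\<lambda>x. f x + g x) x = pderiv_dir i f x + pderiv_dir i g x"
 using pderiv_dir_eqI[OF has_derivative_add[OF frechet_pderiv[OF assms(1)] frechet_pderiv[OF assms(2)]], of i]
 by (simp add: axis_def if_distrib if_distribR cong: if_cong)

lemma pderiv_dir_mult:
 assumes "f differentiable (at x)" "g differentiable (at x)"
 shows "pderiv_dir i (\<lambda>x. f x * g x) x = f x * pderiv_dir i g x + pderiv_dir i f x * g x"
 using pderiv_dir_eqI[OF has_derivative_mult[OF frechet_pderiv[OF assms(1)] frechet_pderiv[OF assms(2)]], of i]
 by (simp add: axis_def if_distrib if_distribR cong: if_cong)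

lemma smooth_upto_const: "smooth_upto k (\<lambda>x. c)"
 by (induction k arbitrary: c) (auto simp: smooth_upto_0 smooth_upto_Suc pderiv_dir_const)

lemma smooth_const: "smooth (\<lambda>x. c)" by (simp add: smooth_iff_upto smooth_upto_const)

lemma smooth_upto_add: "smooth_upto k f \<Longrightarrow> smooth_upto k g \<Longrightarrow> smooth_upto k (\<lambda>x. f x + g x)"
proof (induction k arbitrary: f g)
 case 0 thus ?case by (auto simp: smooth_upto_0 intro: differentiable_on_add)
next
 case (Suc k)
 have "pderiv_dir i (\<lambda>x. f x + g x) = (\<lambda>x. pderiv_dir i f x + pderiv_dir i g x)" for i
  using pderiv_dir_add smooth_upto_differentiable Suc.prems by blast
 thus ?case using Suc by (auto simp: smooth_upto_Suc intro: differentiable_on_add)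
qed

lemma smooth_add: "smooth f \<Longrightarrow> smooth g \<Longrightarrow> smooth (\<lambda>x. f x + g x)" by (simp add: smooth_iff_upto smooth_upto_add)

lemma smooth_upto_mult: "smooth_upto k f \<Longrightarrow> smooth_upto k g \<Longrightarrow> smooth_upto k (\<lambda>x. f x * g x)"
proof (induction k arbitrary: f g)
 case 0 thus ?case by (auto simp: smooth_upto_0 intro: differentiable_on_mult)
next
 case (Suc k)
 have e: "pderiv_dir i (\<lambda>x. f x * g x) = (\<lambda>x. f x * pderiv_dir i g x + pderiv_dir i f x * g x)" for i
  using pderiv_dir_mult smooth_upto_differentiable Suc.prems by blast
 have "smooth_upto k f" "smooth_upto k g" using Suc.prems smooth_upto_mono[of "Suc k" _ k] by auto
 hence "smooth_upto k (pderiv_dir i (\<lambda>x. f x * g x))" for i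
  unfolding e using Suc by (intro smooth_upto_add Suc.IH) (auto simp: smooth_upto_Suc)
 thus ?case using Suc.prems by (auto simp: smooth_upto_Suc intro: differentiable_on_mult)
qed

lemma smooth_mult: "smooth f \<Longrightarrow> smooth g \<Longrightarrow> smooth (\<lambda>x. f x * g x)" by (simp add: smooth_iff_upto smooth_upto_mult)

lemma pderiv_dir_affine:
 assumes "\<And>x. f differentiable (at x)"
 shows "pderiv_dir i (\<lambda>x. f (a + t *\<^sub>R x)) = (\<lambda>x. t * pderiv_dir i f (a + t *\<^sub>R x))"
proof
 fix x
 have "((\<lambda>x. a + t *\<^sub>R x) has_derivative (\<lambda>h. t *\<^sub>R h)) (at x)" by (auto intro!: derivative_eq_intros)
 from diff_chain_at[OF this frechet_pderiv[OF assms]]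
 have "((\<lambda>x. f (a + t *\<^sub>R x)) has_derivative
   (\<lambda>h. \<Sum>i\<in>UNIV. (t *\<^sub>R h) $ i * pderiv_dir i f (a + t *\<^sub>R x))) (at x)" by (simp add: o_def)
 from pderiv_dir_eqI[OF this, of i]
 show "pderiv_dir i (\<lambda>x. f (a + t *\<^sub>R x)) x = t * pderiv_dir i f (a + t *\<^sub>R x)"
  by (simp add: axis_def if_distrib if_distribR cong: if_cong)
qed

lemma differentiable_affine:
 fixes f :: "real^'n \<Rightarrow> real"
 assumes "\<And>x. f differentiable (at x)"
 shows "(\<lambda>x. f (a + t *\<^sub>R x)) differentiable (at x)"
 using differentiable_chain_at[of "\<lambda>x. a + t *\<^sub>R x" x f] assms by (simp add: o_def)

lemma smooth_upto_affine: "smooth_upto k f \<Longrightarrow> smooth_upto k (\<lambda>x. f (a + t *\<^sub>R x))"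
proof (induction k arbitrary: f)
 case 0
 thus ?case using smooth_upto_differentiable[OF 0] differentiable_affine[of f]
  by (auto simp: smooth_upto_0 differentiable_on_def)
next
 case (Suc k)
 have d: "f differentiable (at x)" for x using Suc.prems smooth_upto_differentiable by blast
 have "smooth_upto k (\<lambda>x. t * pderiv_dir i f (a + t *\<^sub>R x))" for i
  using Suc by (intro smooth_upto_mult smooth_upto_const) (auto simp: smooth_upto_Suc)
 thus ?case using differentiable_affine[OF d] pderiv_dir_affine[OF d]
  by (auto simp: smooth_upto_Suc differentiable_on_def)
qed

lemma smooth_affine: "smooth f \<Longrightarrow> smooth (\<lambda>x. f (a + t *\<^sub>R x))" by (simp add: smooth_iff_upto smooth_upto_affine)

lemma pderiv_list_affine:
 assumes "smooth f"
 shows "pderiv_list js (\<lambda>x. f (a + t *\<^sub>R x)) = (\<lambda>x. t ^ length js * pderiv_list js f (a + t *\<^sub>R x))"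
proof (induction js)
 case (Cons i js)
 have d: "pderiv_list js f differentiable (at x)" for x using smooth_differentiable smooth_pderiv_list assms by blast
 have "pderiv_dir i (\<lambda>x. t ^ length js * pderiv_list js f (a + t *\<^sub>R x)) x =
   t ^ length js * (t * pderiv_dir i (pderiv_list js f) (a + t *\<^sub>R x))" for x
  by (subst pderiv_dir_mult) (auto simp: pderiv_dir_const pderiv_dir_affine[OF d] intro: differentiable_affine[OF d])
 thus ?case unfolding pderiv_list.simps Cons by (simp add: fun_eq_iff mult_ac)
qed simp

lemma smooth_sum: "(\<And>a. a \<in> A \<Longrightarrow> smooth (f a)) \<Longrightarrow> smooth (\<lambda>x. \<Sum>a\<in>A. f a x)"
 by (induction A rule: infinite_finite_induct) (auto simp: smooth_const intro: smooth_add)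

lemma smooth_prod: "(\<And>a. a \<in> A \<Longrightarrow> smooth (f a)) \<Longrightarrow> smooth (\<lambda>x. \<Prod>a\<in>A. f a x)"
 by (induction A rule: infinite_finite_induct) (auto simp: smooth_const intro: smooth_mult)

lemma pderiv_dir_cmult:
 assumes "f differentiable (at x)"
 shows "pderiv_dir i (\<lambda>x. c * f x) x = c * pderiv_dir i f x"
 by (subst pderiv_dir_mult) (auto simp: assms pderiv_dir_const)

lemma pderiv_list_add:
 "smooth f \<Longrightarrow> smooth g \<Longrightarrow>
  pderiv_list js (\<lambda>x. f x + g x) = (\<lambda>x. pderiv_list js f x + pderiv_list js g x)"
 by (induction js) (auto simp: pderiv_dir_add smooth_differentiable smooth_pderiv_list)

lemma pderiv_list_cmult:
 "smooth f \<Longrightarrow> pderiv_list js (\<lambda>x. c * f x) = (\<lambda>x. c * pderiv_list js f x)"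
 by (induction js) (auto simp: pderiv_dir_cmult smooth_differentiable smooth_pderiv_list)

lemma pderiv_list_zero: "pderiv_list js (\<lambda>x. 0) = (\<lambda>x. 0)" by (induction js) (auto simp: pderiv_dir_const)

lemma pderiv_list_sum:
 "(\<And>a. a \<in> A \<Longrightarrow> smooth (f a)) \<Longrightarrow>
  pderiv_list js (\<lambda>x. \<Sum>a\<in>A. f a x) = (\<lambda>x. \<Sum>a\<in>A. pderiv_list js (f a) x)"
 by (induction A rule: infinite_finite_induct) (auto simp: pderiv_list_zero pderiv_list_add smooth_sum)

lemma mi_deriv_add:
 "smooth f \<Longrightarrow> smooth g \<Longrightarrow> mi_deriv \<nu> (\<lambda>x. f x + g x) = (\<lambda>x. mi_deriv \<nu> f x + mi_deriv \<nu> g x)"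
 by (simp add: mi_deriv_def pderiv_list_add)

lemma mi_deriv_cmult: "smooth f \<Longrightarrow> mi_deriv \<nu> (\<lambda>x. c * f x) = (\<lambda>x. c * mi_deriv \<nu> f x)"
 by (simp add: mi_deriv_def pderiv_list_cmult)

lemma mi_deriv_sum:
 "(\<And>a. a \<in> A \<Longrightarrow> smooth (f a)) \<Longrightarrow>
  mi_deriv \<nu> (\<lambda>x. \<Sum>a\<in>A. f a x) = (\<lambda>x. \<Sum>a\<in>A. mi_deriv \<nu> (f a) x)" by (simp add: mi_deriv_def pderiv_list_sum)

lemma smooth_linear: "smooth (\<lambda>x. c + g \<bullet> x)"
proof -
 have h: "((\<lambda>x. c + g \<bullet> x) has_derivative (\<lambda>h. g \<bullet> h)) (at x)" for x by (auto intro!: derivative_eq_intros)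
 have "(\<lambda>x. c + g \<bullet> x) differentiable_on UNIV" using h differentiable_def differentiable_on_def by blast
 moreover have "pderiv_dir i (\<lambda>x. c + g \<bullet> x) = (\<lambda>x. g $ i)" for i
  using pderiv_dir_eqI[OF h] by (auto simp: inner_axis)
 ultimately have "smooth_upto k (\<lambda>x. c + g \<bullet> x)" for k
  by (cases k) (auto simp: smooth_upto_0 smooth_upto_Suc smooth_upto_const)
 thus ?thesis by (simp add: smooth_iff_upto)
qed

lemma pderiv_dir_linear: "pderiv_dir i (\<lambda>x. c + g \<bullet> x) = (\<lambda>x. g $ i)"
proof
 have h: "((\<lambda>x. c + g \<bullet> x) has_derivative (\<lambda>h. g \<bullet> h)) (at x)" for x by (auto intro!: derivative_eq_intros)
 show "pderiv_dir i (\<lambda>x. c + g \<bullet> x) x = g $ i" for x using pderiv_dir_eqI[OF h] by (auto simp: inner_axis)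
qed

lemma smooth_component: "smooth (\<lambda>x. x $ i)" using smooth_linear[of 0 "axis i 1"] by (simp add: inner_axis')

lemma pderiv_dir_component: "pderiv_dir j (\<lambda>x. x $ i) = (\<lambda>x. if i = j then 1 else 0)"
proof -
 have "(\<lambda>x. x $ i) = (\<lambda>x. 0 + axis i 1 \<bullet> x)" by (simp add: inner_axis')
 thus ?thesis by (simp only: pderiv_dir_linear) (simp add: axis_def fun_eq_iff)
qed

lemma smooth_power: "smooth f \<Longrightarrow> smooth (\<lambda>x. f x ^ k)" by (induction k) (auto simp: smooth_const intro: smooth_mult)

lemma smooth_mi_pow: "smooth (\<lambda>x. mi_pow x \<mu>)"
 unfolding mi_pow_def by (intro smooth_prod smooth_power smooth_component)

text \<open>The truncated exponent at \<gamma> i = 0 is harmless because of the factor \<gamma> i.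
  The proof splits off the power of the i-th coordinate; the product of the remaining powers has
  zero derivative in that direction.\<close>

lemma pderiv_dir_mi_pow:
 "pderiv_dir i (\<lambda>x. mi_pow x \<gamma>) = (\<lambda>x. real (\<gamma> i) * mi_pow x (\<gamma>(i := \<gamma> i - 1)))"
proof
 fix x
 have pw: "pderiv_dir i (\<lambda>x. x $ i ^ k) x = real k * x $ i ^ (k - 1)" for k
 proof (induction k)
  case (Suc k)
  thus ?case by (cases k) (auto simp: pderiv_dir_mult smooth_differentiable smooth_power smooth_component
     pderiv_dir_component algebra_simps)
 qed (simp add: pderiv_dir_const)
 have z: "pderiv_dir i (\<lambda>x. \<Prod>j\<in>UNIV-{i}. x $ j ^ \<gamma> j) x = 0"
 proof -
  have "pderiv_dir i (\<lambda>x. \<Prod>j\<in>A. x $ j ^ \<gamma> j) x = 0" if "finite A" "i \<notin> A" for A using that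
  proof induction
   case (insert a A)
   have "pderiv_dir i (\<lambda>x. x $ a ^ k) x = 0" for k
    using insert by (induction k) (auto simp: pderiv_dir_const pderiv_dir_mult smooth_differentiable
     smooth_power smooth_component pderiv_dir_component)
   thus ?case using insert
    by (simp add: pderiv_dir_mult smooth_differentiable smooth_power smooth_component smooth_prod)
  qed (simp add: pderiv_dir_const)
  thus ?thesis by simp
 qed
 have e: "mi_pow x \<beta> = x $ i ^ \<beta> i * (\<Prod>j\<in>UNIV-{i}. x $ j ^ \<beta> j)" for x and \<beta> :: "'a \<Rightarrow> nat"
  unfolding mi_pow_def by (rule prod.remove) auto
 have "pderiv_dir i (\<lambda>x. mi_pow x \<gamma>) x =
   x $ i ^ \<gamma> i * 0 + (real (\<gamma> i) * x $ i ^ (\<gamma> i - 1)) * (\<Prod>j\<in>UNIV-{i}. x $ j ^ \<gamma> j)" unfolding e[of _ \<gamma>]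
  by (subst pderiv_dir_mult) (simp_all add: smooth_differentiable smooth_prod smooth_power smooth_component pw z)
 also have "... = real (\<gamma> i) * mi_pow x (\<gamma>(i := \<gamma> i - 1))" unfolding e by simp
 finally show "pderiv_dir i (\<lambda>x. mi_pow x \<gamma>) x = real (\<gamma> i) * mi_pow x (\<gamma>(i := \<gamma> i - 1))" .
qed

lemma has_real_derivative_along:
 fixes f :: "real^'n \<Rightarrow> real"
 assumes "f differentiable (at (x + s *\<^sub>R v))"
 shows "((\<lambda>s. f (x + s *\<^sub>R v)) has_real_derivative (\<Sum>i\<in>UNIV. v $ i * pderiv_dir i f (x + s *\<^sub>R v))) (at s)"
proof -
 have "((\<lambda>s. x + s *\<^sub>R v) has_derivative (\<lambda>h. h *\<^sub>R v)) (at s)" by (auto intro!: derivative_eq_intros)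
 from diff_chain_at[OF this frechet_pderiv[OF assms]]
 show ?thesis unfolding has_field_derivative_def o_def
  by (rule has_derivative_eq_rhs) (auto simp: fun_eq_iff sum_distrib_left sum_distrib_right mult_ac)
qed

lemma has_real_derivative_axis:
 fixes f :: "real^'n \<Rightarrow> real"
 assumes "f differentiable (at (x + s *\<^sub>R axis i 1))"
 shows "((\<lambda>s. f (x + s *\<^sub>R axis i 1)) has_real_derivative pderiv_dir i f (x + s *\<^sub>R axis i 1)) (at s)"
 using has_real_derivative_along[OF assms] by (simp add: axis_def if_distrib if_distribR cong: if_cong)

text \<open>Both mixed derivatives are limits of the second difference quotient, by two applications of
 the mean value theorem in either order.\<close>

lemma second_difference:
 fixes f :: "real^'n::finite \<Rightarrow> real"
 assumes "smooth f" "0 < t"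
 shows "\<exists>y. dist y x \<le> 2 * t \<and> f (x + t *\<^sub>R axis i 1 + t *\<^sub>R axis j 1) - f (x + t *\<^sub>R axis i 1)
   - f (x + t *\<^sub>R axis j 1) + f x = t * t * pderiv_dir j (pderiv_dir i f) y"
proof -
 \<comment> \<open>The increment in direction j, viewed along direction i: the mean value theorem in
   i and then in j yields the derivatives in this order.\<close>
 let ?g = "\<lambda>s. f (x + t *\<^sub>R axis j 1 + s *\<^sub>R axis i 1) - f (x + s *\<^sub>R axis i 1)"
 let ?g' = "\<lambda>s. pderiv_dir i f (x + t *\<^sub>R axis j 1 + s *\<^sub>R axis i 1) - pderiv_dir i f (x + s *\<^sub>R axis i 1)"
 have "(?g has_real_derivative ?g' s) (at s)" for s
  by (intro DERIV_diff has_real_derivative_axis smooth_differentiable assms)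
 from MVT2[OF assms(2), of ?g ?g'] this
 obtain s where s: "0 < s" "s < t" "?g t - ?g 0 = t * ?g' s" by auto
 let ?h = "\<lambda>u. pderiv_dir i f (x + s *\<^sub>R axis i 1 + u *\<^sub>R axis j 1)"
 have "(?h has_real_derivative pderiv_dir j (pderiv_dir i f) (x + s *\<^sub>R axis i 1 + u *\<^sub>R axis j 1)) (at u)" for u
  by (intro has_real_derivative_axis smooth_differentiable smooth_pderiv_dir assms)
 from MVT2[OF assms(2), of ?h "\<lambda>u. pderiv_dir j (pderiv_dir i f) (x + s *\<^sub>R axis i 1 + u *\<^sub>R axis j 1)"] this
 obtain u where u: "0 < u" "u < t"
  "?h t - ?h 0 = t * pderiv_dir j (pderiv_dir i f) (x + s *\<^sub>R axis i 1 + u *\<^sub>R axis j 1)" by auto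
 have "norm (s *\<^sub>R axis i (1::real) + u *\<^sub>R axis j 1) \<le> s + u"
  using norm_triangle_ineq[of "s *\<^sub>R axis i (1::real)" "u *\<^sub>R axis j 1"] s(1) u(1) by simp
 hence "dist (x + s *\<^sub>R axis i 1 + u *\<^sub>R axis j 1) x \<le> 2 * t" using s u by (simp add: dist_norm add.assoc)
 moreover have "f (x + t *\<^sub>R axis i 1 + t *\<^sub>R axis j 1) - f (x + t *\<^sub>R axis i 1)
   - f (x + t *\<^sub>R axis j 1) + f x = t * t * pderiv_dir j (pderiv_dir i f) (x + s *\<^sub>R axis i 1 + u *\<^sub>R axis j 1)"
  using s(3) u(3) by (simp add: algebra_simps)
 ultimately show ?thesis by blast
qed

lemma pderiv_dir_commute:
 assumes "smooth f"
 shows "pderiv_dir i (pderiv_dir j f) = pderiv_dir j (pderiv_dir i f)"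
proof
 fix x
 have lim: "\<exists>y. (\<lambda>k::nat. y k) \<longlonglongrightarrow> x \<and> (\<forall>k. f (x + inverse (Suc k) *\<^sub>R axis i 1 + inverse (Suc k) *\<^sub>R axis j 1) - f (x + inverse (Suc k) *\<^sub>R axis i 1)
   - f (x + inverse (Suc k) *\<^sub>R axis j 1) + f x = inverse (Suc k) * inverse (Suc k) * pderiv_dir j (pderiv_dir i f) (y k))" for i j
 proof -
  have "\<forall>k::nat. \<exists>y. dist y x \<le> 2 * inverse (Suc k) \<and> f (x + inverse (Suc k) *\<^sub>R axis i 1 + inverse (Suc k) *\<^sub>R axis j 1) - f (x + inverse (Suc k) *\<^sub>R axis i 1)
   - f (x + inverse (Suc k) *\<^sub>R axis j 1) + f x = inverse (Suc k) * inverse (Suc k) * pderiv_dir j (pderiv_dir i f) y"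
   by (intro allI second_difference assms) simp
  then obtain y where y: "\<And>k::nat. dist (y k) x \<le> 2 * inverse (Suc k)"
    "\<And>k. f (x + inverse (Suc k) *\<^sub>R axis i 1 + inverse (Suc k) *\<^sub>R axis j 1) - f (x + inverse (Suc k) *\<^sub>R axis i 1)
   - f (x + inverse (Suc k) *\<^sub>R axis j 1) + f x = inverse (Suc k) * inverse (Suc k) * pderiv_dir j (pderiv_dir i f) (y k)"
   by metis
  have "(\<lambda>k. 2 * inverse (real (Suc k))) \<longlonglongrightarrow> 2 * 0" by (intro tendsto_intros LIMSEQ_inverse_real_of_nat)
  hence "(\<lambda>k. dist (y k) x) \<longlonglongrightarrow> 0"
   using tendsto_sandwich[of "\<lambda>_. 0" "\<lambda>k. dist (y k) x" sequentially "\<lambda>k. 2 * inverse (real (Suc k))" 0]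
    always_eventually[of "\<lambda>k. dist (y k) x \<le> 2 * inverse (real (Suc k))"] y(1) by simp
  thus ?thesis using y(2) tendsto_dist_iff by blast
 qed
 obtain y where y: "y \<longlonglongrightarrow> x" "\<And>k::nat. f (x + inverse (Suc k) *\<^sub>R axis i 1 + inverse (Suc k) *\<^sub>R axis j 1) - f (x + inverse (Suc k) *\<^sub>R axis i 1)
   - f (x + inverse (Suc k) *\<^sub>R axis j 1) + f x = inverse (Suc k) * inverse (Suc k) * pderiv_dir j (pderiv_dir i f) (y k)"
  using lim[of i j] by blast
 obtain z where z: "z \<longlonglongrightarrow> x" "\<And>k::nat. f (x + inverse (Suc k) *\<^sub>R axis j 1 + inverse (Suc k) *\<^sub>R axis i 1) - f (x + inverse (Suc k) *\<^sub>R axis j 1)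
   - f (x + inverse (Suc k) *\<^sub>R axis i 1) + f x = inverse (Suc k) * inverse (Suc k) * pderiv_dir i (pderiv_dir j f) (z k)"
  using lim[of j i] by blast
 \<comment> \<open>The second difference is symmetric in i and j, so both representations with the
   same step agree and the nonzero factor cancels.\<close>
 have eq: "pderiv_dir i (pderiv_dir j f) (z k) = pderiv_dir j (pderiv_dir i f) (y k)" for k
 proof -
  have "inverse (real (Suc k)) * inverse (Suc k) * pderiv_dir i (pderiv_dir j f) (z k)
    = inverse (real (Suc k)) * inverse (Suc k) * pderiv_dir j (pderiv_dir i f) (y k)"
   unfolding y(2)[of k, symmetric] z(2)[of k, symmetric] by (simp add: algebra_simps)
  moreover have "inverse (real (Suc k)) * inverse (Suc k) \<noteq> 0" by simp
  ultimately show ?thesis using mult_cancel_left by blast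
 qed
 have c: "isCont (pderiv_dir a (pderiv_dir b f)) x" for a b
  using assms smooth_pderiv_dir smooth_continuous[of "pderiv_dir a (pderiv_dir b f)" UNIV]
  by (auto simp: continuous_on_eq_continuous_at)
 have "(\<lambda>k. pderiv_dir i (pderiv_dir j f) (z k)) \<longlonglongrightarrow> pderiv_dir i (pderiv_dir j f) x"
  using isCont_tendsto_compose[OF c z(1)] .
 moreover have "(\<lambda>k. pderiv_dir j (pderiv_dir i f) (y k)) \<longlonglongrightarrow> pderiv_dir j (pderiv_dir i f) x"
  using isCont_tendsto_compose[OF c y(1)] .
 ultimately show "pderiv_dir i (pderiv_dir j f) x = pderiv_dir j (pderiv_dir i f) x"
  unfolding eq using LIMSEQ_unique by blast
qed

section \<open>Independence of the order of differentiation and induction over multi-indices\<close>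

lemma pderiv_list_commute_dir:
 "smooth f \<Longrightarrow> pderiv_list js (pderiv_dir i f) = pderiv_dir i (pderiv_list js f)"
 by (induction js) (auto simp: pderiv_dir_commute smooth_pderiv_list)

lemma pderiv_list_perm:
 assumes "smooth f" "\<And>i. count_list js i = count_list ks i"
 shows "pderiv_list js f = pderiv_list ks f" using assms(2)
proof (induction js arbitrary: ks)
 case Nil
 hence "ks = []" by (metis count_list.simps(1) count_list_0_iff list.set_intros(1) neq_Nil_conv)
 thus ?case by simp
next
 case (Cons i js)
 have "count_list ks i \<noteq> 0" using Cons.prems[of i] by auto
 hence "i \<in> set ks" by (metis count_notin)
 then obtain a b where ks: "ks = a @ i # b" by (meson split_list)
 have "count_list js k = count_list (a @ b) k" for k using Cons.prems[of k] unfolding ks by (auto split: if_splits)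
 hence "pderiv_list js f = pderiv_list (a @ b) f" by (rule Cons.IH)
 thus ?case unfolding ks using assms(1) by (simp add: pderiv_list_append pderiv_list_commute_dir smooth_pderiv_list)
qed

text \<open>The list in \<open>mi_deriv\<close> is an arbitrary choice; for smooth functions the
  commutation of derivatives lets every list with the right multiplicities take its place.\<close>

lemma mi_deriv_eq_pderiv_list:
 assumes "smooth f" "\<And>i. count_list js i = \<nu> i"
 shows "mi_deriv \<nu> f = pderiv_list js f" unfolding mi_deriv_def using someI_ex[OF ex_mi_list[of \<nu>]]
 by (intro pderiv_list_perm) (auto simp: assms)

lemma mi_deriv_zero: "mi_deriv (\<lambda>_ :: 'n::finite. 0) f = f"
proof -
 have "(SOME js :: 'n list. \<forall>i. count_list js i = 0) = []"
  by (rule some_equality, simp) (metis count_list_0_iff list.set_intros(1) neq_Nil_conv)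
 thus ?thesis by (simp add: mi_deriv_def)
qed

text \<open>The extra derivative may be placed outermost or innermost. The outer form differentiates
  an already differentiated function, the inner one passes a derivative to the argument in inductive
  integrations by parts.\<close>

lemma mi_deriv_Suc:
 assumes "smooth f"
 shows "mi_deriv (\<nu>(i := Suc (\<nu> i))) f = pderiv_dir i (mi_deriv \<nu> f)"
  and "mi_deriv (\<nu>(i := Suc (\<nu> i))) f = mi_deriv \<nu> (pderiv_dir i f)"
proof -
 obtain js where js: "\<forall>i. count_list js i = \<nu> i" using ex_mi_list by blast
 have "mi_deriv (\<nu>(i := Suc (\<nu> i))) f = pderiv_list (i # js) f"
  by (rule mi_deriv_eq_pderiv_list) (auto simp: js assms)
 moreover have "mi_deriv \<nu> f = pderiv_list js f" "mi_deriv \<nu> (pderiv_dir i f) = pderiv_list js (pderiv_dir i f)"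
  by (auto intro!: mi_deriv_eq_pderiv_list simp: js assms smooth_pderiv_dir)
 ultimately show "mi_deriv (\<nu>(i := Suc (\<nu> i))) f = pderiv_dir i (mi_deriv \<nu> f)"
  "mi_deriv (\<nu>(i := Suc (\<nu> i))) f = mi_deriv \<nu> (pderiv_dir i f)" using assms by (auto simp: pderiv_list_commute_dir)
qed

lemma mi_size_Suc: "mi_size (\<nu>(i := Suc (\<nu> i))) = Suc (mi_size \<nu>)"
proof -
 have "mi_size \<mu> = \<mu> i + (\<Sum>j\<in>UNIV-{i}. \<mu> j)" for \<mu> :: "'a \<Rightarrow> nat" unfolding mi_size_def by (rule sum.remove) auto
 from this[of \<nu>] this[of "\<nu>(i := Suc (\<nu> i))"] show ?thesis by simp
qed

lemma mi_size_eq_0: "mi_size \<nu> = 0 \<longleftrightarrow> \<nu> = (\<lambda>_. 0)" by (auto simp: mi_size_def fun_eq_iff)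

lemma mi_induct [case_names zero Suc]:
 fixes \<nu> :: "'n::finite \<Rightarrow> nat"
 assumes "P (\<lambda>_. 0)" "\<And>\<nu> i. P \<nu> \<Longrightarrow> P (\<nu>(i := Suc (\<nu> i)))"
 shows "P \<nu>"
proof (induction "mi_size \<nu>" arbitrary: \<nu>)
 case 0 hence "\<nu> = (\<lambda>_. 0)" using mi_size_eq_0[of \<nu>] by simp
 thus ?case using assms(1) by simp
next
 case (Suc k)
 then obtain i where i: "\<nu> i \<noteq> 0" using mi_size_eq_0[of \<nu>] by fastforce
 let ?k = "\<nu>(i := \<nu> i - 1)"
 have e: "\<nu> = ?k(i := Suc (?k i))" using i by auto
 have "mi_size \<nu> = Suc (mi_size ?k)" using mi_size_Suc[of ?k i] unfolding e[symmetric] .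
 hence "P ?k" using Suc by auto
 thus ?case using assms(2)[of ?k i] unfolding e[symmetric] by blast
qed

lemma finite_mi_le: "finite {\<mu> :: 'n::finite \<Rightarrow> nat. mi_size \<mu> \<le> m}"
proof -
 have "{\<mu> :: 'n \<Rightarrow> nat. mi_size \<mu> \<le> m} \<subseteq> PiE UNIV (\<lambda>_. {..m})"
 proof
  fix \<mu> :: "'n \<Rightarrow> nat" assume a: "\<mu> \<in> {\<mu>. mi_size \<mu> \<le> m}"
  have "\<mu> i \<le> mi_size \<mu>" for i unfolding mi_size_def by (rule member_le_sum) auto
  hence "\<mu> i \<le> m" for i using a le_trans[of "\<mu> i" "mi_size \<mu>" m] by simp
  thus "\<mu> \<in> PiE UNIV (\<lambda>_. {..m})" by (intro PiE_I) auto
 qed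
 thus ?thesis by (rule finite_subset) (intro finite_PiE, auto)
qed

lemma finite_mi_eq: "finite {\<mu> :: 'n::finite \<Rightarrow> nat. mi_size \<mu> = m}"
 by (rule finite_subset[OF _ finite_mi_le[of m]]) auto

subsection \<open>Integration by parts and mollification\<close>

lemma nn_integral_affine:
 fixes f :: "real^'n \<Rightarrow> ennreal"
 assumes [measurable]: "f \<in> borel_measurable borel" and c: "c \<noteq> 0"
 shows "(LBNN x. f x) = ennreal (\<bar>c\<bar> ^ CARD('n)) * (LBNN x. f (t + c *\<^sub>R x))" by (subst lborel_affine[OF c, of t])
  (simp add: nn_integral_density nn_integral_distr nn_integral_cmult)

lemma integrable_affine:
 fixes f :: "real^'n \<Rightarrow> real"
 assumes "integrable lborel f" "c \<noteq> 0"
 shows "integrable lborel (\<lambda>x. f (t + c *\<^sub>R x))"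
proof -
 have [measurable]: "f \<in> borel_measurable borel" using assms(1) by auto
 have "(LBNN x. norm (f x)) < \<infinity>" using assms(1) by (simp add: integrable_iff_bounded)
 thus ?thesis unfolding integrable_iff_bounded by (subst (asm) nn_integral_affine[OF _ assms(2), of _ t])
   (auto simp: ennreal_mult_less_top assms)
qed

lemma integral_affine:
 fixes f :: "real^'n \<Rightarrow> real"
 assumes [measurable]: "f \<in> borel_measurable borel" and c: "c \<noteq> 0"
 shows "(LBI x. f x) = \<bar>c\<bar> ^ CARD('n) * (LBI x. f (t + c *\<^sub>R x))"
 by (subst lborel_affine[OF c, of t]) (simp add: integral_density integral_distr)

lemma pderiv_dir_zero_on_open:
 assumes "open S" "x \<in> S" "\<And>x. x \<in> S \<Longrightarrow> f x = 0"
 shows "pderiv_dir i f x = 0"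
proof -
 have "((\<lambda>x. 0) has_derivative (\<lambda>_. 0)) (at x)" by simp
 hence "(f has_derivative (\<lambda>_. 0)) (at x)"
  by (rule has_derivative_transform_within_open[OF _ assms(1,2)]) (simp add: assms(3))
 thus ?thesis using pderiv_dir_eqI by metis
qed

lemma pderiv_list_zero_on_open:
 assumes "open S" "\<And>x. x \<in> S \<Longrightarrow> f x = 0"
 shows "x \<in> S \<Longrightarrow> pderiv_list js f x = 0"
 by (induction js arbitrary: x) (auto simp: assms pderiv_dir_zero_on_open[OF assms(1)])

lemma mi_deriv_zero_on_open:
 assumes "open S" "\<And>x. x \<in> S \<Longrightarrow> f x = 0" "x \<in> S"
 shows "mi_deriv \<nu> f x = 0" unfolding mi_deriv_def using assms by (intro pderiv_list_zero_on_open) auto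

lemma open_norm_gt: "open {x :: 'a::real_normed_vector. R < norm x}" by (intro open_Collect_less continuous_intros)

lemma pderiv_dir_zero_outside:
 "(\<And>x. R < norm x \<Longrightarrow> f x = 0) \<Longrightarrow> R < norm x \<Longrightarrow> pderiv_dir i f x = 0"
 by (rule pderiv_dir_zero_on_open[OF open_norm_gt[of R]]) auto

lemma mi_deriv_zero_outside:
 "(\<And>x. R < norm x \<Longrightarrow> f x = 0) \<Longrightarrow> R < norm x \<Longrightarrow> mi_deriv \<nu> f x = 0"
 by (rule mi_deriv_zero_on_open[OF open_norm_gt[of R]]) auto

lemma bounded_support_bound:
 fixes f :: "real^'n \<Rightarrow> real"
 assumes "continuous_on UNIV f" "\<And>x. R < norm x \<Longrightarrow> f x = 0"
 shows "\<exists>M>0. \<forall>x. \<bar>f x\<bar> \<le> M"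
proof -
 have "compact (f ` cball 0 R)" using assms(1) by (intro compact_continuous_image) (auto intro: continuous_on_subset)
 then obtain M where M: "M > 0" "\<And>x. x \<in> cball 0 R \<Longrightarrow> \<bar>f x\<bar> \<le> M"
  using compact_imp_bounded bounded_pos by (metis (no_types, lifting) image_eqI real_norm_def)
 have "\<bar>f x\<bar> \<le> M" for x using M assms(2)[of x] by (cases "norm x \<le> R") auto
 thus ?thesis using M by blast
qed

lemma bounded_support_integrable:
 fixes f :: "real^'n \<Rightarrow> real"
 assumes "continuous_on UNIV f" "\<And>x. R < norm x \<Longrightarrow> f x = 0"
 shows "integrable lborel f"
proof -
 have "integrable lborel (\<lambda>x. indicator (cball 0 R) x *\<^sub>R f x)"
  by (rule borel_integrable_compact) (auto intro: continuous_on_subset[OF assms(1)])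
 also have "(\<lambda>x. indicator (cball 0 R) x *\<^sub>R f x) = f" using assms(2) by (auto simp: fun_eq_iff indicator_def)
 finally show ?thesis .
qed

text \<open>Translation invariance makes every difference quotient integrate to zero; the mean value
  theorem dominates the quotients, so their limit integrates to zero as well.\<close>

lemma integral_pderiv_zero:
 fixes F :: "real^'n \<Rightarrow> real"
 assumes F: "smooth F" and out: "\<And>x. R < norm x \<Longrightarrow> F x = 0"
 shows "(LBI x. pderiv_dir i F x) = 0"
proof -
 let ?t = "\<lambda>k. inverse (real (Suc k))"
 let ?q = "\<lambda>k x. (F (x + ?t k *\<^sub>R axis i 1) - F x) / ?t k"
 have [measurable]: "F \<in> borel_measurable borel" "pderiv_dir i F \<in> borel_measurable borel"
  using F smooth_borel smooth_pderiv_dir by blast+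
 obtain M where M: "M > 0" "\<And>x. \<bar>pderiv_dir i F x\<bar> \<le> M"
  using bounded_support_bound[OF smooth_continuous[OF smooth_pderiv_dir[OF F]]
   pderiv_dir_zero_outside[of R F, OF out]] by blast
 have d: "((\<lambda>s. F (x + s *\<^sub>R axis i 1)) has_real_derivative pderiv_dir i F (x + s *\<^sub>R axis i 1)) (at s)" for x s
  by (intro has_real_derivative_axis smooth_differentiable F)
 have ax: "norm (axis i (1::real)) = 1" by simp
 \<comment> \<open>The steps are at most 1, so all quotients vanish outside the ball enlarged by 1,
   and one bounded function with bounded support dominates them.\<close>
 have bd: "norm (?q k x) \<le> indicator (cball 0 (\<bar>R\<bar> + 1)) x * M" for k x
 proof -
  obtain s where s: "0 < s" "s < ?t k" "F (x + ?t k *\<^sub>R axis i 1) - F (x + 0 *\<^sub>R axis i 1) = (?t k - 0) * pderiv_dir i F (x + s *\<^sub>R axis i 1)"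
   using MVT2[of 0 "?t k" "\<lambda>s. F (x + s *\<^sub>R axis i 1)" "\<lambda>s. pderiv_dir i F (x + s *\<^sub>R axis i 1)"] d by auto
  have q: "?q k x = pderiv_dir i F (x + s *\<^sub>R axis i 1)" using s(3) by (simp add: field_simps)
  have "?t k \<le> 1" by (simp add: inverse_le_1_iff)
  hence s1: "s < 1" using s by simp
  show ?thesis
  proof (cases "norm x \<le> \<bar>R\<bar> + 1")
   case True thus ?thesis unfolding q using M(2) by simp
  next
   case False
   have "norm x \<le> norm (x + s *\<^sub>R axis i 1) + norm (s *\<^sub>R axis i (1::real))"
    by (metis add_diff_cancel_right' norm_triangle_ineq4)
   hence "R < norm (x + s *\<^sub>R axis i 1)" using False s s1 by simp
   thus ?thesis unfolding q using False pderiv_dir_zero_outside[OF out] by simp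
  qed
 qed
 have int_F: "integrable lborel F" by (rule bounded_support_integrable[OF smooth_continuous[OF F] out])
 have zero: "(LBI x. ?q k x) = 0" for k
 proof -
  have a: "integrable lborel (\<lambda>x. F (?t k *\<^sub>R axis i 1 + 1 *\<^sub>R x))" by (rule integrable_affine[OF int_F]) simp
  have "(LBI x. F x) = (LBI x. F (?t k *\<^sub>R axis i 1 + 1 *\<^sub>R x))"
   by (subst integral_affine[where t="?t k *\<^sub>R axis i 1" and c=1]) auto
  thus ?thesis using a int_F by (simp add: add.commute)
 qed
 have lim: "(\<lambda>k. ?q k x) \<longlonglongrightarrow> pderiv_dir i F x" for x
 proof -
  have "((\<lambda>h. (F (x + h *\<^sub>R axis i 1) - F x) / h) \<longlongrightarrow> pderiv_dir i F x) (at 0)"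
   using d[of x 0] by (simp add: DERIV_def)
  moreover have "filterlim ?t (at 0) sequentially" using LIMSEQ_inverse_real_of_nat by (auto simp: filterlim_at)
  ultimately show ?thesis by (rule filterlim_compose)
 qed
 have "(\<lambda>k. \<integral>x. ?q k x \<partial>lborel) \<longlonglongrightarrow> (LBI x. pderiv_dir i F x)"
 proof (rule integral_dominated_convergence)
  have "integrable lborel (\<lambda>x. indicator (cball 0 (\<bar>R\<bar> + 1)) x *\<^sub>R M)" by (rule borel_integrable_compact) auto
  thus "integrable lborel (\<lambda>x :: real^'n. indicator (cball 0 (\<bar>R\<bar> + 1)) x * M)" by simp
 qed (use lim bd in auto)
 thus ?thesis unfolding zero using LIMSEQ_unique tendsto_const by metis
qed

lemma integral_by_parts:
 fixes f :: "real^'n \<Rightarrow> real"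
 assumes f: "smooth f" and g: "smooth g" and out: "\<And>x. R < norm x \<Longrightarrow> g x = 0"
 shows "(LBI x. f x * pderiv_dir i g x) = - (LBI x. pderiv_dir i f x * g x)"
proof -
 have "(LBI x. pderiv_dir i (\<lambda>x. f x * g x) x) = 0"
  by (rule integral_pderiv_zero[of _ R]) (auto simp: smooth_mult f g out)
 moreover have "pderiv_dir i (\<lambda>x. f x * g x) x = f x * pderiv_dir i g x + pderiv_dir i f x * g x" for x
  by (rule pderiv_dir_mult) (auto simp: smooth_differentiable f g)
 moreover have "integrable lborel (\<lambda>x. f x * pderiv_dir i g x)" by (rule bounded_support_integrable[of _ R])
   (auto intro!: smooth_continuous smooth_mult smooth_pderiv_dir f g pderiv_dir_zero_outside[OF out])
 moreover have "integrable lborel (\<lambda>x. pderiv_dir i f x * g x)" by (rule bounded_support_integrable[of _ R])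
   (auto intro!: smooth_continuous smooth_mult smooth_pderiv_dir f g out)
 ultimately show ?thesis by simp
qed

lemma integral_by_parts_mi:
 fixes f :: "real^'n \<Rightarrow> real"
 assumes f: "smooth f" and g: "smooth g" and out: "\<And>x. R < norm x \<Longrightarrow> g x = 0"
 shows "(LBI x. f x * mi_deriv \<nu> g x) = (- 1) ^ mi_size \<nu> * (LBI x. mi_deriv \<nu> f x * g x)" using f
proof (induction \<nu> arbitrary: f rule: mi_induct)
 case zero
 thus ?case by (simp add: mi_deriv_zero mi_size_def)
next
 case (Suc \<nu> i)
 have "(LBI x. f x * pderiv_dir i (mi_deriv \<nu> g) x) = - (LBI x. pderiv_dir i f x * mi_deriv \<nu> g x)"
  by (rule integral_by_parts[of _ _ R]) (auto intro!: Suc.prems smooth_mi_deriv g mi_deriv_zero_outside[OF out])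
 also have "... = - ((- 1) ^ mi_size \<nu> * (LBI x. mi_deriv \<nu> (pderiv_dir i f) x * g x))"
  by (subst Suc.IH) (auto simp: smooth_pderiv_dir Suc.prems)
 finally show ?case unfolding mi_deriv_Suc(1)[OF g] mi_deriv_Suc(2)[OF Suc.prems] mi_size_Suc by simp
qed

text \<open>First \<open>f\<close> is clipped in height and in space. The clipped function is a
  pointwise limit of continuous functions off a negligible set; clipping those in the same way
  preserves the limit and supplies a dominating function.\<close>

lemma L1_dense_continuous:
 fixes f :: "real^'n \<Rightarrow> real"
 assumes f: "integrable lborel f" and e: "0 < e"
 shows "\<exists>g S. continuous_on UNIV g \<and> (\<forall>x. S < norm x \<longrightarrow> g x = 0) \<and> (LBI x. \<bar>f x - g x\<bar>) < e"
proof -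
 define cl :: "real \<Rightarrow> real \<Rightarrow> real" where "cl N t = max (- N) (min N t)" for N t
 define fN :: "nat \<Rightarrow> real^'n \<Rightarrow> real"
  where "fN N x = (if norm x \<le> real N then cl (real N) (f x) else 0)" for N x
 have [measurable]: "f \<in> borel_measurable borel" using f by auto
 have [measurable]: "fN N \<in> borel_measurable borel" for N unfolding fN_def cl_def by measurable
 have "(\<lambda>N. \<integral>x. \<bar>f x - fN N x\<bar> \<partial>lborel) \<longlonglongrightarrow> (\<integral>x. 0 \<partial>(lborel :: (real^'n) measure))"
 proof (rule integral_dominated_convergence)
  show "integrable lborel (\<lambda>x. 2 * \<bar>f x\<bar>)" using f by auto
  show "AE x in lborel. (\<lambda>N. \<bar>f x - fN N x\<bar>) \<longlonglongrightarrow> 0"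
  proof (rule AE_I2)
   fix x
   obtain N0 where N0: "max (norm x) \<bar>f x\<bar> \<le> real N0" using real_arch_simple by blast
   have "\<bar>f x - fN N x\<bar> = 0" if "N \<ge> N0" for N
   proof -
    have "norm x \<le> real N" "\<bar>f x\<bar> \<le> real N" using N0 that by auto
    thus ?thesis unfolding fN_def cl_def by auto
   qed
   thus "(\<lambda>N. \<bar>f x - fN N x\<bar>) \<longlonglongrightarrow> 0" by (intro tendsto_eventually) (auto simp: eventually_sequentially)
  qed
  show "AE x in lborel. norm \<bar>f x - fN N x\<bar> \<le> 2 * \<bar>f x\<bar>" for N by (rule AE_I2) (auto simp: fN_def cl_def)
 qed auto
 hence "eventually (\<lambda>N. (LBI x. \<bar>f x - fN N x\<bar>) < e / 2) sequentially" using e by (intro order_tendstoD) auto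
 then obtain N where N: "(LBI x. \<bar>f x - fN N x\<bar>) < e / 2" using eventually_sequentially by auto
 have "fN N \<in> borel_measurable lebesgue" by (intro measurable_completion) simp
 hence "fN N measurable_on UNIV" by (rule lebesgue_measurable_imp_measurable_on) simp
 then obtain Z g where Z: "negligible Z" and g: "\<And>k. continuous_on UNIV (g k)"
  "\<And>x. x \<notin> Z \<Longrightarrow> (\<lambda>k. g k x) \<longlonglongrightarrow> fN N x" by (auto simp: measurable_on_def)
 \<comment> \<open>One on the ball of radius N, where the clipped function lives, and zero beyond
   radius N + 1: the approximants get a common bounded support without changing the limit.\<close>
 define cut where "cut x = max 0 (min 1 (real N + 1 - norm x))" for x :: "real^'n"
 define h where "h k x = cl (real N) (g k x) * cut x" for k x
 have hc: "continuous_on UNIV (h k)" for k unfolding h_def cut_def cl_def by (intro continuous_intros g)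
 have [measurable]: "h k \<in> borel_measurable borel" for k using hc borel_measurable_continuous_onI by blast
 have h0: "h k x = 0" if "real N + 1 < norm x" for k x using that by (simp add: h_def cut_def)
 have lim: "(\<lambda>k. h k x) \<longlonglongrightarrow> fN N x" if "x \<notin> Z" for x
 proof -
  have "(\<lambda>k. cl (real N) (g k x) * cut x) \<longlonglongrightarrow> cl (real N) (fN N x) * cut x"
   unfolding cl_def by (intro tendsto_intros g(2) that)
  also have "cl (real N) (fN N x) * cut x = fN N x" by (auto simp: fN_def cl_def cut_def)
  finally show ?thesis unfolding h_def .
 qed
 have aeZ: "AE x in lborel. x \<notin> Z"
 proof -
  have "Z \<in> null_sets lebesgue" using Z negligible_iff_null_sets by blast
  hence "AE x in lebesgue. x \<notin> Z" by (rule AE_not_in)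
  thus ?thesis by (simp add: AE_completion_iff)
 qed
 have "(\<lambda>k. \<integral>x. \<bar>fN N x - h k x\<bar> \<partial>lborel) \<longlonglongrightarrow> (\<integral>x. 0 \<partial>(lborel :: (real^'n) measure))"
 proof (rule integral_dominated_convergence)
  have "integrable lborel (\<lambda>x. indicator (cball 0 (real N + 1)) x *\<^sub>R (2 * real N))"
   by (rule borel_integrable_compact) auto
  thus "integrable lborel (\<lambda>x :: real^'n. indicator (cball 0 (real N + 1)) x * (2 * real N))" by simp
  show "AE x in lborel. (\<lambda>k. \<bar>fN N x - h k x\<bar>) \<longlonglongrightarrow> 0" using aeZ
  proof eventually_elim
   case (elim x)
   have "(\<lambda>k. \<bar>fN N x - h k x\<bar>) \<longlonglongrightarrow> \<bar>fN N x - fN N x\<bar>" by (intro tendsto_intros lim elim)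
   thus ?case by simp
  qed
  have c1: "\<bar>cl (real N) t\<bar> \<le> real N" for t by (auto simp: cl_def)
  have c2: "0 \<le> cut x" "cut x \<le> 1" for x by (auto simp: cut_def)
  have "\<bar>h k x\<bar> \<le> real N" for k x unfolding h_def abs_mult using mult_mono[OF c1, of "\<bar>cut x\<bar>" 1] c2[of x] by auto
  moreover have "\<bar>fN N x\<bar> \<le> real N" for x using c1 by (simp add: fN_def)
  ultimately have "\<bar>fN N x - h k x\<bar> \<le> real N + real N" for k x
   by (rule order_trans[OF abs_triangle_ineq4 add_mono, rotated])
  hence "\<bar>fN N x - h k x\<bar> \<le> 2 * real N" for k x by simp
  moreover have "fN N x - h k x = 0" if "x \<notin> cball 0 (real N + 1)" for k x
   using that h0[of x k] by (simp add: fN_def)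
  ultimately show "AE x in lborel. norm \<bar>fN N x - h k x\<bar> \<le> indicator (cball 0 (real N + 1)) x * (2 * real N)" for k
   by (intro AE_I2) (auto simp: indicator_def)
 qed auto
 hence "eventually (\<lambda>k. (LBI x. \<bar>fN N x - h k x\<bar>) < e / 2) sequentially" using e by (intro order_tendstoD) auto
 then obtain k where k: "(LBI x. \<bar>fN N x - h k x\<bar>) < e / 2" using eventually_sequentially by auto
 have ih: "integrable lborel (h k)" by (rule bounded_support_integrable[OF hc h0])
 have iN: "integrable lborel (fN N)" by (rule Bochner_Integration.integrable_bound[OF f]) (auto simp: fN_def cl_def)
 have "(LBI x. \<bar>f x - h k x\<bar>) \<le> (LBI x. \<bar>f x - fN N x\<bar> + \<bar>fN N x - h k x\<bar>)"
  using f ih iN by (intro integral_mono) auto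
 also have "... = (LBI x. \<bar>f x - fN N x\<bar>) + (LBI x. \<bar>fN N x - h k x\<bar>)"
  using f ih iN by (intro Bochner_Integration.integral_add) auto
 also have "... < e" using N k by simp
 finally show ?thesis using hc h0 by blast
qed

text \<open>These are the properties of the kernel of the quasi-interpolant. No sign is assumed, so
  the integral of |\<psi>| enters where a nonnegative kernel would contribute 1.\<close>

locale mollifier =
 fixes \<psi> :: "real^'n::finite \<Rightarrow> real" and r :: real
 assumes psi_smooth: "smooth \<psi>" and psi_zero: "\<And>u. r < norm u \<Longrightarrow> \<psi> u = 0"
  and r_pos: "0 < r" and psi_integral: "(LBI u. \<psi> u) = 1"
begin

text \<open>At the scale \<open>node_size M z / (real m + 1)\<close> and with first argument z this
  is \<open>scaled_kernel\<close>; at small scales it is an approximate identity.\<close>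

definition mker :: "real \<Rightarrow> real^'n \<Rightarrow> real^'n \<Rightarrow> real" where
 "mker \<eta> x y = \<psi> ((1/\<eta>) *\<^sub>R (x - y)) / \<eta> ^ CARD('n)"

definition moll :: "real \<Rightarrow> (real^'n \<Rightarrow> real) \<Rightarrow> real^'n \<Rightarrow> real" where
 "moll \<eta> f x = (LBI y. f y * mker \<eta> x y)"

definition psi_bound :: real where
 "psi_bound = (SOME M. 0 < M \<and> (\<forall>u. \<bar>\<psi> u\<bar> \<le> M))"

lemma psi_bound: "0 < psi_bound" "\<bar>\<psi> u\<bar> \<le> psi_bound"
proof -
 have "0 < psi_bound \<and> (\<forall>u. \<bar>\<psi> u\<bar> \<le> psi_bound)" unfolding psi_bound_def
  by (rule someI_ex) (use bounded_support_bound[OF smooth_continuous[OF psi_smooth] psi_zero] in blast)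
 thus "0 < psi_bound" "\<bar>\<psi> u\<bar> \<le> psi_bound" by auto
qed

lemma psi_borel[measurable]: "\<psi> \<in> borel_measurable borel" by (rule smooth_borel[OF psi_smooth])

lemma psi_integrable: "integrable lborel \<psi>"
 by (rule bounded_support_integrable[OF smooth_continuous[OF psi_smooth] psi_zero])

lemma mker_borel[measurable]: "(\<lambda>(x, y). mker \<eta> x y) \<in> borel_measurable (borel \<Otimes>\<^sub>M borel)"
 unfolding mker_def by measurable

lemma mker_borel'[measurable (raw)]:
 "f \<in> borel_measurable M \<Longrightarrow> g \<in> borel_measurable M \<Longrightarrow> (\<lambda>x. mker \<eta> (f x) (g x)) \<in> borel_measurable M"
 unfolding mker_def divide_inverse by (intro borel_measurable_times borel_measurable_const) measurable

lemma mker_zero: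
 assumes "0 < \<eta>" "r * \<eta> < dist x y" shows "mker \<eta> x y = 0"
proof -
 have "r < norm ((1/\<eta>) *\<^sub>R (x - y))"
 proof -
  have "norm ((1/\<eta>) *\<^sub>R (x - y)) = dist x y / \<eta>" using assms by (simp add: dist_norm)
  moreover have "r < dist x y / \<eta>" using assms by (simp add: field_simps)
  ultimately show ?thesis by (simp only:)
 qed
 thus ?thesis by (simp add: mker_def psi_zero)
qed

lemma mker_bound: "0 < \<eta> \<Longrightarrow> \<bar>mker \<eta> x y\<bar> \<le> psi_bound / \<eta> ^ CARD('n)"
 unfolding mker_def by (simp add: divide_right_mono psi_bound)

lemma integral_mker:
 assumes "0 < \<eta>" shows "(LBI y. mker \<eta> x y) = 1"
proof -
 have "(LBI u. \<psi> u) = \<bar>- 1/\<eta>\<bar> ^ CARD('n) * (LBI y. \<psi> ((1/\<eta>) *\<^sub>R x + (- 1/\<eta>) *\<^sub>R y))"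
  by (rule integral_affine) (use assms in auto)
 also have "... = (LBI y. mker \<eta> x y)"
  using assms by (simp add: mker_def scaleR_diff_right power_divide flip: integral_mult_right_zero)
 finally show ?thesis using psi_integral by simp
qed

lemma nn_integral_mker:
 assumes "0 < \<eta>"
 shows "(LBNN y. ennreal \<bar>mker \<eta> x y\<bar>) = (LBNN u. ennreal \<bar>\<psi> u\<bar>)"
  and "(LBNN x. ennreal \<bar>mker \<eta> x y\<bar>) = (LBNN u. ennreal \<bar>\<psi> u\<bar>)"
proof -
 let ?Z = "LBNN u. ennreal \<bar>\<psi> u\<bar>"
 have k1: "\<bar>- 1/\<eta>\<bar> ^ CARD('n) * \<bar>\<psi> ((1/\<eta>) *\<^sub>R x + (- 1/\<eta>) *\<^sub>R y)\<bar> = \<bar>mker \<eta> x y\<bar>" for y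
  unfolding mker_def using assms by (simp add: scaleR_diff_right power_divide)
 have k2: "\<bar>1/\<eta>\<bar> ^ CARD('n) * \<bar>\<psi> ((- 1/\<eta>) *\<^sub>R y + (1/\<eta>) *\<^sub>R x)\<bar> = \<bar>mker \<eta> x y\<bar>" for x
  unfolding mker_def using assms by (simp add: scaleR_diff_right power_divide)
 have "?Z = ennreal (\<bar>- 1/\<eta>\<bar> ^ CARD('n)) * (LBNN y. ennreal \<bar>\<psi> ((1/\<eta>) *\<^sub>R x + (- 1/\<eta>) *\<^sub>R y)\<bar>)"
  by (rule nn_integral_affine) (use assms in auto)
 also have "... = (LBNN y. ennreal (\<bar>- 1/\<eta>\<bar> ^ CARD('n)) * ennreal \<bar>\<psi> ((1/\<eta>) *\<^sub>R x + (- 1/\<eta>) *\<^sub>R y)\<bar>)"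
  by (rule nn_integral_cmult[symmetric]) simp
 also have "... = (LBNN y. ennreal \<bar>mker \<eta> x y\<bar>)" unfolding k1[symmetric] by (subst ennreal_mult) auto
 finally show "(LBNN y. ennreal \<bar>mker \<eta> x y\<bar>) = ?Z" by (rule sym)
 have "?Z = ennreal (\<bar>1/\<eta>\<bar> ^ CARD('n)) * (LBNN x. ennreal \<bar>\<psi> ((- 1/\<eta>) *\<^sub>R y + (1/\<eta>) *\<^sub>R x)\<bar>)"
  by (rule nn_integral_affine) (use assms in auto)
 also have "... = (LBNN x. ennreal (\<bar>1/\<eta>\<bar> ^ CARD('n)) * ennreal \<bar>\<psi> ((- 1/\<eta>) *\<^sub>R y + (1/\<eta>) *\<^sub>R x)\<bar>)"
  by (rule nn_integral_cmult[symmetric]) simp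
 also have "... = (LBNN x. ennreal \<bar>mker \<eta> x y\<bar>)" unfolding k2[symmetric] by (subst ennreal_mult) auto
 finally show "(LBNN x. ennreal \<bar>mker \<eta> x y\<bar>) = ?Z" by (rule sym)
qed

text \<open>An averaged modulus of continuity at scale \<eta>. It bounds the L1 distance of
  \<open>f\<close> to its mollification, is small for continuous functions of bounded support, and
  changes little under L1 perturbations; together these give convergence for every integrable
  function.\<close>

definition osc :: "real \<Rightarrow> (real^'n \<Rightarrow> real) \<Rightarrow> ennreal" where
 "osc \<eta> f = (LBNN x. \<integral>\<^sup>+y. ennreal (\<bar>f y - f x\<bar> * \<bar>mker \<eta> x y\<bar>) \<partial>lborel)"

lemma integrable_mult_mker:
 assumes f: "integrable lborel f" and "0 < \<eta>"
 shows "integrable lborel (\<lambda>y. f y * mker \<eta> x y)"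
proof (rule Bochner_Integration.integrable_bound)
 show "integrable lborel (\<lambda>y. (psi_bound / \<eta> ^ CARD('n)) * f y)" using f by simp
 have [measurable]: "f \<in> borel_measurable borel" using f by auto
 show "(\<lambda>y. f y * mker \<eta> x y) \<in> borel_measurable lborel" by measurable
 have "\<bar>f y\<bar> * \<bar>mker \<eta> x y\<bar> \<le> \<bar>f y\<bar> * (psi_bound / \<eta> ^ CARD('n))" for y
  by (rule mult_left_mono) (auto simp: mker_bound assms)
 thus "AE y in lborel. norm (f y * mker \<eta> x y) \<le> norm ((psi_bound / \<eta> ^ CARD('n)) * f y)"
  using psi_bound(1) assms(2) by (intro AE_I2) (auto simp: abs_mult mult_ac)
qed

lemma moll_borel[measurable]:
 assumes "integrable lborel f" shows "moll \<eta> f \<in> borel_measurable borel"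
proof -
 have [measurable]: "f \<in> borel_measurable borel" using assms by auto
 have "(\<lambda>x. \<integral>y. f y * mker \<eta> x y \<partial>lborel) \<in> borel_measurable lborel"
  by (rule lborel.borel_measurable_lebesgue_integral) measurable
 thus ?thesis unfolding moll_def by simp
qed

lemma moll_osc:
 assumes f: "integrable lborel f" and e: "0 < \<eta>"
 shows "(LBNN x. ennreal \<bar>moll \<eta> f x - f x\<bar>) \<le> osc \<eta> f" unfolding osc_def
proof (rule nn_integral_mono)
 fix x
 have k: "integrable lborel (\<lambda>y. mker \<eta> x y)" using integral_mker[OF e, of x] not_integrable_integral_eq by fastforce
 have "moll \<eta> f x - f x = (LBI y. f y * mker \<eta> x y) - (LBI y. f x * mker \<eta> x y)"
  unfolding moll_def by (simp add: integral_mker e)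
 also have "... = (LBI y. (f y - f x) * mker \<eta> x y)"
  using integrable_mult_mker[OF f e, of x] k by (simp add: algebra_simps)
 finally have "ennreal \<bar>moll \<eta> f x - f x\<bar> = ennreal (norm (LBI y. (f y - f x) * mker \<eta> x y))" by simp
 also have "... \<le> (LBNN y. ennreal (norm ((f y - f x) * mker \<eta> x y)))" using integrable_mult_mker[OF f e, of x] k
  by (intro integral_norm_bound_ennreal) (simp add: algebra_simps)
 finally show "ennreal \<bar>moll \<eta> f x - f x\<bar> \<le> (LBNN y. ennreal (\<bar>f y - f x\<bar> * \<bar>mker \<eta> x y\<bar>))" by (simp add: abs_mult)
qed

text \<open>The error f - g occurs once at each of the two points. The absolute kernel has the same
  mass in either variable, so each occurrence contributes that mass times the L1 distance, whence
  the factor 2.\<close>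

lemma osc_triangle:
 assumes [measurable]: "f \<in> borel_measurable borel" "g \<in> borel_measurable borel" and e: "0 < \<eta>"
 shows "osc \<eta> f \<le> osc \<eta> g + 2 * (LBNN u. ennreal \<bar>\<psi> u\<bar>) * (LBNN x. ennreal \<bar>f x - g x\<bar>)"
proof -
 let ?K = "\<lambda>x y. ennreal \<bar>mker \<eta> x y\<bar>" and ?d = "\<lambda>x. ennreal \<bar>f x - g x\<bar>"
 let ?L = "\<integral>\<^sup>+u. ennreal \<bar>\<psi> u\<bar> \<partial>lborel"
 have "osc \<eta> f \<le> (LBNN x. \<integral>\<^sup>+y. (ennreal (\<bar>g y - g x\<bar> * \<bar>mker \<eta> x y\<bar>) + ?d y * ?K x y) + ?d x * ?K x y \<partial>lborel)"
  unfolding osc_def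
 proof (intro nn_integral_mono)
  fix x y
  have "\<bar>f y - f x\<bar> \<le> \<bar>g y - g x\<bar> + \<bar>f y - g y\<bar> + \<bar>f x - g x\<bar>" by linarith
  hence "\<bar>f y - f x\<bar> * \<bar>mker \<eta> x y\<bar> \<le> (\<bar>g y - g x\<bar> + \<bar>f y - g y\<bar> + \<bar>f x - g x\<bar>) * \<bar>mker \<eta> x y\<bar>"
   by (rule mult_right_mono) simp
  hence "ennreal (\<bar>f y - f x\<bar> * \<bar>mker \<eta> x y\<bar>) \<le> ennreal ((\<bar>g y - g x\<bar> + \<bar>f y - g y\<bar> + \<bar>f x - g x\<bar>) * \<bar>mker \<eta> x y\<bar>)"
   by (rule ennreal_leI)
  thus "ennreal (\<bar>f y - f x\<bar> * \<bar>mker \<eta> x y\<bar>) \<le>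
    ennreal (\<bar>g y - g x\<bar> * \<bar>mker \<eta> x y\<bar>) + ?d y * ?K x y + ?d x * ?K x y"
   by (simp add: distrib_right ennreal_plus[symmetric] ennreal_mult[symmetric] del: ennreal_plus)
 qed
 also have "... = osc \<eta> g + (LBNN x. \<integral>\<^sup>+y. ?d y * ?K x y \<partial>lborel) + (LBNN x. \<integral>\<^sup>+y. ?d x * ?K x y \<partial>lborel)"
  unfolding osc_def by (simp add: nn_integral_add)
 also have "(LBNN x. \<integral>\<^sup>+y. ?d x * ?K x y \<partial>lborel) = ?L * (LBNN x. ?d x)"
  by (simp add: nn_integral_cmult nn_integral_multc nn_integral_mker[OF e] mult.commute)
 also have "(LBNN x. \<integral>\<^sup>+y. ?d y * ?K x y \<partial>lborel) = (LBNN y. \<integral>\<^sup>+x. ?d y * ?K x y \<partial>lborel)"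
  by (rule lborel_pair.Fubini') measurable
 also have "... = ?L * (LBNN x. ?d x)"
  by (simp add: nn_integral_cmult nn_integral_multc nn_integral_mker[OF e] mult.commute)
 finally show ?thesis by (simp add: mult_2 distrib_right distrib_left add.assoc mult.assoc)
qed

lemma osc_continuous:
 assumes g: "continuous_on UNIV g" and out: "\<And>x. S < norm x \<Longrightarrow> g x = 0"
  and d: "0 < d" "d \<le> 1" "\<And>x y. dist x y \<le> d \<Longrightarrow> \<bar>g x - g y\<bar> \<le> e" and e: "0 < \<eta>" "r * \<eta> \<le> d" "0 \<le> e"
 shows "osc \<eta> g \<le> ennreal e * (LBNN u. ennreal \<bar>\<psi> u\<bar>) * emeasure lborel (cball (0 :: real^'n) (S + 1))"
proof -
 have [measurable]: "g \<in> borel_measurable borel" using g borel_measurable_continuous_onI by blast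
 have "osc \<eta> g \<le> (LBNN x. \<integral>\<^sup>+y. (ennreal e * indicator (cball 0 (S + 1)) x) * ennreal \<bar>mker \<eta> x y\<bar> \<partial>lborel)"
  unfolding osc_def
 proof (intro nn_integral_mono)
  fix x y
  show "ennreal (\<bar>g y - g x\<bar> * \<bar>mker \<eta> x y\<bar>) \<le> ennreal e * indicator (cball 0 (S + 1)) x * ennreal \<bar>mker \<eta> x y\<bar>"
  proof (cases "dist x y \<le> r * \<eta>")
   case False thus ?thesis using mker_zero[OF e(1), of x y] by simp
  next
   case True
   hence dd: "dist x y \<le> d" using e by simp
   have "norm x \<le> norm y + dist x y" by (simp add: dist_norm norm_triangle_sub)
   hence "g y - g x = 0" if "x \<notin> cball 0 (S + 1)" using that out[of x] out[of y] dd d by (simp add: dist_norm)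
   moreover have "\<bar>g y - g x\<bar> \<le> e" using d(3)[OF dd] by (simp add: abs_minus_commute)
   ultimately show ?thesis
    using e by (auto simp: indicator_def simp flip: ennreal_mult intro!: ennreal_leI mult_right_mono)
  qed
 qed
 also have "... = (LBNN x. (ennreal e * (LBNN u. ennreal \<bar>\<psi> u\<bar>)) * indicator (cball (0 :: real^'n) (S + 1)) x)"
  by (subst nn_integral_cmult) (auto simp: nn_integral_mker[OF e(1)] mult_ac)
 also have "... = ennreal e * (LBNN u. ennreal \<bar>\<psi> u\<bar>) * emeasure lborel (cball (0 :: real^'n) (S + 1))"
  by (rule nn_integral_cmult_indicator) simp
 finally show ?thesis .
qed

lemma nn_psi_finite: "(LBNN u. ennreal \<bar>\<psi> u\<bar>) < \<infinity>" using psi_integrable by (simp add: integrable_iff_bounded)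

lemma osc_tendsto_0:
 assumes f: "integrable lborel f" and e: "0 < e"
 shows "\<exists>\<xi>>0. \<forall>\<eta>. 0 < \<eta> \<and> \<eta> \<le> \<xi> \<longrightarrow> osc \<eta> f \<le> ennreal e"
proof -
 define L where "L = enn2real (LBNN u. ennreal \<bar>\<psi> u\<bar>)"
 have L: "(LBNN u. ennreal \<bar>\<psi> u\<bar>) = ennreal L" "0 \<le> L" unfolding L_def using nn_psi_finite by auto
 \<comment> \<open>The budget is e / 2 for replacing f by g, which costs 2 L times the L1 distance,
   and e / 2 for the oscillation of g; adding 1 to L, and below also to V, avoids division by
   zero.\<close>
 have "0 < e / (4 * (L + 1))" using e L by simp
 from L1_dense_continuous[OF f this]
 obtain g S where g: "continuous_on UNIV g" "\<And>x. S < norm x \<Longrightarrow> g x = 0"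
  and fg: "(LBI x. \<bar>f x - g x\<bar>) < e / (4 * (L + 1))" by blast
 have gi: "integrable lborel g" by (rule bounded_support_integrable[OF g])
 have [measurable]: "f \<in> borel_measurable borel" "g \<in> borel_measurable borel" using f gi by auto
 have fg': "(LBNN x. ennreal \<bar>f x - g x\<bar>) \<le> ennreal (e / (4 * (L + 1)))"
  using fg f gi by (subst nn_integral_eq_integral) (auto intro: ennreal_leI)
 define V where "V = measure lborel (cball (0 :: real^'n) (S + 1))"
 have V: "emeasure lborel (cball (0 :: real^'n) (S + 1)) = ennreal V" "0 \<le> V"
  unfolding V_def using emeasure_lborel_cball_finite[of "0 :: real^'n" "S + 1"]
  by (auto intro!: emeasure_eq_ennreal_measure)
 define e' where "e' = e / (2 * (L + 1) * (V + 1))"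
 have e': "0 < e'" using e L V by (simp add: e'_def)
 have uc: "uniformly_continuous_on UNIV g"
 proof -
  have c: "compact (cball (0 :: real^'n) (\<bar>S\<bar> + 2))" by simp
  have ucc: "uniformly_continuous_on (cball 0 (\<bar>S\<bar> + 2)) g"
   by (rule compact_uniformly_continuous[OF _ c]) (rule continuous_on_subset[OF g(1)], simp)
  show ?thesis unfolding uniformly_continuous_on_def
  proof (intro allI impI)
   fix a :: real assume a: "0 < a"
   then obtain d where d: "0 < d" "\<And>x y. x \<in> cball 0 (\<bar>S\<bar> + 2) \<Longrightarrow> y \<in> cball 0 (\<bar>S\<bar> + 2) \<Longrightarrow> dist y x < d \<Longrightarrow> dist (g y) (g x) < a"
    using ucc unfolding uniformly_continuous_on_def by metis
   have "dist (g y) (g x) < a" if "dist y x < min d 1" for x y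
   proof (cases "norm x \<le> \<bar>S\<bar> + 1")
    case True
    have "norm y \<le> norm x + dist y x" by (simp add: dist_norm norm_triangle_sub)
    thus ?thesis using d(2)[of x y] True that by simp
   next
    case False
    have "norm x \<le> norm y + dist y x" by (metis dist_commute dist_norm norm_triangle_sub)
    hence "g x = 0" "g y = 0" using False that by (auto intro!: g(2))
    thus ?thesis using a by simp
   qed
   thus "\<exists>d>0. \<forall>x\<in>UNIV. \<forall>x'\<in>UNIV. dist x' x < d \<longrightarrow> dist (g x') (g x) < a"
    using d(1) by (intro exI[of _ "min d 1"]) auto
  qed
 qed
 obtain d where d: "0 < d" "\<And>x y. dist x y < d \<Longrightarrow> dist (g x) (g y) < e'"
  using uc e' unfolding uniformly_continuous_on_def by (metis UNIV_I)
 define d' where "d' = min (d/2) 1"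
 have d': "0 < d'" "d' \<le> 1" "\<And>x y. dist x y \<le> d' \<Longrightarrow> \<bar>g x - g y\<bar> \<le> e'"
  unfolding d'_def using d by (auto simp: dist_real_def intro!: less_imp_le)
 show ?thesis
 proof (intro exI[of _ "d' / r"] conjI allI impI)
  show "0 < d' / r" using d' r_pos by simp
  fix \<eta> assume eps: "0 < \<eta> \<and> \<eta> \<le> d' / r"
  hence re: "r * \<eta> \<le> d'" using r_pos by (simp add: field_simps)
  have "osc \<eta> f \<le> osc \<eta> g + 2 * ennreal L * (LBNN x. ennreal \<bar>f x - g x\<bar>)"
   using osc_triangle[of f g \<eta>] eps unfolding L by simp
  also have "... \<le> ennreal e' * ennreal L * ennreal V + 2 * ennreal L * ennreal (e / (4 * (L + 1)))"
  proof (intro add_mono mult_left_mono fg')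
   show "osc \<eta> g \<le> ennreal e' * ennreal L * ennreal V"
    using osc_continuous[of g S d' e' \<eta>] g d' eps re e' unfolding L V by auto
  qed auto
  also have "... = ennreal (e' * L * V + 2 * L * (e / (4 * (L + 1))))"
  proof -
   have q: "0 \<le> e / (4 * (L + 1))" using e L by simp
   have "ennreal (2 * L * (e / (4 * (L + 1)))) = ennreal 2 * ennreal L * ennreal (e / (4 * (L + 1)))"
    using L q by (simp only: ennreal_mult mult_nonneg_nonneg zero_le_numeral)
   moreover have "ennreal (e' * L * V) = ennreal e' * ennreal L * ennreal V"
    using L V e' by (simp add: ennreal_mult)
   ultimately show ?thesis using L V e' q by (simp only: ennreal_plus mult_nonneg_nonneg less_imp_le zero_le_numeral ennreal_numeral)
  qed
  also have "... \<le> ennreal e"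
  proof (rule ennreal_leI)
   have "L * V \<le> (L + 1) * (V + 1)" using L V by (intro mult_mono) auto
   hence "e' * (L * V) \<le> e' * ((L + 1) * (V + 1))" using e' by (intro mult_left_mono) auto
   also have "e' * ((L + 1) * (V + 1)) = e / 2"
    unfolding e'_def using L V by (simp add: field_simps add_nonneg_eq_0_iff)
   finally have 1: "e' * L * V \<le> e / 2" by simp
   have "2 * L * (e / (4 * (L + 1))) = (e / 2) * (L / (L + 1))" using L by (simp add: divide_simps)
   also have "... \<le> (e / 2) * 1" using L e by (intro mult_left_mono) (auto simp: divide_le_eq_1)
   finally show "e' * L * V + 2 * L * (e / (4 * (L + 1))) \<le> e" using 1 by simp
  qed
  finally show "osc \<eta> f \<le> ennreal e" .
 qed
qed

lemma moll_integrable: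
 assumes f: "integrable lborel f" and e: "0 < \<eta>" "osc \<eta> f < \<infinity>"
 shows "integrable lborel (\<lambda>x. moll \<eta> f x - f x)"
proof -
 have [measurable]: "f \<in> borel_measurable borel" "moll \<eta> f \<in> borel_measurable borel" using f moll_borel by auto
 show ?thesis using moll_osc[OF f e(1)] e(2) by (intro integrableI_bounded) auto
qed

text \<open>The mollifications of an integrable function converge in \<open>L\<^sup>1\<close>, hence almost everywhere along
 some sequence.\<close>

lemma moll_ae_sequence:
 assumes f: "integrable lborel f" and "0 < \<xi>"
 shows "\<exists>s. (\<forall>k::nat. 0 < s k \<and> s k \<le> \<xi>) \<and> (AE x in lborel. (\<lambda>k. moll (s k) f x) \<longlonglongrightarrow> f x)
   \<and> (\<lambda>k. \<integral>x. \<bar>moll (s k) f x - f x\<bar> \<partial>lborel) \<longlonglongrightarrow> 0 \<and> (\<forall>k. integrable lborel (\<lambda>x. moll (s k) f x - f x))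
   \<and> s \<longlonglongrightarrow> 0"
proof -
 have "\<exists>e. 0 < e \<and> e \<le> \<xi> \<and> e \<le> inverse (Suc k) \<and> osc e f \<le> ennreal (inverse (Suc k))" for k :: nat
 proof -
  obtain d where d: "0 < d" "\<And>\<eta>. 0 < \<eta> \<Longrightarrow> \<eta> \<le> d \<Longrightarrow> osc \<eta> f \<le> ennreal (inverse (Suc k))"
   using osc_tendsto_0[OF f, of "inverse (Suc k)"] by auto
  show ?thesis using d assms(2) by (intro exI[of _ "min (min d \<xi>) (inverse (Suc k))"]) auto
 qed
 then obtain e where e: "\<And>k::nat. 0 < e k \<and> e k \<le> \<xi> \<and> e k \<le> inverse (Suc k) \<and> osc (e k) f \<le> ennreal (inverse (Suc k))" by metis
 have i: "integrable lborel (\<lambda>x. moll (e k) f x - f x)" for k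
  using e[of k] le_less_trans by (intro moll_integrable f) fastforce+
 have b: "(LBI x. norm (moll (e k) f x - f x)) \<le> inverse (Suc k)" for k
 proof -
  have "ennreal (LBI x. norm (moll (e k) f x - f x)) = (LBNN x. ennreal (norm (moll (e k) f x - f x)))"
   using i[of k] by (intro nn_integral_eq_integral[symmetric]) auto
  also have "... \<le> ennreal (inverse (Suc k))" using moll_osc[OF f, of "e k"] e[of k] by auto
  finally show ?thesis by (simp only: ennreal_le_iff inverse_nonnegative_iff_nonnegative of_nat_0_le_iff)
 qed
 have lim: "(\<lambda>k. \<integral>x. norm (moll (e k) f x - f x) \<partial>lborel) \<longlonglongrightarrow> 0"
  by (rule tendsto_sandwich[OF _ _ tendsto_const LIMSEQ_inverse_real_of_nat]) (use b in \<open>auto intro!: always_eventually\<close>)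
 obtain t where t: "strict_mono t" "AE x in lborel. (\<lambda>k. moll (e (t k)) f x - f x) \<longlonglongrightarrow> 0"
  using tendsto_L1_AE_subseq[OF i lim] by auto
 have 0: "e \<longlonglongrightarrow> 0" by (rule tendsto_sandwich[OF _ _ tendsto_const LIMSEQ_inverse_real_of_nat])
   (use e less_imp_le in \<open>auto intro!: always_eventually\<close>)
 show ?thesis
 proof (intro exI[of _ "e \<circ> t"] conjI allI)
  show "AE x in lborel. (\<lambda>k. moll ((e \<circ> t) k) f x) \<longlonglongrightarrow> f x" using t(2) by eventually_elim (simp add: LIM_zero_iff)
  show "(\<lambda>k. \<integral>x. \<bar>moll ((e \<circ> t) k) f x - f x\<bar> \<partial>lborel) \<longlonglongrightarrow> 0"
   using LIMSEQ_subseq_LIMSEQ[OF lim t(1)] by (simp add: o_def)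
  show "(e \<circ> t) \<longlonglongrightarrow> 0" using LIMSEQ_subseq_LIMSEQ[OF 0 t(1)] .
 qed (use e i in auto)
qed

end

subsection \<open>Muckenhoupt weights\<close>

text \<open>The power function on [0, \<infinity>] with infinity kept fixed, so that p-th powers of
  averages can be estimated before anything is known to be finite.\<close>

definition epow :: "real \<Rightarrow> ennreal \<Rightarrow> ennreal" where
 "epow p x = (if x = \<infinity> then \<infinity> else ennreal (enn2real x powr p))"

lemma epow_ennreal: "0 \<le> t \<Longrightarrow> epow p (ennreal t) = ennreal (t powr p)" by (simp add: epow_def)

lemma epow_simps[simp]: "epow p 0 = 0" "epow p \<infinity> = \<infinity>" "epow p 1 = 1" "epow p top = top" by (auto simp: epow_def)

lemma epow_mono: assumes "0 < p" "x \<le> y" shows "epow p x \<le> epow p y"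
proof (cases "y = \<infinity>")
 case True thus ?thesis by (simp add: epow_def)
next
 case False
 hence "x \<noteq> \<infinity>" using assms(2) by (auto simp: top_unique)
 moreover have "enn2real x \<le> enn2real y" using assms(2) False by (simp add: enn2real_mono less_top)
 ultimately show ?thesis using False assms(1) by (auto simp: epow_def intro!: ennreal_leI powr_mono2)
qed

lemma epow_mult: assumes "0 < p" shows "epow p (x * y) = epow p x * epow p y"
proof -
 have a: "epow p z = 0 \<longleftrightarrow> z = 0" for z using enn2real_eq_0_iff[of z] by (auto simp: epow_def)
 show ?thesis
 proof (cases "x = \<infinity> \<or> y = \<infinity>")
  case True
  thus ?thesis using a[of x] a[of y]
   by (cases "x = 0"; cases "y = 0") (auto simp: ennreal_mult_top ennreal_top_mult)
 next
  case False
  then obtain s t where "x = ennreal s" "y = ennreal t" "0 \<le> s" "0 \<le> t"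
   by (metis ennreal_cases infinity_ennreal_def)
  thus ?thesis by (simp add: epow_ennreal powr_mult flip: ennreal_mult)
 qed
qed

lemma epow_borel[measurable]: "epow p \<in> borel_measurable borel"
proof -
 have "(\<lambda>x. if x = \<infinity> then \<infinity> else ennreal (enn2real x powr p)) \<in> borel_measurable borel" by measurable
 thus ?thesis unfolding epow_def .
qed

lemma ball_borel[measurable]: "ball (c :: 'a::euclidean_space) s \<in> sets borel" by simp

abbreviation ballvol :: "'n::finite itself \<Rightarrow> real \<Rightarrow> real" where
 "ballvol N s \<equiv> unit_ball_vol (real CARD('n)) * s ^ CARD('n)"

lemma emeasure_ball_vec: "0 \<le> s \<Longrightarrow> emeasure lborel (ball (c :: real^'n) s) = ennreal (ballvol TYPE('n) s)"
 by (simp add: emeasure_ball)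

lemma ballvol_pos: "0 < s \<Longrightarrow> 0 < ballvol TYPE('n::finite) s" by simp

definition avg :: "real \<Rightarrow> (real^'n \<Rightarrow> ennreal) \<Rightarrow> real^'n \<Rightarrow> ennreal" where
 "avg R f x = ennreal (1 / ballvol TYPE('n) R) * (LBNN y. f y * indicator (ball x R) y)"

lemma indicator_ball: "indicator (ball x R) y = (if dist x y < R then 1 else 0)" by (simp add: indicator_def)

lemma avg_borel[measurable]:
 assumes [measurable]: "f \<in> borel_measurable borel"
 shows "avg R f \<in> borel_measurable borel"
proof -
 have "(\<lambda>x. ennreal (1 / ballvol TYPE('a) R) * (LBNN y. f y * (if dist x y < R then 1 else 0))) \<in> borel_measurable borel"
  by measurable
 thus ?thesis unfolding avg_def[abs_def] indicator_ball .
qed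

text \<open>Young's inequality for f w^(1/p) and c^(p-1) w^(-1/p), multiplied by p. The free
  parameter c is optimised after integration.\<close>

lemma young:
 fixes w :: "'a \<Rightarrow> real"
 assumes c: "0 \<le> c" and p_gt_1: "1 < p" and w_pos: "\<And>x. 0 < w x"
 shows "ennreal (p * c powr (p - 1)) * f \<le> epow p f * ennreal (w x) + ennreal ((p - 1) * c powr p) * ennreal (w x powr (1 / (1 - p)))"
proof (cases f)
 case top
 thus ?thesis using w_pos[of x] by (simp add: ennreal_top_mult)
next
 case (real t)
 define q where "q = p / (p - 1)"
 have q: "1 < q" "1 / p + 1 / q = 1" using p_gt_1 by (auto simp: q_def field_simps)
 define a where "a = t * w x powr (1 / p)"
 define b where "b = c powr (p - 1) * w x powr (- 1 / p)"
 have "a * b = t * c powr (p - 1)" using w_pos[of x] by (simp add: a_def b_def powr_minus field_simps)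
 moreover have "a powr p = t powr p * w x" using real w_pos[of x] p_gt_1 by (simp add: a_def powr_mult powr_powr)
 moreover have "b powr q = c powr p * w x powr (1 / (1 - p))"
 proof -
  have "b powr q = (c powr (p - 1)) powr q * (w x powr (- 1 / p)) powr q" by (simp add: b_def powr_mult)
  also have "(c powr (p - 1)) powr q = c powr p" using p_gt_1 by (simp add: powr_powr q_def)
  also have "(w x powr (- 1 / p)) powr q = w x powr (1 / (1 - p))"
  proof -
   have "(- 1 / p) * q = 1 / (1 - p)" using p_gt_1 by (simp add: q_def divide_simps)
   thus ?thesis by (simp only: powr_powr)
  qed
  finally show ?thesis .
 qed
 moreover have "a * b \<le> a powr p / p + b powr q / q"
  using real w_pos[of x] by (intro Youngs_inequality p_gt_1 q) (auto simp: a_def b_def)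
 ultimately have "t * c powr (p - 1) \<le> (t powr p * w x) / p + (c powr p * w x powr (1 / (1 - p))) / q" by simp
 hence "p * (t * c powr (p - 1)) \<le> p * ((t powr p * w x) / p + (c powr p * w x powr (1 / (1 - p))) / q)"
  using p_gt_1 by (intro mult_left_mono) auto
 also have "... = t powr p * w x + (p - 1) * c powr p * w x powr (1 / (1 - p))"
  using p_gt_1 by (simp add: q_def field_simps)
 finally have "ennreal (p * (t * c powr (p - 1))) \<le> ennreal (t powr p * w x + (p - 1) * c powr p * w x powr (1 / (1 - p)))"
  by (rule ennreal_leI)
 thus ?thesis using real p_gt_1 w_pos[of x]
  by (simp add: epow_ennreal ennreal_mult[symmetric] ennreal_plus[symmetric] mult_ac del: ennreal_plus)
qed

text \<open>Integrating \<open>young\<close> and taking for c the quotient of the integrals of f and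
  of the dual weight turns the additive bound into the product form of Hoelder's inequality, with
  infinite values allowed.\<close>

lemma nn_integral_holder:
 fixes w :: "'a \<Rightarrow> real"
 assumes [measurable]: "f \<in> borel_measurable M" "w \<in> borel_measurable M"
  and p_gt_1: "1 < p" and w_pos: "\<And>x. 0 < w x"
  and fin: "(\<integral>\<^sup>+x. ennreal (w x powr (1 / (1 - p))) \<partial>M) < \<infinity>"
 shows "epow p (\<integral>\<^sup>+x. f x \<partial>M)
   \<le> (\<integral>\<^sup>+x. epow p (f x) * ennreal (w x) \<partial>M) * epow (p - 1) (\<integral>\<^sup>+x. ennreal (w x powr (1 / (1 - p))) \<partial>M)"
  (is "epow p ?F \<le> ?I * epow (p - 1) ?J")
proof (cases "?J = 0")
 case True
 \<comment> \<open>The dual weight is positive everywhere, so a zero integral leaves only a trivial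
   measure.\<close>
 hence "AE x in M. ennreal (w x powr (1 / (1 - p))) = 0" by (subst (asm) nn_integral_0_iff_AE) auto
 hence "AE x in M. f x = 0" by eventually_elim (use w_pos less_imp_neq in fastforce)
 hence "?F = 0" by (subst nn_integral_0_iff_AE) auto
 thus ?thesis by simp
next
 case False
 obtain j where j: "?J = ennreal j" "0 < j" using False fin by (cases ?J) (auto simp: less_le)
 have key: "ennreal (p * c' powr (p - 1)) * ?F \<le> ?I + ennreal ((p - 1) * c' powr p) * ?J" if "0 \<le> c'" for c'
 proof -
  have "ennreal (p * c' powr (p - 1)) * ?F = (\<integral>\<^sup>+x. (ennreal (p * c' powr (p - 1)) * f x) \<partial>M)"
   by (subst nn_integral_cmult[symmetric]) (auto simp: mult_ac)
  also have "... \<le> (\<integral>\<^sup>+x. (epow p (f x) * ennreal (w x) + ennreal ((p - 1) * c' powr p) * ennreal (w x powr (1 / (1 - p)))) \<partial>M)"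
   by (intro nn_integral_mono young that p_gt_1 w_pos)
  also have "... = ?I + ennreal ((p - 1) * c' powr p) * ?J"
   by (simp add: distrib_right nn_integral_add nn_integral_cmult mult.assoc)
  finally show ?thesis .
 qed
 show ?thesis
 proof (cases ?F)
  case top
  have "ennreal ((p - 1) * 1 powr p) * ?J < \<infinity>" by (simp add: j ennreal_mult_less_top)
  hence "?I = \<infinity>" using key[of 1] top p_gt_1 by (auto simp: ennreal_mult_top top_unique)
  thus ?thesis using j by (simp add: epow_ennreal ennreal_top_mult)
 next
  case (real \<phi>)
  show ?thesis
  proof (cases ?I)
   case top thus ?thesis using j by (simp add: epow_ennreal ennreal_top_mult)
  next
   case I: (real i)
   \<comment> \<open>The optimal parameter: with it c^(p-1) times the integral of f equals c^p times
     that of the dual weight, and p - 1 of the p copies on the left cancel.\<close>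
   define c' where "c' = \<phi> / j"
   have c': "0 \<le> c'" using real j by (simp add: c'_def)
   have "ennreal (p * c' powr (p - 1) * \<phi>) \<le> ennreal (i + (p - 1) * c' powr p * j)"
    using key[OF c'] real I j p_gt_1 by (simp add: ennreal_mult[symmetric] ennreal_plus[symmetric] del: ennreal_plus)
   hence "p * c' powr (p - 1) * \<phi> \<le> i + (p - 1) * c' powr p * j"
    using I j p_gt_1 by (subst (asm) ennreal_le_iff) auto
   moreover have "c' powr (p - 1) * \<phi> = c' powr p * j"
   proof (cases "\<phi> = 0")
    case True thus ?thesis using p_gt_1 by (simp add: c'_def)
   next
    case False
    hence "0 < c'" using real j by (simp add: c'_def)
    hence "c' powr p = c' powr (p - 1) * c'" by (simp add: powr_diff)
    thus ?thesis using j by (simp add: c'_def)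
   qed
   ultimately have "p * (c' powr p * j) \<le> i + (p - 1) * (c' powr p * j)" by (simp add: mult.assoc)
   hence 1: "c' powr p * j \<le> i" by (simp add: left_diff_distrib)
   have "\<phi> = c' * j" using j by (simp add: c'_def)
   hence "\<phi> powr p = c' powr p * j powr p" by (simp add: powr_mult)
   also have "j powr p = j * j powr (p - 1)" using j by (simp add: powr_diff)
   finally have "\<phi> powr p \<le> i * j powr (p - 1)"
    using mult_right_mono[OF 1, of "j powr (p - 1)"] by (simp add: mult.assoc)
   thus ?thesis using real I j by (simp add: epow_ennreal ennreal_mult[symmetric] ennreal_leI)
  qed
 qed
qed

text \<open>Hoelder's inequality with constant weight on an interval of length 1, so that the dual
  factor is 1.\<close>

lemma jensen_unit_interval:
 assumes [measurable]: "f \<in> borel_measurable borel" and "1 < p"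
 shows "epow p (LBNN s. f s * indicator {0<..1} s)
   \<le> (LBNN s. epow p (f s) * indicator {0<..1::real} s)"
proof -
 let ?M = "restrict_space lborel {0<..1::real}"
 have "f \<in> borel_measurable ?M" by (auto intro!: measurable_restrict_space1)
 from nn_integral_holder[OF this, of "\<lambda>_. 1" p] show ?thesis
  using assms(2) by (simp add: nn_integral_restrict_space emeasure_restrict_space)
qed

text \<open>The Muckenhoupt condition with the volumes multiplied out: one factor from the average
  of w and p - 1 from the dual average make the volume to the power p. The weight is a Borel
  function, positive at every point, so that no exceptional sets occur in pointwise
  inequalities.\<close>

locale muckenhoupt =
 fixes p A :: real and w :: "real^'n::finite \<Rightarrow> real"
 assumes p_gt_1: "1 < p" and w_borel[measurable]: "w \<in> borel_measurable borel"
  and w_pos: "\<And>x. 0 < w x"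
  and dual_finite: "\<And>c s. 0 < s \<Longrightarrow> (LBNN x. ennreal (w x powr (1 / (1 - p))) * indicator (ball c s) x) < \<infinity>"
  and Ap: "\<And>c s. 0 < s \<Longrightarrow>
   (LBNN x. ennreal (w x) * indicator (ball c s) x) *
   epow (p - 1) (LBNN x. ennreal (w x powr (1 / (1 - p))) * indicator (ball c s) x)
   \<le> ennreal (A * ballvol TYPE('n) s powr p)"
begin

abbreviation dual :: "real^'n \<Rightarrow> real" where "dual x \<equiv> w x powr (1 / (1 - p))"

lemma holder:
 assumes [measurable]: "f \<in> borel_measurable borel" and s: "0 < s"
 shows "epow p (LBNN x. f x * indicator (ball c s) x)
   \<le> (LBNN x. epow p (f x) * ennreal (w x) * indicator (ball c s) x)
    * epow (p - 1) (LBNN x. ennreal (dual x) * indicator (ball c s) x)"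
proof -
 let ?M = "restrict_space lborel (ball c s)"
 have "f \<in> borel_measurable ?M" "w \<in> borel_measurable ?M" by (auto intro!: measurable_restrict_space1)
 from nn_integral_holder[OF this p_gt_1 w_pos] show ?thesis
  using dual_finite[OF s, of c] by (simp add: nn_integral_restrict_space)
qed

text \<open>A negative constant would be truncated to 0 by \<open>ennreal\<close>; this is excluded
  because both integrals over the unit ball are strictly positive.\<close>

lemma A_nonneg: "0 \<le> A"
proof (rule ccontr)
 assume a: "\<not> 0 \<le> A"
 hence "ennreal (A * ballvol TYPE('n) 1 powr p) = 0" by (simp add: ennreal_neg mult_nonpos_nonneg)
 hence "(LBNN x. ennreal (w x) * indicator (ball 0 1) x) *
   epow (p - 1) (LBNN x. ennreal (dual x) * indicator (ball 0 1) x) = 0" using Ap[of 1 0] by simp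
 moreover have nz: "(\<integral>\<^sup>+x. ennreal (f x) * indicator (ball 0 1) x \<partial>(lborel :: (real^'n) measure)) \<noteq> 0"
  if [measurable]: "f \<in> borel_measurable borel" and "\<And>x. 0 < f x" for f :: "real^'n \<Rightarrow> real"
 proof
  assume "(\<integral>\<^sup>+x. ennreal (f x) * indicator (ball 0 1) x \<partial>(lborel :: (real^'n) measure)) = 0"
  hence "AE x in lborel. ennreal (f x) * indicator (ball 0 1) x = 0" by (subst (asm) nn_integral_0_iff_AE) auto
  hence "AE x in lborel. x \<notin> ball (0 :: real^'n) 1"
  proof eventually_elim
   case (elim x)
   have "ennreal (f x) \<noteq> 0" using that(2)[of x] by (simp add: ennreal_eq_0_iff not_le)
   thus ?case using elim by (auto simp: indicator_def split: if_splits)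
  qed
  hence "emeasure lborel (ball (0 :: real^'n) 1) = 0" by (subst (asm) AE_iff_measurable[of "ball 0 1"]) auto
  thus False using ballvol_pos[of 1, where 'n='n] by (simp add: emeasure_ball_vec)
 qed
 ultimately have "epow (p - 1) (LBNN x. ennreal (dual x) * indicator (ball 0 1) x) = 0" using nz[of w] w_pos by auto
 hence "(LBNN x. ennreal (dual x) * indicator (ball 0 1) x) = 0"
  using enn2real_eq_0_iff by (auto simp: epow_def split: if_splits)
 moreover have "0 < dual x" for x using w_pos[of x] by simp
 ultimately show False using nz[of dual] by auto
qed

text \<open>Hoelder's inequality produces the dual integral, and the Muckenhoupt condition trades
  it, multiplied by the weight of the ball, for a power of the volume. This is how unweighted
  integrals are compared with weighted ones.\<close>

lemma transfer:
 assumes [measurable]: "f \<in> borel_measurable borel" and s: "0 < s"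
 shows "epow p (LBNN x. f x * indicator (ball c s) x) * (LBNN x. ennreal (w x) * indicator (ball c s) x)
   \<le> ennreal (A * ballvol TYPE('n) s powr p) * (LBNN x. epow p (f x) * ennreal (w x) * indicator (ball c s) x)"
proof -
 let ?I = "\<integral>\<^sup>+x. epow p (f x) * ennreal (w x) * indicator (ball c s) x \<partial>lborel"
 let ?W = "\<integral>\<^sup>+x. ennreal (w x) * indicator (ball c s) x \<partial>lborel"
 let ?J = "epow (p - 1) (LBNN x. ennreal (dual x) * indicator (ball c s) x)"
 have "epow p (LBNN x. f x * indicator (ball c s) x) * ?W \<le> (?I * ?J) * ?W" by (intro mult_right_mono holder s) auto
 also have "... = (?W * ?J) * ?I" by (simp add: mult_ac)
 also have "... \<le> ennreal (A * ballvol TYPE('n) s powr p) * ?I" by (intro mult_right_mono Ap s) auto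
 finally show ?thesis .
qed

text \<open>Hoelder's inequality on \<open>ball x R\<close> gives a dual factor over a ball
  contained in \<open>ball y (2 * R)\<close>. After exchanging the integrals, w is integrated over
  points x of that same larger ball, and the Muckenhoupt condition there closes the estimate; the
  loss is the volume ratio 2^n to the power p.\<close>

lemma avg_bound:
 assumes [measurable]: "f \<in> borel_measurable borel" and R: "0 < R"
 shows "(LBNN x. epow p (avg R f x) * ennreal (w x))
   \<le> ennreal (A * (2 ^ CARD('n)) powr p) * (LBNN x. epow p (f x) * ennreal (w x))"
proof -
 let ?Z = "A * ballvol TYPE('n) (2 * R) powr p"
 define V where "V = ballvol TYPE('n) R"
 have V: "0 < V" using ballvol_pos[OF R, where 'n='n] by (simp add: V_def)
 have V2: "ballvol TYPE('n) (2 * R) = 2 ^ CARD('n) * V" by (simp add: V_def power_mult_distrib mult_ac)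
 \<comment> \<open>The dual factor of the larger ball depends on y alone, which lets the integration
   in x act on w only.\<close>
 define D where "D y = epow (p - 1) (LBNN x. ennreal (dual x) * (if dist y x < 2 * R then 1 else 0))" for y
 have [measurable]: "D \<in> borel_measurable borel" unfolding D_def by measurable
 let ?c = "ennreal ((1 / V) powr p)" and ?g = "\<lambda>y. epow p (f y) * ennreal (w y)"
 have "epow p (avg R f x) * ennreal (w x) \<le> (LBNN y. ?c * ?g y * D y * (ennreal (w x) * (if dist x y < R then 1 else 0)))" for x
 proof -
  let ?E = "epow (p - 1) (LBNN z. ennreal (dual z) * indicator (ball x R) z)"
  have "epow p (avg R f x) = ?c * epow p (LBNN y. f y * indicator (ball x R) y)"
   using V p_gt_1 by (simp add: avg_def epow_mult epow_ennreal V_def[symmetric])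
  also have "... \<le> ?c * ((LBNN y. ?g y * indicator (ball x R) y) * ?E)" by (intro mult_left_mono holder R) auto
  finally have "epow p (avg R f x) * ennreal (w x) \<le> (?c * ((LBNN y. ?g y * indicator (ball x R) y) * ?E)) * ennreal (w x)"
   by (rule mult_right_mono) simp
  also have "... = (LBNN y. (?c * ?E * ennreal (w x)) * (?g y * indicator (ball x R) y))"
   by (subst nn_integral_cmult) (auto simp: mult_ac)
  also have "... \<le> (LBNN y. ?c * ?g y * D y * (ennreal (w x) * (if dist x y < R then 1 else 0)))"
  proof (rule nn_integral_mono)
   fix y
   show "(?c * ?E * ennreal (w x)) * (?g y * indicator (ball x R) y) \<le> ?c * ?g y * D y * (ennreal (w x) * (if dist x y < R then 1 else 0))"
   proof (cases "dist x y < R")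
    case True
    have "?E \<le> D y" unfolding D_def
    proof (intro epow_mono nn_integral_mono mult_left_mono)
     fix z
     have "dist y z \<le> dist x y + dist x z" by (metis dist_commute dist_triangle)
     thus "indicator (ball x R) z \<le> (if dist y z < 2 * R then 1 else (0 :: ennreal))"
      using True by (auto simp: indicator_def)
    qed (use p_gt_1 in auto)
    hence "?E * (?c * ennreal (w x) * ?g y) \<le> D y * (?c * ennreal (w x) * ?g y)" by (rule mult_right_mono) simp
    thus ?thesis using True by (simp add: mult_ac)
   qed (simp add: indicator_def)
  qed
  finally show ?thesis .
 qed
 hence "(LBNN x. epow p (avg R f x) * ennreal (w x))
   \<le> (LBNN x. \<integral>\<^sup>+y. ?c * ?g y * D y * (ennreal (w x) * (if dist x y < R then 1 else 0)) \<partial>lborel)"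
  by (rule nn_integral_mono)
 also have "... = (LBNN y. \<integral>\<^sup>+x. ?c * ?g y * D y * (ennreal (w x) * (if dist x y < R then 1 else 0)) \<partial>lborel)"
  by (rule lborel_pair.Fubini'[symmetric]) measurable
 also have "... \<le> (LBNN y. ennreal (A * (2 ^ CARD('n)) powr p) * ?g y)"
 proof (rule nn_integral_mono)
  fix y
  have "(LBNN x. ?c * ?g y * D y * (ennreal (w x) * (if dist x y < R then 1 else 0)))
    = ?c * ?g y * (D y * (LBNN x. ennreal (w x) * (if dist x y < R then 1 else 0)))"
   by (subst nn_integral_cmult) (auto simp: mult_ac)
  also have "... \<le> ?c * ?g y * (D y * (LBNN x. ennreal (w x) * indicator (ball y (2 * R)) x))"
   using R by (intro mult_left_mono nn_integral_mono) (auto simp: indicator_def dist_commute)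
  also have "D y * (LBNN x. ennreal (w x) * indicator (ball y (2 * R)) x) \<le> ennreal ?Z"
   using Ap[of "2 * R" y] R unfolding D_def indicator_ball by (simp add: mult.commute)
  hence "?c * ?g y * (D y * (LBNN x. ennreal (w x) * indicator (ball y (2 * R)) x))
    \<le> ?c * ?g y * ennreal ?Z" by (rule mult_left_mono) simp
  also have "... = ennreal ((1 / V) powr p * ?Z) * ?g y"
   using A_nonneg by (subst ennreal_mult) (auto simp: mult_ac)
  also have "(1 / V) powr p * ?Z = A * (2 ^ CARD('n)) powr p"
   unfolding V2 using V by (simp add: powr_divide powr_mult)
  finally show "(LBNN x. ?c * ?g y * D y * (ennreal (w x) * (if dist x y < R then 1 else 0)))
    \<le> ennreal (A * (2 ^ CARD('n)) powr p) * ?g y" .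
 qed
 also have "... = ennreal (A * (2 ^ CARD('n)) powr p) * (LBNN x. epow p (f x) * ennreal (w x))"
  by (rule nn_integral_cmult) measurable
 finally show ?thesis .
qed

end

subsection \<open>Weak gradients and the weighted Poincare inequality\<close>

lemma unit_ball_vol_nonzero[simp]: "unit_ball_vol (real k) \<noteq> 0" using unit_ball_vol_pos[of "real k"] by linarith

text \<open>The functions are integrable over the whole space, so that their mollifications are
  defined everywhere, while the derivative identity is tested only by functions supported in
  D.\<close>

definition weak_grad :: "(real^'n::finite) set \<Rightarrow> (real^'n \<Rightarrow> real) \<Rightarrow> ('n \<Rightarrow> real^'n \<Rightarrow> real) \<Rightarrow> bool" where
 "weak_grad D u g \<longleftrightarrow> integrable lborel u \<and> (\<forall>i. integrable lborel (g i)) \<and>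
   (\<forall>\<phi> i. test_function D \<phi> \<longrightarrow>
    (LBI x. u x * pderiv_dir i \<phi> x) = - (LBI x. g i x * \<phi> x))"

lemma test_function_zero: "test_function D \<phi> \<Longrightarrow> x \<notin> D \<Longrightarrow> \<phi> x = 0"
 unfolding test_function_def fsupport_def using closure_subset[of "{x. \<phi> x \<noteq> 0}"] by blast

lemma test_function_mi_deriv_zero:
 assumes "test_function D \<phi>" "x \<notin> D" shows "mi_deriv \<nu> \<phi> x = 0"
proof (rule mi_deriv_zero_on_open[of "- fsupport \<phi>"])
 show "open (- fsupport \<phi>)" by (simp add: fsupport_def open_Compl)
 show "\<phi> x = 0" if "x \<in> - fsupport \<phi>" for x using that closure_subset[of "{x. \<phi> x \<noteq> 0}"] by (auto simp: fsupport_def)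
qed (use assms in \<open>auto simp: test_function_def\<close>)

lemma test_function_pderiv:
 assumes "test_function D \<phi>" shows "test_function D (pderiv_dir i \<phi>)"
proof -
 have "x \<in> fsupport \<phi>" if "pderiv_dir i \<phi> x \<noteq> 0" for x
 proof (rule ccontr)
  assume "x \<notin> fsupport \<phi>"
  moreover have "open (- fsupport \<phi>)" by (simp add: fsupport_def open_Compl)
  moreover have "\<phi> x = 0" if "x \<in> - fsupport \<phi>" for x
   using that closure_subset[of "{x. \<phi> x \<noteq> 0}"] by (auto simp: fsupport_def)
  ultimately show False using that pderiv_dir_zero_on_open[of "- fsupport \<phi>" x \<phi> i] by auto
 qed
 hence s: "fsupport (pderiv_dir i \<phi>) \<subseteq> fsupport \<phi>"
  unfolding fsupport_def[of "pderiv_dir i \<phi>"] by (intro closure_minimal) (auto simp: fsupport_def)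
 moreover have "compact (fsupport (pderiv_dir i \<phi>))" using assms s unfolding test_function_def
  by (metis (no_types, lifting) closed_closure compact_Int_closed fsupport_def inf.absorb_iff2)
 ultimately show ?thesis using assms smooth_pderiv_dir unfolding test_function_def by blast
qed

lemma test_function_zero_outside_ball:
 assumes "test_function D \<phi>"
 obtains R where "\<And>x. R < norm x \<Longrightarrow> \<phi> x = 0"
proof -
 obtain R where R: "\<And>x. x \<in> fsupport \<phi> \<Longrightarrow> norm x \<le> R"
  using assms compact_imp_bounded bounded_iff unfolding test_function_def by metis
 have "\<phi> x = 0" if "R < norm x" for x
  using R[of x] that closure_subset[of "{x. \<phi> x \<noteq> 0}"] by (force simp: fsupport_def)
 thus ?thesis using that by blast
qed

lemma integrable_mult_bounded:
 fixes f k :: "'a \<Rightarrow> real"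
 assumes f: "integrable M f" and [measurable]: "k \<in> borel_measurable M" and M: "\<And>x. \<bar>k x\<bar> \<le> C"
 shows "integrable M (\<lambda>x. f x * k x)"
proof (rule Bochner_Integration.integrable_bound)
 show "integrable M (\<lambda>x. C * f x)" using f by simp
 have "\<bar>f x\<bar> * \<bar>k x\<bar> \<le> \<bar>f x\<bar> * \<bar>C\<bar>" for x using M[of x] by (intro mult_left_mono) auto
 thus "AE x in M. norm (f x * k x) \<le> norm (C * f x)" by (intro AE_I2) (simp add: abs_mult mult.commute)
qed (use f in measurable)

lemma weak_grad_restrict:
 assumes "weak_grad D u g" "D' \<subseteq> D" and [measurable]: "D' \<in> sets borel"
 shows "weak_grad D' (\<lambda>x. u x * indicator D' x) (\<lambda>i x. g i x * indicator D' x)" unfolding weak_grad_def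
proof (intro conjI allI impI)
 show "integrable lborel (\<lambda>x. u x * indicator D' x)"
  using assms(1) by (intro integrable_mult_bounded[where C=1]) (auto simp: weak_grad_def indicator_def)
 show "integrable lborel (\<lambda>x. g i x * indicator D' x)" for i
  using assms(1) by (intro integrable_mult_bounded[where C=1]) (auto simp: weak_grad_def indicator_def)
 fix \<phi> i assume t: "test_function D' \<phi>"
 have e1: "u x * indicator D' x * pderiv_dir i \<phi> x = u x * pderiv_dir i \<phi> x" for x
  using test_function_zero[OF test_function_pderiv[OF t], of x i] by (auto simp: indicator_def)
 have e2: "g i x * indicator D' x * \<phi> x = g i x * \<phi> x" for x
  using test_function_zero[OF t, of x] by (auto simp: indicator_def)
 have "test_function D \<phi>" using t assms(2) by (auto simp: test_function_def)
 thus "(LBI x. u x * indicator D' x * pderiv_dir i \<phi> x) = - (LBI x. g i x * indicator D' x * \<phi> x)"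
  using assms(1) unfolding e1 e2 by (simp add: weak_grad_def)
qed

lemma integral_norm_le_nn:
 fixes f :: "'a \<Rightarrow> real"
 shows "ennreal \<bar>\<integral>x. f x \<partial>M\<bar> \<le> (\<integral>\<^sup>+x. ennreal \<bar>f x\<bar> \<partial>M)"
proof (cases "integrable M f")
 case True
 from integral_norm_bound_ennreal[OF this] show ?thesis by simp
qed (simp add: not_integrable_integral_eq)

text \<open>Fatou's lemma, in the form that carries a uniform bound from mollified functions to
  their limit.\<close>

lemma nn_integral_limit_le:
 fixes f :: "'a \<Rightarrow> ennreal"
 assumes [measurable]: "\<And>k. F k \<in> borel_measurable M"
  and "AE x in M. (\<lambda>k. F k x) \<longlonglongrightarrow> f x" and "\<And>k. (\<integral>\<^sup>+x. F k x \<partial>M) \<le> C"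
 shows "(\<integral>\<^sup>+x. f x \<partial>M) \<le> C"
proof -
 have "AE x in M. f x = liminf (\<lambda>k. F k x)" using assms(2) by eventually_elim (simp add: lim_imp_Liminf)
 hence "(\<integral>\<^sup>+x. f x \<partial>M) = (\<integral>\<^sup>+x. liminf (\<lambda>k. F k x) \<partial>M)" by (rule nn_integral_cong_AE)
 also have "... \<le> liminf (\<lambda>k. \<integral>\<^sup>+x. F k x \<partial>M)" by (rule nn_integral_liminf) simp
 also have "... \<le> C" using assms(3) by (intro Liminf_le) auto
 finally show ?thesis .
qed

section \<open>Mollified functions with a weak gradient\<close>

context mollifier
begin

text \<open>The partial derivative of \<open>mker\<close> in its first argument; the derivative in
  the second, which is the one integrated against u, is its negative.\<close>

definition dmker :: "'n \<Rightarrow> real \<Rightarrow> real^'n \<Rightarrow> real^'n \<Rightarrow> real" where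
 "dmker i \<eta> x y = pderiv_dir i \<psi> ((1/\<eta>) *\<^sub>R (x - y)) * (1 / \<eta> ^ Suc CARD('n))"

lemma pderiv_psi_borel[measurable]: "pderiv_dir i \<psi> \<in> borel_measurable borel"
 by (rule smooth_borel[OF smooth_pderiv_dir[OF psi_smooth]])

lemma mker_fst: "(\<lambda>x. mker \<eta> x y) = (\<lambda>x. (1 / \<eta> ^ CARD('n)) * \<psi> ((- 1/\<eta>) *\<^sub>R y + (1/\<eta>) *\<^sub>R x))"
 by (simp add: mker_def scaleR_diff_right fun_eq_iff)

lemma mker_snd: "mker \<eta> x = (\<lambda>y. (1 / \<eta> ^ CARD('n)) * \<psi> ((1/\<eta>) *\<^sub>R x + (- 1/\<eta>) *\<^sub>R y))"
 by (simp add: mker_def scaleR_diff_right fun_eq_iff)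

lemma smooth_mker: "smooth (\<lambda>x. mker \<eta> x y)" "smooth (mker \<eta> x)"
proof -
 have "smooth (\<lambda>x. c * \<psi> (a + t *\<^sub>R x))" for c a t
  by (rule smooth_mult[OF smooth_const smooth_affine[OF psi_smooth]])
 thus "smooth (\<lambda>x. mker \<eta> x y)" "smooth (mker \<eta> x)" by (simp_all only: mker_fst) (simp only: mker_snd)
qed

lemma psi_diff: "(\<lambda>x. \<psi> (a + t *\<^sub>R x)) differentiable (at x)"
 by (rule smooth_differentiable[OF smooth_affine[OF psi_smooth]])

lemma pderiv_mker: "pderiv_dir i (\<lambda>x. mker \<eta> x y) x = dmker i \<eta> x y"
 "pderiv_dir i (mker \<eta> x) y = - dmker i \<eta> x y"
proof -
 have pd: "pderiv_dir i (\<lambda>x. \<psi> (a + t *\<^sub>R x)) x = t * pderiv_dir i \<psi> (a + t *\<^sub>R x)" for a t x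
  using pderiv_dir_affine[of \<psi> i a t] smooth_differentiable[OF psi_smooth] by metis
 have arg: "(- 1/\<eta>) *\<^sub>R y + (1/\<eta>) *\<^sub>R x = (1/\<eta>) *\<^sub>R (x - y)" "(1/\<eta>) *\<^sub>R x + (- 1/\<eta>) *\<^sub>R y = (1/\<eta>) *\<^sub>R (x - y)"
  by (simp_all add: scaleR_diff_right)
 have "pderiv_dir i (\<lambda>x. mker \<eta> x y) x = (1 / \<eta> ^ CARD('n)) * ((1/\<eta>) * pderiv_dir i \<psi> ((1/\<eta>) *\<^sub>R (x - y)))"
  unfolding mker_fst pderiv_dir_cmult[OF psi_diff] pd arg ..
 thus "pderiv_dir i (\<lambda>x. mker \<eta> x y) x = dmker i \<eta> x y" by (simp add: dmker_def)
 have "pderiv_dir i (mker \<eta> x) y = (1 / \<eta> ^ CARD('n)) * ((- 1/\<eta>) * pderiv_dir i \<psi> ((1/\<eta>) *\<^sub>R (x - y)))"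
  unfolding mker_snd pderiv_dir_cmult[OF psi_diff] pd arg ..
 thus "pderiv_dir i (mker \<eta> x) y = - dmker i \<eta> x y" by (simp add: dmker_def)
qed

lemma test_function_mker:
 assumes "0 < \<eta>" "cball x (r * \<eta>) \<subseteq> D"
 shows "test_function D (mker \<eta> x)"
proof -
 have "{y. mker \<eta> x y \<noteq> 0} \<subseteq> cball x (r * \<eta>)" using mker_zero[OF assms(1), of x] by (force simp: not_le[symmetric])
 hence s: "fsupport (mker \<eta> x) \<subseteq> cball x (r * \<eta>)" unfolding fsupport_def by (intro closure_minimal) auto
 have "compact (fsupport (mker \<eta> x))"
  using compact_Int_closed[OF compact_cball, of "fsupport (mker \<eta> x)" x "r * \<eta>"] s
  by (simp add: fsupport_def Int_absorb1)
 thus ?thesis using s assms(2) smooth_mker unfolding test_function_def by blast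
qed

lemma dmker_bound: "\<exists>M. \<forall>x y. \<bar>dmker i \<eta> x y\<bar> \<le> M"
proof -
 obtain M where "\<And>u. \<bar>pderiv_dir i \<psi> u\<bar> \<le> M"
  using bounded_support_bound[OF smooth_continuous[OF smooth_pderiv_dir[OF psi_smooth]]
   pderiv_dir_zero_outside[of r \<psi>, OF psi_zero]] by blast
 hence "\<bar>dmker i \<eta> x y\<bar> \<le> M * \<bar>1 / \<eta> ^ Suc CARD('n)\<bar>" for x y
  unfolding dmker_def abs_mult by (intro mult_right_mono) auto
 thus ?thesis by blast
qed

lemma dmker_borel[measurable (raw)]:
 "f \<in> borel_measurable M \<Longrightarrow> h \<in> borel_measurable M \<Longrightarrow> (\<lambda>x. dmker i \<eta> (f x) (h x)) \<in> borel_measurable M"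
 unfolding dmker_def by (intro borel_measurable_times borel_measurable_const) measurable

text \<open>The kernel centred at x is a test function in D. The sign from differentiating in the
  second argument cancels the sign of the weak derivative.\<close>

lemma weak_grad_moll:
 assumes "weak_grad D u g" "0 < \<eta>" "cball x (r * \<eta>) \<subseteq> D"
 shows "(LBI z. u z * dmker i \<eta> x z) = moll \<eta> (g i) x"
proof -
 have "(LBI z. u z * pderiv_dir i (mker \<eta> x) z) = - (LBI z. g i z * mker \<eta> x z)"
  using assms test_function_mker unfolding weak_grad_def by blast
 thus ?thesis by (simp add: pderiv_mker moll_def)
qed

text \<open>The fundamental theorem of calculus for the kernel, integrated against the function, expresses
 the difference of two values of the mollification without differentiating under the integral.\<close>

lemma moll_diff:
 assumes wg: "weak_grad D u g" and e: "0 < \<eta>"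
  and seg: "\<And>s. 0 \<le> s \<Longrightarrow> s \<le> 1 \<Longrightarrow> cball (y + s *\<^sub>R (x - y)) (r * \<eta>) \<subseteq> D"
 shows "ennreal \<bar>moll \<eta> u x - moll \<eta> u y\<bar>
  \<le> ennreal (norm (x - y)) * (LBNN s. (\<Sum>i\<in>UNIV. ennreal \<bar>moll \<eta> (g i) (y + s *\<^sub>R (x - y))\<bar>) * indicator {0..1} s)"
proof -
 have iu: "integrable lborel u" and ig: "integrable lborel (g i)" for i using wg by (auto simp: weak_grad_def)
 have [measurable]: "u \<in> borel_measurable borel" using iu by auto
 define pt where "pt s = y + s *\<^sub>R (x - y)" for s
 define H where "H s z = (\<Sum>i\<in>UNIV. (x - y) $ i * dmker i \<eta> (pt s) z)" for s z
 have ftc: "mker \<eta> x z - mker \<eta> y z = (LBI s. indicator {0..1} s * H s z)" for z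
 proof -
  have d: "((\<lambda>s. mker \<eta> (pt s) z) has_real_derivative H s z) (at s)" for s
   using has_real_derivative_along[OF smooth_differentiable[OF smooth_mker(1)[of \<eta> z]], of y "x - y" s]
   unfolding pt_def H_def pderiv_mker .
  have c: "continuous_on {0..1} (\<lambda>s. H s z)"
  proof -
   have "continuous_on UNIV (pderiv_dir i (\<lambda>x. mker \<eta> x z))" for i
    by (intro smooth_continuous smooth_pderiv_dir smooth_mker)
   hence "continuous_on UNIV (\<lambda>p. dmker i \<eta> p z)" for i unfolding pderiv_mker[abs_def] by simp
   hence "continuous_on {0..1} (\<lambda>s. dmker i \<eta> (pt s) z)" for i
    by (rule continuous_on_compose2) (auto simp: pt_def intro!: continuous_intros)
   thus ?thesis unfolding H_def by (intro continuous_intros)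
  qed
  have "(LBI s. indicator {0..1} s *\<^sub>R H s z) = mker \<eta> (pt 1) z - mker \<eta> (pt 0) z"
   by (rule integral_FTC_atLeastAtMost[OF _ _ c])
    (use d in \<open>auto simp: has_real_derivative_iff_has_vector_derivative intro: has_vector_derivative_at_within\<close>)
  thus ?thesis by (simp add: pt_def)
 qed
 have [measurable]: "pt \<in> borel_measurable borel" unfolding pt_def by measurable
 have Hm[measurable]: "(\<lambda>(s, z). H s z) \<in> borel_measurable (borel \<Otimes>\<^sub>M borel)" unfolding H_def by measurable
 obtain M where M: "\<And>s z. \<bar>H s z\<bar> \<le> M"
 proof -
  define K where "K i = (SOME M. \<forall>x y. \<bar>dmker i \<eta> x y\<bar> \<le> M)" for i
  have K: "\<bar>dmker i \<eta> x y\<bar> \<le> K i" for i x y using someI_ex[OF dmker_bound[of i \<eta>]] unfolding K_def by blast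
  have "\<bar>H s z\<bar> \<le> (\<Sum>i\<in>UNIV. \<bar>(x - y) $ i\<bar> * K i)" for s z
   unfolding H_def by (rule order_trans[OF sum_abs], rule sum_mono, unfold abs_mult, intro mult_left_mono K) auto
  thus ?thesis using that by blast
 qed
 let ?F = "\<lambda>s z. u z * (indicator {0..1} s * H s z)"
 \<comment> \<open>A bounded derivative kernel times an integrable function over a parameter
   interval of finite length; this permits exchanging the two integrals below.\<close>
 have iF: "integrable (lborel \<Otimes>\<^sub>M lborel) (\<lambda>(s, z). ?F s z)"
 proof (rule Bochner_Integration.integrable_bound)
  show "integrable (lborel \<Otimes>\<^sub>M lborel) (\<lambda>(s, z). (indicator {0..1::real} s * M) * u z)"
  proof (rule integrableI_bounded)
   have "(\<integral>\<^sup>+q. ennreal (norm (case q of (s, z) \<Rightarrow> (indicator {0..1::real} s * M) * u z)) \<partial>(lborel \<Otimes>\<^sub>M lborel))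
    = (LBNN s. \<integral>\<^sup>+z. ennreal (norm ((indicator {0..1::real} s * M) * u z)) \<partial>lborel)"
    by (subst lborel.nn_integral_fst[symmetric]) auto
   also have "... = (LBNN s. ennreal \<bar>M\<bar> * (LBNN z. ennreal \<bar>u z\<bar>) * indicator {0..1::real} s)"
    by (intro nn_integral_cong) (auto simp: indicator_def abs_mult ennreal_mult nn_integral_cmult)
   also have "... < \<infinity>"
    using iu by (simp add: nn_integral_cmult_indicator integrable_iff_bounded ennreal_mult_less_top)
   finally show "(\<integral>\<^sup>+q. ennreal (norm (case q of (s, z) \<Rightarrow> (indicator {0..1::real} s * M) * u z)) \<partial>(lborel \<Otimes>\<^sub>M lborel)) < \<infinity>" .
  qed measurable
  have "\<bar>u z\<bar> * \<bar>H s z\<bar> \<le> \<bar>u z\<bar> * \<bar>M\<bar>" for s z using M[of s z] by (intro mult_left_mono) auto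
  thus "AE q in lborel \<Otimes>\<^sub>M lborel. norm (case q of (s, z) \<Rightarrow> ?F s z) \<le> norm (case q of (s, z) \<Rightarrow> (indicator {0..1::real} s * M) * u z)"
   by (intro AE_I2) (auto simp: indicator_def abs_mult mult.commute)
 qed measurable
 have "moll \<eta> u x - moll \<eta> u y = (LBI z. u z * (mker \<eta> x z - mker \<eta> y z))"
  unfolding moll_def using integrable_mult_mker[OF iu e, of x] integrable_mult_mker[OF iu e, of y]
  by (simp add: right_diff_distrib)
 also have "... = (LBI z. \<integral>s. ?F s z \<partial>lborel)" unfolding ftc by simp
 also have "... = (LBI s. \<integral>z. ?F s z \<partial>lborel)" by (rule lborel_pair.Fubini_integral[OF iF])
 also have "... = (LBI s. indicator {0..1} s * (\<Sum>i\<in>UNIV. (x - y) $ i * moll \<eta> (g i) (pt s)))"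
 proof (rule Bochner_Integration.integral_cong[OF refl])
  fix s :: real
  show "(LBI z. ?F s z) = indicator {0..1} s * (\<Sum>i\<in>UNIV. (x - y) $ i * moll \<eta> (g i) (pt s))"
  proof (cases "s \<in> {0..1}")
   case True
   have ii: "integrable lborel (\<lambda>z. u z * dmker i \<eta> (pt s) z)" for i
    using dmker_bound[of i \<eta>] by (elim exE, intro integrable_mult_bounded[OF iu]) auto
   have "(LBI z. ?F s z) = (LBI z. (\<Sum>i\<in>UNIV. (x - y) $ i * (u z * dmker i \<eta> (pt s) z)))"
    using True by (simp add: H_def sum_distrib_left mult_ac)
   also have "... = (\<Sum>i\<in>UNIV. (x - y) $ i * (LBI z. u z * dmker i \<eta> (pt s) z))"
    using ii by (subst Bochner_Integration.integral_sum) auto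
   also have "... = (\<Sum>i\<in>UNIV. (x - y) $ i * moll \<eta> (g i) (pt s))"
    using True seg[of s] unfolding pt_def[symmetric] by (simp add: weak_grad_moll[OF wg e])
   finally show ?thesis using True by simp
  qed simp
 qed
 finally have "ennreal \<bar>moll \<eta> u x - moll \<eta> u y\<bar> =
   ennreal \<bar>\<integral>s. indicator {0..1} s * (\<Sum>i\<in>UNIV. (x - y) $ i * moll \<eta> (g i) (pt s)) \<partial>lborel\<bar>" by simp
 also have "... \<le> (LBNN s. ennreal \<bar>indicator {0..1} s * (\<Sum>i\<in>UNIV. (x - y) $ i * moll \<eta> (g i) (pt s))\<bar>)"
  by (rule integral_norm_le_nn)
 also have "... \<le> (LBNN s. ennreal (norm (x - y)) * ((\<Sum>i\<in>UNIV. ennreal \<bar>moll \<eta> (g i) (pt s)\<bar>) * indicator {0..1} s))"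
 proof (rule nn_integral_mono)
  fix s :: real
  have "\<bar>\<Sum>i\<in>UNIV. (x - y) $ i * moll \<eta> (g i) (pt s)\<bar> \<le> (\<Sum>i\<in>UNIV. norm (x - y) * \<bar>moll \<eta> (g i) (pt s)\<bar>)"
   by (rule order_trans[OF sum_abs], rule sum_mono, unfold abs_mult, intro mult_right_mono component_le_norm_cart) auto
  hence "ennreal \<bar>\<Sum>i\<in>UNIV. (x - y) $ i * moll \<eta> (g i) (pt s)\<bar> \<le> ennreal (norm (x - y) * (\<Sum>i\<in>UNIV. \<bar>moll \<eta> (g i) (pt s)\<bar>))"
   by (intro ennreal_leI) (simp add: sum_distrib_left)
  also have "... = ennreal (norm (x - y)) * (\<Sum>i\<in>UNIV. ennreal \<bar>moll \<eta> (g i) (pt s)\<bar>)"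
   by (subst ennreal_mult) (auto simp: sum_nonneg)
  finally show "ennreal \<bar>indicator {0..1} s * (\<Sum>i\<in>UNIV. (x - y) $ i * moll \<eta> (g i) (pt s))\<bar>
   \<le> ennreal (norm (x - y)) * ((\<Sum>i\<in>UNIV. ennreal \<bar>moll \<eta> (g i) (pt s)\<bar>) * indicator {0..1} s)"
   by (auto simp: indicator_def)
 qed
 also have "... = ennreal (norm (x - y)) * (LBNN s. (\<Sum>i\<in>UNIV. ennreal \<bar>moll \<eta> (g i) (pt s)\<bar>) * indicator {0..1} s)"
 proof (rule nn_integral_cmult)
  have [measurable]: "moll \<eta> (g i) \<in> borel_measurable borel" for i by (rule moll_borel[OF ig])
  show "(\<lambda>s. (\<Sum>i\<in>UNIV. ennreal \<bar>moll \<eta> (g i) (pt s)\<bar>) * indicator {0..1} s) \<in> borel_measurable lborel" by measurable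
 qed
 finally show ?thesis unfolding pt_def .
qed

text \<open>The kernel lives in the closed ball of radius r \<eta>, which is contained in the open
  ball of twice that radius over which \<open>avg\<close> averages. Height times volume is then
  independent of \<eta>.\<close>

lemma moll_sum_avg:
 assumes ig: "\<And>i. integrable lborel (g i)" and e: "0 < \<eta>"
 shows "(\<Sum>i\<in>UNIV. ennreal \<bar>moll \<eta> (g i) x\<bar>)
   \<le> ennreal (psi_bound * ballvol TYPE('n) (2 * r)) * avg (2 * r * \<eta>) (\<lambda>z. ennreal (\<Sum>i\<in>UNIV. \<bar>g i z\<bar>)) x"
proof -
 let ?Z = "ball x (2 * r * \<eta>)"
 have [measurable]: "g i \<in> borel_measurable borel" for i using ig by auto
 let ?c = "psi_bound / \<eta> ^ CARD('n)"
 have c: "0 \<le> ?c" using psi_bound(1) e by simp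
 have "(\<Sum>i\<in>UNIV. ennreal \<bar>moll \<eta> (g i) x\<bar>) \<le> (\<Sum>i\<in>UNIV. \<integral>\<^sup>+z. ennreal ?c * (ennreal \<bar>g i z\<bar> * indicator ?Z z) \<partial>lborel)"
 proof (rule sum_mono)
  fix i
  have "ennreal \<bar>moll \<eta> (g i) x\<bar> \<le> (LBNN z. ennreal \<bar>g i z * mker \<eta> x z\<bar>)"
   unfolding moll_def by (rule integral_norm_le_nn)
  also have "... \<le> (LBNN z. ennreal ?c * (ennreal \<bar>g i z\<bar> * indicator ?Z z))"
  proof (rule nn_integral_mono)
   fix z
   show "ennreal \<bar>g i z * mker \<eta> x z\<bar> \<le> ennreal ?c * (ennreal \<bar>g i z\<bar> * indicator ?Z z)"
   proof (cases "dist x z < 2 * r * \<eta>")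
    case True
    have "\<bar>mker \<eta> x z\<bar> * \<bar>g i z\<bar> \<le> ?c * \<bar>g i z\<bar>" by (intro mult_right_mono mker_bound e) simp
    hence "ennreal \<bar>g i z * mker \<eta> x z\<bar> \<le> ennreal (?c * \<bar>g i z\<bar>)"
     by (intro ennreal_leI) (simp only: abs_mult mult.commute)
    thus ?thesis using True unfolding ennreal_mult[OF c abs_ge_zero] by simp
   next
    case False
    moreover have "0 < r * \<eta>" using e r_pos by simp
    ultimately have "r * \<eta> < dist x z" by linarith
    thus ?thesis using mker_zero[OF e] by simp
   qed
  qed
  finally show "ennreal \<bar>moll \<eta> (g i) x\<bar> \<le> (LBNN z. ennreal ?c * (ennreal \<bar>g i z\<bar> * indicator ?Z z))" .
 qed
 also have "... = ennreal ?c * (LBNN z. (\<Sum>i\<in>UNIV. ennreal \<bar>g i z\<bar>) * indicator ?Z z)"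
  by (simp add: nn_integral_cmult nn_integral_sum sum_distrib_left sum_distrib_right del: sum_ennreal)
 also have "... = ennreal ?c * (LBNN z. ennreal (\<Sum>i\<in>UNIV. \<bar>g i z\<bar>) * indicator ?Z z)"
  by (simp add: sum_ennreal)
 also have "?c = psi_bound * ballvol TYPE('n) (2 * r) * (1 / ballvol TYPE('n) (2 * r * \<eta>))"
  using e r_pos ballvol_pos[of 1, where 'n='n] by (simp add: power_mult_distrib)
 also have "ennreal (psi_bound * ballvol TYPE('n) (2 * r) * (1 / ballvol TYPE('n) (2 * r * \<eta>)))
   = ennreal (psi_bound * ballvol TYPE('n) (2 * r)) * ennreal (1 / ballvol TYPE('n) (2 * r * \<eta>))"
  using psi_bound(1) e r_pos by (intro ennreal_mult) auto
 finally show ?thesis unfolding avg_def mult.assoc .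
qed

end

text \<open>Points around which mollification at scales with r \<eta> < \<xi> sees only D. For
  convex D, segments between such points stay in the set.\<close>

definition core :: "(real^'n) set \<Rightarrow> real \<Rightarrow> (real^'n) set" where
 "core D \<xi> = {x. ball x \<xi> \<subseteq> D}"

lemma core_borel[measurable]: "core D \<xi> \<in> sets borel"
proof -
 have "core D \<xi> = - (\<Union>y\<in>-D. ball y \<xi>)" unfolding core_def by (auto simp: subset_eq dist_commute)
 moreover have "open (\<Union>y\<in>-D. ball y \<xi>)" by auto
 ultimately show ?thesis by (metis borel_closed closed_Compl)
qed

lemma core_subset: "0 < \<xi> \<Longrightarrow> core D \<xi> \<subseteq> D" unfolding core_def by auto

lemma core_segment:
 assumes "convex D" "x \<in> core D \<xi>" "y \<in> core D \<xi>" "0 \<le> s" "s \<le> 1"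
 shows "x + s *\<^sub>R (y - x) \<in> core D \<xi>" unfolding core_def
proof safe
 fix z assume z: "z \<in> ball (x + s *\<^sub>R (y - x)) \<xi>"
 define v where "v = z - (x + s *\<^sub>R (y - x))"
 have "norm v < \<xi>" using z by (simp add: v_def dist_norm norm_minus_commute)
 hence "x + v \<in> D" "y + v \<in> D" using assms(2,3) by (auto simp: core_def subset_eq dist_norm)
 hence "(1 - s) *\<^sub>R (x + v) + s *\<^sub>R (y + v) \<in> D" using assms(1,4,5) by (auto simp: convex_alt)
 also have "(1 - s) *\<^sub>R (x + v) + s *\<^sub>R (y + v) = z" by (simp add: v_def algebra_simps)
 finally show "z \<in> D" .
qed

text \<open>This is why the Poincare inequalities assume a ball of radius 2 \<rho> in D: the
  averaging ball of radius \<rho> stays in the core as long as \<xi> \<le> \<rho>.\<close>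

lemma core_ball: "ball c (2 * \<rho>) \<subseteq> D \<Longrightarrow> \<xi> \<le> \<rho> \<Longrightarrow> ball c \<rho> \<subseteq> core D \<xi>" unfolding core_def
proof safe
 fix y z assume b: "ball c (2 * \<rho>) \<subseteq> D" "\<xi> \<le> \<rho>" "y \<in> ball c \<rho>" "z \<in> ball y \<xi>"
 have "dist c z \<le> dist c y + dist y z" by (rule dist_triangle)
 thus "z \<in> D" using b by auto
qed

lemma eventually_core:
 assumes "open D" "x \<in> D"
 shows "eventually (\<lambda>k. x \<in> core D (a / real (Suc k))) sequentially"
proof -
 obtain e where e: "0 < e" "ball x e \<subseteq> D" using assms open_contains_ball by blast
 have "(\<lambda>k. a * inverse (real (Suc k))) \<longlonglongrightarrow> a * 0" by (intro tendsto_intros LIMSEQ_inverse_real_of_nat)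
 hence "eventually (\<lambda>k. a * inverse (real (Suc k)) < e) sequentially" using e by (intro order_tendstoD) auto
 thus ?thesis by eventually_elim (use e in \<open>auto simp: core_def divide_inverse\<close>)
qed

lemma integral_mult_indicator_subset:
 fixes u :: "'a \<Rightarrow> real"
 assumes "B \<subseteq> D"
 shows "(\<integral>y. u y * indicator D y * indicator B y \<partial>M) = (\<integral>y. u y * indicator B y \<partial>M)"
proof -
 have "(\<lambda>y. u y * indicator D y * indicator B y) = (\<lambda>y. u y * indicator B y)"
  using assms by (auto simp: indicator_def fun_eq_iff)
 thus ?thesis by (simp only:)
qed

section \<open>Weighted Poincare inequality on a convex set\<close>

context mollifier
begin

lemma cball_core: "x \<in> core D \<xi> \<Longrightarrow> r * \<eta> < \<xi> \<Longrightarrow> cball x (r * \<eta>) \<subseteq> D" unfolding core_def by (auto simp: subset_eq)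

lemma moll_mean_diff:
 assumes u: "integrable lborel u" and d: "integrable lborel (\<lambda>x. moll \<eta> u x - u x)" and \<rho>: "0 < \<rho>"
 shows "ennreal \<bar>moll \<eta> u x - (LBI y. moll \<eta> u y * indicator (ball c \<rho>) y) / ballvol TYPE('n) \<rho>\<bar>
  \<le> ennreal (1 / ballvol TYPE('n) \<rho>) * (LBNN y. ennreal \<bar>moll \<eta> u x - moll \<eta> u y\<bar> * indicator (ball c \<rho>) y)"
proof -
 let ?Z = "LBI y. moll \<eta> u y * indicator (ball c \<rho>) y"
 let ?V = "ballvol TYPE('n) \<rho>"
 have V: "0 < ?V" using \<rho> by (rule ballvol_pos)
 have iv: "integrable lborel (indicator (ball c \<rho>) :: real^'n \<Rightarrow> real)" using \<rho> by (simp add: emeasure_ball_vec)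
 have "integrable lborel (\<lambda>x. (moll \<eta> u x - u x) + u x)" using d u by (rule Bochner_Integration.integrable_add)
 hence im: "integrable lborel (moll \<eta> u)" by simp
 have i2: "integrable lborel (\<lambda>y. moll \<eta> u y * indicator (ball c \<rho>) y)"
  by (intro integrable_mult_bounded[where C=1] im) (auto simp: indicator_def)
 have V': "(LBI y. indicator (ball c \<rho>) y) = ?V" using \<rho> by (simp add: measure_def emeasure_ball_vec)
 have "moll \<eta> u x - ?Z / ?V
   = (1 / ?V) * (moll \<eta> u x * (LBI y. indicator (ball c \<rho>) y) - ?Z)"
  unfolding V' using V \<rho> by (simp add: right_diff_distrib)
 also have "... = (1 / ?V) * (LBI y. (moll \<eta> u x - moll \<eta> u y) * indicator (ball c \<rho>) y)"
  using iv i2 by (simp add: left_diff_distrib)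
 finally have "ennreal \<bar>moll \<eta> u x - ?Z / ?V\<bar>
   = ennreal (1 / ?V) * ennreal \<bar>\<integral>y. (moll \<eta> u x - moll \<eta> u y) * indicator (ball c \<rho>) y \<partial>lborel\<bar>"
  using V by (simp only: abs_mult ennreal_mult abs_ge_zero) simp
 also have "... \<le> ennreal (1 / ?V) * (LBNN y. ennreal \<bar>(moll \<eta> u x - moll \<eta> u y) * indicator (ball c \<rho>) y\<bar>)"
  by (intro mult_left_mono integral_norm_le_nn) simp
 also have "(LBNN y. ennreal \<bar>(moll \<eta> u x - moll \<eta> u y) * indicator (ball c \<rho>) y\<bar>)
   = (LBNN y. ennreal \<bar>moll \<eta> u x - moll \<eta> u y\<bar> * indicator (ball c \<rho>) y)"
  by (intro nn_integral_cong) (auto simp: indicator_def)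
 finally show ?thesis .
qed

lemma moll_mean_sequence:
 assumes iu: "integrable lborel u" and "0 < \<xi>" and \<rho>: "0 < \<rho>"
 shows "\<exists>e. (\<forall>k::nat. 0 < e k \<and> e k \<le> \<xi>) \<and> (AE x in lborel. (\<lambda>k. moll (e k) u x) \<longlonglongrightarrow> u x)
   \<and> (\<lambda>k. (LBI y. moll (e k) u y * indicator (ball c \<rho>) y) / ballvol TYPE('n) \<rho>)
    \<longlonglongrightarrow> (LBI y. u y * indicator (ball c \<rho>) y) / ballvol TYPE('n) \<rho>
   \<and> (\<forall>k. integrable lborel (\<lambda>x. moll (e k) u x - u x))"
proof -
 let ?V = "ballvol TYPE('n) \<rho>" and ?B = "indicator (ball c \<rho>) :: real^'n \<Rightarrow> real"
 obtain e where e: "\<And>k::nat. 0 < e k" "\<And>k. e k \<le> \<xi>"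
  "AE x in lborel. (\<lambda>k. moll (e k) u x) \<longlonglongrightarrow> u x"
  "(\<lambda>k. \<integral>x. \<bar>moll (e k) u x - u x\<bar> \<partial>lborel) \<longlonglongrightarrow> 0" "\<And>k. integrable lborel (\<lambda>x. moll (e k) u x - u x)"
  using moll_ae_sequence[OF iu assms(2)] by auto
 have i1: "integrable lborel (\<lambda>y. u y * ?B y)" by (intro integrable_mult_bounded[OF iu, where C=1]) (auto simp: indicator_def)
 have i2: "integrable lborel (\<lambda>y. (moll (e k) u y - u y) * ?B y)" for k by (intro integrable_mult_bounded[OF e(5), where C=1]) (auto simp: indicator_def)
 have bd: "\<bar>(LBI y. (moll (e k) u y - u y) * ?B y)\<bar> \<le> (LBI x. \<bar>moll (e k) u x - u x\<bar>)" for k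
 proof -
  have "\<bar>(LBI y. (moll (e k) u y - u y) * ?B y)\<bar> \<le> (LBI y. \<bar>(moll (e k) u y - u y) * ?B y\<bar>)"
   by (rule integral_abs_bound)
  also have "... \<le> (LBI x. \<bar>moll (e k) u x - u x\<bar>)"
   by (intro integral_mono integrable_abs i2 e(5)) (auto simp: indicator_def abs_mult)
  finally show ?thesis .
 qed
 have "(\<lambda>k. (LBI y. (moll (e k) u y - u y) * ?B y)) \<longlonglongrightarrow> 0" by (rule tendsto_0_le[OF e(4), of _ 1]) (use bd in auto)
 hence "(\<lambda>k. ((LBI y. (moll (e k) u y - u y) * ?B y) + (LBI y. u y * ?B y)) / ?V) \<longlonglongrightarrow> (0 + (LBI y. u y * ?B y)) / ?V"
  using \<rho> by (intro tendsto_intros) auto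
 moreover have "(LBI y. (moll (e k) u y - u y) * ?B y) + (LBI y. u y * ?B y) = (LBI y. moll (e k) u y * ?B y)" for k
  by (subst Bochner_Integration.integral_add[symmetric, OF i2 i1]) (simp add: algebra_simps)
 ultimately have "(\<lambda>k. (LBI y. moll (e k) u y * ?B y) / ?V) \<longlonglongrightarrow> (LBI y. u y * ?B y) / ?V" by simp
 thus ?thesis using e by blast
qed

definition pconst :: real where "pconst = psi_bound * ballvol TYPE('n) (2 * r)"

lemma pconst_pos: "0 < pconst" using psi_bound(1) r_pos by (simp add: pconst_def)

text \<open>The bound for differences is averaged over y in the ball. For fixed s the substitution z
  = x + s (y - x) has Jacobian s^n and lands in \<open>ball x (s * d)\<close>, whose volume is also
  proportional to s^n; the powers cancel, so each s contributes a plain average at radius s d and no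
  singularity at s = 0.\<close>

lemma moll_mean_avg:
 assumes D: "convex D" and dd: "\<And>x y. x \<in> D \<Longrightarrow> y \<in> D \<Longrightarrow> dist x y < d" and \<rho>: "0 < \<rho>" "ball c (2 * \<rho>) \<subseteq> D"
  and wg: "weak_grad D u g" and e: "0 < \<eta>" "r * \<eta> < \<xi>" "\<xi> \<le> \<rho>" and x: "x \<in> core D \<xi>"
  and di: "integrable lborel (\<lambda>x. moll \<eta> u x - u x)"
 defines "H \<equiv> avg (2 * r * \<eta>) (\<lambda>z. ennreal (\<Sum>i\<in>UNIV. \<bar>g i z\<bar>))"
 shows "ennreal \<bar>moll \<eta> u x - (LBI y. moll \<eta> u y * indicator (ball c \<rho>) y) / ballvol TYPE('n) \<rho>\<bar>
  \<le> ennreal (pconst * d * (d / \<rho>) ^ CARD('n)) * (LBNN s. avg (s * d) H x * indicator {0<..1} s)"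
proof -
 let ?Z = "LBNN y. \<integral>\<^sup>+s. H (x + s *\<^sub>R (y - x)) * indicator (ball c \<rho>) y * indicator {0<..1} s \<partial>lborel" and ?Y = "LBNN s. avg (s * d) H x * indicator {0<..1} s" and ?X = "LBNN y. ennreal \<bar>moll \<eta> u x - moll \<eta> u y\<bar> * indicator (ball c \<rho>) y" and ?W = "ballvol TYPE('n) d"
 have ig: "integrable lborel (g i)" and iu: "integrable lborel u" for i using wg by (auto simp: weak_grad_def)
 have [measurable]: "g i \<in> borel_measurable borel" for i using ig by auto
 have Hm[measurable]: "H \<in> borel_measurable borel" unfolding H_def by measurable
 have rpos: "0 < r * \<eta>" using e r_pos by simp
 have "c \<in> ball c (2 * \<rho>)" using \<rho> by simp
 hence d: "0 < d" using dd[of c c] \<rho>(2) by (metis dist_self subsetD)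
 have pt: "ennreal \<bar>moll \<eta> u x - moll \<eta> u y\<bar> \<le> ennreal (d * pconst) * (LBNN s. H (x + s *\<^sub>R (y - x)) * indicator {0<..1} s)"
  if y: "y \<in> ball c \<rho>" for y
 proof -
  have yc: "y \<in> core D \<xi>" using core_ball[OF \<rho>(2) e(3)] y by auto
  have "ennreal \<bar>moll \<eta> u y - moll \<eta> u x\<bar> \<le> ennreal (norm (y - x)) * (LBNN s. (\<Sum>i\<in>UNIV. ennreal \<bar>moll \<eta> (g i) (x + s *\<^sub>R (y - x))\<bar>) * indicator {0..1} s)"
   by (rule moll_diff[OF wg e(1)]) (intro cball_core[OF core_segment[OF D x yc] e(2)])
  also have "... \<le> ennreal d * (LBNN s. ennreal pconst * (H (x + s *\<^sub>R (y - x)) * indicator {0..1} s))"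
  proof (rule mult_mono[OF _ nn_integral_mono])
   have "0 < \<xi>" using e rpos by linarith
   hence "x \<in> D" "y \<in> D" using x yc core_subset by blast+
   thus "ennreal (norm (y - x)) \<le> ennreal d" using dd[of y x] by (intro ennreal_leI) (simp add: dist_norm)
   show "(\<Sum>i\<in>UNIV. ennreal \<bar>moll \<eta> (g i) (x + s *\<^sub>R (y - x))\<bar>) * indicator {0..1} s \<le> ennreal pconst * (H (x + s *\<^sub>R (y - x)) * indicator {0..1} s)" for s :: real
   proof -
    have "(\<Sum>i\<in>UNIV. ennreal \<bar>moll \<eta> (g i) (x + s *\<^sub>R (y - x))\<bar>) \<le> ennreal pconst * H (x + s *\<^sub>R (y - x))"
     unfolding H_def pconst_def by (rule moll_sum_avg) (use ig e in auto)
    from mult_right_mono[OF this zero_le] show ?thesis unfolding mult.assoc .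
   qed
  qed auto
  also have "... = ennreal d * (ennreal pconst * (LBNN s. H (x + s *\<^sub>R (y - x)) * indicator {0..1} s))"
   by (subst nn_integral_cmult) auto
  \<comment> \<open>The point s = 0 is dropped, since an average over a ball of radius 0 would be
    degenerate.\<close>
  also have "(LBNN s. H (x + s *\<^sub>R (y - x)) * indicator {0..1} s) = (LBNN s. H (x + s *\<^sub>R (y - x)) * indicator {0<..1} s)"
  proof (rule nn_integral_cong_AE)
   show "AE s in lborel. H (x + s *\<^sub>R (y - x)) * indicator {0..1} s = H (x + s *\<^sub>R (y - x)) * indicator {0<..1} s"
    using AE_lborel_singleton[of "0 :: real"] by eventually_elim (auto simp: indicator_def)
  qed
  finally show ?thesis using d pconst_pos by (simp add: ennreal_mult mult.assoc abs_minus_commute)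
 qed
 have inner: "(LBNN y. H (x + s *\<^sub>R (y - x)) * indicator (ball c \<rho>) y) \<le> ennreal ?W * avg (s * d) H x"
  if s: "0 < s" "s \<le> 1" for s
 proof -
  let ?f = "\<lambda>z. H z * indicator (ball x (s * d)) z"
  have 1: "(LBNN z. ?f z) = ennreal (s ^ CARD('n)) * (LBNN y. ?f ((x - s *\<^sub>R x) + s *\<^sub>R y))"
   using s by (subst nn_integral_affine[where t="x - s *\<^sub>R x" and c=s]) auto
  have "(LBNN y. H (x + s *\<^sub>R (y - x)) * indicator (ball c \<rho>) y) \<le> (LBNN y. ?f ((x - s *\<^sub>R x) + s *\<^sub>R y))"
  proof (rule nn_integral_mono)
   fix y
   have eq: "(x - s *\<^sub>R x) + s *\<^sub>R y = x + s *\<^sub>R (y - x)" by (simp add: algebra_simps)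
   have "x + s *\<^sub>R (y - x) \<in> ball x (s * d)" if "y \<in> ball c \<rho>"
   proof -
    have "y \<in> D" using that \<rho> by auto
    moreover have "x \<in> D" using x core_subset[of \<xi> D] e rpos by auto
    ultimately have "norm (y - x) < d" using dd[of y x] by (simp add: dist_norm)
    thus ?thesis using s by (simp add: dist_norm)
   qed
   thus "H (x + s *\<^sub>R (y - x)) * indicator (ball c \<rho>) y \<le> ?f ((x - s *\<^sub>R x) + s *\<^sub>R y)"
    unfolding eq by (auto simp: indicator_def)
  qed
  \<comment> \<open>A factor equal to 1 is inserted: it splits into the volume of the ball of radius
    d, the normalisation of \<open>avg\<close> and the Jacobian.\<close>
  also have "... = ennreal (ballvol TYPE('n) d * (1 / ballvol TYPE('n) (s * d)) * s ^ CARD('n)) * (LBNN y. ?f ((x - s *\<^sub>R x) + s *\<^sub>R y))"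
  proof -
   have "ballvol TYPE('n) d * (1 / ballvol TYPE('n) (s * d)) * s ^ CARD('n) = 1"
    using s d by (simp add: power_mult_distrib)
   thus ?thesis by simp
  qed
  also have "... = ennreal ?W * avg (s * d) H x"
  proof -
   have nn: "0 \<le> ballvol TYPE('n) d" "0 \<le> 1 / ballvol TYPE('n) (s * d)" "0 \<le> s ^ CARD('n)" using s d by auto
   show ?thesis
    unfolding avg_def 1 ennreal_mult[OF mult_nonneg_nonneg[OF nn(1,2)] nn(3)] ennreal_mult[OF nn(1,2)] by (simp only: mult.assoc)
  qed
  finally show ?thesis .
 qed
 have J: "?Z
   \<le> ennreal ?W * ?Y"
 proof -
 have "?Z
    = (LBNN s. \<integral>\<^sup>+y. H (x + s *\<^sub>R (y - x)) * indicator (ball c \<rho>) y * indicator {0<..1} s \<partial>lborel)"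
   by (rule lborel_pair.Fubini') measurable
  also have "... \<le> (LBNN s. ennreal ?W * (avg (s * d) H x * indicator {0<..1} s))"
   by (rule nn_integral_mono) (use inner in \<open>auto simp: indicator_def\<close>)
  also have "... = ennreal ?W * ?Y"
  proof (rule nn_integral_cmult)
   show "(\<lambda>s. avg (s * d) H x * indicator {0<..1} s) \<in> borel_measurable lborel"
    unfolding avg_def indicator_ball by measurable
  qed
finally show ?thesis .
 qed
 have "?X
  \<le> (LBNN y. ennreal (d * pconst) * (LBNN s. H (x + s *\<^sub>R (y - x)) * indicator (ball c \<rho>) y * indicator {0<..1} s))"
  by (rule nn_integral_mono) (use pt in \<open>auto simp: indicator_def\<close>)
 also have "... = ennreal (d * pconst) * ?Z"
  by (rule nn_integral_cmult) measurable
 also have "... \<le> ennreal (d * pconst) * (ennreal ?W * ?Y)"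
  by (intro mult_left_mono J) simp
 finally have J2: "?X
  \<le> ennreal (d * pconst) * (ennreal ?W * ?Y)" .
 have "ennreal \<bar>moll \<eta> u x - (LBI y. moll \<eta> u y * indicator (ball c \<rho>) y) / ballvol TYPE('n) \<rho>\<bar>
  \<le> ennreal (1 / ballvol TYPE('n) \<rho>) * ?X"
  by (rule moll_mean_diff[OF iu di \<rho>(1)])
 also have "... \<le> ennreal (1 / ballvol TYPE('n) \<rho>) * (ennreal (d * pconst) * (ennreal ?W * ?Y))"
  by (intro mult_left_mono J2) simp
 also have "... = ennreal ((1 / ballvol TYPE('n) \<rho>) * ((d * pconst) * ballvol TYPE('n) d)) * ?Y"
  using d \<rho>(1) pconst_pos by (simp only: ennreal_mult mult.assoc mult_nonneg_nonneg less_imp_le ballvol_pos divide_nonneg_pos zero_le_one)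
 also have "(1 / ballvol TYPE('n) \<rho>) * ((d * pconst) * ballvol TYPE('n) d) = pconst * d * (d / \<rho>) ^ CARD('n)"
  using \<rho>(1) by (simp add: power_divide)
 finally show ?thesis .
qed

end

locale weighted_moll = mollifier \<psi> r + muckenhoupt p A w
 for \<psi> :: "real^'n::finite \<Rightarrow> real" and r p A and w :: "real^'n \<Rightarrow> real"
begin

definition wint :: "(real^'n) set \<Rightarrow> (real^'n \<Rightarrow> real) \<Rightarrow> ennreal" where
 "wint D f = (LBNN x. ennreal (\<bar>f x\<bar> powr p * w x) * indicator D x)"

lemma ennreal_powr_w: "ennreal (\<bar>t\<bar> powr p * w x) = epow p (ennreal \<bar>t\<bar>) * ennreal (w x)"
 by (simp add: epow_ennreal ennreal_mult less_imp_le w_pos)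

definition avgconst :: real where "avgconst = A * (2 ^ CARD('n)) powr p"

text \<open>Jensen's inequality brings the p-th power inside the integral over s. The bound for
  averages is then applied twice, at radius s d for the segments and at radius 2 r \<eta> for the
  mollified gradient, which explains the square of \<open>avgconst\<close>. Its constant does not
  depend on the radius.\<close>

lemma poincare_mollified:
 assumes D: "convex D" and dd: "\<And>x y. x \<in> D \<Longrightarrow> y \<in> D \<Longrightarrow> dist x y < d" and \<rho>: "0 < \<rho>" "ball c (2 * \<rho>) \<subseteq> D"
  and wg: "weak_grad D u g" and e: "0 < \<eta>" "r * \<eta> < \<xi>" "\<xi> \<le> \<rho>"
  and di: "integrable lborel (\<lambda>x. moll \<eta> u x - u x)"
 shows "wint (core D \<xi>) (\<lambda>x. moll \<eta> u x - (LBI y. moll \<eta> u y * indicator (ball c \<rho>) y) / ballvol TYPE('n) \<rho>)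
  \<le> ennreal ((pconst * d * (d / \<rho>) ^ CARD('n)) powr p * avgconst\<^sup>2) * wint UNIV (\<lambda>x. \<Sum>i\<in>UNIV. \<bar>g i x\<bar>)"
proof -
 have ig: "integrable lborel (g i)" for i using wg by (auto simp: weak_grad_def)
 have [measurable]: "g i \<in> borel_measurable borel" for i using ig by auto
 have "c \<in> ball c (2 * \<rho>)" using \<rho> by simp
 hence d: "0 < d" using dd[of c c] \<rho>(2) by (metis dist_self subsetD)
 let ?m = "(LBI y. moll \<eta> u y * indicator (ball c \<rho>) y) / ballvol TYPE('n) \<rho>"
 let ?C = "pconst * d * (d / \<rho>) ^ CARD('n)"
 have C: "0 \<le> ?C" using d \<rho>(1) pconst_pos by simp
 have AC: "0 \<le> avgconst" using A_nonneg by (simp add: avgconst_def)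
 define G where "G = (\<lambda>z. ennreal (\<Sum>i\<in>UNIV. \<bar>g i z\<bar>))"
 have [measurable]: "G \<in> borel_measurable borel" unfolding G_def by measurable
 define H where "H = avg (2 * r * \<eta>) G"
 have [measurable]: "H \<in> borel_measurable borel" unfolding H_def by measurable
 have sm: "(\<lambda>(x, s). avg (s * d) H x) \<in> borel_measurable (borel \<Otimes>\<^sub>M borel)"
  unfolding avg_def indicator_ball by measurable
 hence [measurable (raw)]: "f \<in> borel_measurable M \<Longrightarrow> h \<in> borel_measurable M \<Longrightarrow> (\<lambda>x. avg (h x * d) H (f x)) \<in> borel_measurable M" for M f h
  using measurable_compose[OF measurable_Pair sm, of f M h] by simp
 have J: "(LBNN x. \<integral>\<^sup>+s. epow p (avg (s * d) H x) * ennreal (w x) * indicator {0<..1} s \<partial>lborel)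
   \<le> ennreal avgconst * (ennreal avgconst * (LBNN x. epow p (G x) * ennreal (w x)))"
 proof -
 have "(LBNN x. \<integral>\<^sup>+s. epow p (avg (s * d) H x) * ennreal (w x) * indicator {0<..1} s \<partial>lborel)
    = (LBNN s. \<integral>\<^sup>+x. epow p (avg (s * d) H x) * ennreal (w x) * indicator {0<..1} s \<partial>lborel)"
   by (rule lborel_pair.Fubini') measurable
  also have "... \<le> (LBNN s. (ennreal avgconst * (ennreal avgconst * (LBNN x. epow p (G x) * ennreal (w x)))) * indicator {0<..1::real} s)"
  proof (rule nn_integral_mono)
   fix s :: real
   show "(LBNN x. epow p (avg (s * d) H x) * ennreal (w x) * indicator {0<..1} s)
    \<le> (ennreal avgconst * (ennreal avgconst * (LBNN x. epow p (G x) * ennreal (w x)))) * indicator {0<..1} s"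
   proof (cases "s \<in> {0<..1}")
    case True
    hence "(LBNN x. epow p (avg (s * d) H x) * ennreal (w x)) \<le> ennreal avgconst * (LBNN x. epow p (H x) * ennreal (w x))"
     using d by (intro avg_bound[folded avgconst_def]) auto
    also have "... \<le> ennreal avgconst * (ennreal avgconst * (LBNN x. epow p (G x) * ennreal (w x)))"
     unfolding H_def using e r_pos by (intro mult_left_mono avg_bound[folded avgconst_def]) auto
    finally show ?thesis using True by simp
   qed simp
  qed
  also have "... = ennreal avgconst * (ennreal avgconst * (LBNN x. epow p (G x) * ennreal (w x)))"
   by (subst nn_integral_cmult_indicator) auto
finally show ?thesis .
 qed
 have "wint (core D \<xi>) (\<lambda>x. moll \<eta> u x - ?m)
  \<le> (LBNN x. ennreal (?C powr p) * (LBNN s. epow p (avg (s * d) H x) * ennreal (w x) * indicator {0<..1} s))"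
  unfolding wint_def
 proof (rule nn_integral_mono)
  fix x
  show "ennreal (\<bar>moll \<eta> u x - ?m\<bar> powr p * w x) * indicator (core D \<xi>) x
   \<le> ennreal (?C powr p) * (LBNN s. epow p (avg (s * d) H x) * ennreal (w x) * indicator {0<..1} s)"
  proof (cases "x \<in> core D \<xi>")
   case True
   have "epow p (ennreal \<bar>moll \<eta> u x - ?m\<bar>) \<le> epow p (ennreal ?C * (LBNN s. avg (s * d) H x * indicator {0<..1} s))"
    using moll_mean_avg[OF D dd \<rho> wg e True di] p_gt_1 unfolding H_def G_def by (intro epow_mono) auto
   also have "... = ennreal (?C powr p) * epow p (LBNN s. avg (s * d) H x * indicator {0<..1} s)"
    using p_gt_1 C by (simp add: epow_mult epow_ennreal)
   also have "... \<le> ennreal (?C powr p) * (LBNN s. epow p (avg (s * d) H x) * indicator {0<..1} s)"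
    using p_gt_1 by (intro mult_left_mono jensen_unit_interval) auto
   finally have "ennreal (\<bar>moll \<eta> u x - ?m\<bar> powr p * w x) \<le> ennreal (?C powr p) * (LBNN s. epow p (avg (s * d) H x) * indicator {0<..1} s) * ennreal (w x)"
    unfolding ennreal_powr_w by (rule mult_right_mono) simp
   also have "... = ennreal (?C powr p) * ((LBNN s. epow p (avg (s * d) H x) * indicator {0<..1} s) * ennreal (w x))"
    by (simp add: mult.assoc)
   also have "(LBNN s. epow p (avg (s * d) H x) * indicator {0<..1} s) * ennreal (w x)
    = (LBNN s. epow p (avg (s * d) H x) * ennreal (w x) * indicator {0<..1} s)"
    by (subst nn_integral_multc[symmetric]) (auto simp: mult_ac)
   finally show ?thesis using True by simp
  qed simp
 qed
 also have "... = ennreal (?C powr p) * (LBNN x. \<integral>\<^sup>+s. epow p (avg (s * d) H x) * ennreal (w x) * indicator {0<..1} s \<partial>lborel)"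
  by (rule nn_integral_cmult) measurable
 also have "... \<le> ennreal (?C powr p) * (ennreal avgconst * (ennreal avgconst * (LBNN x. epow p (G x) * ennreal (w x))))"
  by (intro mult_left_mono J) simp
 also have "... = ennreal (?C powr p * avgconst\<^sup>2) * (LBNN x. epow p (G x) * ennreal (w x))"
  using AC by (simp add: ennreal_mult power2_eq_square mult.assoc)
 also have "(LBNN x. epow p (G x) * ennreal (w x)) = wint UNIV (\<lambda>x. \<Sum>i\<in>UNIV. \<bar>g i x\<bar>)"
  unfolding wint_def ennreal_powr_w G_def by (simp add: sum_nonneg)
 finally show ?thesis .
qed

text \<open>The functions are first cut off to D. Fatou's lemma is applied twice, with the
  mollification scale tending to 0 for a fixed core and then with the cores exhausting D; the
  constant is the same throughout.\<close>

theorem poincare: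
 assumes D: "open D" "convex D" and dd: "\<And>x y. x \<in> D \<Longrightarrow> y \<in> D \<Longrightarrow> dist x y < d" and \<rho>: "0 < \<rho>" "ball c (2 * \<rho>) \<subseteq> D"
  and wg: "weak_grad D u g"
 shows "wint D (\<lambda>x. u x - (LBI y. u y * indicator (ball c \<rho>) y) / ballvol TYPE('n) \<rho>)
  \<le> ennreal ((pconst * d * (d / \<rho>) ^ CARD('n)) powr p * avgconst\<^sup>2) * wint D (\<lambda>x. \<Sum>i\<in>UNIV. \<bar>g i x\<bar>)"
  (is "_ \<le> ?K * _")
proof -
 let ?Z = "\<lambda>x. \<Sum>i\<in>UNIV. \<bar>g i x\<bar>"
 have Dm[measurable]: "D \<in> sets borel" using D(1) by simp
 define u' where "u' = (\<lambda>x. u x * indicator D x)"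
 define g' where "g' = (\<lambda>i x. g i x * indicator D x)"
 have wg': "weak_grad D u' g'" unfolding u'_def g'_def by (rule weak_grad_restrict[OF wg]) auto
 have iu: "integrable lborel u'" using wg' by (auto simp: weak_grad_def)
 have [measurable]: "u' \<in> borel_measurable borel" using iu by auto
 have [measurable]: "moll \<eta> u' \<in> borel_measurable borel" for \<eta> by (rule moll_borel[OF iu])
 let ?V = "ballvol TYPE('n) \<rho>" and ?B = "indicator (ball c \<rho>) :: real^'n \<Rightarrow> real"
 let ?a = "(LBI y. u y * ?B y) / ?V"
 have a': "(LBI y. u' y * ?B y) = (LBI y. u y * ?B y)"
  unfolding u'_def by (rule integral_mult_indicator_subset) (use \<rho> subset_ball[of \<rho> "2 * \<rho>" c] in auto)
 have RHS: "wint UNIV (\<lambda>x. \<Sum>i\<in>UNIV. \<bar>g' i x\<bar>) = wint D ?Z"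
  unfolding wint_def g'_def by (intro nn_integral_cong) (auto simp: indicator_def)
 have c1: "wint (core D \<xi>) (\<lambda>x. u' x - ?a) \<le> ?K * wint D ?Z" if \<xi>: "0 < \<xi>" "\<xi> \<le> \<rho>" for \<xi>
 proof -
  \<comment> \<open>With this cap on the scales, r times each scale is at most \<xi> / 2, strictly
    below \<xi>.\<close>
  have "0 < \<xi> / (2 * r)" using \<xi> r_pos by simp
  from moll_mean_sequence[OF iu this \<rho>(1), of c]
  obtain e where e: "\<And>k::nat. 0 < e k" "\<And>k. e k \<le> \<xi> / (2 * r)"
   "AE x in lborel. (\<lambda>k. moll (e k) u' x) \<longlonglongrightarrow> u' x"
   "(\<lambda>k. (LBI y. moll (e k) u' y * ?B y) / ?V) \<longlonglongrightarrow> (LBI y. u' y * ?B y) / ?V"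
   "\<And>k. integrable lborel (\<lambda>x. moll (e k) u' x - u' x)" by auto
  define m where "m k = (LBI y. moll (e k) u' y * ?B y) / ?V" for k
  have re: "r * e k < \<xi>" for k
  proof -
   have "r * e k \<le> \<xi> / 2" using e(2)[of k] r_pos by (simp add: field_simps)
   thus ?thesis using \<xi> by simp
  qed
  have mlim: "m \<longlonglongrightarrow> ?a" using e(4) unfolding m_def a' .
  show ?thesis unfolding wint_def[of "core D \<xi>"]
  proof (rule nn_integral_limit_le[where F="\<lambda>k x. ennreal (\<bar>moll (e k) u' x - m k\<bar> powr p * w x) * indicator (core D \<xi>) x"])
   show "AE x in lborel. (\<lambda>k. ennreal (\<bar>moll (e k) u' x - m k\<bar> powr p * w x) * indicator (core D \<xi>) x) \<longlonglongrightarrow> ennreal (\<bar>u' x - ?a\<bar> powr p * w x) * indicator (core D \<xi>) x"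
    using e(3)
   proof eventually_elim
    case (elim x)
    have "(\<lambda>k. \<bar>moll (e k) u' x - m k\<bar> powr p * w x) \<longlonglongrightarrow> \<bar>u' x - ?a\<bar> powr p * w x"
     using p_gt_1 by (intro tendsto_intros tendsto_powr' elim mlim) auto
    thus ?case by (auto simp: indicator_def intro: tendsto_ennrealI)
   qed
   show "(LBNN x. ennreal (\<bar>moll (e k) u' x - m k\<bar> powr p * w x) * indicator (core D \<xi>) x) \<le> ?K * wint D ?Z" for k
    using poincare_mollified[OF D(2) dd \<rho> wg' e(1) re \<xi>(2) e(5)] unfolding RHS wint_def[of "core D \<xi>"] m_def by simp
  qed measurable
 qed
 have "wint D (\<lambda>x. u' x - ?a) \<le> ?K * wint D ?Z" unfolding wint_def[of D "\<lambda>x. u' x - ?a"]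
 proof (rule nn_integral_limit_le[where F="\<lambda>k x. ennreal (\<bar>u' x - ?a\<bar> powr p * w x) * indicator (core D (\<rho> / real (Suc k))) x"])
  show "AE x in lborel. (\<lambda>k. ennreal (\<bar>u' x - ?a\<bar> powr p * w x) * indicator (core D (\<rho> / real (Suc k))) x) \<longlonglongrightarrow> ennreal (\<bar>u' x - ?a\<bar> powr p * w x) * indicator D x"
  proof (rule AE_I2)
   fix x
   have "eventually (\<lambda>k. indicator (core D (\<rho> / real (Suc k))) x = (indicator D x :: ennreal)) sequentially"
   proof (cases "x \<in> D")
    case True
    from eventually_core[OF D(1) this, of \<rho>] show ?thesis by eventually_elim (simp add: True)
   next
    case False
    have "x \<notin> core D (\<rho> / real (Suc k))" for k using False core_subset[of "\<rho> / real (Suc k)" D] \<rho>(1) by auto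
    thus ?thesis using False by simp
   qed
   hence "eventually (\<lambda>k. ennreal (\<bar>u' x - ?a\<bar> powr p * w x) * indicator (core D (\<rho> / real (Suc k))) x = ennreal (\<bar>u' x - ?a\<bar> powr p * w x) * indicator D x) sequentially"
    by eventually_elim simp
   thus "(\<lambda>k. ennreal (\<bar>u' x - ?a\<bar> powr p * w x) * indicator (core D (\<rho> / real (Suc k))) x) \<longlonglongrightarrow> ennreal (\<bar>u' x - ?a\<bar> powr p * w x) * indicator D x"
    by (rule tendsto_eventually)
  qed
  show "(LBNN x. ennreal (\<bar>u' x - ?a\<bar> powr p * w x) * indicator (core D (\<rho> / real (Suc k))) x) \<le> ?K * wint D ?Z" for k
  proof -
   have "\<rho> / real (Suc k) \<le> \<rho> / 1" using \<rho>(1) by (intro divide_left_mono) auto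
   thus ?thesis using c1[of "\<rho> / real (Suc k)"] \<rho>(1) unfolding wint_def[of "core D _"] by simp
  qed
 qed measurable
 moreover have "wint D (\<lambda>x. u' x - ?a) = wint D (\<lambda>x. u x - ?a)"
  unfolding wint_def u'_def by (intro nn_integral_cong) (auto simp: indicator_def)
 ultimately show ?thesis by simp
qed

end

context mollifier
begin

definition psi_mass :: ennreal where "psi_mass = (LBNN u. ennreal \<bar>\<psi> u\<bar>)"

lemma moll_nn_le:
 assumes f: "integrable lborel f" and e: "0 < \<eta>"
 shows "(LBNN x. ennreal \<bar>moll \<eta> f x\<bar>) \<le> psi_mass * (LBNN x. ennreal \<bar>f x\<bar>)"
proof -
 have [measurable]: "f \<in> borel_measurable borel" using f by auto
 have "(LBNN x. ennreal \<bar>moll \<eta> f x\<bar>) \<le> (LBNN x. \<integral>\<^sup>+y. ennreal \<bar>f y\<bar> * ennreal \<bar>mker \<eta> x y\<bar> \<partial>lborel)"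
 proof (rule nn_integral_mono)
  fix x
  show "ennreal \<bar>moll \<eta> f x\<bar> \<le> (LBNN y. ennreal \<bar>f y\<bar> * ennreal \<bar>mker \<eta> x y\<bar>)"
   using integral_norm_le_nn[of lborel "\<lambda>y. f y * mker \<eta> x y"] by (simp add: moll_def abs_mult ennreal_mult)
 qed
 also have "... = (LBNN y. \<integral>\<^sup>+x. ennreal \<bar>f y\<bar> * ennreal \<bar>mker \<eta> x y\<bar> \<partial>lborel)"
  by (rule lborel_pair.Fubini'[symmetric]) measurable
 also have "... = psi_mass * (LBNN x. ennreal \<bar>f x\<bar>)"
  by (simp add: nn_integral_cmult nn_integral_multc nn_integral_mker[OF e] psi_mass_def mult.commute)
 finally show ?thesis .
qed

end

section \<open>Supremum bound in one dimension and the fundamental lemma\<close>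

lemma Basis_vec_1:
 assumes "CARD('n::finite) = 1"
 shows "\<exists>i :: 'n::finite. Basis = {axis i (1::real)} \<and> (\<forall>x :: real^'n::finite. x = (x $ i) *\<^sub>R axis i 1)"
proof -
 obtain i :: 'n where i: "UNIV = {i}" using assms card_1_singletonE by metis
 have all: "j = i" for j :: 'n using i by auto
 have "Basis = {axis i (1::real)}" unfolding Basis_vec_def using i by auto
 moreover have "x = (x $ i) *\<^sub>R axis i 1" for x :: "real^'n"
 proof (rule vec_eq_iff[THEN iffD2], rule allI)
  fix k :: 'n
  have "k = i" by (rule all)
  thus "x $ k = ((x $ i) *\<^sub>R axis i 1) $ k" by (simp add: axis_def)
 qed
 ultimately show ?thesis by blast
qed

text \<open>In one dimension a line with nonzero direction is the whole space, and its
  parametrisation stretches lengths by the norm of v; for v = 0 the left-hand side is 0.\<close>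

lemma nn_integral_line_1d:
 fixes f :: "real^'n \<Rightarrow> ennreal"
 assumes 1: "CARD('n) = 1" and [measurable]: "f \<in> borel_measurable borel"
 shows "ennreal (norm v) * (LBNN s. f (y + s *\<^sub>R v)) \<le> (LBNN x. f x)"
proof (cases "v = 0")
 case False
 obtain i :: 'n where B: "Basis = {axis i (1::real)}" and X: "\<And>x :: real^'n. x = (x $ i) *\<^sub>R axis i 1"
  using Basis_vec_1[OF 1] by auto
 let ?e = "axis i (1::real) :: real^'n"
 have L: "lborel = distr lborel borel (\<lambda>t::real. t *\<^sub>R ?e)"
 proof (rule lborel_eqI)
  fix l u :: "real^'n" assume lu: "\<And>b. b \<in> Basis \<Longrightarrow> l \<bullet> b \<le> u \<bullet> b"
  have "emeasure (distr lborel borel (\<lambda>t::real. t *\<^sub>R ?e)) (box l u) = emeasure lborel ((\<lambda>t::real. t *\<^sub>R ?e) -` box l u)"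
   by (subst emeasure_distr) auto
  also have "(\<lambda>t::real. t *\<^sub>R ?e) -` box l u = {l $ i<..<u $ i}" by (auto simp: box_def B inner_axis)
  also have "emeasure lborel {l $ i<..<u $ i} = ennreal (u $ i - l $ i)" using lu[of ?e] by (simp add: B inner_axis)
  finally show "emeasure (distr lborel borel (\<lambda>t::real. t *\<^sub>R ?e)) (box l u) = ennreal (\<Prod>b\<in>Basis. (u - l) \<bullet> b)"
   by (simp add: B inner_axis)
 qed simp
 have v: "v $ i \<noteq> 0" using False X[of v] by auto
 have nv: "norm v = \<bar>v $ i\<bar>" by (subst X[of v]) simp
 have pt: "y + s *\<^sub>R v = (y $ i + v $ i * s) *\<^sub>R ?e" for s
  by (subst X[of y], subst X[of v]) (simp add: scaleR_add_left mult.commute)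
 have "(LBNN x. f x) = (LBNN t. f (t *\<^sub>R ?e))" by (subst L, subst nn_integral_distr) auto
 also have "... = ennreal \<bar>v $ i\<bar> * (LBNN s. f ((y $ i + v $ i * s) *\<^sub>R ?e))"
  by (rule nn_integral_real_affine[OF _ v]) simp
 finally show ?thesis by (simp add: nv pt)
qed simp

context mollifier
begin

text \<open>A difference of values is bounded by the total integral of the gradient. The constant is
  only the mass of |\<psi>|: it involves neither the size of D nor the radius of the averaging ball,
  as neighbours of very different lengths require.\<close>

theorem sup_bound_1d:
 fixes u :: "real^'n \<Rightarrow> real"
 assumes 1: "CARD('n) = 1" and D: "open D" "convex D" and \<rho>: "0 < \<rho>" "ball c (2 * \<rho>) \<subseteq> D" and wg: "weak_grad D u g"
 shows "AE x in lborel. x \<in> D \<longrightarrow>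
   ennreal \<bar>u x - (LBI y. u y * indicator (ball c \<rho>) y) / ballvol TYPE('n) \<rho>\<bar>
   \<le> psi_mass * (LBNN x. ennreal (\<Sum>i\<in>UNIV. \<bar>g i x\<bar>) * indicator D x)"
proof -
 let ?Z = "LBNN x. ennreal (\<Sum>i\<in>UNIV. \<bar>g i x\<bar>) * indicator D x"
 have Dm[measurable]: "D \<in> sets borel" using D(1) by simp
 define u' where "u' = (\<lambda>x. u x * indicator D x)"
 define g' where "g' = (\<lambda>i x. g i x * indicator D x)"
 have wg': "weak_grad D u' g'" unfolding u'_def g'_def by (rule weak_grad_restrict[OF wg]) auto
 have iu: "integrable lborel u'" and ig: "integrable lborel (g' i)" for i using wg' by (auto simp: weak_grad_def)
 have [measurable]: "g' i \<in> borel_measurable borel" for i using ig by auto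
 have [measurable]: "moll \<eta> (g' i) \<in> borel_measurable borel" for \<eta> i by (rule moll_borel[OF ig])
 have [measurable]: "moll \<eta> u' \<in> borel_measurable borel" for \<eta> by (rule moll_borel[OF iu])
 let ?V = "ballvol TYPE('n) \<rho>" and ?B = "indicator (ball c \<rho>) :: real^'n \<Rightarrow> real"
 let ?a = "(LBI y. u y * ?B y) / ?V"
 define Z where "Z = psi_mass * ?Z"
 have a': "(LBI y. u' y * ?B y) = (LBI y. u y * ?B y)"
  unfolding u'_def by (rule integral_mult_indicator_subset) (use \<rho> subset_ball[of \<rho> "2 * \<rho>" c] in auto)
 have total: "(LBNN x. (\<Sum>i\<in>UNIV. ennreal \<bar>moll \<eta> (g' i) x\<bar>)) \<le> Z" if "0 < \<eta>" for \<eta>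
 proof -
  have "(LBNN x. (\<Sum>i\<in>UNIV. ennreal \<bar>moll \<eta> (g' i) x\<bar>)) = (\<Sum>i\<in>UNIV. \<integral>\<^sup>+x. ennreal \<bar>moll \<eta> (g' i) x\<bar> \<partial>lborel)"
   by (rule nn_integral_sum) measurable
  also have "... \<le> (\<Sum>i\<in>UNIV. psi_mass * (LBNN x. ennreal \<bar>g' i x\<bar>))" by (intro sum_mono moll_nn_le ig that)
  also have "... = psi_mass * (LBNN x. (\<Sum>i\<in>UNIV. ennreal \<bar>g' i x\<bar>))"
   by (simp add: nn_integral_sum sum_distrib_left del: sum_ennreal)
  also have "(LBNN x. (\<Sum>i\<in>UNIV. ennreal \<bar>g' i x\<bar>)) = ?Z"
   by (intro nn_integral_cong) (auto simp: g'_def indicator_def)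
  finally show ?thesis unfolding Z_def .
 qed
 have core_bd: "AE x in lborel. x \<in> core D \<xi> \<longrightarrow> ennreal \<bar>u' x - ?a\<bar> \<le> Z" if \<xi>: "0 < \<xi>" "\<xi> \<le> \<rho>" for \<xi>
 proof -
  have "0 < \<xi> / (2 * r)" using \<xi> r_pos by simp
  from moll_mean_sequence[OF iu this \<rho>(1), of c]
  obtain e where e: "\<And>k::nat. 0 < e k" "\<And>k. e k \<le> \<xi> / (2 * r)"
   "AE x in lborel. (\<lambda>k. moll (e k) u' x) \<longlonglongrightarrow> u' x"
   "(\<lambda>k. (LBI y. moll (e k) u' y * ?B y) / ?V) \<longlonglongrightarrow> (LBI y. u' y * ?B y) / ?V"
   "\<And>k. integrable lborel (\<lambda>x. moll (e k) u' x - u' x)" by auto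
  have re: "r * e k < \<xi>" for k
  proof -
   have "r * e k \<le> \<xi> / 2" using e(2)[of k] r_pos by (simp add: field_simps)
   thus ?thesis using \<xi> by simp
  qed
  have bd: "ennreal \<bar>moll (e k) u' x - (LBI y. moll (e k) u' y * ?B y) / ?V\<bar> \<le> Z" if x: "x \<in> core D \<xi>" for x k
  proof -
   have pt: "ennreal \<bar>moll (e k) u' x - moll (e k) u' y\<bar> \<le> Z" if y: "y \<in> ball c \<rho>" for y
   proof -
    have yc: "y \<in> core D \<xi>" using core_ball[OF \<rho>(2) \<xi>(2)] y by auto
    have "ennreal \<bar>moll (e k) u' x - moll (e k) u' y\<bar> \<le> ennreal (norm (x - y)) * (LBNN s. (\<Sum>i\<in>UNIV. ennreal \<bar>moll (e k) (g' i) (y + s *\<^sub>R (x - y))\<bar>) * indicator {0..1} s)"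
     by (rule moll_diff[OF wg' e(1)]) (intro cball_core[OF core_segment[OF D(2) yc x] re])
    also have "... \<le> ennreal (norm (x - y)) * (LBNN s. (\<Sum>i\<in>UNIV. ennreal \<bar>moll (e k) (g' i) (y + s *\<^sub>R (x - y))\<bar>))"
     by (intro mult_left_mono nn_integral_mono) (auto simp: indicator_def)
    also have "... \<le> (LBNN x. (\<Sum>i\<in>UNIV. ennreal \<bar>moll (e k) (g' i) x\<bar>))"
     by (rule nn_integral_line_1d[OF 1]) measurable
    also have "... \<le> Z" by (rule total[OF e(1)])
    finally show ?thesis .
   qed
   have "ennreal \<bar>moll (e k) u' x - (LBI y. moll (e k) u' y * ?B y) / ?V\<bar>
    \<le> ennreal (1 / ?V) * (LBNN y. ennreal \<bar>moll (e k) u' x - moll (e k) u' y\<bar> * indicator (ball c \<rho>) y)"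
    by (rule moll_mean_diff[OF iu e(5) \<rho>(1)])
   also have "... \<le> ennreal (1 / ?V) * (LBNN y. Z * indicator (ball c \<rho>) y)"
    by (intro mult_left_mono nn_integral_mono) (use pt in \<open>auto simp: indicator_def\<close>)
   also have "... = ennreal (1 / ?V) * (Z * ennreal ?V)"
    using \<rho>(1) by (simp add: nn_integral_cmult_indicator emeasure_ball_vec)
   also have "... = Z"
   proof -
    have "ennreal (1 / ?V) * ennreal ?V = 1" using \<rho>(1) by (subst ennreal_mult[symmetric]) auto
    thus ?thesis by (metis mult.commute mult.left_commute mult.right_neutral)
   qed
   finally show ?thesis .
  qed
  from e(3) show ?thesis
  proof eventually_elim
   case (elim x)
   show ?case
   proof
    assume x: "x \<in> core D \<xi>"
    have "(\<lambda>k. ennreal \<bar>moll (e k) u' x - (LBI y. moll (e k) u' y * ?B y) / ?V\<bar>) \<longlonglongrightarrow> ennreal \<bar>u' x - ?a\<bar>"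
     unfolding a'[symmetric] by (intro tendsto_ennrealI tendsto_intros elim e(4))
    thus "ennreal \<bar>u' x - ?a\<bar> \<le> Z" by (rule tendsto_upperbound) (use bd[OF x] in auto)
   qed
  qed
 qed
 \<comment> \<open>A countable family of cores exhausts D, so the exceptional null sets can be
   united.\<close>
 have "AE x in lborel. \<forall>k::nat. x \<in> core D (\<rho> / real (Suc k)) \<longrightarrow> ennreal \<bar>u' x - ?a\<bar> \<le> Z"
 proof (subst AE_all_countable, rule allI)
  fix k :: nat
  have "\<rho> / real (Suc k) \<le> \<rho> / 1" using \<rho>(1) by (intro divide_left_mono) auto
  thus "AE x in lborel. x \<in> core D (\<rho> / real (Suc k)) \<longrightarrow> ennreal \<bar>u' x - ?a\<bar> \<le> Z" using \<rho>(1) by (intro core_bd) auto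
 qed
 thus ?thesis
 proof eventually_elim
  case (elim x)
  show ?case
  proof
   assume x: "x \<in> D"
   obtain k where "x \<in> core D (\<rho> / real (Suc k))"
    using eventually_core[OF D(1) x, of \<rho>] by (auto simp: eventually_sequentially)
   hence "ennreal \<bar>u' x - ?a\<bar> \<le> Z" using elim by blast
   thus "ennreal \<bar>u x - ?a\<bar> \<le> psi_mass * ?Z"
    using x by (simp add: u'_def Z_def)
  qed
 qed
qed

text \<open>Mollification at a point of the smaller ball tests f with a kernel supported in the
  larger one, so the mollified functions vanish there and so does their almost everywhere
  limit.\<close>

lemma fundamental_lemma_ball:
 fixes f :: "real^'n \<Rightarrow> real"
 assumes f: "integrable lborel f" and s: "0 < s"
  and z: "\<And>\<phi>. test_function (ball c (2 * s)) \<phi> \<Longrightarrow> (LBI x. f x * \<phi> x) = 0"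
 shows "AE x\<in>ball c s in lborel. f x = 0"
proof -
 have "0 < s / (2 * r)" using s r_pos by simp
 from moll_ae_sequence[OF f this] obtain e where e: "\<And>k::nat. 0 < e k" "\<And>k. e k \<le> s / (2 * r)"
   "AE x in lborel. (\<lambda>k. moll (e k) f x) \<longlonglongrightarrow> f x" by auto
 from e(3) show ?thesis
 proof eventually_elim
  case (elim x)
  show ?case
  proof
   assume x: "x \<in> ball c s"
   have "moll (e k) f x = 0" for k unfolding moll_def
   proof (rule z, rule test_function_mker[OF e(1)])
    have re: "r * e k \<le> s / 2" using e(2)[of k] r_pos by (simp add: field_simps)
    show "cball x (r * e k) \<subseteq> ball c (2 * s)"
    proof
     fix y assume y: "y \<in> cball x (r * e k)"
     have "dist c y \<le> dist c x + dist x y" by (rule dist_triangle)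
     thus "y \<in> ball c (2 * s)" using x y re s by simp
    qed
   qed
   thus "f x = 0" using LIMSEQ_unique[of "\<lambda>k. moll (e k) f x" "f x" 0] elim by simp
  qed
 qed
qed

end

section \<open>Borel representatives of Lebesgue integrable functions\<close>

lemma borel_representative:
 fixes f :: "real^'n \<Rightarrow> real"
 assumes "set_integrable lebesgue S f" "S \<in> sets borel"
 obtains f' where "integrable lborel f'" "AE x\<in>S in lborel. f' x = f x" "\<And>x. x \<notin> S \<Longrightarrow> f' x = 0"
proof -
 have i: "integrable lebesgue (\<lambda>x. indicator S x * f x)" using assms by (simp add: set_integrable_def)
 hence "(\<lambda>x. indicator S x * f x) \<in> borel_measurable lebesgue" by auto
 then obtain h where h: "h \<in> borel_measurable lborel" "AE x in lborel. indicator S x * f x = h x"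
  using completion_ex_borel_measurable_real by blast
 define f' where "f' = (\<lambda>x. h x * indicator S x)"
 have [measurable]: "f' \<in> borel_measurable lborel" unfolding f'_def using h(1) assms(2) by measurable
 have ae: "AE x in lborel. f' x = indicator S x * f x"
  using h(2) by eventually_elim (auto simp: f'_def indicator_def split: if_splits)
 have "integrable lebesgue f'"
 proof (subst integrable_cong_AE[of _ _ "\<lambda>x. indicator S x * f x"])
  show "AE x in lebesgue. f' x = indicator S x * f x" using ae by (simp add: AE_completion_iff)
  show "f' \<in> borel_measurable lebesgue" by (rule measurable_completion) simp
 qed (use i in auto)
 hence "integrable lborel f'" by (subst (asm) integrable_completion) auto
 moreover have "AE x\<in>S in lborel. f' x = f x" using ae by eventually_elim auto
 moreover have "f' x = 0" if "x \<notin> S" for x using that by (simp add: f'_def)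
 ultimately show ?thesis using that by blast
qed

lemma measurable_completion_AE:
 fixes f h :: "'a::euclidean_space \<Rightarrow> real"
 assumes h: "h \<in> borel_measurable lebesgue" and ae: "AE x in lborel. f x = h x"
 shows "f \<in> borel_measurable lebesgue"
proof -
 have "AE x in lebesgue. f x = h x" using ae by (simp add: AE_completion_iff)
 hence "AE x in lebesgue. h x = f x" by eventually_elim simp
 from borel_measurable_AE[OF h this] show ?thesis .
qed

lemma integral_representative:
 fixes f :: "real^'n \<Rightarrow> real"
 assumes f': "f' \<in> borel_measurable borel" "AE x\<in>S in lborel. f' x = f x"
  and k: "k \<in> borel_measurable borel" "\<And>x. x \<notin> S \<Longrightarrow> k x = 0"
 shows "(LINT x|lebesgue. f x * k x) = (LBI x. f' x * k x)"
proof -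
 have ae: "AE x in lebesgue. f x * k x = f' x * k x"
  using f'(2) unfolding AE_completion_iff by eventually_elim (use k(2) in auto)
 have m: "(\<lambda>x. f' x * k x) \<in> borel_measurable lebesgue" using f'(1) k(1) by (intro measurable_completion) auto
 have m2: "(\<lambda>x. f x * k x) \<in> borel_measurable lebesgue"
  by (rule measurable_completion_AE[OF m]) (use f'(2) k(2) in \<open>auto elim!: eventually_mono\<close>)
 have "(LINT x|lebesgue. f x * k x) = (LINT x|lebesgue. f' x * k x)" by (rule integral_cong_AE[OF m2 m ae])
 also have "... = (LBI x. f' x * k x)" using f'(1) k(1) by (intro integral_completion) auto
 finally show ?thesis .
qed

section \<open>Gluing Poincare inequalities across overlapping sets\<close>

context weighted_moll
begin

lemma wint_mono:
 assumes "D \<subseteq> D'" "\<And>x. x \<in> D \<Longrightarrow> \<bar>f x\<bar> \<le> \<bar>g x\<bar>"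
 shows "wint D f \<le> wint D' g" unfolding wint_def
proof (rule nn_integral_mono)
 fix x
 have "\<bar>f x\<bar> powr p * w x \<le> \<bar>g x\<bar> powr p * w x" if "x \<in> D"
  using assms(2)[OF that] w_pos[of x] p_gt_1 by (intro mult_right_mono powr_mono2) auto
 thus "ennreal (\<bar>f x\<bar> powr p * w x) * indicator D x \<le> ennreal (\<bar>g x\<bar> powr p * w x) * indicator D' x"
  using assms(1) by (auto simp: indicator_def intro: ennreal_leI)
qed

lemma wint_add:
 assumes [measurable]: "f \<in> borel_measurable borel" "g \<in> borel_measurable borel" "D \<in> sets borel"
 shows "wint D (\<lambda>x. f x + g x) \<le> ennreal (2 powr p) * (wint D f + wint D g)"
proof -
 have "wint D (\<lambda>x. f x + g x) \<le> (LBNN x. ennreal (2 powr p) * (ennreal (\<bar>f x\<bar> powr p * w x) * indicator D x + ennreal (\<bar>g x\<bar> powr p * w x) * indicator D x))"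
  unfolding wint_def
 proof (rule nn_integral_mono)
  fix x
  have "\<bar>f x + g x\<bar> powr p \<le> (2 * max \<bar>f x\<bar> \<bar>g x\<bar>) powr p" using p_gt_1 by (intro powr_mono2) auto
  also have "... = 2 powr p * (max \<bar>f x\<bar> \<bar>g x\<bar>) powr p" by (simp add: powr_mult)
  also have "(max \<bar>f x\<bar> \<bar>g x\<bar>) powr p \<le> \<bar>f x\<bar> powr p + \<bar>g x\<bar> powr p" by (cases "\<bar>f x\<bar> \<le> \<bar>g x\<bar>") (auto simp: max_def)
  finally have "\<bar>f x + g x\<bar> powr p * w x \<le> (2 powr p * (\<bar>f x\<bar> powr p + \<bar>g x\<bar> powr p)) * w x"
   using w_pos[of x] by (intro mult_right_mono) auto
  hence "ennreal (\<bar>f x + g x\<bar> powr p * w x) \<le> ennreal (2 powr p * (\<bar>f x\<bar> powr p * w x + \<bar>g x\<bar> powr p * w x))"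
   by (intro ennreal_leI) (simp add: algebra_simps)
  also have "... = ennreal (2 powr p) * (ennreal (\<bar>f x\<bar> powr p * w x) + ennreal (\<bar>g x\<bar> powr p * w x))"
   using w_pos[of x] by (simp add: ennreal_mult ennreal_plus)
  finally show "ennreal (\<bar>f x + g x\<bar> powr p * w x) * indicator D x \<le> ennreal (2 powr p) * (ennreal (\<bar>f x\<bar> powr p * w x) * indicator D x + ennreal (\<bar>g x\<bar> powr p * w x) * indicator D x)"
   by (auto simp: indicator_def)
 qed
 also have "... = ennreal (2 powr p) * (wint D f + wint D g)"
  unfolding wint_def by (subst nn_integral_cmult, measurable, subst nn_integral_add) auto
 finally show ?thesis .
qed

lemma wint_const: "D \<in> sets borel \<Longrightarrow> wint D (\<lambda>_. a) = ennreal (\<bar>a\<bar> powr p) * wint D (\<lambda>_. 1)" unfolding wint_def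
 by (subst nn_integral_cmult[symmetric]) (auto simp: ennreal_mult less_imp_le[OF w_pos] mult.assoc)

lemma wint_Un:
 assumes "finite F" "\<And>K. K \<in> F \<Longrightarrow> K \<in> sets borel" "f \<in> borel_measurable borel"
 shows "wint (\<Union>F) f \<le> (\<Sum>K\<in>F. wint K f)"
proof -
 have [measurable]: "f \<in> borel_measurable borel" by fact
 have "wint (\<Union>F) f \<le> (LBNN x. (\<Sum>K\<in>F. ennreal (\<bar>f x\<bar> powr p * w x) * indicator K x))" unfolding wint_def
 proof (rule nn_integral_mono)
  fix x
  show "ennreal (\<bar>f x\<bar> powr p * w x) * indicator (\<Union>F) x \<le> (\<Sum>K\<in>F. ennreal (\<bar>f x\<bar> powr p * w x) * indicator K x)"
  proof (cases "x \<in> \<Union>F")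
   case True
   then obtain K where K: "K \<in> F" "x \<in> K" by blast
   have "ennreal (\<bar>f x\<bar> powr p * w x) * indicator K x \<le> (\<Sum>K\<in>F. ennreal (\<bar>f x\<bar> powr p * w x) * indicator K x)"
    by (rule member_le_sum) (use K assms(1) in auto)
   thus ?thesis using K True by simp
  qed simp
 qed
 also have "... = (\<Sum>K\<in>F. wint K f)" unfolding wint_def
 proof (rule nn_integral_sum)
  fix K assume "K \<in> F"
  hence [measurable]: "K \<in> sets borel" by (rule assms(2))
  show "(\<lambda>x. ennreal (\<bar>f x\<bar> powr p * w x) * indicator K x) \<in> borel_measurable lborel" by measurable
 qed
 finally show ?thesis .
qed

lemma integral_transfer:
 assumes [measurable]: "f \<in> borel_measurable borel" "B \<in> sets borel" and s: "0 < s" and sub: "B \<subseteq> ball c s" "D \<subseteq> ball c s"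
 shows "epow p (LBNN y. ennreal \<bar>f y\<bar> * indicator B y) * wint D (\<lambda>_. 1)
  \<le> ennreal (A * ballvol TYPE('n) s powr p) * wint B f"
proof -
 let ?f = "\<lambda>y. ennreal \<bar>f y\<bar> * indicator B y"
 have e1: "?f y * indicator (ball c s) y = ?f y" for y using sub by (auto simp: indicator_def)
 have e2: "epow p (?f y) * ennreal (w y) * indicator (ball c s) y = ennreal (\<bar>f y\<bar> powr p * w y) * indicator B y" for y
  using sub by (auto simp: indicator_def ennreal_powr_w)
 have "wint D (\<lambda>_. 1) \<le> (LBNN x. ennreal (w x) * indicator (ball c s) x)"
  unfolding wint_def using sub by (intro nn_integral_mono) (auto simp: indicator_def)
 hence "epow p (LBNN y. ?f y) * wint D (\<lambda>_. 1) \<le> epow p (LBNN y. ?f y * indicator (ball c s) y) * (LBNN x. ennreal (w x) * indicator (ball c s) x)"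
  unfolding e1 by (rule mult_left_mono) simp
 also have "... \<le> ennreal (A * ballvol TYPE('n) s powr p) * (LBNN x. epow p (?f x) * ennreal (w x) * indicator (ball c s) x)"
  by (intro transfer s) measurable
 finally show ?thesis unfolding e2 wint_def .
qed

text \<open>Splitting u into u - a and a constant a costs \<open>2 powr p\<close>. The first summand
  is the Poincare inequality with the power of d removed, the second the comparison of a with u on
  the overlap; both depend only on the ratio of diameter bound to radius.\<close>

definition glue_const :: "real \<Rightarrow> real" where
 "glue_const \<tau> = 2 powr p * ((pconst * \<tau> ^ CARD('n)) powr p * avgconst\<^sup>2 + A * (\<tau> ^ CARD('n)) powr p)"

lemma glue_const_nonneg: "0 \<le> glue_const \<tau>" unfolding glue_const_def using A_nonneg by simp

text \<open>The constant a is the mean over a ball that also lies in E. The Muckenhoupt condition on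
  \<open>ball c d\<close>, which contains D, bounds the weighted size of a on all of D by u on the
  small ball; thus control on E propagates to D.\<close>

lemma poincare_glue:
 assumes D: "open D" "convex D" and dd: "\<And>x y. x \<in> D \<Longrightarrow> y \<in> D \<Longrightarrow> dist x y < d" and \<rho>: "0 < \<rho>" "ball c (2 * \<rho>) \<subseteq> D"
  and E: "ball c \<rho> \<subseteq> E" and wg: "weak_grad D u g" and um[measurable]: "u \<in> borel_measurable borel"
 shows "wint D u \<le> ennreal (glue_const (d / \<rho>)) * (ennreal (d powr p) * wint D (\<lambda>x. \<Sum>i\<in>UNIV. \<bar>g i x\<bar>) + wint E u)"
proof -
 let ?Z = "LBNN y. ennreal \<bar>u y\<bar> * indicator (ball c \<rho>) y"
 have Dm[measurable]: "D \<in> sets borel" using D(1) by simp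
 have "c \<in> ball c (2 * \<rho>)" using \<rho> by simp
 hence cD: "c \<in> D" using \<rho>(2) by blast
 hence d: "0 < d" using dd[of c c] by simp
 let ?V = "ballvol TYPE('n) \<rho>"
 define a where "a = (LBI y. u y * indicator (ball c \<rho>) y) / ?V"
 let ?\<tau> = "(d / \<rho>) ^ CARD('n)" and ?G = "wint D (\<lambda>x. \<Sum>i\<in>UNIV. \<bar>g i x\<bar>)"
 have tau: "0 < ?\<tau>" using d \<rho>(1) by simp
 have Vp: "0 < ?V" by (rule ballvol_pos[OF \<rho>(1)])
 let ?K = "(pconst * ?\<tau>) powr p * avgconst\<^sup>2"
 have 1: "wint D (\<lambda>x. u x - a) \<le> ennreal ?K * (ennreal (d powr p) * ?G)"
 proof -
  have "(pconst * d * ?\<tau>) powr p * avgconst\<^sup>2 = ?K * d powr p"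
   using d tau pconst_pos by (simp add: powr_mult mult_ac)
  hence "ennreal ((pconst * d * ?\<tau>) powr p * avgconst\<^sup>2) = ennreal ?K * ennreal (d powr p)"
   by (simp only:) (rule ennreal_mult, auto)
  thus ?thesis using poincare[OF D dd \<rho> wg] unfolding a_def[symmetric] by (simp only: mult.assoc)
 qed
 have 2: "wint D (\<lambda>_. a) \<le> ennreal (A * ?\<tau> powr p) * wint E u"
 proof -
  have "ennreal (\<bar>a\<bar> powr p) = epow p (ennreal \<bar>a\<bar>)" by (simp add: epow_ennreal)
  also have "... \<le> epow p (ennreal (1 / ?V) * ?Z)"
  proof (rule epow_mono)
   have "ennreal \<bar>a\<bar> = ennreal (1 / ?V) * ennreal \<bar>\<integral>y. u y * indicator (ball c \<rho>) y \<partial>lborel\<bar>"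
   proof -
    have "\<bar>a\<bar> = (1 / ?V) * \<bar>\<integral>y. u y * indicator (ball c \<rho>) y \<partial>lborel\<bar>"
     unfolding a_def abs_divide abs_of_pos[OF Vp] by simp
    moreover have "0 \<le> 1 / ?V" using Vp by (intro divide_nonneg_pos) auto
    ultimately show ?thesis by (simp only: ennreal_mult abs_ge_zero)
   qed
   also have "... \<le> ennreal (1 / ?V) * (LBNN y. ennreal \<bar>u y * indicator (ball c \<rho>) y\<bar>)"
    by (intro mult_left_mono integral_norm_le_nn) simp
   also have "(LBNN y. ennreal \<bar>u y * indicator (ball c \<rho>) y\<bar>) = ?Z"
    by (intro nn_integral_cong) (auto simp: indicator_def)
   finally show "ennreal \<bar>a\<bar> \<le> ennreal (1 / ?V) * ?Z" .
  qed (use p_gt_1 in simp)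
  also have "... = ennreal ((1 / ?V) powr p) * epow p ?Z"
   using p_gt_1 Vp by (subst epow_mult) (auto simp: epow_ennreal[of "1 / ?V"])
  finally have B: "ennreal (\<bar>a\<bar> powr p) \<le> ennreal ((1 / ?V) powr p) * epow p ?Z" .
  have "wint D (\<lambda>_. a) = ennreal (\<bar>a\<bar> powr p) * wint D (\<lambda>_. 1)" by (rule wint_const[OF Dm])
  also have "... \<le> ennreal ((1 / ?V) powr p) * epow p ?Z * wint D (\<lambda>_. 1)"
   by (rule mult_right_mono[OF B]) simp
  also have "... = ennreal ((1 / ?V) powr p) * (epow p ?Z * wint D (\<lambda>_. 1))"
   by (rule mult.assoc)
  also have "... \<le> ennreal ((1 / ?V) powr p) * (ennreal (A * ballvol TYPE('n) d powr p) * wint (ball c \<rho>) u)"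
  proof (intro mult_left_mono integral_transfer d)
   show "D \<subseteq> ball c d" using dd cD by auto
   thus "ball c \<rho> \<subseteq> ball c d" using \<rho> subset_ball[of \<rho> "2 * \<rho>" c] by auto
  qed auto
  also have "... = ennreal (A * ?\<tau> powr p) * wint (ball c \<rho>) u"
  proof -
   have "(1 / ?V) powr p * (A * ballvol TYPE('n) d powr p) = A * ?\<tau> powr p"
    using d \<rho>(1) by (simp add: powr_divide powr_mult power_divide)
   hence "ennreal ((1 / ?V) powr p) * ennreal (A * ballvol TYPE('n) d powr p) = ennreal (A * ?\<tau> powr p)"
    by (subst ennreal_mult[symmetric]) (use A_nonneg in \<open>auto simp only: mult_nonneg_nonneg powr_ge_zero\<close>)
   thus ?thesis by (simp only: mult.assoc[symmetric])
  qed
  also have "... \<le> ennreal (A * ?\<tau> powr p) * wint E u" by (intro mult_left_mono wint_mono E) auto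
  finally show ?thesis .
 qed
 have "wint D u = wint D (\<lambda>x. (u x - a) + a)" by simp
 also have "... \<le> ennreal (2 powr p) * (wint D (\<lambda>x. u x - a) + wint D (\<lambda>_. a))" by (rule wint_add) auto
 also have "... \<le> ennreal (2 powr p) * (ennreal ?K * (ennreal (d powr p) * ?G) + ennreal (A * ?\<tau> powr p) * wint E u)"
  by (intro mult_left_mono add_mono 1 2) auto
 also have "... \<le> ennreal (2 powr p) * (ennreal (?K + A * ?\<tau> powr p) * (ennreal (d powr p) * ?G) + ennreal (?K + A * ?\<tau> powr p) * wint E u)"
  using A_nonneg by (intro mult_left_mono add_mono mult_right_mono ennreal_leI) auto
 also have "... = ennreal (glue_const (d / \<rho>)) * (ennreal (d powr p) * ?G + wint E u)"
 proof -
  have "0 \<le> ?K + A * ?\<tau> powr p" using A_nonneg by simp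
  hence "ennreal (glue_const (d / \<rho>)) = ennreal (2 powr p) * ennreal (?K + A * ?\<tau> powr p)"
   unfolding glue_const_def by (subst ennreal_mult) auto
  thus ?thesis by (simp only: distrib_left mult.assoc)
 qed
 finally show ?thesis .
qed

end

subsection \<open>Barycentric coordinates and shape-regular meshes\<close>

definition verts :: "(real^'n) set \<Rightarrow> (real^'n) set" where
 "verts K = {a. a extreme_point_of K}"

text \<open>The constant term and the gradient of the affine function that is 1 at the vertex a and
  0 at the other vertices. Keeping the gradient explicit makes Lipschitz bounds immediate.\<close>

definition bary_data :: "(real^'n) set \<Rightarrow> real^'n \<Rightarrow> real \<times> (real^'n)" where
 "bary_data K a = (SOME q. \<forall>b\<in>verts K. fst q + snd q \<bullet> b = (if b = a then 1 else 0))"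

definition bary :: "(real^'n) set \<Rightarrow> real^'n \<Rightarrow> real^'n \<Rightarrow> real" where
 "bary K a x = fst (bary_data K a) + snd (bary_data K a) \<bullet> x"

lemma full_simplex_verts:
 assumes "int CARD('n) simplex (K :: (real^'n) set)"
 shows "\<not> affine_dependent (verts K)" "card (verts K) = Suc CARD('n)" "finite (verts K)" "convex hull (verts K) = K"
proof -
 obtain C where C: "\<not> affine_dependent C" "int (card C) = int CARD('n) + 1" "K = convex hull C"
  using assms unfolding simplex_def by blast
 have "verts K = C" unfolding verts_def C(3) using extreme_point_of_convex_hull_affine_independent[OF C(1)] by auto
 thus "\<not> affine_dependent (verts K)" "card (verts K) = Suc CARD('n)" "finite (verts K)" "convex hull (verts K) = K"
  using C aff_independent_finite[OF C(1)] by auto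
qed

text \<open>With another vertex b0 as origin the edge vectors are linearly independent, and a linear
  functional may be prescribed on them: 1 on the edge to a and 0 on the others.\<close>

lemma bary_vertex:
 assumes K: "int CARD('n) simplex (K :: (real^'n) set)" and a: "a \<in> verts K" and b: "b \<in> verts K"
 shows "bary K a b = (if b = a then 1 else 0)"
proof -
 note C = full_simplex_verts[OF K]
 have "card (verts K) \<ge> 2" using C(2) by (simp add: Suc_leI)
 hence "verts K \<noteq> {a}" by auto
 then obtain b0 where b0: "b0 \<in> verts K" "b0 \<noteq> a" using a by blast
 let ?S = "(\<lambda>x. - b0 + x) ` (verts K - {b0})"
 have "independent ?S" using affine_dependent_iff_dependent2[OF b0(1)] C(1) by blast
 then obtain g where g: "linear g" "\<And>y. y \<in> ?S \<Longrightarrow> g y = (if y = - b0 + a then 1 else 0 :: real)"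
  using linear_independent_extend[of ?S "\<lambda>y. if y = - b0 + a then 1 else 0"] by metis
 have gx: "g y = adjoint g 1 \<bullet> y" for y using adjoint_works[OF g(1), of y 1] by (simp add: inner_commute)
 have "\<forall>b\<in>verts K. fst (- g b0, adjoint g 1) + snd (- g b0, adjoint g 1) \<bullet> b = (if b = a then 1 else 0)"
 proof
  fix b assume b: "b \<in> verts K"
  have "- g b0 + g b = g (- b0 + b)" using g(1) by (simp add: linear_diff)
  also have "... = (if b = a then 1 else 0)"
  proof (cases "b = b0")
   case True thus ?thesis using b0 g(1) by (simp add: linear_0)
  next
   case False
   thus ?thesis using b g(2)[of "- b0 + b"] by auto
  qed
  finally show "fst (- g b0, adjoint g 1) + snd (- g b0, adjoint g 1) \<bullet> b = (if b = a then 1 else 0)"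
   by (simp add: gx)
 qed
 hence "\<exists>q. \<forall>b\<in>verts K. fst q + snd q \<bullet> b = (if b = a then 1 else 0)" by blast
 from someI_ex[OF this] show ?thesis using b unfolding bary_def bary_data_def by blast
qed

lemma bary_affine:
 assumes "sum u S = 1" "finite S"
 shows "bary K a (\<Sum>b\<in>S. u b *\<^sub>R b) = (\<Sum>b\<in>S. u b * bary K a b)"
proof -
 have "(\<Sum>b\<in>S. u b * bary K a b) = (\<Sum>b\<in>S. fst (bary_data K a) * u b) + (\<Sum>b\<in>S. snd (bary_data K a) \<bullet> (u b *\<^sub>R b))"
  by (simp add: bary_def distrib_left sum.distrib mult.commute)
 also have "(\<Sum>b\<in>S. fst (bary_data K a) * u b) = fst (bary_data K a)" using assms(1) by (simp flip: sum_distrib_left)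
 finally show ?thesis by (simp add: bary_def inner_sum_right)
qed

lemma bary_unique:
 assumes K: "int CARD('n) simplex (K :: (real^'n) set)" and u: "sum u (verts K) = 1" "(\<Sum>b\<in>verts K. u b *\<^sub>R b) = x" and a: "a \<in> verts K"
 shows "bary K a x = u a"
proof -
 note C = full_simplex_verts[OF K]
 have "bary K a x = (\<Sum>b\<in>verts K. u b * bary K a b)" using bary_affine[OF u(1) C(3)] u(2) by metis
 also have "... = (\<Sum>b\<in>verts K. if b = a then u b else 0)" by (rule sum.cong) (auto simp: bary_vertex[OF K a])
 also have "... = u a" using a C(3) by simp
 finally show ?thesis .
qed

lemma bary_repr:
 assumes K: "int CARD('n) simplex (K :: (real^'n) set)"
 shows "(\<Sum>a\<in>verts K. bary K a x) = 1" "(\<Sum>a\<in>verts K. bary K a x *\<^sub>R a) = x"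
proof -
 note C = full_simplex_verts[OF K]
 have "x \<in> affine hull (verts K)" using affine_independent_span_eq[OF C(1)] C(2) by simp
 then obtain u where u: "sum u (verts K) = 1" "(\<Sum>b\<in>verts K. u b *\<^sub>R b) = x"
  unfolding affine_hull_finite[OF C(3)] by auto
 have "bary K a x = u a" if "a \<in> verts K" for a by (rule bary_unique[OF K u that])
 hence "(\<Sum>a\<in>verts K. bary K a x) = sum u (verts K)" "(\<Sum>a\<in>verts K. bary K a x *\<^sub>R a) = (\<Sum>a\<in>verts K. u a *\<^sub>R a)"
  by (auto intro!: sum.cong)
 thus "(\<Sum>a\<in>verts K. bary K a x) = 1" "(\<Sum>a\<in>verts K. bary K a x *\<^sub>R a) = x" unfolding u .
qed

lemma bary_mem:
 assumes K: "int CARD('n) simplex (K :: (real^'n) set)"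
 shows "x \<in> K \<longleftrightarrow> (\<forall>a\<in>verts K. 0 \<le> bary K a x)"
proof
 note C = full_simplex_verts[OF K]
 {
  assume "x \<in> K"
  hence "x \<in> convex hull (verts K)" using C(4) by simp
  then obtain u where u: "\<forall>a\<in>verts K. 0 \<le> u a" "sum u (verts K) = 1" "(\<Sum>b\<in>verts K. u b *\<^sub>R b) = x"
   unfolding convex_hull_finite[OF C(3)] by auto
  thus "\<forall>a\<in>verts K. 0 \<le> bary K a x" using bary_unique[OF K u(2,3)] by simp
 }
 assume nn: "\<forall>a\<in>verts K. 0 \<le> bary K a x"
 have "x \<in> convex hull (verts K)" unfolding convex_hull_finite[OF C(3)] mem_Collect_eq
  by (rule exI[of _ "\<lambda>a. bary K a x"], intro conjI nn bary_repr[OF K])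
 thus "x \<in> K" using C(4) by simp
qed

lemma bary_le_1:
 assumes K: "int CARD('n) simplex (K :: (real^'n) set)" and x: "x \<in> K" and a: "a \<in> verts K"
 shows "bary K a x \<le> 1"
proof -
 have "bary K a x \<le> (\<Sum>a\<in>verts K. bary K a x)"
  using x a bary_mem[OF K] full_simplex_verts(3)[OF K] by (intro member_le_sum) auto
 thus ?thesis using bary_repr(1)[OF K] by simp
qed

lemma bary_diff: "bary K a x - bary K a y = snd (bary_data K a) \<bullet> (x - y)" by (simp add: bary_def inner_diff_right)

text \<open>Shape regularity in the form used throughout: a ball of radius \<beta> times the
  diameter inside each simplex. The mesh is kept apart from any domain; elements interact only
  through their common faces.\<close>

locale fat_mesh =
 fixes M :: "(real^'n::finite) set set" and \<beta> :: real
 assumes finite_M: "finite M" and simp_M: "K \<in> M \<Longrightarrow> int CARD('n) simplex K"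
  and face_M: "K \<in> M \<Longrightarrow> K' \<in> M \<Longrightarrow> K \<inter> K' face_of K"
  and beta_pos: "0 < \<beta>" and fat: "K \<in> M \<Longrightarrow> \<exists>c. cball c (\<beta> * diameter K) \<subseteq> K"
begin

lemma compact_M: "K \<in> M \<Longrightarrow> compact K" and closed_M: "K \<in> M \<Longrightarrow> closed K" and convex_M: "K \<in> M \<Longrightarrow> convex K"
 using compact_simplex closed_simplex convex_simplex simp_M by blast+

lemma finite_verts: "K \<in> M \<Longrightarrow> finite (verts K)" using full_simplex_verts(3) simp_M by blast

lemma verts_subset: "K \<in> M \<Longrightarrow> verts K \<subseteq> K" unfolding verts_def extreme_point_of_def by auto

lemma dist_le_diameter: "K \<in> M \<Longrightarrow> x \<in> K \<Longrightarrow> y \<in> K \<Longrightarrow> dist x y \<le> diameter K"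
 using diameter_bounded_bound compact_imp_bounded compact_M by blast

lemma diameter_pos: assumes "K \<in> M" shows "0 < diameter K"
proof -
 have c: "card (verts K) = Suc CARD('n)" using full_simplex_verts(2) simp_M assms by blast
 hence "verts K \<noteq> {}" by auto
 then obtain a where a: "a \<in> verts K" by blast
 have "verts K \<noteq> {a}" using c by auto
 then obtain b where b: "b \<in> verts K" "b \<noteq> a" using a by blast
 have "0 < dist a b" using b by auto
 also have "... \<le> diameter K" using dist_le_diameter[OF assms] verts_subset[OF assms] a b by blast
 finally show ?thesis .
qed

text \<open>A face of a simplex is spanned by some of its vertices; being extreme points of the
  common face, these are vertices of the other simplex as well.\<close>

lemma inter_hull:
 assumes K: "K \<in> M" "K' \<in> M" shows "K \<inter> K' = convex hull (verts K \<inter> verts K')"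
proof -
 note C = full_simplex_verts[OF simp_M[OF K(1)]] and C' = full_simplex_verts[OF simp_M[OF K(2)]]
 have "K \<inter> K' face_of convex hull (verts K)" using face_M[OF K] C(4) by simp
 then obtain c where c: "c \<subseteq> verts K" "K \<inter> K' = convex hull c"
  using face_of_convex_hull_affine_independent[OF C(1)] by blast
 have f': "K \<inter> K' face_of K'" using face_M[OF K(2,1)] by (simp add: Int_commute)
 have ci: "\<not> affine_dependent c" using C(1) c(1) affine_dependent_subset by blast
 have "c \<subseteq> verts K'"
 proof
  fix a assume "a \<in> c"
  hence "a extreme_point_of (K \<inter> K')"
   unfolding c(2) using extreme_point_of_convex_hull_affine_independent[OF ci] by blast
  thus "a \<in> verts K'" using extreme_point_of_face[OF f'] by (simp add: verts_def)
 qed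
 hence "K \<inter> K' \<subseteq> convex hull (verts K \<inter> verts K')" using c by (metis Int_greatest hull_mono)
 moreover have "convex hull (verts K \<inter> verts K') \<subseteq> K \<inter> K'"
  using C(4) C'(4) by (metis Int_greatest hull_mono inf_le1 inf_le2)
 ultimately show ?thesis by blast
qed

lemma bary_agree:
 assumes K: "K \<in> M" "K' \<in> M" and x: "x \<in> K" "x \<in> K'" and a: "a \<in> verts K"
 shows "bary K a x = (if a \<in> verts K' then bary K' a x else 0)"
proof -
 let ?c = "verts K \<inter> verts K'"
 have fin: "finite ?c" using finite_verts K by blast
 have "x \<in> convex hull ?c" using inter_hull[OF K] x by blast
 then obtain u where u: "sum u ?c = 1" "(\<Sum>b\<in>?c. u b *\<^sub>R b) = x" unfolding convex_hull_finite[OF fin] by auto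
 define v where "v b = (if b \<in> ?c then u b else 0)" for b
 have e: "sum v S = 1" "(\<Sum>b\<in>S. v b *\<^sub>R b) = x" if "?c \<subseteq> S" "finite S" for S
 proof -
  have "sum v S = sum v ?c" by (rule sum.mono_neutral_right) (use that in \<open>auto simp: v_def\<close>)
  thus "sum v S = 1" using u by (simp add: v_def)
  have "(\<Sum>b\<in>S. v b *\<^sub>R b) = (\<Sum>b\<in>?c. v b *\<^sub>R b)" by (rule sum.mono_neutral_right) (use that in \<open>auto simp: v_def\<close>)
  thus "(\<Sum>b\<in>S. v b *\<^sub>R b) = x" using u by (simp add: v_def)
 qed
 have "bary K b x = v b" if "b \<in> verts K" for b
  by (rule bary_unique[OF simp_M[OF K(1)] e that]) (use finite_verts K in auto)
 moreover have "bary K' b x = v b" if "b \<in> verts K'" for b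
  by (rule bary_unique[OF simp_M[OF K(2)] e that]) (use finite_verts K in auto)
 ultimately show ?thesis using a by (simp add: v_def)
qed

text \<open>The coordinate stays between 0 and 1 on the inscribed ball, but along the gradient
  direction it changes by the norm of the gradient times the diameter of that ball.\<close>

lemma grad_bound:
 assumes K: "K \<in> M" and a: "a \<in> verts K"
 shows "norm (snd (bary_data K a)) * (2 * \<beta> * diameter K) \<le> 1"
proof (cases "snd (bary_data K a) = 0")
 case False
 let ?g = "snd (bary_data K a)" and ?s = "\<beta> * diameter K"
 have s: "0 < ?s" using beta_pos diameter_pos[OF K] by simp
 obtain c where c: "cball c ?s \<subseteq> K" using fat[OF K] by blast
 let ?e = "(?s / norm ?g) *\<^sub>R ?g"
 have ne: "norm ?e = ?s" using False s by simp
 have m: "c + ?e \<in> K" "c - ?e \<in> K" using c ne by (auto simp: subset_eq dist_norm)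
 have e2: "c + ?e - (c - ?e) = (2 * (?s / norm ?g)) *\<^sub>R ?g" by (simp add: scaleR_2[symmetric])
 have "bary K a (c + ?e) - bary K a (c - ?e) = 2 * ?s * norm ?g"
  unfolding bary_diff e2 inner_scaleR_right dot_square_norm using False by (simp add: power2_eq_square)
 hence "2 * ?s * norm ?g \<le> 1" using bary_le_1[OF simp_M[OF K] m(1) a] bary_mem[OF simp_M[OF K]] m(2) a by fastforce
 thus ?thesis by (simp add: mult_ac)
qed simp

text \<open>Along the edge the coordinate of a drops from 1 to 0, so a short edge would force a
  large gradient.\<close>

lemma edge_bound:
 assumes K: "K \<in> M" and a: "a \<in> verts K" and b: "b \<in> verts K" "a \<noteq> b"
 shows "2 * \<beta> * diameter K \<le> dist a b"
proof -
 have "1 = bary K a a - bary K a b" using bary_vertex[OF simp_M[OF K] a] a b by simp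
 also have "... = snd (bary_data K a) \<bullet> (a - b)" by (rule bary_diff)
 also have "... \<le> norm (snd (bary_data K a)) * dist a b" by (simp add: dist_norm norm_cauchy_schwarz)
 finally have 1: "1 \<le> norm (snd (bary_data K a)) * dist a b" .
 let ?n = "norm (snd (bary_data K a))" and ?d = "2 * \<beta> * diameter K"
 have "?n * ?d \<le> ?n * dist a b" using grad_bound[OF K a] 1 by linarith
 moreover have "0 < ?n" using 1 by (cases "?n = 0") auto
 ultimately show ?thesis by simp
qed

text \<open>The homothety with centre a and ratio t / diameter maps the simplex into its part within
  distance t of a, and the inscribed ball to one of radius \<beta> t.\<close>

lemma scale_ball:
 assumes K: "K \<in> M" and a: "a \<in> K" and t: "0 < t" "t \<le> diameter K"
 shows "\<exists>c. cball c (\<beta> * t) \<subseteq> K \<inter> cball a t"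
proof -
 let ?h = "diameter K" and ?s = "t / diameter K"
 have h: "0 < ?h" by (rule diameter_pos[OF K])
 have s: "0 < ?s" "?s \<le> 1" using t h by auto
 obtain c where c: "cball c (\<beta> * ?h) \<subseteq> K" using fat[OF K] by blast
 have "cball (a + ?s *\<^sub>R (c - a)) (\<beta> * t) \<subseteq> K \<inter> cball a t"
 proof
  fix y assume y: "y \<in> cball (a + ?s *\<^sub>R (c - a)) (\<beta> * t)"
  define z where "z = a + (1 / ?s) *\<^sub>R (y - a)"
  have yz: "y = a + ?s *\<^sub>R (z - a)" using t h by (simp add: z_def)
  have "y - (a + ?s *\<^sub>R (c - a)) = ?s *\<^sub>R (z - c)" unfolding yz by (simp add: algebra_simps)
  hence "?s * norm (z - c) \<le> \<beta> * t" using y t h by (simp add: dist_norm norm_minus_commute)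
  hence "norm (z - c) \<le> \<beta> * ?h" using t h by (simp add: field_simps)
  hence z: "z \<in> K" using c by (auto simp: dist_norm norm_minus_commute)
  have "(1 - ?s) *\<^sub>R a + ?s *\<^sub>R z \<in> K" using convex_M[OF K] a z s by (auto simp: convex_alt)
  hence "y \<in> K" unfolding yz by (simp add: algebra_simps)
  moreover have "dist a y = ?s * dist a z" unfolding yz using t h by (simp add: dist_norm norm_minus_commute)
  moreover have "?s * dist a z \<le> ?s * ?h" using dist_le_diameter[OF K a z] s by (intro mult_left_mono) auto
  ultimately show "y \<in> K \<inter> cball a t" using h by simp
 qed
 thus ?thesis by blast
qed

text \<open>Distinct simplices share at most n vertices, and the hull of at most n points has empty
  interior.\<close>

lemma interior_disjoint:
 assumes K: "K \<in> M" "K' \<in> M" "K \<noteq> K'" shows "interior K \<inter> interior K' = {}"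
proof -
 note C = full_simplex_verts[OF simp_M[OF K(1)]] and C' = full_simplex_verts[OF simp_M[OF K(2)]]
 have "verts K \<inter> verts K' \<noteq> verts K"
 proof
  assume "verts K \<inter> verts K' = verts K"
  hence "verts K = verts K'" using C(2) C'(2,3) by (metis card_subset_eq inf.absorb_iff1)
  thus False using C(4) C'(4) K(3) by simp
 qed
 hence "card (verts K \<inter> verts K') < card (verts K)" using C(3) by (intro psubset_card_mono) auto
 hence "interior (convex hull (verts K \<inter> verts K')) = {}" using C(2,3) by (intro empty_interior_convex_hull) auto
 thus ?thesis using inter_hull[OF K(1,2)] interior_Int by metis
qed

text \<open>A packing argument: at the scale t of the smallest diameter, each element contributes a
  ball of radius \<beta> t inside the ball of radius t around a, and these balls are disjoint.
  Working at the smallest scale avoids comparing the diameters.\<close>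

lemma card_star:
 assumes F: "F \<subseteq> M" "\<And>K. K \<in> F \<Longrightarrow> a \<in> K"
 shows "real (card F) * \<beta> ^ CARD('n) \<le> 1"
proof (cases "F = {}")
 case False
 have finF: "finite F" using F(1) finite_M finite_subset by blast
 define t where "t = Min (diameter ` F)"
 have t: "0 < t" "\<And>K. K \<in> F \<Longrightarrow> t \<le> diameter K"
  unfolding t_def using False finF F(1) diameter_pos by (auto simp: subset_eq)
 have "\<exists>c. cball c (\<beta> * t) \<subseteq> K \<inter> cball a t" if "K \<in> F" for K using scale_ball[of K a t] F that t by blast
 then obtain c where c: "\<And>K. K \<in> F \<Longrightarrow> cball (c K) (\<beta> * t) \<subseteq> K \<inter> cball a t" by metis
 have bt: "0 < \<beta> * t" using beta_pos t by simp
 have sub: "ball (c K) (\<beta> * t) \<subseteq> interior K" if "K \<in> F" for K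
  using c[OF that] ball_subset_cball by (intro interior_maximal) blast+
 have dis: "disjoint_family_on (\<lambda>K. ball (c K) (\<beta> * t)) F"
  unfolding disjoint_family_on_def using sub interior_disjoint F(1) by blast
 have "(\<Sum>K\<in>F. emeasure lborel (ball (c K) (\<beta> * t))) = emeasure lborel (\<Union>K\<in>F. ball (c K) (\<beta> * t))"
  by (rule sum_emeasure) (use dis finF in auto)
 also have "... \<le> emeasure lborel (cball a t)" using c ball_subset_cball by (intro emeasure_mono) fastforce+
 also have "... = ennreal (ballvol TYPE('n) t)" using t by (simp add: emeasure_cball)
 finally have "ennreal (real (card F) * ballvol TYPE('n) (\<beta> * t)) \<le> ennreal (ballvol TYPE('n) t)"
  using bt by (simp add: emeasure_ball_vec ennreal_mult ennreal_of_nat_eq_real_of_nat)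
 hence "real (card F) * ballvol TYPE('n) (\<beta> * t) \<le> ballvol TYPE('n) t" using t by (subst (asm) ennreal_le_iff) auto
 hence "(real (card F) * \<beta> ^ CARD('n)) * ballvol TYPE('n) t \<le> 1 * ballvol TYPE('n) t"
  by (simp add: power_mult_distrib mult_ac)
 thus ?thesis using ballvol_pos[OF t(1), where 'n='n] by (rule mult_right_le_imp_le)
qed simp

lemma vertex_of_all: assumes "K \<in> M" "K' \<in> M" "a \<in> verts K" "a \<in> K'" shows "a \<in> verts K'"
proof (rule ccontr)
 assume n: "a \<notin> verts K'"
 have "a \<in> K" using verts_subset assms by blast
 hence "bary K a a = 0" using bary_agree[OF assms(1,2) _ assms(4) assms(3)] n by simp
 thus False using bary_vertex[OF simp_M[OF assms(1)] assms(3) assms(3)] by simp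
qed

lemma star_nbhd:
 assumes a: "a \<in> interior (\<Union>M)"
 shows "\<exists>\<eta>>0. ball a \<eta> \<subseteq> \<Union>{K\<in>M. a \<in> K}"
proof -
 have "closed (\<Union>{K\<in>M. a \<notin> K})" using finite_M closed_M by (intro closed_Union) auto
 hence "open (interior (\<Union>M) - \<Union>{K\<in>M. a \<notin> K})" by (intro open_Diff) auto
 moreover have "a \<in> interior (\<Union>M) - \<Union>{K\<in>M. a \<notin> K}" using a by auto
 ultimately obtain \<eta> where e: "\<eta> > 0" "ball a \<eta> \<subseteq> interior (\<Union>M) - \<Union>{K\<in>M. a \<notin> K}" using open_contains_ball by blast
 hence "ball a \<eta> \<subseteq> \<Union>{K\<in>M. a \<in> K}" using interior_subset[of "\<Union>M"] by blast
 thus ?thesis using e by blast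
qed

text \<open>Close to a, the ray towards x lies in some element K of the star. The coordinates of the
  vertices other than a vanish at a and are linear along the ray, so they stay nonnegative; the
  coordinate of a starts at 1 and cannot drop below 0 within distance 2 \<beta> times the diameter
  of K.\<close>

lemma ball_in_star:
 assumes a: "a \<in> interior (\<Union>M)" "a \<in> verts K0" "K0 \<in> M" and s: "\<And>K. K \<in> M \<Longrightarrow> a \<in> K \<Longrightarrow> s \<le> 2 * \<beta> * diameter K"
 shows "ball a s \<subseteq> \<Union>{K\<in>M. a \<in> K}"
proof
 fix x assume x: "x \<in> ball a s"
 obtain \<eta> where e: "\<eta> > 0" "ball a \<eta> \<subseteq> \<Union>{K\<in>M. a \<in> K}" using star_nbhd[OF a(1)] by blast
 define v where "v = x - a"
 define t where "t = min 1 (\<eta> / (2 * (norm v + 1)))"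
 have nv: "0 < norm v + 1" by (smt (verit) norm_ge_zero)
 have t: "0 < t" "t \<le> 1" using e nv by (auto simp: t_def)
 have "t * norm v < \<eta>"
 proof -
  have "t * norm v \<le> \<eta> / (2 * (norm v + 1)) * (norm v + 1)" by (intro mult_mono) (use e nv t in \<open>auto simp: t_def\<close>)
  also have "... = \<eta> / 2" using nv by (simp add: field_simps)
  finally show ?thesis using e by simp
 qed
 hence "a + t *\<^sub>R v \<in> ball a \<eta>" using t by (simp add: dist_norm)
 then obtain K where K: "K \<in> M" "a \<in> K" "a + t *\<^sub>R v \<in> K" using e by blast
 have aK: "a \<in> verts K" by (rule vertex_of_all[OF a(3) K(1) a(2) K(2)])
 have x_eq: "x = a + v" by (simp add: v_def)
 have "0 \<le> bary K b x" if b: "b \<in> verts K" for b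
 proof (cases "b = a")
  case True
  have "1 - bary K a x = snd (bary_data K a) \<bullet> (a - x)"
   using bary_diff[of K a a x] bary_vertex[OF simp_M[OF K(1)] aK aK] by simp
  also have "... \<le> norm (snd (bary_data K a)) * dist a x" by (simp add: dist_norm norm_cauchy_schwarz)
  also have "... \<le> norm (snd (bary_data K a)) * (2 * \<beta> * diameter K)"
   using x s[OF K(1,2)] by (intro mult_left_mono) auto
  also have "... \<le> 1" by (rule grad_bound[OF K(1) aK])
  finally show ?thesis using True by simp
 next
  case False
  have 0: "bary K b a = 0" using bary_vertex[OF simp_M[OF K(1)] b aK] False by simp
  have "0 \<le> bary K b (a + t *\<^sub>R v)" using K(3) bary_mem[OF simp_M[OF K(1)]] b by blast
  also have "... = t * (snd (bary_data K b) \<bullet> v)" using bary_diff[of K b "a + t *\<^sub>R v" a] 0 by simp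
  finally have "0 \<le> snd (bary_data K b) \<bullet> v" using t by (simp add: zero_le_mult_iff)
  also have "... = bary K b x" using bary_diff[of K b x a] 0 by (simp add: v_def)
  finally show ?thesis .
 qed
 hence "x \<in> K" using bary_mem[OF simp_M[OF K(1)]] by blast
 thus "x \<in> \<Union>{K\<in>M. a \<in> K}" using K by blast
qed

text \<open>In dimension at least two the star of an interior vertex is connected through edges, because a
 punctured ball is connected.\<close>

lemma star_edge:
 assumes n: "2 \<le> CARD('n)" and a: "a \<in> interior (\<Union>M)" "a \<in> verts K0" "K0 \<in> M"
  and F: "F \<subseteq> {K\<in>M. a \<in> K}" "F \<noteq> {}" "F \<noteq> {K\<in>M. a \<in> K}"
 shows "\<exists>K\<in>F. \<exists>K'\<in>{K\<in>M. a \<in> K} - F. \<exists>b. b \<noteq> a \<and> b \<in> verts K \<and> b \<in> verts K'"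
proof (rule ccontr)
 assume c: "\<not> ?thesis"
 let ?S = "{K\<in>M. a \<in> K}" and ?G = "{K\<in>M. a \<in> K} - F"
 have meet: "K \<inter> K' \<subseteq> {a}" if "K \<in> F" "K' \<in> ?G" for K K'
 proof -
  have "verts K \<inter> verts K' \<subseteq> {a}" using c that by blast
  hence "convex hull (verts K \<inter> verts K') \<subseteq> convex hull {a}" by (rule hull_mono)
  thus ?thesis using inter_hull[of K K'] F(1) that by auto
 qed
 obtain \<eta> where e: "\<eta> > 0" "ball a \<eta> \<subseteq> \<Union>?S" using star_nbhd[OF a(1)] by blast
 have cl: "closed (\<Union>F)" "closed (\<Union>?G)"
  using finite_M closed_M F(1) finite_subset[of F M] by (auto intro!: closed_Union)
 \<comment> \<open>Every element of the star has points other than a arbitrarily close to a, so both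
   closed unions meet the punctured ball.\<close>
 have near: "\<exists>x. x \<in> K \<and> x \<in> ball a \<eta> - {a}" if K: "K \<in> M" "a \<in> K" for K
 proof -
  have h: "0 < diameter K" by (rule diameter_pos[OF K(1)])
  define t where "t = min (\<eta> / 2) (diameter K)"
  have t: "0 < t" "t \<le> diameter K" "t < \<eta>" using e h by (auto simp: t_def min_def)
  obtain q where q: "cball q (\<beta> * t) \<subseteq> K \<inter> cball a t" using scale_ball[OF K t(1,2)] by blast
  obtain i :: 'n where True by simp
  have bt: "0 < \<beta> * t" using beta_pos t by simp
  have m: "q \<in> K \<inter> cball a t" "q + (\<beta> * t) *\<^sub>R axis i 1 \<in> K \<inter> cball a t"
   using q bt by (auto simp: subset_eq dist_norm)
  have "q \<noteq> q + (\<beta> * t) *\<^sub>R axis i 1" using beta_pos t(1) by (simp add: axis_eq_0_iff)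
  thus ?thesis using m t(3) by (metis DiffI IntE dual_order.strict_trans2 mem_ball mem_cball singletonD order.strict_trans1)
 qed
 obtain K1 where K1: "K1 \<in> F" using F(2) by blast
 obtain K2 where K2: "K2 \<in> ?G" using F(1,3) by blast
 have "connected (ball a \<eta> - {a})" using n by (intro connected_punctured_ball) simp
 moreover have "ball a \<eta> - {a} \<subseteq> \<Union>F \<union> \<Union>?G" using e by blast
 moreover have "\<Union>F \<inter> \<Union>?G \<inter> (ball a \<eta> - {a}) = {}" using meet by fastforce
 moreover have "\<Union>F \<inter> (ball a \<eta> - {a}) \<noteq> {}" using near[of K1] K1 F(1) by blast
 moreover have "\<Union>?G \<inter> (ball a \<eta> - {a}) \<noteq> {}" using near[of K2] K2 by blast
 ultimately show False using connected_closedD[of "ball a \<eta> - {a}" "\<Union>F" "\<Union>?G"] cl by blast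
qed

text \<open>Two elements with a common edge have diameters comparable up to the factor 2 \<beta>, by
  \<open>edge_bound\<close>. Starting from K, elements are added one at a time through such edges;
  the packing bound limits the number of steps to N. The second disjunct is the degenerate range
  where powers of 2 \<beta> do not decrease.\<close>

lemma diameter_star:
 assumes n: "2 \<le> CARD('n)" and a: "a \<in> interior (\<Union>M)" "a \<in> verts K" "K \<in> M" and K': "K' \<in> M" "a \<in> K'"
  and N: "1 \<le> real N * \<beta> ^ CARD('n)"
 shows "(2 * \<beta>) ^ N * diameter K \<le> diameter K' \<or> 1 \<le> 2 * \<beta>"
proof (cases "1 \<le> 2 * \<beta>")
 case False
 let ?S = "{K\<in>M. a \<in> K}"
 have aK: "a \<in> K" using verts_subset a by blast
 have finS: "finite ?S" using finite_M by simp
 \<comment> \<open>Invariant: after j steps either the star is exhausted or more than j elements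
   have been collected, and each has lost at most j factors.\<close>
 have "\<exists>F. F \<subseteq> ?S \<and> K \<in> F \<and> (\<forall>L\<in>F. (2 * \<beta>) ^ j * diameter K \<le> diameter L) \<and> (F = ?S \<or> j < card F)" for j
 proof (induction j)
  case 0
  show ?case by (rule exI[of _ "{K}"]) (use a aK in auto)
 next
  case (Suc j)
  then obtain F where F: "F \<subseteq> ?S" "K \<in> F" "\<And>L. L \<in> F \<Longrightarrow> (2 * \<beta>) ^ j * diameter K \<le> diameter L" "F = ?S \<or> j < card F" by blast
  have dec: "(2 * \<beta>) ^ Suc j * diameter K \<le> (2 * \<beta>) ^ j * diameter K"
   using False beta_pos diameter_pos[OF a(3)] by (intro mult_right_mono power_decreasing) auto
  show ?case
  proof (cases "F = ?S")
   case True
   have "(2 * \<beta>) ^ Suc j * diameter K \<le> diameter L" if "L \<in> F" for L using F(3)[OF that] dec by linarith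
   thus ?thesis using F(1,2) True by blast
  next
   case ne: False
   have "F \<noteq> {}" using F(2) by blast
   from star_edge[OF n a F(1) this ne]
   obtain L L' b where L: "L \<in> F" "L' \<in> ?S" "L' \<notin> F" "b \<noteq> a" "b \<in> verts L" "b \<in> verts L'" by blast
   have aL: "a \<in> verts L" using vertex_of_all[OF a(3) _ a(2), of L] F(1) L(1) by blast
   have "(2 * \<beta>) ^ Suc j * diameter K = 2 * \<beta> * ((2 * \<beta>) ^ j * diameter K)" by simp
   also have "... \<le> 2 * \<beta> * diameter L" using F(3)[OF L(1)] beta_pos by (intro mult_left_mono) auto
   also have "... \<le> dist a b" using edge_bound[of L a b] aL L F(1) by blast
   also have "... \<le> diameter L'" using L verts_subset[of L'] by (intro dist_le_diameter) auto
   finally have new: "(2 * \<beta>) ^ Suc j * diameter K \<le> diameter L'" .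
   have fF: "finite F" using F(1) finS finite_subset by blast
   show ?thesis
   proof (intro exI[of _ "insert L' F"] conjI ballI)
    show "insert L' F \<subseteq> ?S" "K \<in> insert L' F" using F(1,2) L(2) by blast+
    show "(2 * \<beta>) ^ Suc j * diameter K \<le> diameter L''" if "L'' \<in> insert L' F" for L''
    proof (cases "L'' = L'")
     case True thus ?thesis using new by simp
    next
     case False
     hence "L'' \<in> F" using that by simp
     from F(3)[OF this] dec show ?thesis by linarith
    qed
    show "insert L' F = ?S \<or> Suc j < card (insert L' F)" using F(4) ne L(3) fF by simp
   qed
  qed
 qed
 from this[of N] obtain F where F: "F \<subseteq> ?S" "\<forall>L\<in>F. (2 * \<beta>) ^ N * diameter K \<le> diameter L" "F = ?S \<or> N < card F" by blast
 have "F = ?S"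
 proof (rule ccontr)
  assume "F \<noteq> ?S"
  hence "real N < real (card F)" using F(3) by simp
  hence "real N * \<beta> ^ CARD('n) < real (card F) * \<beta> ^ CARD('n)" using beta_pos by simp
  moreover have "real (card F) * \<beta> ^ CARD('n) \<le> 1" using F(1) by (intro card_star) auto
  ultimately show False using N by linarith
 qed
 thus ?thesis using F(2) K' by blast
qed simp

end

subsection \<open>Poincare inequalities on the patch of an element\<close>

context weighted_moll
begin

lemma glue_const_mono: assumes "0 \<le> s" "s \<le> t" shows "glue_const s \<le> glue_const t"
proof -
 have "pconst * s ^ CARD('n) \<le> pconst * t ^ CARD('n)"
  using pconst_pos assms by (intro mult_left_mono power_mono) auto
 thus ?thesis unfolding glue_const_def using A_nonneg p_gt_1 assms pconst_pos
  by (intro mult_left_mono add_mono mult_right_mono powr_mono2 power_mono) auto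
qed

text \<open>The start of the chain: with mean zero on the ball the constant to be subtracted is 0.
  \<open>glue_const\<close> serves as an upper bound so that all links share one constant.\<close>

lemma poincare_base:
 assumes D: "open D" "convex D" and dd: "\<And>x y. x \<in> D \<Longrightarrow> y \<in> D \<Longrightarrow> dist x y < d" and \<rho>: "0 < \<rho>" "ball c (2 * \<rho>) \<subseteq> D"
  and wg: "weak_grad D u g" and z: "(LBI y. u y * indicator (ball c \<rho>) y) = 0"
 shows "wint D u \<le> ennreal (glue_const (d / \<rho>)) * (ennreal (d powr p) * wint D (\<lambda>x. \<Sum>i\<in>UNIV. \<bar>g i x\<bar>))"
proof -
 have "c \<in> ball c (2 * \<rho>)" using \<rho> by simp
 hence d: "0 < d" using dd[of c c] \<rho>(2) by (metis dist_self subsetD)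
 let ?\<tau> = "(d / \<rho>) ^ CARD('n)"
 let ?K = "(pconst * ?\<tau>) powr p * avgconst\<^sup>2"
 have tau: "0 < ?\<tau>" using d \<rho>(1) by simp
 have "(pconst * d * ?\<tau>) powr p * avgconst\<^sup>2 = ?K * d powr p" using d tau pconst_pos by (simp add: powr_mult mult_ac)
 hence e: "ennreal ((pconst * d * ?\<tau>) powr p * avgconst\<^sup>2) = ennreal ?K * ennreal (d powr p)"
  by (simp only:) (rule ennreal_mult, auto)
 have "1 \<le> 2 powr p" using p_gt_1 by (simp add: ge_one_powr_ge_zero)
 hence "1 * (?K + 0) \<le> 2 powr p * (?K + A * ?\<tau> powr p)" using A_nonneg by (intro mult_mono add_left_mono) auto
 hence k: "?K \<le> glue_const (d / \<rho>)" unfolding glue_const_def by simp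
 have "wint D u \<le> ennreal ?K * (ennreal (d powr p) * wint D (\<lambda>x. \<Sum>i\<in>UNIV. \<bar>g i x\<bar>))"
  using poincare[OF D dd \<rho> wg] unfolding z e by (simp only: div_0 diff_zero mult.assoc)
 also have "... \<le> ennreal (glue_const (d / \<rho>)) * (ennreal (d powr p) * wint D (\<lambda>x. \<Sum>i\<in>UNIV. \<bar>g i x\<bar>))"
  by (intro mult_right_mono ennreal_leI k) simp
 finally show ?thesis .
qed

end

lemma weak_grad_subset: "weak_grad D u g \<Longrightarrow> D' \<subseteq> D \<Longrightarrow> weak_grad D' u g"
 unfolding weak_grad_def test_function_def by blast

text \<open>R is the cut-off radius in units of the diameter of T. The bound on \<beta> excludes the
  degenerate case of \<open>diameter_star\<close> and keeps the radii of the vertex balls below the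
  diameter of T; interior vertices guarantee that these balls lie in the stars.\<close>

locale patch = weighted_moll \<psi> r p A w + fat_mesh M \<beta>
 for \<psi> :: "real^'n::finite \<Rightarrow> real" and r p A and w :: "real^'n \<Rightarrow> real" and M :: "(real^'n) set set" and \<beta> +
 fixes T :: "(real^'n) set" and R :: real
 assumes T_M: "T \<in> M" and beta_small: "\<beta> < 1 / 2" and R_ge: "1 \<le> R"
  and verts_interior: "\<And>a. a \<in> verts T \<Longrightarrow> a \<in> interior (\<Union>M)"
begin

definition h where "h = diameter T"
definition star where "star a = {K \<in> M. a \<in> K}"
text \<open>Half of the radius that \<open>ball_in_star\<close> allows, governed by the smallest
  element of the star.\<close>

definition rad where "rad a = \<beta> * Min (diameter ` star a)"
definition piece where "piece a K = interior K \<inter> ball a (R * h)"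
text \<open>An element of a star may meet T in a single vertex. The ball around the vertex overlaps
  both of them in sets with interior and serves as a bridge in the chain.\<close>

definition pieces where "pieces = insert (interior T) (\<Union>a\<in>verts T. insert (ball a (rad a)) (piece a ` star a))"
definition X where "X = \<Union>pieces"
definition cT where "cT = (SOME c. cball c (\<beta> * h) \<subseteq> T)"

lemma h_pos: "0 < h" unfolding h_def by (rule diameter_pos[OF T_M])

lemma verts_T: "a \<in> verts T \<Longrightarrow> a \<in> T" using verts_subset[OF T_M] by blast

lemma star_props: "finite (star a)" "a \<in> verts T \<Longrightarrow> T \<in> star a" "K \<in> star a \<Longrightarrow> K \<in> M" "K \<in> star a \<Longrightarrow> a \<in> K"
 unfolding star_def using finite_M T_M verts_T by auto

lemma rad_props:
 assumes a: "a \<in> verts T"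
 shows "0 < rad a" "K \<in> star a \<Longrightarrow> rad a \<le> \<beta> * diameter K" "rad a < h" "ball a (rad a) \<subseteq> \<Union>(star a)"
proof -
 have ne: "diameter ` star a \<noteq> {}" "finite (diameter ` star a)" using star_props(1,2) a by blast+
 have "0 < Min (diameter ` star a)" using ne diameter_pos star_props(3) by (subst Min_gr_iff) auto
 thus "0 < rad a" unfolding rad_def using beta_pos by simp
 show le: "rad a \<le> \<beta> * diameter K" if "K \<in> star a" for K
  unfolding rad_def using ne beta_pos that by (intro mult_left_mono Min_le) auto
 have "rad a \<le> \<beta> * h" using le[OF star_props(2)[OF a]] by (simp add: h_def)
 also have "... < 1 * h" using beta_small h_pos by (intro mult_strict_right_mono) auto
 finally show "rad a < h" by simp
 have "rad a \<le> 2 * \<beta> * diameter K" if "K \<in> M" "a \<in> K" for K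
 proof -
  have "0 < \<beta> * diameter K" using beta_pos diameter_pos[OF that(1)] by simp
  thus ?thesis using le[of K] that by (simp add: star_def)
 qed
 from ball_in_star[OF verts_interior[OF a] a T_M this] show "ball a (rad a) \<subseteq> \<Union>(star a)" unfolding star_def by simp
qed

lemma cT: "cball cT (\<beta> * h) \<subseteq> T" unfolding cT_def h_def by (rule someI_ex[OF fat[OF T_M]])

lemma ball_cT: "ball cT (2 * (\<beta> * h / 2)) \<subseteq> interior T" using cT ball_subset_cball by (intro interior_maximal) auto

lemma pieces_props:
 assumes "D \<in> pieces" shows "open D" "convex D" "D \<subseteq> X" "\<And>x y. x \<in> D \<Longrightarrow> y \<in> D \<Longrightarrow> dist x y < 2 * R * h"
proof -
 have hR: "h \<le> R * h" using R_ge h_pos by simp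
 have b: "dist x y < 2 * R * h" if "x \<in> ball a (R * h)" "y \<in> ball a (R * h)" for a x y
  using that dist_triangle2[of x y a] by (simp add: dist_commute)
 have "open D \<and> convex D \<and> (\<forall>x\<in>D. \<forall>y\<in>D. dist x y < 2 * R * h)" using assms unfolding pieces_def
 proof (elim insertE UN_E imageE)
  assume D: "D = interior T"
  have "dist x y < 2 * R * h" if "x \<in> interior T" "y \<in> interior T" for x y
  proof -
   have "dist x y \<le> h" unfolding h_def using that interior_subset by (intro dist_le_diameter[OF T_M]) blast+
   moreover have "2 * R * h = R * h + R * h" by simp
   ultimately show ?thesis using hR h_pos by linarith
  qed
  thus ?thesis using D convex_M[OF T_M] convex_interior by blast
 next
  fix a assume a: "a \<in> verts T" and D: "D = ball a (rad a)"
  have "ball a (rad a) \<subseteq> ball a (R * h)" using rad_props(3)[OF a] hR by (intro subset_ball) simp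
  hence "dist x y < 2 * R * h" if "x \<in> D" "y \<in> D" for x y using that D by (intro b[of _ a]) blast+
  thus ?thesis using D by auto
 next
  fix a K assume K: "K \<in> star a" and D: "D = piece a K"
  show ?thesis unfolding D piece_def using b[of _ a] convex_M[OF star_props(3)[OF K]]
   by (auto intro: convex_Int convex_interior)
 qed
 thus "open D" "convex D" "\<And>x y. x \<in> D \<Longrightarrow> y \<in> D \<Longrightarrow> dist x y < 2 * R * h" by auto
 show "D \<subseteq> X" unfolding X_def using assms by blast
qed

lemma open_X: "open X" unfolding X_def using pieces_props(1) by blast

lemma interior_T_X: "interior T \<subseteq> X" unfolding X_def pieces_def by blast

lemma X_subset: "X \<subseteq> interior (\<Union>{K \<in> M. K \<inter> T \<noteq> {}})"
proof (rule interior_maximal[OF _ open_X])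
 have s: "\<Union>(star a) \<subseteq> \<Union>{K \<in> M. K \<inter> T \<noteq> {}}" if "a \<in> verts T" for a using verts_T[OF that] unfolding star_def by blast
 have "D \<subseteq> \<Union>{K \<in> M. K \<inter> T \<noteq> {}}" if "D \<in> pieces" for D using that unfolding pieces_def
 proof (elim insertE UN_E imageE)
  assume "D = interior T"
  moreover have "cT \<in> ball cT (2 * (\<beta> * h / 2))" using beta_pos h_pos by simp
  hence "cT \<in> T" using ball_cT interior_subset[of T] by blast
  ultimately show ?thesis using T_M interior_subset[of T] by blast
 next
  fix a assume a: "a \<in> verts T" "D = ball a (rad a)"
  thus ?thesis using rad_props(4)[OF a(1)] s[OF a(1)] by blast
 next
  fix a K assume a: "a \<in> verts T" "K \<in> star a" "D = piece a K"
  have "piece a K \<subseteq> K" unfolding piece_def using interior_subset by blast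
  thus ?thesis using s[OF a(1)] a(2,3) by blast
 qed
 thus "X \<subseteq> \<Union>{K \<in> M. K \<inter> T \<noteq> {}}" unfolding X_def by blast
qed

lemma X_ball: assumes a0: "a0 \<in> verts T" shows "X \<subseteq> ball a0 ((R + 1) * h)" "T \<subseteq> ball a0 ((R + 1) * h)"
proof -
 have hR: "h \<le> R * h" using R_ge h_pos by simp
 have dT: "dist a0 x \<le> h" if "x \<in> T" for x
  unfolding h_def using that verts_T[OF a0] by (intro dist_le_diameter[OF T_M])
 have e: "(R + 1) * h = R * h + h" by (simp add: algebra_simps)
 have T': "x \<in> ball a0 ((R + 1) * h)" if "x \<in> T" for x
 proof -
  have "dist a0 x < R * h + h" using dT[OF that] h_pos hR by linarith
  thus ?thesis unfolding e by simp
 qed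
 thus "T \<subseteq> ball a0 ((R + 1) * h)" by blast
 have b: "x \<in> ball a0 ((R + 1) * h)" if "a \<in> verts T" "dist a x < R * h" for a x
  using dT[OF verts_T[OF that(1)]] that(2) dist_triangle[of a0 x a] unfolding e by (simp add: dist_commute)
 have "D \<subseteq> ball a0 ((R + 1) * h)" if "D \<in> pieces" for D using that unfolding pieces_def
 proof (elim insertE UN_E imageE)
  assume "D = interior T"
  thus ?thesis using T' interior_subset[of T] by blast
 next
  fix a assume a: "a \<in> verts T" "D = ball a (rad a)"
  thus ?thesis using rad_props(3)[OF a(1)] hR b[OF a(1)] by auto
 next
  fix a K assume a: "a \<in> verts T" "K \<in> star a" "D = piece a K"
  thus ?thesis using b[OF a(1)] unfolding piece_def by auto
 qed
 thus "X \<subseteq> ball a0 ((R + 1) * h)" unfolding X_def by blast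
qed

lemma finite_pieces: "finite pieces" unfolding pieces_def using finite_verts[OF T_M] star_props(1) by auto

lemma card_pieces: "real (card pieces) \<le> 1 + (real CARD('n) + 1) * (1 + 1 / \<beta> ^ CARD('n))"
proof -
 let ?P = "\<lambda>a. insert (ball a (rad a)) (piece a ` star a)"
 have s: "real (card (?P a)) \<le> 1 + 1 / \<beta> ^ CARD('n)" for a
 proof -
  have "card (?P a) \<le> Suc (card (piece a ` star a))" by (rule card_insert_le_m1) auto
  also have "... \<le> Suc (card (star a))" using card_image_le[OF star_props(1)] by simp
  finally have "real (card (?P a)) \<le> 1 + real (card (star a))" by simp
  moreover have "real (card (star a)) * \<beta> ^ CARD('n) \<le> 1" by (rule card_star[of _ a]) (auto simp: star_def)
  hence "real (card (star a)) \<le> 1 / \<beta> ^ CARD('n)" using beta_pos by (simp add: field_simps)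
  ultimately show ?thesis by simp
 qed
 have "card pieces \<le> Suc (card (\<Union>a\<in>verts T. ?P a))" unfolding pieces_def by (rule card_insert_le_m1) auto
 also have "... \<le> Suc (\<Sum>a\<in>verts T. card (?P a))" using card_UN_le[OF finite_verts[OF T_M]] by simp
 finally have "real (card pieces) \<le> 1 + (\<Sum>a\<in>verts T. real (card (?P a)))" by (simp flip: of_nat_sum)
 also have "(\<Sum>a\<in>verts T. real (card (?P a))) \<le> (\<Sum>a\<in>verts T. 1 + 1 / \<beta> ^ CARD('n))" by (rule sum_mono) (rule s)
 also have "... = (real CARD('n) + 1) * (1 + 1 / \<beta> ^ CARD('n))"
  using full_simplex_verts(2)[OF simp_M[OF T_M]] by simp
 finally show ?thesis by simp
qed

text \<open>Each piece is reached from the interior of \<open>T\<close> through at most one ball around a vertex, in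
 overlapping sets that contain balls of comparable size.\<close>

lemma overlap_T:
 assumes a: "a \<in> verts T"
 shows "\<exists>c. ball c (\<beta> * rad a / 2) \<subseteq> interior T \<inter> ball a (rad a)"
proof -
 have t: "0 < rad a / 2" "rad a / 2 \<le> diameter T" using rad_props(1,3)[OF a] h_pos by (auto simp: h_def)
 from scale_ball[OF T_M verts_T[OF a] t] obtain c where c: "cball c (\<beta> * (rad a / 2)) \<subseteq> T \<inter> cball a (rad a / 2)" by blast
 have b: "ball c (\<beta> * rad a / 2) \<subseteq> cball c (\<beta> * (rad a / 2))" by auto
 hence "ball c (\<beta> * rad a / 2) \<subseteq> interior T" using c by (intro interior_maximal) blast+
 moreover have "cball a (rad a / 2) \<subseteq> ball a (rad a)" using t by auto
 ultimately show ?thesis using c b by blast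
qed

lemma overlap_K:
 assumes a: "a \<in> verts T" and K: "K \<in> star a"
 shows "\<exists>c. ball c (\<beta> * rad a / 2) \<subseteq> piece a K \<inter> ball a (rad a)"
proof -
 have KM: "K \<in> M" "a \<in> K" using star_props(3,4)[OF K] by auto
 have "\<beta> * diameter K \<le> 1 * diameter K" using beta_small diameter_pos[OF KM(1)] by (intro mult_right_mono) auto
 hence t: "0 < rad a / 2" "rad a / 2 \<le> diameter K" using rad_props(1,2)[OF a] K by force+
 from scale_ball[OF KM t] obtain c where c: "cball c (\<beta> * (rad a / 2)) \<subseteq> K \<inter> cball a (rad a / 2)" by blast
 have b: "ball c (\<beta> * rad a / 2) \<subseteq> cball c (\<beta> * (rad a / 2))" by auto
 hence "ball c (\<beta> * rad a / 2) \<subseteq> interior K" using c by (intro interior_maximal) blast+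
 moreover have "cball a (rad a / 2) \<subseteq> ball a (rad a)" using t by auto
 moreover have "ball a (rad a) \<subseteq> ball a (R * h)"
 proof (rule subset_ball)
  have "h \<le> R * h" using R_ge h_pos by simp
  thus "rad a \<le> R * h" using rad_props(3)[OF a] by simp
 qed
 ultimately show ?thesis using c b unfolding piece_def by blast
qed

text \<open>The diameter bound 2 R h divided by the smallest radius \<beta> (\<beta> \<gamma> h) / 4
  of the balls placed in the overlaps, where \<gamma> h bounds the diameters in the stars from
  below.\<close>

definition ratio where "ratio \<gamma> = 8 * R / (\<beta> * (\<beta> * \<gamma>))"

text \<open>Chains have three members: T, a vertex ball, a truncated element. With C the constant of
  one link they give C, C (1 + C) and C (1 + C (1 + C)), all at most C (1 + C)^2; summing over the
  bounded number of pieces supplies the first factor.\<close>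

lemma patch_poincare:
 assumes \<gamma>: "0 < \<gamma>" "\<gamma> \<le> 1" "\<And>a K. a \<in> verts T \<Longrightarrow> K \<in> star a \<Longrightarrow> \<gamma> * h \<le> diameter K"
  and wg: "weak_grad X u g" and z: "(LBI y. u y * indicator (ball cT (\<beta> * h / 2)) y) = 0"
 shows "wint X u \<le> ennreal ((1 + (real CARD('n) + 1) * (1 + 1 / \<beta> ^ CARD('n))) * (glue_const (ratio \<gamma>) * (1 + glue_const (ratio \<gamma>)) ^ 2))
   * (ennreal ((2 * R * h) powr p) * wint X (\<lambda>x. \<Sum>i\<in>UNIV. \<bar>g i x\<bar>))"
proof -
 let ?Z = "\<beta> * (\<gamma> * h)" and ?Y = "\<lambda>x. \<Sum>i\<in>UNIV. \<bar>g i x\<bar>"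
 have [measurable]: "u \<in> borel_measurable borel" using wg by (auto simp: weak_grad_def)
 let ?C = "glue_const (ratio \<gamma>)"
 define B where "B = ennreal ((2 * R * h) powr p) * wint X ?Y"
 have C: "0 \<le> ?C" by (rule glue_const_nonneg)
 have beta1: "\<beta> * \<gamma> \<le> 1" using beta_small \<gamma> beta_pos mult_mono[of \<beta> 1 \<gamma> 1] by simp
 have bg: "0 < \<beta> * \<gamma>" using beta_pos \<gamma> by simp
 have rad_ge: "\<beta> * (\<gamma> * h) \<le> rad a" if a: "a \<in> verts T" for a
 proof -
  have "\<gamma> * h \<le> Min (diameter ` star a)" using star_props(1,2)[of a] a \<gamma>(3)[OF a] by (subst Min_ge_iff) auto
  thus ?thesis unfolding rad_def using beta_pos by (intro mult_left_mono) auto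
 qed
 have G: "ennreal ((2 * R * h) powr p) * wint D ?Y \<le> B" if "D \<subseteq> X" for D
  unfolding B_def using that by (intro mult_left_mono wint_mono) auto
 have ratio: "2 * R * h / \<rho> \<le> ratio \<gamma>" if "\<beta> * ?Z / 4 \<le> \<rho>" for \<rho>
 proof -
  have p0: "0 < \<beta> * ?Z / 4" using bg beta_pos h_pos \<gamma> by simp
  have "2 * R * h / \<rho> \<le> 2 * R * h / (\<beta> * ?Z / 4)"
   using p0 that R_ge h_pos by (intro divide_left_mono) auto
  also have "... = ratio \<gamma>" unfolding ratio_def using h_pos by simp
  finally show ?thesis .
 qed
 have glue: "wint D u \<le> ennreal ?C * (B + wint E u)"
  if "D \<in> pieces" "0 < \<rho>" "ball c (2 * \<rho>) \<subseteq> D" "ball c \<rho> \<subseteq> E" "\<beta> * ?Z / 4 \<le> \<rho>" for D E c \<rho>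
 proof -
  note D = pieces_props[OF that(1)]
  have "wint D u \<le> ennreal (glue_const (2 * R * h / \<rho>)) * (ennreal ((2 * R * h) powr p) * wint D ?Y + wint E u)"
   by (rule poincare_glue[OF D(1,2,4) that(2,3,4) weak_grad_subset[OF wg D(3)]]) simp_all
  also have "... \<le> ennreal ?C * (B + wint E u)"
   using ratio[OF that(5)] R_ge h_pos that(2) by (intro mult_mono add_mono G D(3) ennreal_leI glue_const_mono) auto
  finally show ?thesis .
 qed
 have TP: "interior T \<in> pieces" by (simp add: pieces_def)
 have T1: "wint (interior T) u \<le> ennreal ?C * B"
 proof -
  note D = pieces_props[OF TP]
  have \<rho>: "0 < \<beta> * h / 2" using beta_pos h_pos by simp
  have "wint (interior T) u \<le> ennreal (glue_const (2 * R * h / (\<beta> * h / 2))) * (ennreal ((2 * R * h) powr p) * wint (interior T) ?Y)"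
   by (rule poincare_base[OF D(1,2,4) \<rho> ball_cT weak_grad_subset[OF wg D(3)] z])
  also have "... \<le> ennreal ?C * B"
  proof (intro mult_mono G D(3) ennreal_leI glue_const_mono ratio)
   have "\<beta> * ?Z = (\<beta> * \<gamma>) * (\<beta> * h)" by simp
   also have "... \<le> 1 * (\<beta> * h)" using beta1 beta_pos h_pos by (intro mult_right_mono) auto
   finally show "\<beta> * ?Z / 4 \<le> \<beta> * h / 2" using \<rho> by linarith
  qed (use R_ge h_pos \<rho> beta_pos in auto)
  finally show ?thesis .
 qed
 have ball1: "wint (ball a (rad a)) u \<le> ennreal ?C * (B + ennreal ?C * B)" if a: "a \<in> verts T" for a
 proof -
  obtain c where c: "ball c (\<beta> * rad a / 2) \<subseteq> interior T \<inter> ball a (rad a)" using overlap_T[OF a] by blast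
  have rp: "0 < \<beta> * rad a / 4" using beta_pos rad_props(1)[OF a] by simp
  have "wint (ball a (rad a)) u \<le> ennreal ?C * (B + wint (interior T) u)"
  proof -
   have 1: "ball a (rad a) \<in> pieces" using a by (auto simp: pieces_def)
   have 2: "ball c (2 * (\<beta> * rad a / 4)) \<subseteq> ball a (rad a)" "ball c (\<beta> * rad a / 4) \<subseteq> interior T"
    using c rp subset_ball[of "\<beta> * rad a / 4" "\<beta> * rad a / 2" c] by auto
   have "\<beta> * ?Z / 4 \<le> \<beta> * rad a / 4" using rad_ge[OF a] beta_pos by simp
   from glue[OF 1 rp 2 this] show ?thesis .
  qed
  also have "... \<le> ennreal ?C * (B + ennreal ?C * B)" by (intro mult_left_mono add_left_mono T1) auto
  finally show ?thesis .
 qed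
 have piece1: "wint (piece a K) u \<le> ennreal ?C * (B + ennreal ?C * (B + ennreal ?C * B))" if a: "a \<in> verts T" and K: "K \<in> star a" for a K
 proof -
  obtain c where c: "ball c (\<beta> * rad a / 2) \<subseteq> piece a K \<inter> ball a (rad a)" using overlap_K[OF a K] by blast
  have rp: "0 < \<beta> * rad a / 4" using beta_pos rad_props(1)[OF a] by simp
  have "wint (piece a K) u \<le> ennreal ?C * (B + wint (ball a (rad a)) u)"
  proof -
   have 1: "piece a K \<in> pieces" using a K by (auto simp: pieces_def)
   have 2: "ball c (2 * (\<beta> * rad a / 4)) \<subseteq> piece a K" "ball c (\<beta> * rad a / 4) \<subseteq> ball a (rad a)"
    using c rp subset_ball[of "\<beta> * rad a / 4" "\<beta> * rad a / 2" c] by auto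
   have "\<beta> * ?Z / 4 \<le> \<beta> * rad a / 4" using rad_ge[OF a] beta_pos by simp
   from glue[OF 1 rp 2 this] show ?thesis .
  qed
  also have "... \<le> ennreal ?C * (B + ennreal ?C * (B + ennreal ?C * B))" by (intro mult_left_mono add_left_mono ball1 a) auto
  finally show ?thesis .
 qed
 have eB: "ennreal c * B + ennreal d * B = ennreal (c + d) * B" if "0 \<le> c" "0 \<le> d" for c d
  using that by (simp add: distrib_right)
 have e1: "B + ennreal ?C * B = ennreal (1 + ?C) * B" using C by (simp add: distrib_right)
 have e2: "ennreal ?C * (B + ennreal ?C * B) = ennreal (?C * (1 + ?C)) * B"
  unfolding e1 using C by (subst ennreal_mult) (auto simp: mult.assoc)
 have e3: "ennreal ?C * (B + ennreal ?C * (B + ennreal ?C * B)) = ennreal (?C * (1 + ?C * (1 + ?C))) * B"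
 proof -
  have "B + ennreal (?C * (1 + ?C)) * B = ennreal (1 + ?C * (1 + ?C)) * B" using C by (simp add: distrib_right)
  thus ?thesis unfolding e2 using C by (subst ennreal_mult) (auto simp: mult.assoc)
 qed
 let ?C2 = "?C * (1 + ?C) ^ 2"
 have all: "wint D u \<le> ennreal ?C2 * B" if D: "D \<in> pieces" for D
 proof -
  have i: "?C \<le> ?C2" "?C * (1 + ?C) \<le> ?C2" "?C * (1 + ?C * (1 + ?C)) \<le> ?C2"
  proof -
   have "1 \<le> (1 + ?C) ^ 2" "1 + ?C \<le> (1 + ?C) ^ 2" "1 + ?C * (1 + ?C) \<le> (1 + ?C) ^ 2"
    using C by (auto simp: power2_eq_square algebra_simps)
   thus "?C \<le> ?C2" "?C * (1 + ?C) \<le> ?C2" "?C * (1 + ?C * (1 + ?C)) \<le> ?C2"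
    using C mult_left_mono[of 1 "(1 + ?C) ^ 2" ?C] by (auto intro!: mult_left_mono)
  qed
  have j: "ennreal ?C * B \<le> ennreal ?C2 * B" "ennreal (?C * (1 + ?C)) * B \<le> ennreal ?C2 * B"
   "ennreal (?C * (1 + ?C * (1 + ?C))) * B \<le> ennreal ?C2 * B" by (intro mult_right_mono ennreal_leI i; simp)+
  show ?thesis using D unfolding pieces_def
  proof (elim insertE UN_E imageE)
   assume "D = interior T" thus ?thesis using T1 j(1) by (auto intro: order_trans)
  next
   fix a assume "a \<in> verts T" "D = ball a (rad a)"
   thus ?thesis using ball1[of a] j(2) unfolding e2 by (auto intro: order_trans)
  next
   fix a K assume "a \<in> verts T" "K \<in> star a" "D = piece a K"
   thus ?thesis using piece1[of a K] j(3) unfolding e3 by (auto intro: order_trans)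
  qed
 qed
 have "wint X u \<le> (\<Sum>D\<in>pieces. wint D u)" unfolding X_def using finite_pieces pieces_props(1) by (intro wint_Un) auto
 also have "... \<le> (\<Sum>D\<in>pieces. ennreal ?C2 * B)" by (rule sum_mono) (rule all)
 also have "... = ennreal (real (card pieces)) * (ennreal ?C2 * B)" by (simp add: ennreal_of_nat_eq_real_of_nat)
 also have "... \<le> ennreal (1 + (real CARD('n) + 1) * (1 + 1 / \<beta> ^ CARD('n))) * (ennreal ?C2 * B)"
  by (intro mult_right_mono ennreal_leI card_pieces) simp
 also have "... = ennreal ((1 + (real CARD('n) + 1) * (1 + 1 / \<beta> ^ CARD('n))) * ?C2) * B"
  using C beta_pos by (subst mult.assoc[symmetric], subst ennreal_mult[symmetric]) auto
 finally show ?thesis unfolding B_def .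
qed

text \<open>The same chain with suprema: each link adds one more total integral of the gradient, and
  three links give the factor 3. The overlaps may be tiny compared with the pieces, because the
  constant of \<open>sup_bound_1d\<close> does not see their size.\<close>

lemma patch_sup_1d:
 assumes 1: "CARD('n) = 1" and wg: "weak_grad X u g" and z: "(LBI y. u y * indicator (ball cT (\<beta> * h / 2)) y) = 0"
 shows "AE x\<in>X in lborel. ennreal \<bar>u x\<bar> \<le> 3 * (psi_mass * (LBNN x. ennreal (\<Sum>i\<in>UNIV. \<bar>g i x\<bar>) * indicator X x))"
proof -
 define Z where "Z = psi_mass * (LBNN x. ennreal (\<Sum>i\<in>UNIV. \<bar>g i x\<bar>) * indicator X x)"
 have [measurable]: "u \<in> borel_measurable borel" and iu: "integrable lborel u" using wg by (auto simp: weak_grad_def)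
 have ZD: "psi_mass * (LBNN x. ennreal (\<Sum>i\<in>UNIV. \<bar>g i x\<bar>) * indicator D x) \<le> Z" if "D \<subseteq> X" for D
  unfolding Z_def using that by (intro mult_left_mono nn_integral_mono) (auto simp: indicator_def)
 have TP: "interior T \<in> pieces" by (simp add: pieces_def)
 have T1: "AE x\<in>interior T in lborel. ennreal \<bar>u x\<bar> \<le> Z"
 proof -
  note D = pieces_props[OF TP]
  have \<rho>: "0 < \<beta> * h / 2" using beta_pos h_pos by simp
  from sup_bound_1d[OF 1 D(1,2) \<rho> ball_cT weak_grad_subset[OF wg D(3)]]
  show ?thesis unfolding z by eventually_elim (use ZD[OF D(3)] in \<open>auto intro: order_trans\<close>)
 qed
 have glue: "AE x\<in>D in lborel. ennreal \<bar>u x\<bar> \<le> Z + Y"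
  if D: "D \<in> pieces" and E: "AE x\<in>E in lborel. ennreal \<bar>u x\<bar> \<le> Y" and \<rho>: "0 < \<rho>" and c: "ball c (2 * \<rho>) \<subseteq> E \<inter> D" for D E Y c \<rho>
 proof -
  note P = pieces_props[OF D]
  let ?V = "ballvol TYPE('n) \<rho>"
  define m where "m = (LBI y. u y * indicator (ball c \<rho>) y) / ?V"
  have V: "0 < ?V" by (rule ballvol_pos[OF \<rho>])
  have "ennreal \<bar>m\<bar> \<le> ennreal (1 / ?V) * (LBNN y. ennreal \<bar>u y * indicator (ball c \<rho>) y\<bar>)"
  proof -
   have "\<bar>m\<bar> = (1 / ?V) * \<bar>\<integral>y. u y * indicator (ball c \<rho>) y \<partial>lborel\<bar>"
    unfolding m_def abs_divide abs_of_pos[OF V] by simp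
   moreover have "0 \<le> 1 / ?V" using V by (intro divide_nonneg_pos) auto
   ultimately have "ennreal \<bar>m\<bar> = ennreal (1 / ?V) * ennreal \<bar>\<integral>y. u y * indicator (ball c \<rho>) y \<partial>lborel\<bar>"
    by (simp only: ennreal_mult abs_ge_zero)
   thus ?thesis using integral_norm_le_nn by (auto intro!: mult_left_mono)
  qed
  also have "... \<le> ennreal (1 / ?V) * (LBNN y. Y * indicator (ball c \<rho>) y)"
  proof (intro mult_left_mono nn_integral_mono_AE)
   have sub: "ball c \<rho> \<subseteq> E" using c \<rho> subset_ball[of \<rho> "2 * \<rho>" c] by auto
   show "AE y in lborel. ennreal \<bar>u y * indicator (ball c \<rho>) y\<bar> \<le> Y * indicator (ball c \<rho>) y"
    using E by eventually_elim (use sub in \<open>auto simp: indicator_def\<close>)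
  qed simp
  also have "... = ennreal (1 / ?V) * (Y * ennreal ?V)"
   using \<rho> by (simp add: nn_integral_cmult_indicator emeasure_ball_vec)
  also have "... = Y"
  proof -
   have "ennreal (1 / ?V) * ennreal ?V = 1" using \<rho> by (subst ennreal_mult[symmetric]) auto
   thus ?thesis by (metis mult.commute mult.left_commute mult.right_neutral)
  qed
  finally have m: "ennreal \<bar>m\<bar> \<le> Y" .
  have cD: "ball c (2 * \<rho>) \<subseteq> D" using c by blast
  from sup_bound_1d[OF 1 P(1,2) \<rho> cD weak_grad_subset[OF wg P(3)]]
  show ?thesis
  proof eventually_elim
   case (elim x)
   show ?case
   proof
    assume "x \<in> D"
    hence 1: "ennreal \<bar>u x - m\<bar> \<le> Z" using elim ZD[OF P(3)] unfolding m_def by (auto intro: order_trans)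
    have "ennreal \<bar>u x\<bar> \<le> ennreal (\<bar>u x - m\<bar> + \<bar>m\<bar>)" by (intro ennreal_leI) linarith
    also have "... = ennreal \<bar>u x - m\<bar> + ennreal \<bar>m\<bar>" by (rule ennreal_plus) auto
    also have "... \<le> Z + Y" by (intro add_mono 1 m)
    finally show "ennreal \<bar>u x\<bar> \<le> Z + Y" .
   qed
  qed
 qed
 have le3: "Z \<le> 3 * Z" "Z + Z \<le> 3 * Z" "Z + (Z + Z) \<le> 3 * Z"
 proof -
  have "(3 :: ennreal) = 1 + (1 + 1)" by simp
  hence "3 * Z = Z + (Z + Z)" by (simp only: distrib_right mult_1)
  thus "Z \<le> 3 * Z" "Z + Z \<le> 3 * Z" "Z + (Z + Z) \<le> 3 * Z" by (auto simp: add_increasing2 add_left_mono)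
 qed
 have ball1: "AE x\<in>ball a (rad a) in lborel. ennreal \<bar>u x\<bar> \<le> Z + Z" if a: "a \<in> verts T" for a
 proof -
  obtain c where c: "ball c (\<beta> * rad a / 2) \<subseteq> interior T \<inter> ball a (rad a)" using overlap_T[OF a] by blast
  have "0 < \<beta> * rad a / 4" "ball c (2 * (\<beta> * rad a / 4)) \<subseteq> interior T \<inter> ball a (rad a)" "ball a (rad a) \<in> pieces"
   using c beta_pos rad_props(1)[OF a] a by (auto simp: pieces_def)
  from glue[OF this(3) T1 this(1,2)] show ?thesis .
 qed
 have piece1: "AE x in lborel. x \<in> piece a K \<longrightarrow> ennreal \<bar>u x\<bar> \<le> Z + (Z + Z)" if a: "a \<in> verts T" and K: "K \<in> star a" for a K
 proof -
  obtain c where c: "ball c (\<beta> * rad a / 2) \<subseteq> piece a K \<inter> ball a (rad a)" using overlap_K[OF a K] by blast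
  have "0 < \<beta> * rad a / 4" "ball c (2 * (\<beta> * rad a / 4)) \<subseteq> ball a (rad a) \<inter> piece a K" "piece a K \<in> pieces"
   using c beta_pos rad_props(1)[OF a] a K by (auto simp: pieces_def)
  from glue[OF this(3) ball1[OF a] this(1,2)] show ?thesis .
 qed
 have all: "AE x\<in>D in lborel. ennreal \<bar>u x\<bar> \<le> 3 * Z" if D: "D \<in> pieces" for D using D unfolding pieces_def
 proof (elim insertE UN_E imageE)
  assume D: "D = interior T"
  show ?thesis using T1 by eventually_elim (use D le3 in \<open>auto intro: order_trans\<close>)
 next
  fix a assume D: "a \<in> verts T" "D = ball a (rad a)"
  show ?thesis using ball1[OF D(1)] by eventually_elim (use D le3 in \<open>auto intro: order_trans\<close>)
 next
  fix a K assume D: "a \<in> verts T" "K \<in> star a" "D = piece a K"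
  show ?thesis using piece1[OF D(1,2)] by eventually_elim (use D le3 in \<open>auto intro: order_trans\<close>)
 qed
 have "AE x in lborel. \<forall>D\<in>pieces. x \<in> D \<longrightarrow> ennreal \<bar>u x\<bar> \<le> 3 * Z"
  unfolding AE_finite_all[OF finite_pieces] using all by blast
 thus ?thesis unfolding Z_def[symmetric] by eventually_elim (auto simp: X_def)
qed

end

lemma (in mollifier) psi_mass_finite: "psi_mass = ennreal (enn2real psi_mass)" "0 \<le> enn2real psi_mass"
 using nn_psi_finite by (auto simp: psi_mass_def)

section \<open>Uniform constants and estimates on the patch\<close>

context weighted_moll
begin

text \<open>The bound of \<open>diameter_star\<close> with N the ceiling of \<beta>^(-n), the
  packing bound for the number of elements in a star.\<close>

definition size_ratio :: "real \<Rightarrow> real" where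
 "size_ratio \<beta> = (2 * \<beta>) ^ nat \<lceil>1 / \<beta> ^ CARD('n)\<rceil>"

text \<open>The patch and T lie in a ball of radius (R + 1) h around a vertex; this is the
  Muckenhoupt bound for that ball with the power of h split off.\<close>

definition reach_const :: "real \<Rightarrow> real" where
 "reach_const R = A * (ballvol TYPE('n) (R + 1)) powr p"

text \<open>The constants are formed before any mesh is fixed and refer to the weight only through
  A; this is what makes the final bound uniform.\<close>

definition patch_const :: "real \<Rightarrow> real \<Rightarrow> real" where
 "patch_const \<beta> R = (if CARD('n) = 1 then (3 * enn2real psi_mass) powr p * reach_const R
   else (1 + (real CARD('n) + 1) * (1 + 1 / \<beta> ^ CARD('n))) *
    (let C = glue_const (8 * R / (\<beta> * (\<beta> * size_ratio \<beta>))) in C * (1 + C) ^ 2) * (2 * R) powr p)"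

text \<open>Here k1 / h^n stands for a bound on the height of a kernel and k2 for one on its mass;
  dimension one uses the mass, higher dimensions the height.\<close>

definition kernel_const :: "real \<Rightarrow> real \<Rightarrow> real \<Rightarrow> real \<Rightarrow> real" where
 "kernel_const \<beta> R k1 k2 = (if CARD('n) = 1 then (k2 * (3 * enn2real psi_mass)) powr p * reach_const R
   else k1 powr p * reach_const R * patch_const \<beta> R)"

lemma reach_const_nonneg: "0 \<le> reach_const R" unfolding reach_const_def using A_nonneg by simp

lemma patch_const_nonneg: "0 < \<beta> \<Longrightarrow> 0 \<le> patch_const \<beta> R"
 unfolding patch_const_def Let_def using reach_const_nonneg glue_const_nonneg by simp

lemma kernel_const_nonneg: "0 < \<beta> \<Longrightarrow> 0 \<le> kernel_const \<beta> R k1 k2"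
 unfolding kernel_const_def using reach_const_nonneg patch_const_nonneg by simp

end

context patch
begin

lemma size_ratio: "0 < size_ratio \<beta>" "size_ratio \<beta> \<le> 1"
proof -
 show "0 < size_ratio \<beta>" unfolding size_ratio_def using beta_pos by simp
 show "size_ratio \<beta> \<le> 1" unfolding size_ratio_def by (rule power_le_one) (use beta_pos beta_small in auto)
qed

lemma size_ratio_le:
 assumes n: "2 \<le> CARD('n)" and a: "a \<in> verts T" and K: "K \<in> star a"
 shows "size_ratio \<beta> * h \<le> diameter K"
proof -
 let ?N = "nat \<lceil>1 / \<beta> ^ CARD('n)\<rceil>"
 have "1 / \<beta> ^ CARD('n) \<le> real ?N" by linarith
 hence N: "1 \<le> real ?N * \<beta> ^ CARD('n)" using beta_pos by (simp only: pos_divide_le_eq zero_less_power)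
 from diameter_star[OF n verts_interior[OF a] a T_M star_props(3,4)[OF K] N]
 show ?thesis using beta_small unfolding size_ratio_def h_def by simp
qed

lemma reach_h: "A * ballvol TYPE('n) ((R + 1) * h) powr p = reach_const R * (h ^ CARD('n)) powr p"
 using h_pos R_ge by (simp add: reach_const_def power_mult_distrib powr_mult mult.assoc)

lemma integral_patch_transfer:
 assumes [measurable]: "f \<in> borel_measurable borel"
 shows "epow p (LBNN y. ennreal \<bar>f y\<bar> * indicator X y) * wint T (\<lambda>_. 1)
   \<le> ennreal (reach_const R * (h ^ CARD('n)) powr p) * wint X f"
  "epow p (LBNN y. ennreal \<bar>f y\<bar> * indicator X y) * wint X (\<lambda>_. 1)
   \<le> ennreal (reach_const R * (h ^ CARD('n)) powr p) * wint X f"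
proof -
 have "verts T \<noteq> {}" using full_simplex_verts(2)[OF simp_M[OF T_M]] by auto
 then obtain a where a: "a \<in> verts T" by blast
 have s: "0 < (R + 1) * h" using R_ge h_pos by simp
 have [measurable]: "X \<in> sets borel" using open_X by simp
 show "epow p (LBNN y. ennreal \<bar>f y\<bar> * indicator X y) * wint T (\<lambda>_. 1)
   \<le> ennreal (reach_const R * (h ^ CARD('n)) powr p) * wint X f"
  "epow p (LBNN y. ennreal \<bar>f y\<bar> * indicator X y) * wint X (\<lambda>_. 1)
   \<le> ennreal (reach_const R * (h ^ CARD('n)) powr p) * wint X f" unfolding reach_h[symmetric]
  by (rule integral_transfer[OF _ _ s X_ball(1)[OF a] X_ball(2)[OF a]], simp_all)
   (rule integral_transfer[OF _ _ s X_ball(1)[OF a] X_ball(1)[OF a]], simp_all)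
qed

text \<open>The supremum bound contains no power of h. The factor h^p arises when the integral of
  the gradient over the patch is transferred to a weighted one, because the surrounding ball has
  length comparable to h.\<close>

lemma sup_transfer_1d:
 assumes 1: "CARD('n) = 1" and wg: "weak_grad X u g" and z: "(LBI y. u y * indicator (ball cT (\<beta> * h / 2)) y) = 0"
  and c: "0 \<le> c"
 defines "Z \<equiv> 3 * (psi_mass * (LBNN x. ennreal (\<Sum>i\<in>UNIV. \<bar>g i x\<bar>) * indicator X x))"
 shows "epow p (ennreal c * Z) * wint X (\<lambda>_. 1) \<le> ennreal ((c * (3 * enn2real psi_mass)) powr p * reach_const R * h powr p) * wint X (\<lambda>x. \<Sum>i\<in>UNIV. \<bar>g i x\<bar>)"
  "epow p (ennreal c * Z) * wint T (\<lambda>_. 1) \<le> ennreal ((c * (3 * enn2real psi_mass)) powr p * reach_const R * h powr p) * wint X (\<lambda>x. \<Sum>i\<in>UNIV. \<bar>g i x\<bar>)"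
proof -
 have "integrable lborel (g i)" for i using wg by (simp add: weak_grad_def)
 hence [measurable]: "g i \<in> borel_measurable borel" for i using borel_measurable_integrable by force
 let ?G = "\<lambda>x. \<Sum>i\<in>UNIV. \<bar>g i x\<bar>" and ?L = "enn2real psi_mass"
 let ?I = "\<integral>\<^sup>+x. ennreal \<bar>?G x\<bar> * indicator X x \<partial>lborel"
 have "Z = ennreal 3 * (ennreal ?L * ?I)" unfolding Z_def psi_mass_finite(1)[symmetric] by (simp add: sum_nonneg)
 hence Z: "ennreal c * Z = ennreal (c * (3 * ?L)) * ?I"
  using c psi_mass_finite(2) by (simp only: ennreal_mult mult.assoc mult_nonneg_nonneg zero_le_numeral)
 have e: "epow p (ennreal c * Z) = ennreal ((c * (3 * ?L)) powr p) * epow p ?I"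
  unfolding Z using p_gt_1 c psi_mass_finite(2) by (subst epow_mult) (auto simp: epow_ennreal)
 have conc: "epow p (ennreal c * Z) * W \<le> ennreal ((c * (3 * ?L)) powr p * reach_const R * h powr p) * wint X ?G"
  if "epow p ?I * W \<le> ennreal (reach_const R * (h ^ CARD('n)) powr p) * wint X ?G" for W
 proof -
  have "epow p (ennreal c * Z) * W = ennreal ((c * (3 * ?L)) powr p) * (epow p ?I * W)" unfolding e by (rule mult.assoc)
  also have "... \<le> ennreal ((c * (3 * ?L)) powr p) * (ennreal (reach_const R * (h ^ CARD('n)) powr p) * wint X ?G)"
   by (intro mult_left_mono that) simp
  also have "... = ennreal ((c * (3 * ?L)) powr p * (reach_const R * (h ^ CARD('n)) powr p)) * wint X ?G"
   using reach_const_nonneg by (subst mult.assoc[symmetric], subst ennreal_mult[symmetric]) auto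
  finally show ?thesis using 1 by (simp add: mult.assoc)
 qed
 show "epow p (ennreal c * Z) * wint X (\<lambda>_. 1) \<le> ennreal ((c * (3 * ?L)) powr p * reach_const R * h powr p) * wint X ?G"
  "epow p (ennreal c * Z) * wint T (\<lambda>_. 1) \<le> ennreal ((c * (3 * ?L)) powr p * reach_const R * h powr p) * wint X ?G"
  by (intro conc integral_patch_transfer; measurable)+
qed

lemma patch_estimate:
 assumes wg: "weak_grad X u g" and z: "(LBI y. u y * indicator (ball cT (\<beta> * h / 2)) y) = 0"
 shows "wint X u \<le> ennreal (patch_const \<beta> R * h powr p) * wint X (\<lambda>x. \<Sum>i\<in>UNIV. \<bar>g i x\<bar>)"
proof (cases "CARD('n) = 1")
 case True
 have [measurable]: "u \<in> borel_measurable borel" using wg by (auto simp: weak_grad_def)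
 have Xm: "X \<in> sets borel" using open_X by simp
 define Z where "Z = 3 * (psi_mass * (LBNN x. ennreal (\<Sum>i\<in>UNIV. \<bar>g i x\<bar>) * indicator X x))"
 have "wint X u \<le> (LBNN x. epow p Z * (ennreal (\<bar>1\<bar> powr p * w x) * indicator X x))" unfolding wint_def
 proof (rule nn_integral_mono_AE)
  show "AE x in lborel. ennreal (\<bar>u x\<bar> powr p * w x) * indicator X x \<le> epow p Z * (ennreal (\<bar>1\<bar> powr p * w x) * indicator X x)"
   using patch_sup_1d[OF True wg z]
  proof eventually_elim
   case (elim x)
   show ?case
   proof (cases "x \<in> X")
    case x: True
    hence "epow p (ennreal \<bar>u x\<bar>) \<le> epow p Z" using elim p_gt_1 unfolding Z_def by (intro epow_mono) auto
    thus ?thesis using x unfolding ennreal_powr_w by (auto intro!: mult_right_mono)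
   qed simp
  qed
 qed
 also have "... = epow p (ennreal 1 * Z) * wint X (\<lambda>_. 1)"
  unfolding wint_def using Xm by (subst nn_integral_cmult) auto
 also have "... \<le> ennreal ((1 * (3 * enn2real psi_mass)) powr p * reach_const R * h powr p) * wint X (\<lambda>x. \<Sum>i\<in>UNIV. \<bar>g i x\<bar>)"
  unfolding Z_def by (rule sup_transfer_1d(1)[OF True wg z]) simp
 finally show ?thesis using True by (simp add: patch_const_def)
next
 case False
 have "0 < CARD('n)" by simp
 hence n: "2 \<le> CARD('n)" using False by linarith
 let ?C = "glue_const (ratio (size_ratio \<beta>))" and ?N = "1 + (real CARD('n) + 1) * (1 + 1 / \<beta> ^ CARD('n))"
 have "wint X u \<le> ennreal (?N * (?C * (1 + ?C) ^ 2)) * (ennreal ((2 * R * h) powr p) * wint X (\<lambda>x. \<Sum>i\<in>UNIV. \<bar>g i x\<bar>))"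
  by (rule patch_poincare[OF size_ratio size_ratio_le[OF n] wg z])
 also have "... = ennreal (?N * (?C * (1 + ?C) ^ 2) * (2 * R * h) powr p) * wint X (\<lambda>x. \<Sum>i\<in>UNIV. \<bar>g i x\<bar>)"
  using glue_const_nonneg[of "ratio (size_ratio \<beta>)"] beta_pos by (subst mult.assoc[symmetric], subst ennreal_mult[symmetric]) auto
 also have "?N * (?C * (1 + ?C) ^ 2) * (2 * R * h) powr p = patch_const \<beta> R * h powr p"
  using False h_pos R_ge by (simp add: patch_const_def ratio_def Let_def powr_mult mult_ac)
 finally show ?thesis .
qed

text \<open>In dimension at least two the height k1 / h^n of the kernel cancels against the volume
  in \<open>integral_patch_transfer\<close>. In dimension one a node may have a neighbour much
  smaller than T, so the kernel may be much higher than 1 / h; its mass stays bounded and is paired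
  with the supremum of u.\<close>

lemma patch_kernel:
 assumes wg: "weak_grad X u g" and z: "(LBI y. u y * indicator (ball cT (\<beta> * h / 2)) y) = 0"
  and [measurable]: "k \<in> borel_measurable borel" and kX: "\<And>x. x \<notin> X \<Longrightarrow> k x = 0"
  and k1: "0 \<le> k1"
  and k2: "0 \<le> k2" "(LBNN x. ennreal \<bar>k x\<bar>) \<le> ennreal k2"
  and k1': "2 \<le> CARD('n) \<Longrightarrow> \<forall>x. \<bar>k x\<bar> \<le> k1 / h ^ CARD('n)"
 shows "epow p (LBNN x. ennreal \<bar>u x * k x\<bar>) * wint T (\<lambda>_. 1)
   \<le> ennreal (kernel_const \<beta> R k1 k2 * h powr p) * wint X (\<lambda>x. \<Sum>i\<in>UNIV. \<bar>g i x\<bar>)"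
proof (cases "CARD('n) = 1")
 case True
 have [measurable]: "u \<in> borel_measurable borel" using wg by (auto simp: weak_grad_def)
 define Z where "Z = 3 * (psi_mass * (LBNN x. ennreal (\<Sum>i\<in>UNIV. \<bar>g i x\<bar>) * indicator X x))"
 have "(LBNN x. ennreal \<bar>u x * k x\<bar>) \<le> (LBNN x. Z * ennreal \<bar>k x\<bar>)"
 proof (rule nn_integral_mono_AE)
  show "AE x in lborel. ennreal \<bar>u x * k x\<bar> \<le> Z * ennreal \<bar>k x\<bar>" using patch_sup_1d[OF True wg z]
  proof eventually_elim
   case (elim x)
   show ?case
   proof (cases "x \<in> X")
    case x: True
    hence "ennreal \<bar>u x\<bar> * ennreal \<bar>k x\<bar> \<le> Z * ennreal \<bar>k x\<bar>" using elim unfolding Z_def by (intro mult_right_mono) auto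
    thus ?thesis by (simp add: abs_mult ennreal_mult)
   qed (simp add: kX)
  qed
 qed
 also have "... = Z * (LBNN x. ennreal \<bar>k x\<bar>)" by (rule nn_integral_cmult) simp
 also have "... \<le> Z * ennreal k2" by (intro mult_left_mono k2) simp
 finally have "epow p (LBNN x. ennreal \<bar>u x * k x\<bar>) * wint T (\<lambda>_. 1) \<le> epow p (ennreal k2 * Z) * wint T (\<lambda>_. 1)"
  using p_gt_1 by (intro mult_right_mono epow_mono) (auto simp: mult.commute)
 also have "... \<le> ennreal ((k2 * (3 * enn2real psi_mass)) powr p * reach_const R * h powr p) * wint X (\<lambda>x. \<Sum>i\<in>UNIV. \<bar>g i x\<bar>)"
  unfolding Z_def by (rule sup_transfer_1d(2)[OF True wg z k2(1)])
 finally show ?thesis using True by (simp add: kernel_const_def)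
next
 case False
 have "0 < CARD('n)" by simp
 hence n: "2 \<le> CARD('n)" using False by linarith
 have [measurable]: "u \<in> borel_measurable borel" using wg by (auto simp: weak_grad_def)
 have Xm: "X \<in> sets borel" using open_X by simp
 let ?k = "k1 / h ^ CARD('n)" and ?I = "\<integral>\<^sup>+y. ennreal \<bar>u y\<bar> * indicator X y \<partial>lborel" and ?G = "wint X (\<lambda>x. \<Sum>i\<in>UNIV. \<bar>g i x\<bar>)"
 have kn: "0 \<le> ?k" using k1 h_pos by simp
 have "(LBNN x. ennreal \<bar>u x * k x\<bar>) \<le> (LBNN x. ennreal ?k * (ennreal \<bar>u x\<bar> * indicator X x))"
 proof (rule nn_integral_mono)
  fix x
  show "ennreal \<bar>u x * k x\<bar> \<le> ennreal ?k * (ennreal \<bar>u x\<bar> * indicator X x)"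
  proof (cases "x \<in> X")
   case True
   have "\<bar>k x\<bar> * \<bar>u x\<bar> \<le> ?k * \<bar>u x\<bar>" using k1' n by (intro mult_right_mono) auto
   hence "ennreal (\<bar>k x\<bar> * \<bar>u x\<bar>) \<le> ennreal (?k * \<bar>u x\<bar>)" by (rule ennreal_leI)
   thus ?thesis using True unfolding ennreal_mult[OF kn abs_ge_zero] by (simp add: abs_mult mult.commute)
  qed (simp add: kX)
 qed
 also have "... = ennreal ?k * ?I" using Xm by (intro nn_integral_cmult) auto
 finally have "epow p (LBNN x. ennreal \<bar>u x * k x\<bar>) * wint T (\<lambda>_. 1) \<le> epow p (ennreal ?k * ?I) * wint T (\<lambda>_. 1)"
  using p_gt_1 by (intro mult_right_mono epow_mono) auto
 also have "epow p (ennreal ?k * ?I) = ennreal (?k powr p) * epow p ?I"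
  using p_gt_1 kn by (simp add: epow_mult epow_ennreal)
 also have "ennreal (?k powr p) * epow p ?I * wint T (\<lambda>_. 1) = ennreal (?k powr p) * (epow p ?I * wint T (\<lambda>_. 1))" by (rule mult.assoc)
 also have "... \<le> ennreal (?k powr p) * (ennreal (reach_const R * (h ^ CARD('n)) powr p) * wint X u)"
  by (intro mult_left_mono integral_patch_transfer) auto
 also have "... \<le> ennreal (?k powr p) * (ennreal (reach_const R * (h ^ CARD('n)) powr p) * (ennreal (patch_const \<beta> R * h powr p) * ?G))"
  by (intro mult_left_mono patch_estimate wg z) auto
 also have "... = ennreal (?k powr p * ((reach_const R * (h ^ CARD('n)) powr p) * (patch_const \<beta> R * h powr p))) * ?G"
  using reach_const_nonneg patch_const_nonneg[OF beta_pos] by (simp only: ennreal_mult mult.assoc mult_nonneg_nonneg powr_ge_zero)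
 also have "?k powr p * ((reach_const R * (h ^ CARD('n)) powr p) * (patch_const \<beta> R * h powr p)) = kernel_const \<beta> R k1 k2 * h powr p"
  using False h_pos k1 by (simp add: kernel_const_def powr_divide)
 finally show ?thesis .
qed

end

subsection \<open>Polynomials and the Lagrange basis on a simplex\<close>

text \<open>Polynomials of degree at most d in a form suited to induction: constants, sums,
  multiplication by a coordinate. \<open>polyf_iff\<close> identifies them with the coefficient form
  of \<open>poly_on\<close>.\<close>

inductive polyf :: "nat \<Rightarrow> (real^'n::finite \<Rightarrow> real) \<Rightarrow> bool" where
 polyf_const: "polyf d (\<lambda>x. c)"
| polyf_add: "polyf d f \<Longrightarrow> polyf d g \<Longrightarrow> polyf d (\<lambda>x. f x + g x)"
| polyf_mult: "polyf d f \<Longrightarrow> polyf (Suc d) (\<lambda>x. x $ i * f x)"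
| polyf_Suc: "polyf d f \<Longrightarrow> polyf (Suc d) f"

lemma polyf_cmult: "polyf d f \<Longrightarrow> polyf d (\<lambda>x. c * f x)"
proof (induction rule: polyf.induct)
 case (polyf_mult d f i)
 from polyf.polyf_mult[OF polyf_mult(2), of i] show ?case by (simp add: mult.left_commute)
qed (auto intro: polyf.intros simp: distrib_left)

lemma polyf_sum: "(\<And>a. a \<in> A \<Longrightarrow> polyf d (f a)) \<Longrightarrow> polyf d (\<lambda>x. \<Sum>a\<in>A. f a x)"
 by (induction A rule: infinite_finite_induct) (auto intro: polyf.intros)

lemma polyf_affine_mult:
 assumes "polyf d f" shows "polyf (Suc d) (\<lambda>x. (c + g \<bullet> x) * f x)"
proof -
 have "polyf (Suc d) (\<lambda>x. c * f x + (\<Sum>i\<in>UNIV. g $ i * (x $ i * f x)))"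
  by (intro polyf_add polyf_Suc polyf_cmult polyf_sum polyf_mult assms)
 thus ?thesis by (simp add: inner_vec_def distrib_right sum_distrib_right mult.assoc)
qed

lemma polyf_mono: "polyf d f \<Longrightarrow> d \<le> e \<Longrightarrow> polyf e f"
proof (induction e)
 case (Suc e) thus ?case by (cases "d = Suc e") (auto intro: polyf_Suc)
qed simp

lemma mi_pow_Suc: "mi_pow x (\<mu>(i := Suc (\<mu> i))) = x $ i * mi_pow x \<mu>"
proof -
 have e: "mi_pow x \<beta> = x $ i ^ \<beta> i * (\<Prod>j\<in>UNIV-{i}. x $ j ^ \<beta> j)" for \<beta> :: "'a \<Rightarrow> nat"
  unfolding mi_pow_def by (rule prod.remove) auto
 show ?thesis unfolding e by simp
qed

lemma polyf_mi_pow: "polyf (mi_size \<mu>) (\<lambda>x. mi_pow x \<mu>)"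
proof (induction \<mu> rule: mi_induct)
 case zero
 have "(\<lambda>x :: real^'a. mi_pow x (\<lambda>_. 0)) = (\<lambda>x. 1)" by (simp add: mi_pow_def)
 thus ?case using polyf_const by metis
next
 case (Suc \<mu> i)
 from polyf_mult[OF Suc, of i] show ?case by (simp only: mi_size_Suc mi_pow_Suc)
qed

lemma polyf_iff:
 fixes f :: "real^'n::finite \<Rightarrow> real"
 shows "polyf d f \<longleftrightarrow> poly_on d UNIV f"
proof
 assume "polyf d f"
 thus "poly_on d UNIV f"
 proof induction
  case (polyf_const d c)
  have "(\<Sum>\<mu> | mi_size \<mu> \<le> d. (if \<mu> = (\<lambda>_. 0) then c else 0) * mi_pow x \<mu>) = c" for x :: "real^'n"
  proof -
   have "(\<Sum>\<mu> | mi_size \<mu> \<le> d. (if \<mu> = (\<lambda>_. 0) then c else 0) * mi_pow x \<mu>)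
    = (\<Sum>\<mu>\<in>{\<lambda>_. 0}. (if \<mu> = (\<lambda>_. 0) then c else 0) * mi_pow x \<mu>)"
    by (rule sum.mono_neutral_right[OF finite_mi_le]) (auto simp: mi_size_def)
   thus ?thesis by (simp add: mi_pow_def)
  qed
  thus ?case unfolding poly_on_def by (intro exI[of _ "\<lambda>\<mu>. if \<mu> = (\<lambda>_. 0) then c else 0"]) simp
 next
  case (polyf_add d f g)
  then obtain c e where "\<And>x. f x = (\<Sum>\<mu> | mi_size \<mu> \<le> d. c \<mu> * mi_pow x \<mu>)" "\<And>x. g x = (\<Sum>\<mu> | mi_size \<mu> \<le> d. e \<mu> * mi_pow x \<mu>)"
   unfolding poly_on_def by blast
  hence "f x + g x = (\<Sum>\<mu> | mi_size \<mu> \<le> d. (c \<mu> + e \<mu>) * mi_pow x \<mu>)" for x by (simp add: sum.distrib distrib_right)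
  thus ?case unfolding poly_on_def by (intro exI[of _ "\<lambda>\<mu>. c \<mu> + e \<mu>"]) simp
 next
  case (polyf_mult d f i)
  then obtain c where c: "\<And>x. f x = (\<Sum>\<mu> | mi_size \<mu> \<le> d. c \<mu> * mi_pow x \<mu>)" unfolding poly_on_def by blast
  let ?up = "\<lambda>\<mu> :: 'n \<Rightarrow> nat. \<mu>(i := Suc (\<mu> i))"
  \<comment> \<open>Multiplication by a coordinate shifts the exponents; coefficients without a
    preimage under the shift are 0.\<close>
  define c' where "c' \<beta> = (if 0 < \<beta> i then c (\<beta>(i := \<beta> i - 1)) else 0)" for \<beta> :: "'n \<Rightarrow> nat"
  have inj: "inj_on ?up {\<mu>. mi_size \<mu> \<le> d}" by (rule inj_on_inverseI[where g="\<lambda>\<beta>. \<beta>(i := \<beta> i - 1)"]) simp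
  have "x $ i * f x = (\<Sum>\<beta> | mi_size \<beta> \<le> Suc d. c' \<beta> * mi_pow x \<beta>)" for x
  proof -
   have "x $ i * f x = (\<Sum>\<mu> | mi_size \<mu> \<le> d. c' (?up \<mu>) * mi_pow x (?up \<mu>))"
    unfolding c sum_distrib_left by (rule sum.cong) (auto simp: c'_def mi_pow_Suc)
   also have "... = (\<Sum>\<beta>\<in>?up ` {\<mu>. mi_size \<mu> \<le> d}. c' \<beta> * mi_pow x \<beta>)" by (simp add: sum.reindex[OF inj])
   also have "... = (\<Sum>\<beta> | mi_size \<beta> \<le> Suc d. c' \<beta> * mi_pow x \<beta>)"
   proof (rule sum.mono_neutral_left)
    show "?up ` {\<mu>. mi_size \<mu> \<le> d} \<subseteq> {\<beta>. mi_size \<beta> \<le> Suc d}" using mi_size_Suc[of _ i] by force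
    show "\<forall>\<beta>\<in>{\<beta>. mi_size \<beta> \<le> Suc d} - ?up ` {\<mu>. mi_size \<mu> \<le> d}. c' \<beta> * mi_pow x \<beta> = 0"
    proof
     fix \<beta> assume b: "\<beta> \<in> {\<beta>. mi_size \<beta> \<le> Suc d} - ?up ` {\<mu>. mi_size \<mu> \<le> d}"
     have "\<not> 0 < \<beta> i"
     proof
      assume p: "0 < \<beta> i"
      let ?a = "\<beta>(i := \<beta> i - 1)"
      have e: "\<beta> = ?up ?a" using p by auto
      have "mi_size \<beta> = Suc (mi_size ?a)" using mi_size_Suc[of ?a i] unfolding e[symmetric] .
      hence "?a \<in> {\<mu>. mi_size \<mu> \<le> d}" using b by simp
      from imageI[OF this, of ?up] have "\<beta> \<in> ?up ` {\<mu>. mi_size \<mu> \<le> d}" unfolding e[symmetric] .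
      thus False using b by blast
     qed
     thus "c' \<beta> * mi_pow x \<beta> = 0" by (simp add: c'_def)
    qed
   qed (rule finite_mi_le)
   finally show ?thesis .
  qed
  thus ?case unfolding poly_on_def by blast
 next
  case (polyf_Suc d f)
  then obtain c where c: "\<And>x. f x = (\<Sum>\<mu> | mi_size \<mu> \<le> d. c \<mu> * mi_pow x \<mu>)" unfolding poly_on_def by blast
  have "f x = (\<Sum>\<mu> | mi_size \<mu> \<le> Suc d. (if mi_size \<mu> \<le> d then c \<mu> else 0) * mi_pow x \<mu>)" for x
   unfolding c by (rule sum.mono_neutral_cong_left) (auto simp: finite_mi_le)
  thus ?case unfolding poly_on_def by (intro exI[of _ "\<lambda>\<mu>. if mi_size \<mu> \<le> d then c \<mu> else 0"]) simp
 qed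
next
 assume "poly_on d UNIV f"
 then obtain c where c: "f = (\<lambda>x. \<Sum>\<mu> | mi_size \<mu> \<le> d. c \<mu> * mi_pow x \<mu>)" unfolding poly_on_def by blast
 show "polyf d f" unfolding c by (intro polyf_sum polyf_cmult) (auto intro: polyf_mono[OF polyf_mi_pow])
qed

lemma poly_on_extend:
 assumes "poly_on d S f"
 obtains g where "polyf d g" "\<And>x. x \<in> S \<Longrightarrow> f x = g x"
proof -
 obtain c where c: "\<And>x. x \<in> S \<Longrightarrow> f x = (\<Sum>\<mu> | mi_size \<mu> \<le> d. c \<mu> * mi_pow x \<mu>)"
  using assms unfolding poly_on_def by blast
 have "polyf d (\<lambda>x. \<Sum>\<mu> | mi_size \<mu> \<le> d. c \<mu> * mi_pow x \<mu>)" unfolding polyf_iff poly_on_def by blast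
 thus ?thesis using that c by blast
qed

lemma poly_on_cong: "polyf d g \<Longrightarrow> (\<And>x. x \<in> S \<Longrightarrow> f x = g x) \<Longrightarrow> poly_on d S f" unfolding polyf_iff poly_on_def by auto

lemma polyf_smooth: "polyf d f \<Longrightarrow> smooth f"
 by (induction rule: polyf.induct) (auto intro: smooth_const smooth_add smooth_mult smooth_component)

text \<open>At a lattice point with indices j the factor for a is the binomial coefficient of j a
  over k a, hence zero when j a < k a.\<close>

definition phi :: "(real^'n::finite) set \<Rightarrow> nat \<Rightarrow> (real^'n \<Rightarrow> nat) \<Rightarrow> real^'n \<Rightarrow> real" where
 "phi K m k x = (\<Prod>a\<in>verts K. (real m * bary K a x) gchoose k a)"

lemma gchoose_Suc: "(t gchoose Suc k) = ((t - real k) / real (Suc k)) * (t gchoose k)" for t :: real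
 using gbinomial_mult_1[of t k] by (simp add: field_simps)

lemma polyf_gchoose:
 assumes f: "polyf d f" shows "polyf (d + k) (\<lambda>x. (c + g \<bullet> x gchoose k) * f x)"
proof (induction k)
 case (Suc k)
 have "(\<lambda>x. (c + g \<bullet> x gchoose Suc k) * f x) =
   (\<lambda>x. ((c - real k) / real (Suc k) + ((1 / real (Suc k)) *\<^sub>R g) \<bullet> x) * ((c + g \<bullet> x gchoose k) * f x))"
 proof
  fix x
  have "(c + g \<bullet> x - real k) / real (Suc k) = (c - real k) / real (Suc k) + ((1 / real (Suc k)) *\<^sub>R g) \<bullet> x"
   by (simp add: add_divide_distrib diff_divide_distrib)
  thus "(c + g \<bullet> x gchoose Suc k) * f x = ((c - real k) / real (Suc k) + ((1 / real (Suc k)) *\<^sub>R g) \<bullet> x) * ((c + g \<bullet> x gchoose k) * f x)"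
   unfolding gchoose_Suc by (simp only: mult.assoc)
 qed
 thus ?case
  using polyf_affine_mult[OF Suc, of "(c - real k) / real (Suc k)" "(1 / real (Suc k)) *\<^sub>R g"] by (simp only: add_Suc_right)
qed (simp add: f)

lemma mbary_affine: "real m * bary K a x = real m * fst (bary_data K a) + (real m *\<^sub>R snd (bary_data K a)) \<bullet> x"
 by (simp add: bary_def distrib_left)

lemma polyf_phi: assumes "finite (verts K)" shows "polyf (\<Sum>a\<in>verts K. k a) (phi K m k)"
proof -
 have "polyf (\<Sum>a\<in>A. k a) (\<lambda>x. \<Prod>a\<in>A. (real m * bary K a x) gchoose k a)" if "finite A" for A using that
 proof induction
  case (insert a A)
  from polyf_gchoose[OF insert(3), of "k a" "real m * fst (bary_data K a)" "real m *\<^sub>R snd (bary_data K a)"]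
  have "polyf (sum k A + k a) (\<lambda>x. (real m * bary K a x gchoose k a) * (\<Prod>a\<in>A. (real m * bary K a x) gchoose k a))"
   unfolding mbary_affine[symmetric] .
  thus ?case using insert(1,2) by (simp add: add.commute)
 qed (simp add: polyf_const)
 thus ?thesis using assms unfolding phi_def[abs_def] by blast
qed

text \<open>The linear span of the products with total index exactly d, while the scaling m of the
  coordinates stays fixed; steps from d < m to d + 1 then climb to the full degree.\<close>

inductive phispan :: "(real^'n::finite) set \<Rightarrow> nat \<Rightarrow> nat \<Rightarrow> (real^'n \<Rightarrow> real) \<Rightarrow> bool" for K m d where
 phispan_zero: "phispan K m d (\<lambda>x. 0)"
| phispan_step: "phispan K m d f \<Longrightarrow> (\<Sum>a\<in>verts K. k a) = d \<Longrightarrow> phispan K m d (\<lambda>x. f x + c * phi K m k x)"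

lemma phispan_cmult: "phispan K m d f \<Longrightarrow> phispan K m d (\<lambda>x. e * f x)"
proof (induction rule: phispan.induct)
 case (phispan_step f k c)
 from phispan.phispan_step[OF phispan_step(3,2), of "e * c"] show ?case by (simp add: algebra_simps)
qed (simp add: phispan_zero)

lemma phispan_add: "phispan K m d f \<Longrightarrow> phispan K m d g \<Longrightarrow> phispan K m d (\<lambda>x. f x + g x)"
proof (induction rule: phispan.induct)
 case (phispan_step f k c)
 from phispan.phispan_step[OF phispan_step(3)[OF phispan_step(4)] phispan_step(2), of c]
 show ?case by (simp add: algebra_simps)
qed simp

lemma phispan_sum: "(\<And>a. a \<in> A \<Longrightarrow> phispan K m d (f a)) \<Longrightarrow> phispan K m d (\<lambda>x. \<Sum>a\<in>A. f a x)"
 by (induction A rule: infinite_finite_induct) (auto intro: phispan_zero phispan_add)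

lemma phispan_phi: "(\<Sum>a\<in>verts K. k a) = d \<Longrightarrow> phispan K m d (phi K m k)"
 using phispan_step[OF phispan_zero, of k K d m 1] by simp

section \<open>Interpolation at the lattice nodes of one simplex\<close>

context
 fixes K :: "(real^'n::finite) set" and m :: nat
 assumes K: "int CARD('n) simplex K"
begin

text \<open>The identity t C(t,k) = k C(t,k) + (k + 1) C(t,k + 1) for the factor of a, the other
  factors being unchanged.\<close>

lemma mbary_phi:
 assumes a: "a \<in> verts K"
 shows "real m * bary K a x * phi K m k x = real (k a) * phi K m k x + real (Suc (k a)) * phi K m (k(a := Suc (k a))) x"
proof -
 have fin: "finite (verts K)" using full_simplex_verts(3)[OF K] .
 let ?t = "real m * bary K a x" and ?r = "\<Prod>b\<in>verts K - {a}. (real m * bary K b x) gchoose k b"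
 have e: "phi K m j x = (?t gchoose j a) * (\<Prod>b\<in>verts K - {a}. (real m * bary K b x) gchoose j b)" for j
  unfolding phi_def by (rule prod.remove[OF fin a])
 have r: "(\<Prod>b\<in>verts K - {a}. (real m * bary K b x) gchoose (k(a := Suc (k a))) b) = ?r" by (rule prod.cong) auto
 show ?thesis unfolding e[of k] e[of "k(a := Suc (k a))"] r
  using arg_cong[OF gbinomial_mult_1[of ?t "k a"], of "\<lambda>z. z * ?r"] by (simp add: algebra_simps)
qed

lemma sum_update: "finite A \<Longrightarrow> a \<in> A \<Longrightarrow> (\<Sum>b\<in>A. (k(a := Suc (k a))) b) = Suc (\<Sum>b\<in>A. k b)"
 by (simp add: sum.remove[of A a])

text \<open>Summing \<open>mbary_phi\<close> over all vertices, where the coordinates add up to 1,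
  expresses (m - d) times the product through products of total index d + 1; the strict inequality d
  < m allows division.\<close>

lemma phi_raise:
 assumes k: "(\<Sum>a\<in>verts K. k a) = d" and d: "d < m"
 shows "phispan K m (Suc d) (phi K m k)"
proof -
 have fin: "finite (verts K)" using full_simplex_verts(3)[OF K] .
 have "(real m - real d) * phi K m k x = (\<Sum>a\<in>verts K. real (Suc (k a)) * phi K m (k(a := Suc (k a))) x)" for x
 proof -
  have "(\<Sum>a\<in>verts K. real m * bary K a x * phi K m k x) = real m * phi K m k x"
   using bary_repr(1)[OF K, of x] by (simp flip: sum_distrib_left sum_distrib_right)
  moreover have "(\<Sum>a\<in>verts K. real m * bary K a x * phi K m k x) =
   (\<Sum>a\<in>verts K. real (k a) * phi K m k x) + (\<Sum>a\<in>verts K. real (Suc (k a)) * phi K m (k(a := Suc (k a))) x)"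
   by (subst sum.distrib[symmetric], rule sum.cong[OF refl], rule mbary_phi)
  moreover have "(\<Sum>a\<in>verts K. real (k a) * phi K m k x) = real d * phi K m k x"
   using k by (simp flip: sum_distrib_right of_nat_sum)
  ultimately show ?thesis by (simp add: left_diff_distrib)
 qed
 hence "phi K m k = (\<lambda>x. (1 / (real m - real d)) * (\<Sum>a\<in>verts K. real (Suc (k a)) * phi K m (k(a := Suc (k a))) x))"
  using d by (auto simp: fun_eq_iff field_simps)
 moreover have "phispan K m (Suc d) (\<lambda>x. (1 / (real m - real d)) * (\<Sum>a\<in>verts K. real (Suc (k a)) * phi K m (k(a := Suc (k a))) x))"
  using k sum_update[OF fin] by (intro phispan_cmult phispan_sum phispan_phi) auto
 ultimately show ?thesis by simp
qed

lemma phispan_raise: "phispan K m d f \<Longrightarrow> d < m \<Longrightarrow> phispan K m (Suc d) f"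
proof (induction rule: phispan.induct)
 case (phispan_step f k c)
 show ?case by (intro phispan_add phispan_cmult phispan_step(3) phi_raise phispan_step(2,4))
qed (simp add: phispan_zero)

lemma phispan_bary:
 assumes a: "a \<in> verts K"
 shows "phispan K m d f \<Longrightarrow> d < m \<Longrightarrow> phispan K m (Suc d) (\<lambda>x. bary K a x * f x)"
proof (induction rule: phispan.induct)
 case (phispan_step f k c)
 have fin: "finite (verts K)" using full_simplex_verts(3)[OF K] .
 have "phispan K m (Suc d) (\<lambda>x. (c / real m) * (real (k a) * phi K m k x + real (Suc (k a)) * phi K m (k(a := Suc (k a))) x))"
  using phispan_step sum_update[OF fin a, of k] by (intro phispan_cmult phispan_add phi_raise phispan_phi) auto
 hence "phispan K m (Suc d) (\<lambda>x. c * (bary K a x * phi K m k x))"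
  unfolding mbary_phi[OF a, symmetric] using phispan_step(4) by (simp add: mult.assoc)
 from phispan_add[OF phispan_step(3)[OF phispan_step(4)] this]
 show ?case by (simp add: algebra_simps)
qed (simp add: phispan_zero)

text \<open>A coordinate function is the combination of the barycentric coordinates with the
  coordinates of the vertices as coefficients, so multiplying by it raises the degree of the span by
  one; constants are raised from degree 0.\<close>

lemma phispan_polyf: "polyf d f \<Longrightarrow> d \<le> m \<Longrightarrow> phispan K m d f"
proof (induction rule: polyf.induct)
 case (polyf_const d c)
 have "phispan K m d (\<lambda>x. 1)" if "d \<le> m" for d using that
 proof (induction d)
  case 0
  have "phispan K m 0 (phi K m (\<lambda>_. 0))" by (rule phispan_phi) simp
  thus ?case by (simp add: phi_def[abs_def])
 next
  case (Suc d) thus ?case by (intro phispan_raise) auto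
 qed
 from phispan_cmult[OF this[OF polyf_const], of c] show ?case by simp
next
 case (polyf_mult d f i)
 have "(\<lambda>x. x $ i * f x) = (\<lambda>x. \<Sum>a\<in>verts K. a $ i * (bary K a x * f x))"
 proof
  fix x
  have "x $ i = (\<Sum>a\<in>verts K. bary K a x *\<^sub>R a) $ i" using bary_repr(2)[OF K, of x] by simp
  also have "... = (\<Sum>a\<in>verts K. a $ i * bary K a x)" by (simp add: sum_component mult.commute)
  finally have "x $ i * f x = (\<Sum>a\<in>verts K. a $ i * bary K a x) * f x" by (rule arg_cong)
  thus "x $ i * f x = (\<Sum>a\<in>verts K. a $ i * (bary K a x * f x))" by (simp only: sum_distrib_right mult.assoc)
 qed
 thus ?case using polyf_mult by (simp only:) (intro phispan_sum phispan_cmult phispan_bary; simp)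
qed (auto intro: phispan_add phispan_raise)

definition node_index :: "real^'n \<Rightarrow> real^'n \<Rightarrow> nat" where
 "node_index z a = nat \<lfloor>real m * bary K a z\<rfloor>"

definition node_of :: "(real^'n \<Rightarrow> nat) \<Rightarrow> real^'n" where
 "node_of j = (\<Sum>a\<in>verts K. (real (j a) / real m) *\<^sub>R a)"

lemma lagrange_nodes_eq: "lagrange_nodes m K = node_of ` {j. (\<Sum>a\<in>verts K. j a) = m}"
 unfolding lagrange_nodes_def node_of_def verts_def by auto

lemma bary_node:
 assumes m: "0 < m" and j: "(\<Sum>a\<in>verts K. j a) = m" and a: "a \<in> verts K"
 shows "real m * bary K a (node_of j) = real (j a)"
proof -
 have "(\<Sum>a\<in>verts K. real (j a) / real m) = 1" using m j by (simp flip: sum_divide_distrib of_nat_sum)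
 from bary_unique[OF K this refl a] show ?thesis using m by (simp add: node_of_def)
qed

text \<open>If j and k differ but have the same total, some j a lies below k a and its factor
  vanishes; if they agree all factors are 1.\<close>

lemma phi_node:
 assumes m: "0 < m" and j: "(\<Sum>a\<in>verts K. j a) = m" and k: "(\<Sum>a\<in>verts K. k a) = m"
 shows "phi K m k (node_of j) = (if \<forall>a\<in>verts K. j a = k a then 1 else 0)"
proof -
 have fin: "finite (verts K)" using full_simplex_verts(3)[OF K] .
 have e: "phi K m k (node_of j) = (\<Prod>a\<in>verts K. real (j a choose k a))"
  unfolding phi_def by (rule prod.cong) (auto simp: bary_node[OF m j] binomial_gbinomial)
 show ?thesis
 proof (cases "\<forall>a\<in>verts K. j a = k a")
  case True thus ?thesis unfolding e by simp
 next
  case False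
  have "\<exists>a\<in>verts K. j a < k a"
  proof (rule ccontr)
   assume "\<not> ?thesis"
   hence le: "\<And>a. a \<in> verts K \<Longrightarrow> k a \<le> j a" by (auto simp: not_less)
   from False obtain a where a: "a \<in> verts K" "k a < j a" using le by (force simp: le_less)
   have "(\<Sum>a\<in>verts K. k a) < (\<Sum>a\<in>verts K. j a)" by (rule sum_strict_mono_ex1[OF fin]) (use le a in auto)
   thus False using j k by simp
  qed
  thus ?thesis unfolding e using False fin by (auto simp: binomial_eq_0 intro!: prod_zero)
 qed
qed

lemma node_index_node_of:
 "0 < m \<Longrightarrow> (\<Sum>a\<in>verts K. j a) = m \<Longrightarrow> a \<in> verts K \<Longrightarrow> node_index (node_of j) a = j a"
 unfolding node_index_def by (simp add: bary_node)

lemma node_index_sum: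
 assumes m: "0 < m" and z: "z \<in> lagrange_nodes m K"
 shows "(\<Sum>a\<in>verts K. node_index z a) = m" "node_of (node_index z) = z"
proof -
 obtain j where j: "z = node_of j" "(\<Sum>a\<in>verts K. j a) = m" using z unfolding lagrange_nodes_eq by auto
 have e: "node_index z a = j a" if "a \<in> verts K" for a unfolding j(1) by (rule node_index_node_of[OF m j(2) that])
 thus "(\<Sum>a\<in>verts K. node_index z a) = m" using j(2) by simp
 show "node_of (node_index z) = z" unfolding j(1) node_of_def using e by (simp add: j(1) node_of_def)
qed

lemma phi_at_node:
 assumes m: "0 < m" and z: "z \<in> lagrange_nodes m K" and y: "y \<in> lagrange_nodes m K"
 shows "phi K m (node_index z) y = (if y = z then 1 else 0)"
proof -
 have "phi K m (node_index z) (node_of (node_index y)) = (if \<forall>a\<in>verts K. node_index y a = node_index z a then 1 else 0)"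
  by (rule phi_node[OF m node_index_sum(1)[OF m y] node_index_sum(1)[OF m z]])
 moreover have "(\<forall>a\<in>verts K. node_index y a = node_index z a) \<longleftrightarrow> y = z"
 proof
  assume "\<forall>a\<in>verts K. node_index y a = node_index z a"
  hence "node_of (node_index y) = node_of (node_index z)" by (simp add: node_of_def)
  thus "y = z" using node_index_sum(2)[OF m] y z by simp
 qed simp
 ultimately show ?thesis using node_index_sum(2)[OF m y] by simp
qed

lemma finite_nodes: "0 < m \<Longrightarrow> finite (lagrange_nodes m K)"
proof -
 have fin: "finite (verts K)" using full_simplex_verts(3)[OF K] .
 have "lagrange_nodes m K \<subseteq> node_of ` PiE (verts K) (\<lambda>_. {..m})"
 proof
  fix z assume "z \<in> lagrange_nodes m K"
  then obtain j where j: "z = node_of j" "(\<Sum>a\<in>verts K. j a) = m" unfolding lagrange_nodes_eq by auto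
  have "z = node_of (restrict j (verts K))" unfolding j(1) node_of_def by (intro sum.cong) auto
  moreover have "j a \<le> m" if "a \<in> verts K" for a using member_le_sum[of a "verts K" j] that fin j(2) by simp
  hence "restrict j (verts K) \<in> PiE (verts K) (\<lambda>_. {..m})" by auto
  ultimately show "z \<in> node_of ` PiE (verts K) (\<lambda>_. {..m})" by blast
 qed
 thus ?thesis by (rule finite_subset) (intro finite_imageI finite_PiE fin, simp)
qed

text \<open>The products \<open>phi\<close> of total degree exactly \<open>m\<close> are the nodal basis functions (Silvester's
 formula), and they span the polynomials of degree at most \<open>m\<close>.\<close>

lemma lagrange_interpolation:
 assumes m: "0 < m" and f: "polyf m f"
 shows "f x = (\<Sum>z\<in>lagrange_nodes m K. f z * phi K m (node_index z) x)"
proof -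
 have "phispan K m m f" using phispan_polyf[OF f] by simp
 thus ?thesis
 proof (induction arbitrary: x rule: phispan.induct)
  case (phispan_step f k c)
  have "phi K m k x = (\<Sum>z\<in>lagrange_nodes m K. phi K m k z * phi K m (node_index z) x)"
  proof -
   let ?z = "node_of k"
   have z: "?z \<in> lagrange_nodes m K" unfolding lagrange_nodes_eq using phispan_step(2) by blast
   have pk: "phi K m k = phi K m (node_index ?z)"
    unfolding phi_def[abs_def] using node_index_node_of[OF m phispan_step(2)] by simp
   have "(\<Sum>y\<in>lagrange_nodes m K. phi K m k y * phi K m (node_index y) x)
    = (\<Sum>y\<in>lagrange_nodes m K. if y = ?z then phi K m (node_index y) x else 0)"
    unfolding pk by (intro sum.cong refl) (simp add: phi_at_node[OF m z])
   also have "... = phi K m (node_index ?z) x" using z finite_nodes[OF m] by simp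
   finally show ?thesis unfolding pk[symmetric] by simp
  qed
  thus ?case using phispan_step(3)[of x] by (simp add: distrib_right sum.distrib sum_distrib_left mult.assoc)
 qed simp
qed

end

text \<open>One number B for the size and one inverse length L per derivative. Under products the B
  multiply and the L add, so a bound that scales correctly with the diameter is assembled from
  affine factors.\<close>

definition dbound :: "(real^'n::finite) set \<Rightarrow> real \<Rightarrow> real \<Rightarrow> (real^'n \<Rightarrow> real) \<Rightarrow> bool" where
 "dbound S B L f \<longleftrightarrow> smooth f \<and> (\<forall>js. \<forall>x\<in>S. \<bar>pderiv_list js f x\<bar> \<le> B * L ^ length js)"

lemma dbound_pderiv: "dbound S B L f \<Longrightarrow> dbound S (B * L) L (pderiv_dir i f)" unfolding dbound_def
proof (intro conjI allI ballI)
 fix js x assume a: "smooth f \<and> (\<forall>js. \<forall>x\<in>S. \<bar>pderiv_list js f x\<bar> \<le> B * L ^ length js)" and x: "x \<in> S"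
 have "\<bar>pderiv_list (js @ [i]) f x\<bar> \<le> B * L ^ length (js @ [i])" using a x by blast
 thus "\<bar>pderiv_list js (pderiv_dir i f) x\<bar> \<le> B * L * L ^ length js" by (simp add: pderiv_list_append mult_ac)
qed (simp add: smooth_pderiv_dir)

lemma dbound_mult:
 assumes "dbound S B1 L1 f" "dbound S B2 L2 g" "0 \<le> B1" "0 \<le> B2" "0 \<le> L1" "0 \<le> L2"
 shows "dbound S (B1 * B2) (L1 + L2) (\<lambda>x. f x * g x)"
proof -
 have "\<bar>pderiv_list js (\<lambda>x. f x * g x) x\<bar> \<le> B1 * B2 * (L1 + L2) ^ length js" if "x \<in> S" for js x using assms(1-4)
 proof (induction "length js" arbitrary: js f g B1 B2)
  case 0
  have "\<bar>pderiv_list [] f x\<bar> \<le> B1 * L1 ^ length ([] :: 'a list)" "\<bar>pderiv_list [] g x\<bar> \<le> B2 * L2 ^ length ([] :: 'a list)"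
   using 0(2,3) that unfolding dbound_def by blast+
  thus ?case using 0 by (auto simp: abs_mult intro: mult_mono)
 next
  case (Suc l)
  obtain ks i where js: "js = ks @ [i]" using Suc(2) by (cases js rule: rev_cases) auto
  have l: "l = length ks" using Suc(2) js by simp
  have sm: "smooth f" "smooth g" using Suc(3,4) by (auto simp: dbound_def)
  have e: "pderiv_dir i (\<lambda>x. f x * g x) = (\<lambda>x. f x * pderiv_dir i g x + pderiv_dir i f x * g x)"
   using pderiv_dir_mult smooth_differentiable sm by blast
  have e2: "pderiv_list js (\<lambda>x. f x * g x) x = pderiv_list ks (\<lambda>x. f x * pderiv_dir i g x) x + pderiv_list ks (\<lambda>x. pderiv_dir i f x * g x) x"
   unfolding js pderiv_list_append pderiv_list.simps e
   by (subst pderiv_list_add) (auto intro: smooth_mult smooth_pderiv_dir sm)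
  have 1: "\<bar>pderiv_list ks (\<lambda>x. f x * pderiv_dir i g x) x\<bar> \<le> B1 * (B2 * L2) * (L1 + L2) ^ length ks"
   by (rule Suc(1)[OF l Suc(3) dbound_pderiv[OF Suc(4)]]) (use Suc(5,6) assms(6) in auto)
  have 2: "\<bar>pderiv_list ks (\<lambda>x. pderiv_dir i f x * g x) x\<bar> \<le> (B1 * L1) * B2 * (L1 + L2) ^ length ks"
   by (rule Suc(1)[OF l dbound_pderiv[OF Suc(3)] Suc(4)]) (use Suc(5,6) assms(5) in auto)
  have "B1 * (B2 * L2) * (L1 + L2) ^ length ks + (B1 * L1) * B2 * (L1 + L2) ^ length ks = B1 * B2 * (L1 + L2) ^ length js"
   unfolding js by (simp add: algebra_simps)
  thus ?case using 1 2 unfolding e2 by linarith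
 qed
 moreover have "smooth (\<lambda>x. f x * g x)" using assms(1,2) by (auto simp: dbound_def intro: smooth_mult)
 ultimately show ?thesis by (simp add: dbound_def)
qed

lemma dbound_affine:
 assumes "\<And>x. x \<in> S \<Longrightarrow> \<bar>c + g \<bullet> x\<bar> \<le> B" "norm g \<le> B * L" "0 \<le> B" "0 \<le> L"
 shows "dbound S B L (\<lambda>x. c + g \<bullet> x)" unfolding dbound_def
proof (intro conjI allI ballI)
 fix js :: "'a list" and x assume x: "x \<in> S"
 show "\<bar>pderiv_list js (\<lambda>x. c + g \<bullet> x) x\<bar> \<le> B * L ^ length js"
 proof (cases js rule: rev_cases)
  case Nil thus ?thesis using assms(1)[OF x] by simp
 next
  case (snoc ks i)
  have p: "pderiv_list js (\<lambda>x. c + g \<bullet> x) = pderiv_list ks (\<lambda>x. g $ i)"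
   unfolding snoc pderiv_list_append by (simp add: pderiv_dir_linear)
  show ?thesis
  proof (cases ks rule: rev_cases)
   case Nil
   have "\<bar>g $ i\<bar> \<le> norm g" by (rule component_le_norm_cart)
   thus ?thesis unfolding p using assms(2) snoc Nil by simp
  next
   case (snoc ls j)
   have "pderiv_list ks (\<lambda>x. g $ i) = (\<lambda>x. 0)"
    unfolding snoc pderiv_list_append by (simp add: pderiv_dir_const pderiv_list_zero)
   thus ?thesis unfolding p using assms(3,4) by simp
  qed
 qed
qed (rule smooth_linear)

text \<open>The product consists of m affine factors (m \<lambda> - j) / (j + 1), with \<lambda> a
  barycentric coordinate. Each is at most 2 m on the simplex, with gradient controlled by
  \<open>grad_bound\<close>; the m inverse lengths add up.\<close>

lemma (in fat_mesh) dbound_phi: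
 assumes K: "K \<in> M" and m: "0 < m" and k: "(\<Sum>a\<in>verts K. k a) = m"
 shows "dbound K ((2 * real m) ^ m) (real m / (2 * \<beta> * diameter K)) (phi K m k)"
proof -
 let ?L = "1 / (2 * \<beta> * diameter K)"
 have Lp: "0 < 2 * \<beta> * diameter K" using beta_pos diameter_pos[OF K] by simp
 have L: "0 \<le> ?L" using Lp by simp
 have fin: "finite (verts K)" by (rule finite_verts[OF K])
 have one: "dbound K 1 0 (\<lambda>x :: real^'n. 1)" using dbound_affine[of K 1 0 1 0] by simp
 have ka: "k a \<le> m" if "a \<in> verts K" for a using member_le_sum[of a "verts K" k] that fin k by simp
 have fac: "dbound K ((2 * real m) ^ j) (real j * ?L) (\<lambda>x. (real m * bary K a x) gchoose j)" if a: "a \<in> verts K" and j: "j \<le> m" for a j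
  using j
 proof (induction j)
  case 0 thus ?case using one by simp
 next
  case (Suc j)
  let ?d = "real (Suc j)" and ?g = "snd (bary_data K a)"
  have lin: "(real m * bary K a x - real j) / ?d = (real m * fst (bary_data K a) - real j) / ?d + ((real m / ?d) *\<^sub>R ?g) \<bullet> x" for x
   by (simp add: mbary_affine diff_divide_distrib add_divide_distrib)
  have d: "dbound K (2 * real m) ?L (\<lambda>x. (real m * bary K a x - real j) / ?d)" unfolding lin
  proof (rule dbound_affine)
   fix x assume x: "x \<in> K"
   have b: "0 \<le> bary K a x" "bary K a x \<le> 1"
    using bary_mem[OF simp_M[OF K]] x a bary_le_1[OF simp_M[OF K] x a] by auto
   have "0 \<le> real m * bary K a x" "real m * bary K a x \<le> real m" using b m by (auto simp: mult_left_le)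
   moreover have "real j \<le> real m" using Suc.prems by simp
   ultimately have "\<bar>real m * bary K a x - real j\<bar> \<le> 2 * real m" unfolding abs_le_iff by linarith
   hence "\<bar>real m * bary K a x - real j\<bar> / ?d \<le> 2 * real m / 1" by (intro frac_le) auto
   thus "\<bar>(real m * fst (bary_data K a) - real j) / ?d + ((real m / ?d) *\<^sub>R ?g) \<bullet> x\<bar> \<le> 2 * real m"
    unfolding lin[symmetric] by (simp add: abs_divide)
   next
   have "norm ?g \<le> ?L" using grad_bound[OF K a] Lp by (simp add: field_simps)
   moreover have "real m / ?d \<le> 2 * real m / 1" by (intro frac_le) auto
   ultimately have "(real m / ?d) * norm ?g \<le> (2 * real m) * ?L" by (intro mult_mono) auto
   thus "norm ((real m / ?d) *\<^sub>R ?g) \<le> 2 * real m * ?L" by simp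
  qed (use L in auto)
  have e: "(\<lambda>x. (real m * bary K a x) gchoose Suc j) = (\<lambda>x. ((real m * bary K a x - real j) / ?d) * ((real m * bary K a x) gchoose j))"
   by (simp add: gchoose_Suc fun_eq_iff)
  have "dbound K (2 * real m * (2 * real m) ^ j) (?L + real j * ?L) (\<lambda>x. ((real m * bary K a x - real j) / ?d) * ((real m * bary K a x) gchoose j))"
   by (rule dbound_mult[OF d Suc.IH]) (use Suc.prems L in auto)
  thus ?case unfolding e by (simp add: distrib_right add_divide_distrib)
 qed
 have "dbound K ((2 * real m) ^ (\<Sum>a\<in>A. k a)) (real (\<Sum>a\<in>A. k a) * ?L) (\<lambda>x. \<Prod>a\<in>A. (real m * bary K a x) gchoose k a)"
  if "finite A" "A \<subseteq> verts K" for A using that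
 proof induction
  case empty thus ?case using one by simp
 next
  case (insert a A)
  have "dbound K ((2 * real m) ^ k a * (2 * real m) ^ (\<Sum>a\<in>A. k a)) (real (k a) * ?L + real (\<Sum>a\<in>A. k a) * ?L)
    (\<lambda>x. ((real m * bary K a x) gchoose k a) * (\<Prod>a\<in>A. (real m * bary K a x) gchoose k a))"
  proof (rule dbound_mult[OF fac insert.IH])
   show "0 \<le> real (k a) * ?L" "0 \<le> real (\<Sum>a\<in>A. k a) * ?L" by (intro mult_nonneg_nonneg L of_nat_0_le_iff)+
  qed (use insert.prems ka in auto)
  thus ?case using insert.hyps by (simp add: power_add distrib_right add_divide_distrib)
 qed
 from this[OF fin subset_refl] show ?thesis unfolding k phi_def[abs_def] by simp
qed

subsection \<open>The nodal basis of the mesh\<close>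

lemma zero_gchoose: "0 < k \<Longrightarrow> (0 :: real) gchoose k = 0" by (cases k) auto

context fat_mesh
begin

text \<open>The barycentric coordinate of a as one function on the whole mesh;
  \<open>bary_agree\<close> makes the choice of the element immaterial.\<close>

definition hat :: "real^'n \<Rightarrow> real^'n \<Rightarrow> real" where
 "hat a x = (if \<exists>K\<in>M. x \<in> K \<and> a \<in> verts K then bary (SOME K. K \<in> M \<and> x \<in> K \<and> a \<in> verts K) a x else 0)"

lemma hat_eq:
 assumes "K \<in> M" "x \<in> K" shows "hat a x = (if a \<in> verts K then bary K a x else 0)"
proof (cases "\<exists>K\<in>M. x \<in> K \<and> a \<in> verts K")
 case True
 let ?K = "SOME K. K \<in> M \<and> x \<in> K \<and> a \<in> verts K"
 have "?K \<in> M \<and> x \<in> ?K \<and> a \<in> verts ?K" by (rule someI_ex) (use True in blast)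
 thus ?thesis using bary_agree[of ?K K x a] assms True unfolding hat_def by simp
next
 case False
 thus ?thesis using assms unfolding hat_def by auto
qed

text \<open>The local product taken over all vertices of the mesh, with indices read off at z. A
  vertex whose coordinate is zero at z has index 0 and contributes the factor 1.\<close>

definition gphi :: "nat \<Rightarrow> real^'n \<Rightarrow> real^'n \<Rightarrow> real" where
 "gphi m z x = (\<Prod>a\<in>(\<Union>K\<in>M. verts K). (real m * hat a x) gchoose nat \<lfloor>real m * hat a z\<rfloor>)"

lemma finite_all_verts: "finite (\<Union>K\<in>M. verts K)" using finite_M finite_verts by blast

lemma gphi_on:
 assumes K: "K \<in> M" and x: "x \<in> K" and z: "z \<in> K"
 shows "gphi m z x = phi K m (node_index K m z) x"
proof -
 have "gphi m z x = (\<Prod>a\<in>verts K. (real m * hat a x) gchoose nat \<lfloor>real m * hat a z\<rfloor>)" unfolding gphi_def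
  by (rule prod.mono_neutral_right[OF finite_all_verts]) (use K hat_eq[OF K z] in auto)
 also have "... = phi K m (node_index K m z) x"
  unfolding phi_def node_index_def[OF simp_M[OF K]] by (rule prod.cong) (auto simp: hat_eq[OF K x] hat_eq[OF K z])
 finally show ?thesis .
qed

lemma node_bary:
 assumes K: "K \<in> M" and m: "0 < m" and z: "z \<in> lagrange_nodes m K" and a: "a \<in> verts K"
 shows "real m * bary K a z = real (node_index K m z a)"
 using bary_node[OF simp_M[OF K] m node_index_sum(1)[OF simp_M[OF K] m z] a] node_index_sum(2)[OF simp_M[OF K] m z] by simp

lemma nodes_subset:
 assumes K: "K \<in> M" and m: "0 < m" and z: "z \<in> lagrange_nodes m K" shows "z \<in> K"
proof -
 have "0 \<le> bary K a z" if "a \<in> verts K" for a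
 proof -
  have "0 \<le> real m * bary K a z" unfolding node_bary[OF K m z that] by simp
  thus ?thesis using m by (simp add: zero_le_mult_iff)
 qed
 thus ?thesis using bary_mem[OF simp_M[OF K]] by blast
qed

text \<open>Coordinates agree on the common face, and vertices outside that face have coordinate 0;
  hence all coordinates of z in K are multiples of 1 / m.\<close>

lemma node_restrict:
 assumes K: "K \<in> M" "K' \<in> M" and m: "0 < m" and z: "z \<in> lagrange_nodes m K'" "z \<in> K"
 shows "z \<in> lagrange_nodes m K"
proof -
 let ?j = "node_index K m z"
 have j: "real (?j a) = real m * bary K a z" if a: "a \<in> verts K" for a
 proof -
  have "bary K a z = (if a \<in> verts K' then bary K' a z else 0)"
   by (rule bary_agree[OF K z(2) nodes_subset[OF K(2) m z(1)] a])
  then obtain i :: nat where "real m * bary K a z = real i"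
   using node_bary[OF K(2) m z(1), of a] by (cases "a \<in> verts K'") auto
  thus ?thesis by (simp add: node_index_def[OF simp_M[OF K(1)]])
 qed
 have "real (\<Sum>a\<in>verts K. ?j a) = real m * (\<Sum>a\<in>verts K. bary K a z)" by (simp add: j sum_distrib_left)
 hence "real (\<Sum>a\<in>verts K. ?j a) = real m" unfolding bary_repr(1)[OF simp_M[OF K(1)]] by simp
 hence s: "(\<Sum>a\<in>verts K. ?j a) = m" by (simp only: of_nat_eq_iff)
 have "node_of K m ?j = (\<Sum>a\<in>verts K. bary K a z *\<^sub>R a)"
  unfolding node_of_def[OF simp_M[OF K(1)]] using m by (intro sum.cong) (auto simp: j)
 hence e: "node_of K m ?j = z" using bary_repr(2)[OF simp_M[OF K(1)]] by simp
 have "node_of K m ?j \<in> node_of K m ` {j. (\<Sum>a\<in>verts K. j a) = m}" by (rule imageI) (simp only: mem_Collect_eq s)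
 thus ?thesis unfolding lagrange_nodes_eq[OF simp_M[OF K(1)]] e .
qed

text \<open>Some vertex of K' outside K has a positive coordinate at z, since otherwise z would lie
  in the common face. Its factor at x is the binomial coefficient of 0 over a positive
  number.\<close>

lemma gphi_off:
 assumes K: "K \<in> M" "K' \<in> M" and m: "0 < m" and x: "x \<in> K" and z: "z \<in> lagrange_nodes m K'" "z \<notin> K"
 shows "gphi m z x = 0"
proof -
 note zK = nodes_subset[OF K(2) m z(1)]
 have "\<exists>a\<in>verts K'. a \<notin> verts K \<and> 0 < bary K' a z"
 proof (rule ccontr)
  assume c: "\<not> ?thesis"
  have nn: "0 \<le> bary K' a z" if "a \<in> verts K'" for a using bary_mem[OF simp_M[OF K(2)]] zK that by blast
  hence zero: "bary K' a z = 0" if "a \<in> verts K' - verts K" for a using c that by force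
  have fin: "finite (verts K')" "finite (verts K' \<inter> verts K)" using finite_verts K by auto
  have "(\<Sum>a\<in>verts K' \<inter> verts K. bary K' a z) = (\<Sum>a\<in>verts K'. bary K' a z)"
   by (rule sum.mono_neutral_left) (use fin zero in auto)
  moreover have "(\<Sum>a\<in>verts K' \<inter> verts K. bary K' a z *\<^sub>R a) = (\<Sum>a\<in>verts K'. bary K' a z *\<^sub>R a)"
   by (rule sum.mono_neutral_left) (use fin zero in auto)
  ultimately have "z \<in> convex hull (verts K' \<inter> verts K)"
   unfolding convex_hull_finite[OF fin(2)] mem_Collect_eq using bary_repr[OF simp_M[OF K(2)], of z] nn
   by (intro exI[of _ "\<lambda>a. bary K' a z"]) auto
  thus False using inter_hull[OF K(2,1)] z(2) by blast
 qed
 then obtain a where a: "a \<in> verts K'" "a \<notin> verts K" "0 < bary K' a z" by blast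
 have "real (node_index K' m z a) = real m * bary K' a z" using node_bary[OF K(2) m z(1) a(1)] by simp
 moreover have "0 < real m * bary K' a z" using m a(3) by simp
 ultimately have p: "0 < node_index K' m z a" by (simp only: of_nat_0_less_iff[symmetric])
 have "(real m * hat a x) gchoose nat \<lfloor>real m * hat a z\<rfloor> = 0"
  using p a by (simp add: hat_eq[OF K(1) x] hat_eq[OF K(2) zK] node_index_def[OF simp_M[OF K(2)]] zero_gchoose)
 thus ?thesis unfolding gphi_def using finite_all_verts a(1) K(2) by (intro prod_zero) auto
qed

lemma gphi_outside:
 assumes K: "K \<in> M" and m: "0 < m" and x: "x \<notin> \<Union>M" and z: "z \<in> lagrange_nodes m K"
 shows "gphi m z x = 0"
proof -
 have h0: "hat a x = 0" for a using x unfolding hat_def by auto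
 note zK = nodes_subset[OF K m z]
 have "\<exists>a\<in>verts K. node_index K m z a \<noteq> 0"
  using node_index_sum(1)[OF simp_M[OF K] m z] m by (metis less_irrefl sum.neutral)
 then obtain a where a: "a \<in> verts K" "node_index K m z a \<noteq> 0" by blast
 have "(real m * hat a x) gchoose nat \<lfloor>real m * hat a z\<rfloor> = 0"
  using a by (simp add: h0 hat_eq[OF K zK] node_index_def[OF simp_M[OF K]] zero_gchoose)
 thus ?thesis unfolding gphi_def using finite_all_verts a(1) K by (intro prod_zero) auto
qed

lemma continuous_gchoose:
 fixes f :: "'a::topological_space \<Rightarrow> real"
 assumes "continuous_on S f" shows "continuous_on S (\<lambda>x. f x gchoose k)"
 unfolding gbinomial_prod_rev by (intro continuous_intros assms) auto

lemma continuous_gphi: "continuous_on (\<Union>M) (gphi m z)"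
proof -
 have "continuous_on (\<Union>K\<in>M. K) (hat a)" for a
 proof (rule continuous_on_closed_Union[OF finite_M closed_M])
  fix K assume K: "K \<in> M"
  have "continuous_on K (\<lambda>x. if a \<in> verts K then bary K a x else 0)"
   unfolding bary_def by (cases "a \<in> verts K") (auto intro!: continuous_intros)
  thus "continuous_on K (hat a)" by (rule continuous_on_eq) (simp add: hat_eq[OF K])
 qed
 hence "continuous_on (\<Union>M) (hat a)" for a by simp
 thus ?thesis unfolding gphi_def[abs_def] by (intro continuous_on_prod continuous_gchoose continuous_on_mult_left)
qed

lemma gphi_poly:
 assumes K: "K \<in> M" "K' \<in> M" and m: "0 < m" and z: "z \<in> lagrange_nodes m K'"
 shows "poly_on m K (gphi m z)"
proof (cases "z \<in> K")
 case True
 have "polyf m (phi K m (node_index K m z))" using polyf_phi[OF finite_verts[OF K(1)], of "node_index K m z" m]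
  unfolding node_index_sum(1)[OF simp_M[OF K(1)] m node_restrict[OF K m z True]] .
 thus ?thesis by (rule poly_on_cong) (rule gphi_on[OF K(1) _ True])
next
 case False
 show ?thesis by (rule poly_on_cong[OF polyf_const[of m 0]]) (use gphi_off[OF K m _ z False] in auto)
qed

lemma gphi_node:
 assumes K: "K \<in> M" "K' \<in> M" and m: "0 < m" and z: "z \<in> lagrange_nodes m K'" and y: "y \<in> lagrange_nodes m K"
 shows "gphi m z y = (if y = z then 1 else 0)"
proof (cases "z \<in> K")
 case True
 thus ?thesis unfolding gphi_on[OF K(1) nodes_subset[OF K(1) m y] True]
  by (intro phi_at_node[OF simp_M[OF K(1)] m node_restrict[OF K m z True] y])
next
 case False
 thus ?thesis using gphi_off[OF K m nodes_subset[OF K(1) m y] z False] nodes_subset[OF K(1) m y] by auto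
qed

text \<open>If the basis function of \<open>z\<close> does not vanish at \<open>x\<close>, then the open segment between them lies in
 the relative interior of one face, along which the mesh has the same tangent cones; so \<open>x\<close> is
 interior when \<open>z\<close> is.\<close>

lemma gphi_interior:
 assumes m: "0 < m" and z: "z \<in> interior (\<Union>M)" "z \<in> lagrange_nodes m K'" "K' \<in> M" and x: "x \<in> \<Union>M" and nz: "gphi m z x \<noteq> 0"
 shows "x \<in> interior (\<Union>M)"
proof -
 obtain Q where Q: "Q \<in> M" "x \<in> Q" using x by blast
 have zQ: "z \<in> Q" using gphi_off[OF Q(1) z(3) m Q(2) z(2)] nz by blast
 note zn = node_restrict[OF Q(1) z(3) m z(2) zQ]
 note sQ = simp_M[OF Q(1)]
 \<comment> \<open>The vertices of the smallest face of Q containing x. A nonvanishing product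
   forces z into the same face, since a vertex with zero coordinate at x must have index 0 at
   z.\<close>
 define S where "S = {a\<in>verts Q. 0 < bary Q a x}"
 have nnx: "0 \<le> bary Q a x" and nnz: "0 \<le> bary Q a z" if "a \<in> verts Q" for a
  using bary_mem[OF sQ] Q(2) zQ that by blast+
 have zS: "bary Q a z = 0" if a: "a \<in> verts Q" "a \<notin> S" for a
 proof (rule ccontr)
  assume "bary Q a z \<noteq> 0"
  hence "real m * bary Q a z \<noteq> 0" using m by simp
  hence "real (node_index Q m z a) \<noteq> 0" unfolding node_bary[OF Q(1) m zn a(1)] .
  moreover have "bary Q a x = 0" using a nnx by (force simp: S_def)
  ultimately have "phi Q m (node_index Q m z) x = 0" unfolding phi_def using a finite_verts[OF Q(1)]
   by (intro prod_zero bexI[of _ a]) (auto simp: zero_gchoose)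
  thus False using nz gphi_on[OF Q zQ] by simp
 qed
 have xS: "bary Q a x = 0" if "a \<in> verts Q" "a \<notin> S" for a using that nnx by (force simp: S_def)
 obtain e where e: "0 < e" "ball z e \<subseteq> interior (\<Union>M)" using z(1) open_contains_ball[of "interior (\<Union>M)"] by auto
 define t where "t = min 1 (e / (2 * (norm (x - z) + 1)))"
 have nv: "0 < norm (x - z) + 1" by (smt (verit) norm_ge_zero)
 have t: "0 < t" "t \<le> 1" using e nv by (auto simp: t_def)
 \<comment> \<open>A point between z and x near z: it is interior because z is, and its positive
   coordinates are exactly those in S.\<close>
 define y where "y = z + t *\<^sub>R (x - z)"
 have "t * norm (x - z) \<le> e / (2 * (norm (x - z) + 1)) * (norm (x - z) + 1)"
  by (intro mult_mono) (use e nv t in \<open>auto simp: t_def\<close>)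
 also have "... = e / 2" using nv by (simp add: field_simps)
 finally have "y \<in> ball z e" using e t by (simp add: y_def dist_norm)
 hence yi: "y \<in> interior (\<Union>M)" using e by blast
 have by': "bary Q a y = (1 - t) * bary Q a z + t * bary Q a x" for a
  unfolding bary_def y_def by (simp add: inner_add_right inner_diff_right algebra_simps)
 have yS: "0 < bary Q a y" if "a \<in> S" for a
 proof -
  have "0 \<le> (1 - t) * bary Q a z" "0 < t * bary Q a x" using that t nnz by (auto simp: S_def)
  thus ?thesis unfolding by' by linarith
 qed
 have yS0: "bary Q a y = 0" if "a \<in> verts Q" "a \<notin> S" for a unfolding by' using zS xS that by simp
 have yQ: "y \<in> Q" using bary_mem[OF sQ] yS yS0 less_imp_le by (metis order_refl)
 have finS: "finite S" unfolding S_def using finite_verts[OF Q(1)] by simp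
 obtain \<eta> where eps: "\<eta> > 0" "ball y \<eta> \<subseteq> \<Union>{K\<in>M. y \<in> K}" using star_nbhd[OF yi] by blast
 define c0 where "c0 = Min (insert 1 ((\<lambda>a. bary Q a x) ` S))"
 have c0: "0 < c0" "\<And>a. a \<in> S \<Longrightarrow> c0 \<le> bary Q a x" unfolding c0_def using finS by (auto simp: S_def)
 define dm where "dm = Min (diameter ` M)"
 have dm: "0 < dm" "\<And>K. K \<in> M \<Longrightarrow> dm \<le> diameter K"
 proof -
  have ne: "diameter ` M \<noteq> {}" "finite (diameter ` M)" using finite_M Q(1) by auto
  show "0 < dm" unfolding dm_def using diameter_pos Min_gr_iff[OF ne(2,1)] by blast
  show "dm \<le> diameter K" if "K \<in> M" for K unfolding dm_def using ne that by (intro Min_le) auto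
 qed
 \<comment> \<open>The first bound yields, for every short u, an element K containing y and y + u.
   In K the coordinates in S stay nonnegative at x + u by the second bound; the others vanish at x
   and y alike and have equal increments.\<close>
 define \<xi> where "\<xi> = min \<eta> (c0 * (2 * \<beta> * dm))"
 have dl: "0 < \<xi>" unfolding \<xi>_def using eps c0 dm beta_pos by simp
 have "ball x \<xi> \<subseteq> \<Union>M"
 proof
  fix q assume q: "q \<in> ball x \<xi>"
  define u where "u = q - x"
  have nu: "norm u < \<xi>" using q by (simp add: u_def dist_norm norm_minus_commute)
  have "y + u \<in> ball y \<eta>" using nu by (simp add: dist_norm \<xi>_def)
  then obtain K where K: "K \<in> M" "y \<in> K" "y + u \<in> K" using eps by blast
  note sK = simp_M[OF K(1)]
  have SK: "a \<in> verts K" if "a \<in> S" for a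
  proof (rule ccontr)
   assume "a \<notin> verts K"
   hence "bary Q a y = 0" using bary_agree[OF Q(1) K(1) yQ K(2), of a] that by (simp add: S_def)
   thus False using yS[OF that] by simp
  qed
  have SQ: "S \<subseteq> verts Q" by (auto simp: S_def)
  have "(\<Sum>a\<in>S. bary Q a x) = (\<Sum>a\<in>verts Q. bary Q a x)"
   by (rule sum.mono_neutral_left) (use finite_verts[OF Q(1)] xS SQ in auto)
  moreover have "(\<Sum>a\<in>S. bary Q a x *\<^sub>R a) = (\<Sum>a\<in>verts Q. bary Q a x *\<^sub>R a)"
   by (rule sum.mono_neutral_left) (use finite_verts[OF Q(1)] xS SQ in auto)
  ultimately have "x \<in> convex hull S"
   unfolding convex_hull_finite[OF finS] mem_Collect_eq using bary_repr[OF sQ, of x]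
   by (intro exI[of _ "\<lambda>a. bary Q a x"]) (auto simp: S_def)
  hence xK: "x \<in> K" using hull_mono[of S "verts K" convex] SK full_simplex_verts(4)[OF sK] by blast
  have eqx: "bary K a x = (if a \<in> S then bary Q a x else 0)" and eqy: "a \<notin> S \<Longrightarrow> bary K a y = 0" if a: "a \<in> verts K" for a
   using bary_agree[OF K(1) Q(1) xK Q(2) a] bary_agree[OF K(1) Q(1) K(2) yQ a] xS yS0 SQ by auto
  have "0 \<le> bary K a q" if a: "a \<in> verts K" for a
  proof (cases "a \<in> S")
   case True
   have "bary K a x - bary K a q = snd (bary_data K a) \<bullet> (x - q)" by (rule bary_diff)
   also have "... \<le> norm (snd (bary_data K a)) * norm u"
    using norm_cauchy_schwarz[of "snd (bary_data K a)" "x - q"] by (simp add: u_def norm_minus_commute)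
   also have "... \<le> norm (snd (bary_data K a)) * (c0 * (2 * \<beta> * diameter K))"
   proof (rule mult_left_mono)
    have "norm u \<le> c0 * (2 * \<beta> * dm)" using nu by (simp add: \<xi>_def)
    also have "... \<le> c0 * (2 * \<beta> * diameter K)" using c0(1) beta_pos dm(2)[OF K(1)] by (intro mult_left_mono) auto
    finally show "norm u \<le> c0 * (2 * \<beta> * diameter K)" .
   qed simp
   also have "... = c0 * (norm (snd (bary_data K a)) * (2 * \<beta> * diameter K))" by simp
   also have "... \<le> c0 * 1" by (intro mult_left_mono grad_bound[OF K(1) a]) (use c0 in simp)
   finally show ?thesis using eqx[OF a] True c0(2)[OF True] by simp
  next
   case False
   have "bary K a q = bary K a q - bary K a x" using eqx[OF a] False by simp
   also have "... = bary K a (y + u) - bary K a y" unfolding bary_diff by (simp add: u_def)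
   also have "... = bary K a (y + u)" using eqy[OF a False] by simp
   finally show ?thesis using bary_mem[OF sK] K(3) a by simp
  qed
  thus "q \<in> \<Union>M" using bary_mem[OF sK] K(1) by blast
 qed
 thus ?thesis using dl mem_interior by blast
qed

lemma vertex_is_node:
 assumes K: "K \<in> M" and m: "0 < m" and a: "a \<in> verts K" shows "a \<in> lagrange_nodes m K"
proof -
 let ?j = "\<lambda>b. if b = a then m else 0"
 have fin: "finite (verts K)" by (rule finite_verts[OF K])
 have s: "(\<Sum>b\<in>verts K. ?j b) = m" using a fin by simp
 have "node_of K m ?j = (\<Sum>b\<in>verts K. if b = a then b else 0)"
  unfolding node_of_def[OF simp_M[OF K]] using m by (intro sum.cong) auto
 also have "... = a" using a fin by simp
 finally have e: "node_of K m ?j = a" .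
 have "node_of K m ?j \<in> node_of K m ` {j. (\<Sum>a\<in>verts K. j a) = m}" by (rule imageI) (simp only: mem_Collect_eq s)
 thus ?thesis unfolding lagrange_nodes_eq[OF simp_M[OF K]] e .
qed

text \<open>An element that meets T shares a vertex with it, and vertices are nodes.\<close>

lemma element_patch_eq:
 assumes T: "T \<in> M" and m: "0 < m"
 shows "element_patch m M T = \<Union>{K\<in>M. K \<inter> T \<noteq> {}}"
proof
 show "element_patch m M T \<subseteq> \<Union>{K\<in>M. K \<inter> T \<noteq> {}}" unfolding element_patch_def node_star_def by blast
 show "\<Union>{K\<in>M. K \<inter> T \<noteq> {}} \<subseteq> element_patch m M T"
 proof
  fix x assume "x \<in> \<Union>{K\<in>M. K \<inter> T \<noteq> {}}"
  then obtain K where K: "K \<in> M" "K \<inter> T \<noteq> {}" "x \<in> K" by blast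
  have "verts K \<inter> verts T \<noteq> {}" using inter_hull[OF K(1) T] K(2) by auto
  then obtain a where a: "a \<in> verts K" "a \<in> verts T" by blast
  have "a \<in> mesh_nodes m M" using vertex_is_node[OF T m a(2)] T unfolding mesh_nodes_def by blast
  moreover have "a \<in> T" "x \<in> node_star M a" using a verts_subset K T unfolding node_star_def by blast+
  ultimately show "x \<in> element_patch m M T" unfolding element_patch_def by blast
 qed
qed

end

text \<open>Moving a boundary point slightly against the direction e leads into an open set below
  the graph that misses \<Omega>. This excludes slits, so a mesh of the closure has \<Omega> itself
  as interior.\<close>

lemma frontier_Int_interior_closure:
 assumes "open \<Omega>" "lipschitz_boundary \<Omega>"
 shows "frontier \<Omega> \<inter> interior (closure \<Omega>) = {}"
proof (rule ccontr)
 assume "frontier \<Omega> \<inter> interior (closure \<Omega>) \<noteq> {}"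
 then obtain x where x: "x \<in> frontier \<Omega>" "x \<in> interior (closure \<Omega>)" by blast
 obtain e U g L where e: "norm e = 1" "open U" "x \<in> U" "L-lipschitz_on {y. y \<bullet> e = 0} g"
  "\<Omega> \<inter> U = {y \<in> U. g (y - (y \<bullet> e) *\<^sub>R e) < y \<bullet> e}" using assms(2) x(1) unfolding lipschitz_boundary_def by blast
 let ?P = "\<lambda>y. y - (y \<bullet> e) *\<^sub>R e"
 have ee: "e \<bullet> e = 1" using e(1) by (simp add: norm_eq_1)
 have P0: "?P y \<bullet> e = 0" for y by (simp add: inner_diff_left ee)
 have "x \<notin> \<Omega>" using x(1) assms(1) by (simp add: frontier_def interior_open)
 hence gx: "x \<bullet> e \<le> g (?P x)" using e(3,5) by force
 have "open (U \<inter> interior (closure \<Omega>))" using e(2) by blast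
 then obtain d where d: "0 < d" "ball x d \<subseteq> U \<inter> interior (closure \<Omega>)" using open_contains_ball x(2) e(3) by blast
 define q where "q = x - (d / 2) *\<^sub>R e"
 have qb: "q \<in> ball x d" using d e(1) by (simp add: q_def dist_norm)
 have qe: "q \<bullet> e = x \<bullet> e - d / 2" by (simp add: q_def inner_diff_left ee)
 have Pq: "?P q = ?P x" unfolding qe by (simp add: q_def algebra_simps)
 have cont: "continuous_on UNIV (\<lambda>y. g (?P y) - y \<bullet> e)"
 proof (intro continuous_intros)
  show "continuous_on UNIV (\<lambda>y. g (?P y))"
   by (rule continuous_on_compose2[OF lipschitz_on_continuous_on[OF e(4)]]) (auto intro!: continuous_intros simp: P0)
 qed
 have "open {y. 0 < g (?P y) - y \<bullet> e}" by (rule open_Collect_less[OF continuous_on_const cont])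
 hence o: "open ({y. 0 < g (?P y) - y \<bullet> e} \<inter> U)" using e(2) by blast
 have "q \<in> {y. 0 < g (?P y) - y \<bullet> e} \<inter> U" using d qb gx unfolding mem_Collect_eq Pq Int_iff by (auto simp: qe)
 moreover have "q \<in> closure \<Omega>" using qb d interior_subset[of "closure \<Omega>"] by blast
 ultimately have "({y. 0 < g (?P y) - y \<bullet> e} \<inter> U) \<inter> \<Omega> \<noteq> {}" using o open_Int_closure_eq_empty by blast
 thus False using e(5) by force
qed

section \<open>The finite element space of a meshed domain\<close>

locale domain_mesh = fat_mesh M \<beta> for M :: "(real^'n::finite) set set" and \<beta> +
 fixes \<Omega> :: "(real^'n) set" and m :: nat
 assumes open_Omega: "open \<Omega>" and lip: "lipschitz_boundary \<Omega>" and M_Omega: "\<Union>M = closure \<Omega>" and m_pos: "0 < m"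
begin

lemma interior_Un_M: "interior (\<Union>M) = \<Omega>"
proof
 show "\<Omega> \<subseteq> interior (\<Union>M)" unfolding M_Omega using open_Omega closure_subset by (rule interior_maximal[rotated])
 show "interior (\<Union>M) \<subseteq> \<Omega>"
  using frontier_Int_interior_closure[OF open_Omega lip] interior_subset[of "closure \<Omega>"] open_Omega
  unfolding M_Omega frontier_def by (auto simp: interior_open)
qed

lemma gphi_fe_space:
 assumes z: "z \<in> interior_nodes m \<Omega> M" shows "gphi m z \<in> fe_space m \<Omega> M"
proof -
 obtain K where K: "K \<in> M" "z \<in> lagrange_nodes m K" and zf: "z \<notin> frontier \<Omega>"
  using z unfolding interior_nodes_def mesh_nodes_def by blast
 have zc: "z \<in> closure \<Omega>" using nodes_subset[OF K(1) m_pos K(2)] K(1) M_Omega by blast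
 hence zi: "z \<in> interior (\<Union>M)" unfolding interior_Un_M using zf open_Omega by (simp add: frontier_def interior_open)
 show ?thesis unfolding fe_space_def mem_Collect_eq
 proof (intro conjI ballI allI impI)
  show "continuous_on (closure \<Omega>) (gphi m z)" using continuous_gphi M_Omega by simp
  show "poly_on m T (gphi m z)" if "T \<in> M" for T by (rule gphi_poly[OF that K(1) m_pos K(2)])
  show "gphi m z x = 0" if "x \<notin> closure \<Omega>" for x by (rule gphi_outside[OF K(1) m_pos _ K(2)]) (use that M_Omega in simp)
  show "gphi m z x = 0" if x: "x \<in> frontier \<Omega>" for x
  proof (rule ccontr)
   assume "gphi m z x \<noteq> 0"
   hence "x \<in> interior (\<Union>M)" using x M_Omega by (intro gphi_interior[OF m_pos zi K(2,1)]) (auto simp: frontier_def)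
   thus False using x open_Omega unfolding interior_Un_M by (simp add: frontier_def interior_open)
  qed
 qed
qed

lemma fe_space_unique:
 assumes W: "W \<in> fe_space m \<Omega> M" "V \<in> fe_space m \<Omega> M" and eq: "\<And>y. y \<in> mesh_nodes m M \<Longrightarrow> W y = V y"
 shows "W = V"
proof
 fix x
 show "W x = V x"
 proof (cases "x \<in> closure \<Omega>")
  case False thus ?thesis using W by (simp add: fe_space_def)
 next
  case True
  then obtain K where K: "K \<in> M" "x \<in> K" using M_Omega by blast
  obtain f where f: "polyf m f" "\<And>x. x \<in> K \<Longrightarrow> W x = f x"
   using W(1) K(1) poly_on_extend unfolding fe_space_def by blast
  obtain g where g: "polyf m g" "\<And>x. x \<in> K \<Longrightarrow> V x = g x"
   using W(2) K(1) poly_on_extend unfolding fe_space_def by blast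
  have "f z = g z" if "z \<in> lagrange_nodes m K" for z
   using eq[of z] f(2) g(2) nodes_subset[OF K(1) m_pos that] that K(1) unfolding mesh_nodes_def by auto
  hence "f x = g x"
   unfolding lagrange_interpolation[OF simp_M[OF K(1)] m_pos f(1), of x] lagrange_interpolation[OF simp_M[OF K(1)] m_pos g(1), of x]
   by (intro sum.cong) auto
  thus ?thesis using f(2) g(2) K(2) by simp
 qed
qed

text \<open>The explicit product lies in the space and has the right nodal values; uniqueness by
  elementwise interpolation resolves the definite description.\<close>

lemma nodal_basis_eq:
 assumes z: "z \<in> interior_nodes m \<Omega> M" shows "nodal_basis m \<Omega> M z = gphi m z"
proof -
 obtain K where K: "K \<in> M" "z \<in> lagrange_nodes m K" using z unfolding interior_nodes_def mesh_nodes_def by blast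
 have n: "\<forall>y\<in>mesh_nodes m M. gphi m z y = (if y = z then 1 else 0)"
  unfolding mesh_nodes_def using gphi_node[OF _ K(1) m_pos K(2)] by blast
 show ?thesis unfolding nodal_basis_def
 proof (rule the_equality)
  show "gphi m z \<in> fe_space m \<Omega> M \<and> (\<forall>y\<in>mesh_nodes m M. gphi m z y = (if y = z then 1 else 0))"
   using gphi_fe_space[OF z] n by blast
  fix \<phi> assume "\<phi> \<in> fe_space m \<Omega> M \<and> (\<forall>y\<in>mesh_nodes m M. \<phi> y = (if y = z then 1 else 0))"
  thus "\<phi> = gphi m z" using gphi_fe_space[OF z] n by (intro fe_space_unique) auto
 qed
qed

lemma finite_mesh_nodes: "finite (mesh_nodes m M)"
 unfolding mesh_nodes_def using finite_M finite_nodes[OF simp_M m_pos] by blast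

lemma element_in_Omega:
 assumes T: "T \<in> M" and f: "frontier T \<inter> frontier \<Omega> = {}" shows "T \<subseteq> \<Omega>"
proof
 fix x assume x: "x \<in> T"
 have c: "x \<in> closure \<Omega>" using x T M_Omega by blast
 show "x \<in> \<Omega>"
 proof (cases "x \<in> interior T")
  case True
  have "interior T \<subseteq> interior (\<Union>M)" using T by (intro interior_mono) blast
  thus ?thesis using True interior_Un_M by blast
 next
  case False
  hence "x \<in> frontier T" using x closed_M[OF T] by (simp add: frontier_def)
  thus ?thesis using f c open_Omega by (auto simp: frontier_def interior_open)
 qed
qed

lemma element_nodes_interior:
 assumes T: "T \<in> M" and f: "T \<subseteq> \<Omega>" shows "lagrange_nodes m T \<subseteq> interior_nodes m \<Omega> M"
 using nodes_subset[OF T m_pos] f T open_Omega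
 unfolding interior_nodes_def mesh_nodes_def by (auto simp: frontier_def interior_open)

lemma quasi_interpolant_on_element:
 assumes T: "T \<in> M" and f: "T \<subseteq> \<Omega>" and x: "x \<in> T"
 shows "quasi_interpolant m \<psi> \<Omega> M v x = (\<Sum>z\<in>lagrange_nodes m T. averaged_taylor m \<psi> M z v z * phi T m (node_index T m z) x)"
proof -
 have "quasi_interpolant m \<psi> \<Omega> M v x = (\<Sum>z\<in>interior_nodes m \<Omega> M. averaged_taylor m \<psi> M z v z * gphi m z x)"
  unfolding quasi_interpolant_def by (intro sum.cong) (auto simp: nodal_basis_eq)
 also have "... = (\<Sum>z\<in>lagrange_nodes m T. averaged_taylor m \<psi> M z v z * gphi m z x)"
 proof (rule sum.mono_neutral_right)
  show "finite (interior_nodes m \<Omega> M)" using finite_mesh_nodes by (simp add: interior_nodes_def)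
  show "lagrange_nodes m T \<subseteq> interior_nodes m \<Omega> M" by (rule element_nodes_interior[OF T f])
  show "\<forall>z\<in>interior_nodes m \<Omega> M - lagrange_nodes m T. averaged_taylor m \<psi> M z v z * gphi m z x = 0"
  proof
   fix z assume z: "z \<in> interior_nodes m \<Omega> M - lagrange_nodes m T"
   then obtain K where K: "K \<in> M" "z \<in> lagrange_nodes m K" unfolding interior_nodes_def mesh_nodes_def by blast
   have "z \<notin> T" using node_restrict[OF T K(1) m_pos K(2)] z by blast
   thus "averaged_taylor m \<psi> M z v z * gphi m z x = 0" using gphi_off[OF T K(1) m_pos x K(2)] by simp
  qed
 qed
 also have "... = (\<Sum>z\<in>lagrange_nodes m T. averaged_taylor m \<psi> M z v z * phi T m (node_index T m z) x)"
  by (intro sum.cong refl) (simp add: gphi_on[OF T x nodes_subset[OF T m_pos]])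
 finally show ?thesis .
qed

end

subsection \<open>Averaged Taylor polynomials\<close>

lemma mi_deriv_mi_pow:
 "mi_deriv \<mu> (\<lambda>x. mi_pow x \<gamma>) = (\<lambda>x. (\<Prod>i\<in>UNIV. fact (\<mu> i) * real (\<gamma> i choose \<mu> i)) * mi_pow x (\<lambda>i. \<gamma> i - \<mu> i))"
proof (induction \<mu> rule: mi_induct)
 case zero
 show ?case by (simp add: mi_deriv_zero)
next
 case (Suc \<mu> i)
 let ?\<beta> = "\<lambda>j. \<gamma> j - \<mu> j"
 let ?C = "\<lambda>\<mu>. \<Prod>i\<in>UNIV. fact (\<mu> i) * real (\<gamma> i choose \<mu> i)"
 have "mi_deriv (\<mu>(i := Suc (\<mu> i))) (\<lambda>x. mi_pow x \<gamma>) = pderiv_dir i (\<lambda>x. ?C \<mu> * mi_pow x ?\<beta>)"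
  unfolding mi_deriv_Suc(1)[OF smooth_mi_pow] Suc ..
 also have "... = (\<lambda>x. ?C \<mu> * real (?\<beta> i) * mi_pow x (?\<beta>(i := ?\<beta> i - 1)))"
  by (rule ext) (simp add: pderiv_dir_cmult smooth_differentiable smooth_mi_pow pderiv_dir_mi_pow)
 also have "?\<beta>(i := ?\<beta> i - 1) = (\<lambda>j. \<gamma> j - (\<mu>(i := Suc (\<mu> i))) j)" by auto
 also have "?C \<mu> * real (?\<beta> i) = ?C (\<mu>(i := Suc (\<mu> i)))"
 proof -
  have r: "?C \<xi> = (fact (\<xi> i) * real (\<gamma> i choose \<xi> i)) * (\<Prod>j\<in>UNIV-{i}. fact (\<xi> j) * real (\<gamma> j choose \<xi> j))" for \<xi>
   by (rule prod.remove) auto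
  have "fact (\<mu> i) * real (\<gamma> i choose \<mu> i) * real (\<gamma> i - \<mu> i) = fact (Suc (\<mu> i)) * real (\<gamma> i choose Suc (\<mu> i))"
  proof -
   have "Suc (\<mu> i) * (\<gamma> i choose Suc (\<mu> i)) = (\<gamma> i choose \<mu> i) * (\<gamma> i - \<mu> i)"
   proof (cases "\<gamma> i")
    case (Suc k)
    have "Suc (\<mu> i) * (Suc k choose Suc (\<mu> i)) = Suc k * (k choose \<mu> i)" by (rule Suc_times_binomial)
    also have "... = (Suc k - \<mu> i) * (Suc k choose \<mu> i)" using binomial_absorb_comp[of "Suc k" "\<mu> i"] by simp
    finally show ?thesis unfolding Suc by (simp only: mult.commute)
   qed simp
   hence "real (Suc (\<mu> i)) * real (\<gamma> i choose Suc (\<mu> i)) = real (\<gamma> i choose \<mu> i) * real (\<gamma> i - \<mu> i)"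
    unfolding of_nat_mult[symmetric] by (simp only:)
   thus ?thesis by (simp add: mult_ac)
  qed
  thus ?thesis unfolding r by (simp add: mult_ac)
 qed
 finally have "mi_deriv (\<mu>(i := Suc (\<mu> i))) (\<lambda>x. mi_pow x \<gamma>) = (\<lambda>x. ?C (\<mu>(i := Suc (\<mu> i))) * mi_pow x (\<lambda>j. \<gamma> j - (\<mu>(i := Suc (\<mu> i))) j))"
  by (simp only:)
 thus ?case .
qed

text \<open>Every coordinate of z is (z - x) + x; multiplying the one-dimensional binomial
  expansions gives the sum over all \<mu> below \<gamma>, and the remaining multi-indices contribute
  a zero binomial coefficient.\<close>

lemma taylor_monomial:
 assumes g: "mi_size \<gamma> \<le> m"
 shows "(\<Sum>\<mu> | mi_size \<mu> \<le> m. mi_deriv \<mu> (\<lambda>x. mi_pow x \<gamma>) x * mi_pow (z - x) \<mu> / mi_fact \<mu>) = mi_pow z \<gamma>"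
proof -
 let ?t = "\<lambda>\<mu>. \<Prod>i\<in>UNIV. real (\<gamma> i choose \<mu> i) * (z - x) $ i ^ \<mu> i * x $ i ^ (\<gamma> i - \<mu> i)"
 have t: "mi_deriv \<mu> (\<lambda>x. mi_pow x \<gamma>) x * mi_pow (z - x) \<mu> / mi_fact \<mu> = ?t \<mu>" for \<mu>
 proof -
  have "mi_fact \<mu> \<noteq> 0" by (simp add: mi_fact_def)
  moreover have "mi_deriv \<mu> (\<lambda>x. mi_pow x \<gamma>) x * mi_pow (z - x) \<mu> = mi_fact \<mu> * ?t \<mu>"
   unfolding mi_deriv_mi_pow by (simp only: mi_fact_def mi_pow_def prod.distrib mult_ac)
  ultimately show ?thesis by simp
 qed
 have "(\<Sum>\<mu> | mi_size \<mu> \<le> m. ?t \<mu>) = (\<Sum>\<mu>\<in>PiE UNIV (\<lambda>i. {..\<gamma> i}). ?t \<mu>)"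
 proof (rule sum.mono_neutral_right)
  show "PiE UNIV (\<lambda>i. {..\<gamma> i}) \<subseteq> {\<mu>. mi_size \<mu> \<le> m}"
  proof
   fix \<mu> assume "\<mu> \<in> PiE UNIV (\<lambda>i. {..\<gamma> i})"
   hence "mi_size \<mu> \<le> mi_size \<gamma>" unfolding mi_size_def by (intro sum_mono) auto
   thus "\<mu> \<in> {\<mu>. mi_size \<mu> \<le> m}" using g by simp
  qed
  show "\<forall>\<mu>\<in>{\<mu>. mi_size \<mu> \<le> m} - PiE UNIV (\<lambda>i. {..\<gamma> i}). ?t \<mu> = 0"
  proof
   fix \<mu> assume "\<mu> \<in> {\<mu>. mi_size \<mu> \<le> m} - PiE UNIV (\<lambda>i. {..\<gamma> i})"
   then obtain i where "\<gamma> i < \<mu> i" by (auto simp: PiE_iff not_le)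
   thus "?t \<mu> = 0" by (intro prod_zero) (auto simp: binomial_eq_0)
  qed
 qed (rule finite_mi_le)
 also have "... = (\<Prod>i\<in>UNIV. \<Sum>a\<le>\<gamma> i. real (\<gamma> i choose a) * (z - x) $ i ^ a * x $ i ^ (\<gamma> i - a))"
  by (rule prod_sum_PiE[symmetric]) auto
 also have "... = (\<Prod>i\<in>UNIV. ((z - x) $ i + x $ i) ^ \<gamma> i)" by (simp only: binomial_ring vector_minus_component)
 also have "... = mi_pow z \<gamma>" by (simp add: mi_pow_def)
 finally show ?thesis unfolding t .
qed

lemma taylor_polynomial:
 assumes P: "polyf m P"
 shows "(\<Sum>\<mu> | mi_size \<mu> \<le> m. mi_deriv \<mu> P x * mi_pow (z - x) \<mu> / mi_fact \<mu>) = P z"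
proof -
 obtain c where c: "P = (\<lambda>x. \<Sum>\<gamma> | mi_size \<gamma> \<le> m. c \<gamma> * mi_pow x \<gamma>)" using P unfolding polyf_iff poly_on_def by auto
 have d: "mi_deriv \<mu> P x = (\<Sum>\<gamma> | mi_size \<gamma> \<le> m. c \<gamma> * mi_deriv \<mu> (\<lambda>x. mi_pow x \<gamma>) x)" for \<mu>
  unfolding c by (subst mi_deriv_sum) (auto simp: mi_deriv_cmult smooth_mi_pow intro: smooth_mult smooth_const)
 have "(\<Sum>\<mu> | mi_size \<mu> \<le> m. mi_deriv \<mu> P x * mi_pow (z - x) \<mu> / mi_fact \<mu>)
  = (\<Sum>\<mu> | mi_size \<mu> \<le> m. \<Sum>\<gamma> | mi_size \<gamma> \<le> m. c \<gamma> * (mi_deriv \<mu> (\<lambda>x. mi_pow x \<gamma>) x * mi_pow (z - x) \<mu> / mi_fact \<mu>))"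
  unfolding d by (simp add: sum_distrib_right sum_divide_distrib mult.assoc)
 also have "... = (\<Sum>\<gamma> | mi_size \<gamma> \<le> m. c \<gamma> * (\<Sum>\<mu> | mi_size \<mu> \<le> m. mi_deriv \<mu> (\<lambda>x. mi_pow x \<gamma>) x * mi_pow (z - x) \<mu> / mi_fact \<mu>))"
  by (subst sum.swap) (simp add: sum_distrib_left)
 also have "... = (\<Sum>\<gamma> | mi_size \<gamma> \<le> m. c \<gamma> * mi_pow z \<gamma>)" by (intro sum.cong refl) (simp add: taylor_monomial)
 finally show ?thesis unfolding c .
qed

lemma mi_deriv_mi_pow_top:
 assumes "mi_size \<gamma> \<le> mi_size \<mu>"
 shows "mi_deriv \<mu> (\<lambda>x. mi_pow x \<gamma>) = (\<lambda>x. if \<mu> = \<gamma> then mi_fact \<gamma> else 0)"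
proof (cases "\<mu> = \<gamma>")
 case True
 thus ?thesis unfolding mi_deriv_mi_pow by (simp add: mi_fact_def mi_pow_def)
next
 case False
 have "\<exists>i. \<gamma> i < \<mu> i"
 proof (rule ccontr)
  assume "\<not> ?thesis"
  hence le: "\<And>i. \<mu> i \<le> \<gamma> i" by (auto simp: not_less)
  from False obtain i where "\<mu> i \<noteq> \<gamma> i" by auto
  hence "\<mu> i < \<gamma> i" using le[of i] by simp
  hence "mi_size \<mu> < mi_size \<gamma>" unfolding mi_size_def using le by (intro sum_strict_mono_ex1) auto
  thus False using assms by simp
 qed
 then obtain i where "\<gamma> i < \<mu> i" by blast
 hence "(\<Prod>i\<in>UNIV. fact (\<mu> i) * real (\<gamma> i choose \<mu> i)) = 0" by (intro prod_zero) (auto simp: binomial_eq_0)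
 thus ?thesis using False by (simp only: mi_deriv_mi_pow mult_zero_left if_False)
qed

lemma mi_deriv_polyf_zero:
 assumes P: "polyf m P" and k: "m < mi_size \<nu>" shows "mi_deriv \<nu> P = (\<lambda>x. 0)"
proof -
 obtain c where c: "P = (\<lambda>x. \<Sum>\<gamma> | mi_size \<gamma> \<le> m. c \<gamma> * mi_pow x \<gamma>)" using P unfolding polyf_iff poly_on_def by auto
 have "mi_deriv \<nu> (\<lambda>x. c \<gamma> * mi_pow x \<gamma>) = (\<lambda>x. 0)" if "mi_size \<gamma> \<le> m" for \<gamma>
  using that k mi_deriv_mi_pow_top[of \<gamma> \<nu>] by (auto simp: mi_deriv_cmult smooth_mi_pow)
 thus ?thesis unfolding c by (subst mi_deriv_sum) (auto intro: smooth_mult smooth_const smooth_mi_pow)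
qed

lemma smooth_integrable_ball:
 assumes "smooth f" shows "integrable lborel (\<lambda>x. f x * indicator (ball c \<rho>) x)"
proof -
 have "integrable lborel (\<lambda>x. indicator (cball c \<rho>) x *\<^sub>R f x)"
  by (rule borel_integrable_compact) (auto intro: smooth_continuous assms)
 from integrable_mult_bounded[OF this, of "indicator (ball c \<rho>)" 1]
 have "integrable lborel (\<lambda>x. indicator (cball c \<rho>) x *\<^sub>R f x * indicator (ball c \<rho>) x)" by (auto simp: indicator_def)
 moreover have "(\<lambda>x. indicator (cball c \<rho>) x *\<^sub>R f x * indicator (ball c \<rho>) x) = (\<lambda>x. f x * indicator (ball c \<rho>) x)"
  by (auto simp: fun_eq_iff indicator_def)
 ultimately show ?thesis by simp
qed

text \<open>Derivatives of top order see only the homogeneous top part, whose coefficients are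
  therefore determined directly; the lower part is found by induction after subtracting the averages
  caused by the top part.\<close>

lemma polynomial_prescribed_averages:
 fixes c :: "('n::finite \<Rightarrow> nat) \<Rightarrow> real"
 assumes \<rho>: "0 < \<rho>"
 shows "\<exists>P. polyf m P \<and> (\<forall>\<nu>. mi_size \<nu> \<le> m \<longrightarrow> (LBI x. mi_deriv \<nu> P x * indicator (ball x0 \<rho>) x) = c \<nu>)"
proof (induction m arbitrary: c)
 case 0
 let ?V = "ballvol TYPE('n) \<rho>"
 have V: "(LBI x. indicator (ball x0 \<rho>) x) = ?V" using \<rho> by (simp add: measure_def emeasure_ball_vec)
 have Vp: "0 < ?V" using \<rho> by (rule ballvol_pos)
 show ?case
 proof (intro exI[of _ "\<lambda>_. c (\<lambda>_. 0) / ?V"] conjI allI impI polyf_const)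
  fix \<nu> :: "'n \<Rightarrow> nat" assume "mi_size \<nu> \<le> 0"
  hence "\<nu> = (\<lambda>_. 0)" using mi_size_eq_0[of \<nu>] by simp
  thus "(LBI x. mi_deriv \<nu> (\<lambda>_. c (\<lambda>_. 0) / ?V) x * indicator (ball x0 \<rho>) x) = c \<nu>"
   using V Vp \<rho> by (simp add: mi_deriv_zero)
 qed
next
 case (Suc m)
 let ?V = "ballvol TYPE('n) \<rho>" and ?B = "indicator (ball x0 \<rho>) :: real^'n \<Rightarrow> real"
 have V: "(LBI x. ?B x) = ?V" using \<rho> by (simp add: measure_def emeasure_ball_vec)
 have Vp: "0 < ?V" using \<rho> by (rule ballvol_pos)
 define Pt where "Pt = (\<lambda>x. \<Sum>\<gamma> | mi_size \<gamma> = Suc m. (c \<gamma> / (?V * mi_fact \<gamma>)) * mi_pow x \<gamma>)"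
 have Pt: "polyf (Suc m) Pt" unfolding Pt_def
  by (intro polyf_sum polyf_cmult) (auto intro: polyf_mono[OF polyf_mi_pow])
 have top: "mi_deriv \<nu> Pt = (\<lambda>x. c \<nu> / ?V)" if k: "mi_size \<nu> = Suc m" for \<nu>
 proof
  fix x
  have "mi_deriv \<nu> Pt x = (\<Sum>\<gamma> | mi_size \<gamma> = Suc m. (c \<gamma> / (?V * mi_fact \<gamma>)) * mi_deriv \<nu> (\<lambda>x. mi_pow x \<gamma>) x)"
   unfolding Pt_def
   by (subst mi_deriv_sum) (rule smooth_mult[OF smooth_const smooth_mi_pow], simp only: mi_deriv_cmult[OF smooth_mi_pow])
  also have "... = (\<Sum>\<gamma> | mi_size \<gamma> = Suc m. if \<gamma> = \<nu> then c \<gamma> / (?V * mi_fact \<gamma>) * mi_fact \<gamma> else 0)"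
   by (rule sum.cong) (use k in \<open>auto simp: mi_deriv_mi_pow_top\<close>)
  also have "... = c \<nu> / (?V * mi_fact \<nu>) * mi_fact \<nu>" using k by (simp add: finite_mi_eq)
  also have "... = c \<nu> / ?V" by (simp add: mi_fact_def)
  finally show "mi_deriv \<nu> Pt x = c \<nu> / ?V" .
 qed
 obtain P where P: "polyf m P" "\<And>\<nu>. mi_size \<nu> \<le> m \<Longrightarrow> (LBI x. mi_deriv \<nu> P x * ?B x) = c \<nu> - (LBI x. mi_deriv \<nu> Pt x * ?B x)"
  using Suc.IH[of "\<lambda>\<nu>. c \<nu> - (LBI x. mi_deriv \<nu> Pt x * ?B x)"] by blast
 show ?case
 proof (intro exI[of _ "\<lambda>x. Pt x + P x"] conjI allI impI)
  show "polyf (Suc m) (\<lambda>x. Pt x + P x)" by (intro polyf_add Pt polyf_Suc P(1))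
  fix \<nu> :: "'n \<Rightarrow> nat" assume k: "mi_size \<nu> \<le> Suc m"
  have sm: "smooth Pt" "smooth P" using Pt P(1) polyf_smooth by blast+
  have "(LBI x. mi_deriv \<nu> (\<lambda>x. Pt x + P x) x * ?B x) = (LBI x. mi_deriv \<nu> Pt x * ?B x + mi_deriv \<nu> P x * ?B x)"
   unfolding mi_deriv_add[OF sm] by (simp add: distrib_right)
  also have "... = (LBI x. mi_deriv \<nu> Pt x * ?B x) + (LBI x. mi_deriv \<nu> P x * ?B x)"
   by (intro Bochner_Integration.integral_add smooth_integrable_ball smooth_mi_deriv sm)
  also have "... = c \<nu>"
  proof (cases "mi_size \<nu> \<le> m")
   case True thus ?thesis using P(2) by simp
  next
   case False
   hence k: "mi_size \<nu> = Suc m" using k by simp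
   show ?thesis unfolding top[OF k] using mi_deriv_polyf_zero[OF P(1), of \<nu>] k V Vp \<rho> by simp
  qed
  finally show "(LBI x. mi_deriv \<nu> (\<lambda>x. Pt x + P x) x * ?B x) = c \<nu>" .
 qed
qed

lemma ex_list_mi_size: "\<exists>js. (\<forall>i. count_list js i = \<nu> i) \<and> length js = mi_size \<nu>"
proof -
 obtain js where js: "\<forall>i. count_list js i = \<nu> i" using ex_mi_list by blast
 have "length js = (\<Sum>i\<in>set js. count_list js i)" by (simp add: sum_count_set)
 also have "... = mi_size \<nu>" unfolding mi_size_def using js
  by (intro sum.mono_neutral_cong_left) (auto simp flip: count_list_0_iff)
 finally show ?thesis using js by blast
qed

lemma mi_deriv_list:
 assumes "smooth f" obtains js where "length js = mi_size \<nu>" "mi_deriv \<nu> f = pderiv_list js f"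
 using ex_list_mi_size[of \<nu>] mi_deriv_eq_pderiv_list[OF assms] by blast

lemma mi_deriv_affine:
 assumes "smooth f"
 shows "mi_deriv \<mu> (\<lambda>x. f (a + t *\<^sub>R x)) = (\<lambda>x. t ^ mi_size \<mu> * mi_deriv \<mu> f (a + t *\<^sub>R x))"
proof -
 obtain js where js: "\<forall>i. count_list js i = \<mu> i" "length js = mi_size \<mu>" using ex_list_mi_size by blast
 thus ?thesis using pderiv_list_affine[OF assms, of js a t] mi_deriv_eq_pderiv_list[OF assms, of js \<mu>]
   mi_deriv_eq_pderiv_list[OF smooth_affine[OF assms], of js \<mu> a t] by simp
qed

lemma mi_pow_scale: "mi_pow (s *\<^sub>R x) \<mu> = s ^ mi_size \<mu> * mi_pow x \<mu>"
 by (simp add: mi_pow_def mi_size_def power_mult_distrib prod.distrib power_sum)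

section \<open>The kernel of the averaged Taylor polynomial\<close>

context mollifier
begin

definition taylor_term :: "real \<Rightarrow> real^'n \<Rightarrow> ('n \<Rightarrow> nat) \<Rightarrow> real^'n \<Rightarrow> real" where
 "taylor_term \<eta> z \<mu> = mi_deriv \<mu> (\<lambda>x. mi_pow (z - x) \<mu> * mker \<eta> z x)"

text \<open>The averaged Taylor polynomial enters the interpolant through its value at its own node;
  with y = z it is integration against this single kernel.\<close>

definition qker :: "nat \<Rightarrow> real \<Rightarrow> real^'n \<Rightarrow> real^'n \<Rightarrow> real" where
 "qker m \<eta> z x = (\<Sum>\<mu> | mi_size \<mu> \<le> m. (- 1) ^ mi_size \<mu> / mi_fact \<mu> * taylor_term \<eta> z \<mu> x)"

definition qprofile :: "nat \<Rightarrow> real^'n \<Rightarrow> real" where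
 "qprofile m u = (\<Sum>\<mu> | mi_size \<mu> \<le> m. 1 / mi_fact \<mu> * mi_deriv \<mu> (\<lambda>u. mi_pow u \<mu> * \<psi> u) u)"

lemma smooth_profile_term: "smooth (\<lambda>u. mi_pow u \<mu> * \<psi> u)" by (intro smooth_mult smooth_mi_pow psi_smooth)

lemma smooth_qprofile: "smooth (qprofile m)" unfolding qprofile_def[abs_def]
 by (intro smooth_sum smooth_mult[OF smooth_const] smooth_mi_deriv smooth_profile_term)

lemma qprofile_zero: "r < norm u \<Longrightarrow> qprofile m u = 0" unfolding qprofile_def
 by (intro sum.neutral ballI) (auto intro!: mi_deriv_zero_outside[of r] simp: psi_zero)

lemma smooth_mi_pow_diff: "smooth (\<lambda>x. mi_pow (z - x) \<mu>)" using smooth_affine[OF smooth_mi_pow, of z "- 1" \<mu>] by simp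

lemma smooth_taylor: "smooth (\<lambda>x. mi_pow (z - x) \<mu> * mker \<eta> z x)"
 by (intro smooth_mult smooth_mi_pow_diff smooth_mker)

text \<open>Each derivative produces 1 / \<eta> and each factor of z - x produces \<eta>, so the
  powers cancel order by order and the kernel is a rescaled fixed profile. Height and mass bounds
  with constants depending on \<psi> and m follow.\<close>

lemma qker_profile:
 assumes e: "0 < \<eta>" shows "qker m \<eta> z x = qprofile m ((1/\<eta>) *\<^sub>R (z - x)) / \<eta> ^ CARD('n)"
proof -
 have t: "(- 1) ^ mi_size \<mu> * taylor_term \<eta> z \<mu> x = (1 / \<eta> ^ CARD('n)) * mi_deriv \<mu> (\<lambda>u. mi_pow u \<mu> * \<psi> u) ((1/\<eta>) *\<^sub>R (z - x))" for \<mu>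
 proof -
  let ?F = "\<lambda>u. mi_pow u \<mu> * \<psi> u" and ?k = "mi_size \<mu>"
  have eq: "(\<lambda>x. mi_pow (z - x) \<mu> * mker \<eta> z x) = (\<lambda>x. (\<eta> ^ ?k / \<eta> ^ CARD('n)) * ?F ((1/\<eta>) *\<^sub>R z + (- 1/\<eta>) *\<^sub>R x))"
  proof
   fix x
   have a: "(1/\<eta>) *\<^sub>R z + (- 1/\<eta>) *\<^sub>R x = (1/\<eta>) *\<^sub>R (z - x)" by (simp add: scaleR_diff_right)
   show "mi_pow (z - x) \<mu> * mker \<eta> z x = (\<eta> ^ ?k / \<eta> ^ CARD('n)) * ?F ((1/\<eta>) *\<^sub>R z + (- 1/\<eta>) *\<^sub>R x)"
    unfolding a mi_pow_scale mker_def using e by (simp add: power_divide)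
  qed
  have a: "(1/\<eta>) *\<^sub>R z + (- 1/\<eta>) *\<^sub>R x = (1/\<eta>) *\<^sub>R (z - x)" by (simp add: scaleR_diff_right)
  have "taylor_term \<eta> z \<mu> x = (\<eta> ^ ?k / \<eta> ^ CARD('n)) * ((- 1/\<eta>) ^ ?k * mi_deriv \<mu> ?F ((1/\<eta>) *\<^sub>R (z - x)))"
   unfolding taylor_term_def eq mi_deriv_cmult[OF smooth_affine[OF smooth_profile_term]]
   unfolding mi_deriv_affine[OF smooth_profile_term] a ..
  moreover have "(- 1) ^ ?k * (\<eta> ^ ?k * (- 1/\<eta>) ^ ?k) = 1" using e by (simp flip: power_mult_distrib)
  ultimately show ?thesis by (simp add: mult_ac)
 qed
 have "qker m \<eta> z x = (\<Sum>\<mu> | mi_size \<mu> \<le> m. 1 / mi_fact \<mu> * ((- 1) ^ mi_size \<mu> * taylor_term \<eta> z \<mu> x))"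
  unfolding qker_def by (intro sum.cong) auto
 also have "... = qprofile m ((1/\<eta>) *\<^sub>R (z - x)) / \<eta> ^ CARD('n)"
  unfolding t qprofile_def by (simp add: sum_divide_distrib)
 finally show ?thesis .
qed

definition qbound :: "nat \<Rightarrow> real" where
 "qbound m = (SOME B. 0 < B \<and> (\<forall>u. \<bar>qprofile m u\<bar> \<le> B))"

lemma qbound: "0 < qbound m" "\<bar>qprofile m u\<bar> \<le> qbound m"
proof -
 have "0 < qbound m \<and> (\<forall>u. \<bar>qprofile m u\<bar> \<le> qbound m)" unfolding qbound_def
  by (rule someI_ex) (use bounded_support_bound[OF smooth_continuous[OF smooth_qprofile] qprofile_zero] in blast)
 thus "0 < qbound m" "\<bar>qprofile m u\<bar> \<le> qbound m" by auto
qed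

definition qmass :: "nat \<Rightarrow> real" where
 "qmass m = enn2real (LBNN u. ennreal \<bar>qprofile m u\<bar>)"

lemma qker_bound: "0 < \<eta> \<Longrightarrow> \<bar>qker m \<eta> z x\<bar> \<le> qbound m / \<eta> ^ CARD('n)"
 unfolding qker_profile by (simp add: divide_right_mono qbound)

lemma qker_mass:
 assumes e: "0 < \<eta>" shows "(LBNN x. ennreal \<bar>qker m \<eta> z x\<bar>) = ennreal (qmass m)"
proof -
 have [measurable]: "qprofile m \<in> borel_measurable borel" by (rule smooth_borel[OF smooth_qprofile])
 have k: "\<bar>- 1/\<eta>\<bar> ^ CARD('n) * \<bar>qprofile m ((1/\<eta>) *\<^sub>R z + (- 1/\<eta>) *\<^sub>R x)\<bar> = \<bar>qker m \<eta> z x\<bar>" for x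
  unfolding qker_profile[OF e] using e by (simp add: scaleR_diff_right power_divide)
 have "(LBNN u. ennreal \<bar>qprofile m u\<bar>) = ennreal (\<bar>- 1/\<eta>\<bar> ^ CARD('n)) * (LBNN x. ennreal \<bar>qprofile m ((1/\<eta>) *\<^sub>R z + (- 1/\<eta>) *\<^sub>R x)\<bar>)"
  by (rule nn_integral_affine) (use e in auto)
 also have "... = (LBNN x. ennreal (\<bar>- 1/\<eta>\<bar> ^ CARD('n)) * ennreal \<bar>qprofile m ((1/\<eta>) *\<^sub>R z + (- 1/\<eta>) *\<^sub>R x)\<bar>)"
  by (rule nn_integral_cmult[symmetric]) simp
 also have "... = (LBNN x. ennreal \<bar>qker m \<eta> z x\<bar>)" unfolding k[symmetric] by (subst ennreal_mult) auto
 finally have eq: "(LBNN x. ennreal \<bar>qker m \<eta> z x\<bar>) = (LBNN u. ennreal \<bar>qprofile m u\<bar>)" by (rule sym)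
 have "integrable lborel (qprofile m)"
  by (rule bounded_support_integrable[OF smooth_continuous[OF smooth_qprofile] qprofile_zero])
 hence "(LBNN u. ennreal \<bar>qprofile m u\<bar>) < \<infinity>" by (simp add: integrable_iff_bounded)
 thus ?thesis unfolding eq qmass_def by simp
qed

lemma taylor_term_zero: "x \<notin> fsupport (mker \<eta> z) \<Longrightarrow> taylor_term \<eta> z \<mu> x = 0" unfolding taylor_term_def
proof (rule mi_deriv_zero_on_open[of "- fsupport (mker \<eta> z)"])
 show "open (- fsupport (mker \<eta> z))" by (simp add: fsupport_def open_Compl)
 show "mi_pow (z - x) \<mu> * mker \<eta> z x = 0" if "x \<in> - fsupport (mker \<eta> z)" for x
  using that closure_subset[of "{x. mker \<eta> z x \<noteq> 0}"] by (auto simp: fsupport_def)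
qed simp

lemma mker_zero_outside:
 assumes e: "0 < \<eta>" and x: "norm z + r * \<eta> < norm x" shows "mker \<eta> z x = 0"
proof (rule mker_zero[OF e])
 have "norm x \<le> norm z + dist z x" by (metis dist_norm norm_minus_commute norm_triangle_sub)
 thus "r * \<eta> < dist z x" using x by linarith
qed

lemma taylor_term_bounded:
 assumes e: "0 < \<eta>" shows "\<exists>B. \<forall>x. \<bar>taylor_term \<eta> z \<mu> x\<bar> \<le> B"
proof -
 have "continuous_on UNIV (taylor_term \<eta> z \<mu>)"
  unfolding taylor_term_def by (intro smooth_continuous smooth_mi_deriv smooth_taylor)
 moreover have "taylor_term \<eta> z \<mu> x = 0" if "norm z + r * \<eta> < norm x" for x
  unfolding taylor_term_def using that mker_zero_outside[OF e]
  by (intro mi_deriv_zero_outside[of "norm z + r * \<eta>"]) auto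
 ultimately show ?thesis using bounded_support_bound by blast
qed

text \<open>Integration by parts moves the derivatives to P and squares the sign to 1; the exact
  Taylor expansion collapses the sum to P z, and the kernel has integral 1.\<close>

lemma taylor_reproduction:
 assumes e: "0 < \<eta>" and P: "polyf m P"
 shows "(\<Sum>\<mu> | mi_size \<mu> \<le> m. (- 1) ^ mi_size \<mu> / mi_fact \<mu> * (LBI x. P x * taylor_term \<eta> z \<mu> x)) = P z"
proof -
 have smP: "smooth P" by (rule polyf_smooth[OF P])
 let ?g = "\<lambda>\<mu> x. mi_pow (z - x) \<mu> * mker \<eta> z x"
 have g0: "?g \<mu> x = 0" if "norm z + r * \<eta> < norm x" for \<mu> x using mker_zero_outside[OF e that] by simp
 have t: "(- 1) ^ mi_size \<mu> / mi_fact \<mu> * (LBI x. P x * taylor_term \<eta> z \<mu> x)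
   = (LBI x. mi_deriv \<mu> P x * mi_pow (z - x) \<mu> / mi_fact \<mu> * mker \<eta> z x)" for \<mu>
 proof -
  have "(LBI x. P x * taylor_term \<eta> z \<mu> x) = (- 1) ^ mi_size \<mu> * (LBI x. mi_deriv \<mu> P x * ?g \<mu> x)"
   unfolding taylor_term_def by (rule integral_by_parts_mi[OF smP smooth_taylor g0])
  hence "(- 1) ^ mi_size \<mu> / mi_fact \<mu> * (LBI x. P x * taylor_term \<eta> z \<mu> x)
   = ((- 1) ^ mi_size \<mu> * (- 1) ^ mi_size \<mu>) * ((1 / mi_fact \<mu>) * (LBI x. mi_deriv \<mu> P x * ?g \<mu> x))" by simp
  also have "(- 1 :: real) ^ mi_size \<mu> * (- 1) ^ mi_size \<mu> = 1" by (simp flip: power_mult_distrib)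
  also have "1 * ((1 / mi_fact \<mu>) * (LBI x. mi_deriv \<mu> P x * ?g \<mu> x)) = (LBI x. (1 / mi_fact \<mu>) * (mi_deriv \<mu> P x * ?g \<mu> x))"
   by simp
  finally show ?thesis by (simp add: mult_ac)
 qed
 have i: "integrable lborel (\<lambda>x. mi_deriv \<mu> P x * mi_pow (z - x) \<mu> / mi_fact \<mu> * mker \<eta> z x)" for \<mu>
 proof -
  have "smooth (\<lambda>x. (1 / mi_fact \<mu>) * (mi_deriv \<mu> P x * ?g \<mu> x))"
   by (rule smooth_mult[OF smooth_const smooth_mult[OF smooth_mi_deriv[OF smP] smooth_taylor]])
  hence "integrable lborel (\<lambda>x. (1 / mi_fact \<mu>) * (mi_deriv \<mu> P x * ?g \<mu> x))"
   by (rule bounded_support_integrable[OF smooth_continuous, of _ "norm z + r * \<eta>"]) (simp add: g0)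
  thus ?thesis by (simp add: mult_ac)
 qed
 have "(\<Sum>\<mu> | mi_size \<mu> \<le> m. (- 1) ^ mi_size \<mu> / mi_fact \<mu> * (LBI x. P x * taylor_term \<eta> z \<mu> x))
  = (LBI x. (\<Sum>\<mu> | mi_size \<mu> \<le> m. mi_deriv \<mu> P x * mi_pow (z - x) \<mu> / mi_fact \<mu> * mker \<eta> z x))"
  unfolding t by (rule Bochner_Integration.integral_sum[symmetric]) (rule i)
 also have "... = (LBI x. P z * mker \<eta> z x)" by (simp only: sum_distrib_right[symmetric] taylor_polynomial[OF P])
 also have "... = P z" by (simp add: integral_mker[OF e])
 finally show ?thesis .
qed

end

subsection \<open>Bramble--Hilbert estimate on the patch\<close>

lemma sum_abs_powr_le:
 fixes f :: "'b \<Rightarrow> real"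
 assumes p: "0 < p" and I: "finite I"
 shows "(\<Sum>i\<in>I. \<bar>f i\<bar>) powr p \<le> real (card I) powr p * (\<Sum>i\<in>I. \<bar>f i\<bar> powr p)"
proof (cases "I = {}")
 case False
 have "Max ((\<lambda>i. \<bar>f i\<bar>) ` I) \<in> (\<lambda>i. \<bar>f i\<bar>) ` I" using I False by (intro Max_in) auto
 then obtain j where j: "j \<in> I" "Max ((\<lambda>i. \<bar>f i\<bar>) ` I) = \<bar>f j\<bar>" by auto
 have le: "\<bar>f i\<bar> \<le> \<bar>f j\<bar>" if "i \<in> I" for i unfolding j(2)[symmetric] using I that by (intro Max_ge) auto
 have "(\<Sum>i\<in>I. \<bar>f i\<bar>) \<le> real (card I) * \<bar>f j\<bar>" using sum_bounded_above[of I "\<lambda>i. \<bar>f i\<bar>" "\<bar>f j\<bar>"] le by simp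
 hence "(\<Sum>i\<in>I. \<bar>f i\<bar>) powr p \<le> (real (card I) * \<bar>f j\<bar>) powr p" using p by (intro powr_mono2) (auto intro: sum_nonneg)
 also have "... = real (card I) powr p * \<bar>f j\<bar> powr p" by (simp add: powr_mult)
 also have "... \<le> real (card I) powr p * (\<Sum>i\<in>I. \<bar>f i\<bar> powr p)"
  using I j(1) by (intro mult_left_mono member_le_sum[of j]) auto
 finally show ?thesis .
qed simp

lemma (in weighted_moll) wint_sum:
 fixes f :: "'b \<Rightarrow> real^'n \<Rightarrow> real"
 assumes I: "finite I" and [measurable]: "\<And>i. i \<in> I \<Longrightarrow> f i \<in> borel_measurable borel" "D \<in> sets borel"
 shows "wint D (\<lambda>x. \<Sum>i\<in>I. \<bar>f i x\<bar>) \<le> ennreal (real (card I) powr p) * (\<Sum>i\<in>I. wint D (f i))"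
proof -
 have "wint D (\<lambda>x. \<Sum>i\<in>I. \<bar>f i x\<bar>) \<le> (LBNN x. ennreal (real (card I) powr p) * (\<Sum>i\<in>I. ennreal (\<bar>f i x\<bar> powr p * w x) * indicator D x))"
  unfolding wint_def
 proof (rule nn_integral_mono)
  fix x
  have "\<bar>\<Sum>i\<in>I. \<bar>f i x\<bar>\<bar> powr p * w x \<le> real (card I) powr p * (\<Sum>i\<in>I. \<bar>f i x\<bar> powr p) * w x"
   using sum_abs_powr_le[of p I "\<lambda>i. f i x"] I p_gt_1 less_imp_le[OF w_pos] by (intro mult_right_mono) (auto simp: sum_nonneg)
  also have "... = real (card I) powr p * (\<Sum>i\<in>I. \<bar>f i x\<bar> powr p * w x)" by (simp add: sum_distrib_right mult.assoc)
  finally have "ennreal (\<bar>\<Sum>i\<in>I. \<bar>f i x\<bar>\<bar> powr p * w x) \<le> ennreal (real (card I) powr p * (\<Sum>i\<in>I. \<bar>f i x\<bar> powr p * w x))"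
   by (rule ennreal_leI)
  also have "... = ennreal (real (card I) powr p) * (\<Sum>i\<in>I. ennreal (\<bar>f i x\<bar> powr p * w x))"
   using less_imp_le[OF w_pos] by (subst ennreal_mult) (auto intro!: sum_nonneg mult_nonneg_nonneg)
  finally show "ennreal (\<bar>\<Sum>i\<in>I. \<bar>f i x\<bar>\<bar> powr p * w x) * indicator D x
   \<le> ennreal (real (card I) powr p) * (\<Sum>i\<in>I. ennreal (\<bar>f i x\<bar> powr p * w x) * indicator D x)"
   by (cases "x \<in> D") auto
 qed
 also have "... = ennreal (real (card I) powr p) * (LBNN x. (\<Sum>i\<in>I. ennreal (\<bar>f i x\<bar> powr p * w x) * indicator D x))"
  by (rule nn_integral_cmult) measurable
 also have "(LBNN x. (\<Sum>i\<in>I. ennreal (\<bar>f i x\<bar> powr p * w x) * indicator D x)) = (\<Sum>i\<in>I. wint D (f i))"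
  unfolding wint_def by (rule nn_integral_sum) measurable
 finally show ?thesis .
qed

lemma weak_grad_borel: "weak_grad D u g \<Longrightarrow> u \<in> borel_measurable borel" "weak_grad D u g \<Longrightarrow> g i \<in> borel_measurable borel"
 unfolding weak_grad_def using borel_measurable_integrable[of lborel] by auto

lemma weak_grad_diff:
 assumes 1: "weak_grad D u g" and 2: "weak_grad D v h"
 shows "weak_grad D (\<lambda>x. u x - v x) (\<lambda>i x. g i x - h i x)" unfolding weak_grad_def
proof (intro conjI allI impI)
 note w1 = 1[unfolded weak_grad_def] and w2 = 2[unfolded weak_grad_def]
 show "integrable lborel (\<lambda>x. u x - v x)" "integrable lborel (\<lambda>x. g i x - h i x)" for i using w1 w2 by auto
 fix \<phi> i assume \<phi>: "test_function D \<phi>"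
 have s: "smooth \<phi>" using \<phi> by (simp add: test_function_def)
 obtain R where R: "\<And>x. R < norm x \<Longrightarrow> \<phi> x = 0" using test_function_zero_outside_ball[OF \<phi>] by blast
 have m: "\<And>\<phi>. smooth \<phi> \<Longrightarrow> \<phi> \<in> borel_measurable lborel" using smooth_borel by simp
 obtain B1 where B1: "\<And>x. \<bar>\<phi> x\<bar> \<le> B1" using bounded_support_bound[OF smooth_continuous[OF s] R] by blast
 obtain B2 where B2: "\<And>x. \<bar>pderiv_dir i \<phi> x\<bar> \<le> B2"
  using bounded_support_bound[OF smooth_continuous[OF smooth_pderiv_dir[OF s]] pderiv_dir_zero_outside[of R, OF R]] by blast
 have i1: "integrable lborel (\<lambda>x. f x * \<phi> x)" if "integrable lborel f" for f :: "real^'a \<Rightarrow> real"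
  by (rule integrable_mult_bounded[OF that m[OF s] B1])
 have i2: "integrable lborel (\<lambda>x. f x * pderiv_dir i \<phi> x)" if "integrable lborel f" for f :: "real^'a \<Rightarrow> real"
  by (rule integrable_mult_bounded[OF that m[OF smooth_pderiv_dir[OF s]] B2])
 have "(LBI x. (u x - v x) * pderiv_dir i \<phi> x) = (LBI x. u x * pderiv_dir i \<phi> x) - (LBI x. v x * pderiv_dir i \<phi> x)"
  unfolding left_diff_distrib by (rule Bochner_Integration.integral_diff) (use i2 w1 w2 in auto)
 also have "... = - (LBI x. g i x * \<phi> x) + (LBI x. h i x * \<phi> x)" using w1 w2 \<phi> by simp
 also have "... = - (LBI x. (g i x - h i x) * \<phi> x)"
  unfolding left_diff_distrib by (subst Bochner_Integration.integral_diff) (use i1 w1 w2 in auto)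
 finally show "(LBI x. (u x - v x) * pderiv_dir i \<phi> x) = - (LBI x. (g i x - h i x) * \<phi> x)" .
qed

lemma smooth_integrable_bounded:
 assumes f: "smooth f" and D: "D \<in> sets borel" "D \<subseteq> ball c s"
 shows "integrable lborel (\<lambda>x. f x * indicator D x)"
proof -
 have "integrable lborel (\<lambda>x. f x * indicator (ball c s) x * indicator D x)"
  by (rule integrable_mult_bounded[OF smooth_integrable_ball[OF f], of _ 1]) (use D in \<open>auto simp: indicator_def\<close>)
 moreover have "(\<lambda>x. f x * indicator (ball c s) x * indicator D x) = (\<lambda>x. f x * indicator D x)"
  using D by (auto simp: fun_eq_iff indicator_def)
 ultimately show ?thesis by simp
qed

lemma weak_grad_smooth:
 assumes f: "smooth f" and D: "D \<in> sets borel" "D \<subseteq> ball c s"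
 shows "weak_grad D (\<lambda>x. f x * indicator D x) (\<lambda>i x. pderiv_dir i f x * indicator D x)" unfolding weak_grad_def
proof (intro conjI allI impI smooth_integrable_bounded[OF _ D] f smooth_pderiv_dir)
 fix \<phi> i assume \<phi>: "test_function D \<phi>"
 have s: "smooth \<phi>" using \<phi> by (simp add: test_function_def)
 obtain R where R: "\<And>x. R < norm x \<Longrightarrow> \<phi> x = 0" using test_function_zero_outside_ball[OF \<phi>] by blast
 have "(\<lambda>x. f x * indicator D x * pderiv_dir i \<phi> x) = (\<lambda>x. f x * pderiv_dir i \<phi> x)"
  using test_function_zero[OF test_function_pderiv[OF \<phi>]] by (auto simp: fun_eq_iff indicator_def)
 moreover have "(\<lambda>x. pderiv_dir i f x * indicator D x * \<phi> x) = (\<lambda>x. pderiv_dir i f x * \<phi> x)"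
  using test_function_zero[OF \<phi>] by (auto simp: fun_eq_iff indicator_def)
 ultimately show "(LBI x. f x * indicator D x * pderiv_dir i \<phi> x) = - (LBI x. pderiv_dir i f x * indicator D x * \<phi> x)"
  using integral_by_parts[OF f s R, where i = i] by simp
qed

text \<open>\<open>g \<nu>\<close> plays the role of the weak derivative of order \<open>\<nu>\<close> of \<open>g 0\<close>.\<close>

definition weak_tower :: "nat \<Rightarrow> (real^'n::finite) set \<Rightarrow> (('n \<Rightarrow> nat) \<Rightarrow> real^'n \<Rightarrow> real) \<Rightarrow> bool" where
 "weak_tower m D g \<longleftrightarrow> (\<forall>\<nu>. mi_size \<nu> \<le> m \<longrightarrow> weak_grad D (g \<nu>) (\<lambda>i. g (\<nu>(i := Suc (\<nu> i)))))"

lemma weak_tower_minus_poly: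
 assumes g: "weak_tower m D' g" and P: "smooth P" and D: "D \<in> sets borel" "D \<subseteq> ball c s" "D \<subseteq> D'"
 shows "weak_tower m D (\<lambda>\<nu> x. g \<nu> x * indicator D x - mi_deriv \<nu> P x * indicator D x)" unfolding weak_tower_def
proof (intro allI impI)
 fix \<nu> :: "'a \<Rightarrow> nat" assume "mi_size \<nu> \<le> m"
 hence "weak_grad D (\<lambda>x. g \<nu> x * indicator D x) (\<lambda>i x. g (\<nu>(i := Suc (\<nu> i))) x * indicator D x)"
  using g D weak_grad_restrict unfolding weak_tower_def by blast
 thus "weak_grad D (\<lambda>x. g \<nu> x * indicator D x - mi_deriv \<nu> P x * indicator D x)
  (\<lambda>i x. g (\<nu>(i := Suc (\<nu> i))) x * indicator D x - mi_deriv (\<nu>(i := Suc (\<nu> i))) P x * indicator D x)"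
  unfolding mi_deriv_Suc(1)[OF P] by (rule weak_grad_diff) (rule weak_grad_smooth[OF smooth_mi_deriv[OF P] D(1,2)])
qed

context weighted_moll
begin

definition step_const :: real where "step_const = real CARD('n) powr p * real CARD('n)"

definition tower_const :: "real \<Rightarrow> real \<Rightarrow> real" where
 "tower_const \<beta> R = patch_const \<beta> R * step_const"

lemma step_const_nonneg: "0 \<le> step_const" by (simp add: step_const_def)

lemma tower_const_nonneg: "0 < \<beta> \<Longrightarrow> 0 \<le> tower_const \<beta> R"
 unfolding tower_const_def by (intro mult_nonneg_nonneg patch_const_nonneg step_const_nonneg)

end

context patch
begin

text \<open>Each order of differentiation costs one application of \<open>patch_estimate\<close>,
  that is one factor t, until order m + 1 is reached. The gradient version saves one such step,
  because \<open>patch_kernel\<close> starts from a bound by the gradient.\<close>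

lemma tower_estimate:
 assumes u: "weak_tower m X u"
  and z: "\<And>\<nu>. mi_size \<nu> \<le> m \<Longrightarrow> (LBI y. u \<nu> y * indicator (ball cT (\<beta> * h / 2)) y) = 0"
 defines "S \<equiv> \<Sum>\<nu> | mi_size \<nu> = Suc m. wint X (u \<nu>)" and "t \<equiv> tower_const \<beta> R * h powr p"
 shows tower_bound: "mi_size \<nu> \<le> Suc m \<Longrightarrow> wint X (u \<nu>) \<le> ennreal (t ^ (Suc m - mi_size \<nu>)) * S"
  and tower_grad_bound: "mi_size \<nu> \<le> m \<Longrightarrow>
   wint X (\<lambda>x. \<Sum>i\<in>UNIV. \<bar>u (\<nu>(i := Suc (\<nu> i))) x\<bar>) \<le> ennreal (step_const * t ^ (m - mi_size \<nu>)) * S"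
proof -
 have t: "0 \<le> t" unfolding t_def using tower_const_nonneg[OF beta_pos] by simp
 have [measurable]: "X \<in> sets borel" using open_X by simp
 have grad: "wint X (\<lambda>x. \<Sum>i\<in>UNIV. \<bar>u (\<nu>(i := Suc (\<nu> i))) x\<bar>) \<le> ennreal (step_const * t ^ (m - mi_size \<nu>)) * S"
  if k: "mi_size \<nu> \<le> m" and IH: "\<And>i. wint X (u (\<nu>(i := Suc (\<nu> i)))) \<le> ennreal (t ^ (m - mi_size \<nu>)) * S" for \<nu>
 proof -
  have wg: "weak_grad X (u \<nu>) (\<lambda>i. u (\<nu>(i := Suc (\<nu> i))))" using u k by (simp add: weak_tower_def)
  have "wint X (\<lambda>x. \<Sum>i\<in>UNIV. \<bar>u (\<nu>(i := Suc (\<nu> i))) x\<bar>) \<le> ennreal (real CARD('n) powr p) * (\<Sum>i\<in>UNIV. wint X (u (\<nu>(i := Suc (\<nu> i)))))"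
   by (rule wint_sum) (use weak_grad_borel(2)[OF wg] in auto)
  also have "... \<le> ennreal (real CARD('n) powr p) * (\<Sum>i\<in>(UNIV :: 'n set). ennreal (t ^ (m - mi_size \<nu>)) * S)"
   by (intro mult_left_mono sum_mono IH) auto
  also have "... = ennreal (real CARD('n) powr p) * (ennreal (real CARD('n)) * (ennreal (t ^ (m - mi_size \<nu>)) * S))"
   by (simp add: ennreal_of_nat_eq_real_of_nat)
  also have "... = ennreal (step_const * t ^ (m - mi_size \<nu>)) * S"
  proof -
   have "ennreal (step_const * t ^ (m - mi_size \<nu>)) = ennreal (real CARD('n) powr p) * ennreal (real CARD('n)) * ennreal (t ^ (m - mi_size \<nu>))"
    unfolding step_const_def using t by (subst ennreal_mult[symmetric] , simp, simp)+ simp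
   thus ?thesis by (simp only: mult.assoc)
  qed
  finally show ?thesis .
 qed
 have bound: "mi_size \<nu> + j = Suc m \<Longrightarrow> wint X (u \<nu>) \<le> ennreal (t ^ j) * S" for \<nu> j
 proof (induction j arbitrary: \<nu>)
  case 0
  hence "wint X (u \<nu>) \<le> S" unfolding S_def by (intro member_le_sum[of \<nu>]) (auto simp: finite_mi_eq)
  thus ?case by simp
 next
  case (Suc j)
  hence k: "mi_size \<nu> \<le> m" and j: "m - mi_size \<nu> = j" by auto
  have wg: "weak_grad X (u \<nu>) (\<lambda>i. u (\<nu>(i := Suc (\<nu> i))))" using u k by (simp add: weak_tower_def)
  have "wint X (u \<nu>) \<le> ennreal (patch_const \<beta> R * h powr p) * wint X (\<lambda>x. \<Sum>i\<in>UNIV. \<bar>u (\<nu>(i := Suc (\<nu> i))) x\<bar>)"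
   by (rule patch_estimate[OF wg z[OF k]])
  also have "... \<le> ennreal (patch_const \<beta> R * h powr p) * (ennreal (step_const * t ^ j) * S)"
   using grad[OF k, unfolded j] Suc.IH Suc.prems by (intro mult_left_mono) (auto simp: mi_size_Suc)
  also have "... = ennreal (t ^ Suc j) * S"
  proof -
   have "ennreal (patch_const \<beta> R * h powr p) * ennreal (step_const * t ^ j) = ennreal (t ^ Suc j)"
    using t patch_const_nonneg[OF beta_pos] step_const_nonneg
    by (subst ennreal_mult[symmetric]) (auto simp: t_def tower_const_def mult_ac)
   thus ?thesis by (simp only: mult.assoc[symmetric])
  qed
  finally show ?case .
 qed
 show "mi_size \<nu> \<le> Suc m \<Longrightarrow> wint X (u \<nu>) \<le> ennreal (t ^ (Suc m - mi_size \<nu>)) * S" by (rule bound) simp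
 assume k: "mi_size \<nu> \<le> m"
 show "wint X (\<lambda>x. \<Sum>i\<in>UNIV. \<bar>u (\<nu>(i := Suc (\<nu> i))) x\<bar>) \<le> ennreal (step_const * t ^ (m - mi_size \<nu>)) * S"
  by (rule grad[OF k]) (use k in \<open>auto intro!: bound simp: mi_size_Suc\<close>)
qed

end

lemma (in fat_mesh) card_nodes:
 assumes K: "K \<in> M" and m: "0 < m"
 shows "card (lagrange_nodes m K) \<le> Suc m ^ Suc CARD('n)"
proof -
 let ?V = "verts K" and ?N = "lagrange_nodes m K"
 note ni = node_index_sum[OF simp_M[OF K] m]
 let ?r = "\<lambda>z. restrict (node_index K m z) ?V"
 have "inj_on ?r ?N"
 proof (rule inj_onI)
  fix z y assume zy: "z \<in> ?N" "y \<in> ?N" and eq: "?r z = ?r y"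
  have "node_index K m z a = node_index K m y a" if "a \<in> ?V" for a using fun_cong[OF eq, of a] that by simp
  hence "node_of K m (node_index K m z) = node_of K m (node_index K m y)"
   unfolding node_of_def[OF simp_M[OF K]] by (intro sum.cong) auto
  thus "z = y" using ni(2) zy by simp
 qed
 moreover have "?r ` ?N \<subseteq> PiE ?V (\<lambda>_. {..m})"
 proof (intro image_subsetI PiE_I)
  fix z a assume z: "z \<in> ?N" and a: "a \<in> ?V"
  have "node_index K m z a \<le> (\<Sum>a\<in>?V. node_index K m z a)" using a finite_verts[OF K] by (intro member_le_sum) auto
  thus "?r z a \<in> {..m}" using a ni(1)[OF z] by simp
 qed auto
 ultimately have "card ?N \<le> card (PiE ?V (\<lambda>_. {..m}))"
  using finite_verts[OF K] by (intro card_inj_on_le) (auto intro: finite_PiE)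
 also have "... = Suc m ^ Suc CARD('n)"
  using full_simplex_verts(2)[OF simp_M[OF K]] finite_verts[OF K] by (simp add: card_PiE)
 finally show ?thesis .
qed

section \<open>Coefficients of the interpolation error at the nodes\<close>

context mollifier
begin

definition qcoef :: "nat \<Rightarrow> real \<Rightarrow> real^'n \<Rightarrow> (real^'n \<Rightarrow> real) \<Rightarrow> real" where
 "qcoef m \<eta> z v = (\<Sum>\<mu> | mi_size \<mu> \<le> m. (- 1) ^ mi_size \<mu> / mi_fact \<mu> * (LBI x. v x * taylor_term \<eta> z \<mu> x))"

lemma smooth_taylor_term: "smooth (taylor_term \<eta> z \<mu>)"
 unfolding taylor_term_def by (intro smooth_mi_deriv smooth_taylor)

lemma integrable_taylor_term:
 fixes u :: "real^'n \<Rightarrow> real"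
 assumes "integrable lborel u" "0 < \<eta>" shows "integrable lborel (\<lambda>x. u x * taylor_term \<eta> z \<mu> x)"
proof -
 obtain B where B: "\<And>x. \<bar>taylor_term \<eta> z \<mu> x\<bar> \<le> B" using taylor_term_bounded[OF assms(2)] by blast
 show ?thesis by (rule integrable_mult_bounded[OF assms(1) _ B]) (use smooth_borel[OF smooth_taylor_term] in simp)
qed

lemma qcoef_integral:
 fixes u :: "real^'n \<Rightarrow> real"
 assumes u: "integrable lborel u" and e: "0 < \<eta>"
 shows "qcoef m \<eta> z u = (LBI x. u x * qker m \<eta> z x)"
proof -
 have "(LBI x. u x * qker m \<eta> z x)
  = (LBI x. (\<Sum>\<mu> | mi_size \<mu> \<le> m. (- 1) ^ mi_size \<mu> / mi_fact \<mu> * (u x * taylor_term \<eta> z \<mu> x)))"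
  unfolding qker_def by (simp only: sum_distrib_left mult.left_commute)
 also have "... = (\<Sum>\<mu> | mi_size \<mu> \<le> m. \<integral>x. (- 1) ^ mi_size \<mu> / mi_fact \<mu> * (u x * taylor_term \<eta> z \<mu> x) \<partial>lborel)"
  by (rule Bochner_Integration.integral_sum) (intro integrable_mult_right integrable_taylor_term u e)
 finally show ?thesis unfolding qcoef_def by simp
qed

lemma integrable_smooth_taylor_term:
 fixes P :: "real^'n \<Rightarrow> real"
 assumes P: "smooth P" and e: "0 < \<eta>" shows "integrable lborel (\<lambda>x. P x * taylor_term \<eta> z \<mu> x)"
proof (rule bounded_support_integrable[of _ "norm z + r * \<eta>"])
 show "continuous_on UNIV (\<lambda>x. P x * taylor_term \<eta> z \<mu> x)"
  by (intro smooth_continuous smooth_mult P smooth_taylor_term)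
 fix x :: "real^'n" assume x: "norm z + r * \<eta> < norm x"
 have "taylor_term \<eta> z \<mu> x = 0" unfolding taylor_term_def
  by (rule mi_deriv_zero_outside[OF _ x]) (simp add: mker_zero_outside[OF e])
 thus "P x * taylor_term \<eta> z \<mu> x = 0" by simp
qed

text \<open>Only values on the support of the kernel matter, and there v splits into a reproduced
  polynomial and a globally integrable remainder.\<close>

lemma qcoef_decompose:
 fixes P u v :: "real^'n \<Rightarrow> real"
 assumes e: "0 < \<eta>" and P: "polyf m P" and u: "integrable lborel u"
  and supp: "AE x in lborel. x \<in> fsupport (mker \<eta> z) \<longrightarrow> v x = P x + u x" and v: "v \<in> borel_measurable borel"
 shows "qcoef m \<eta> z v = P z + (LBI x. u x * qker m \<eta> z x)"
proof -
 have sP: "smooth P" by (rule polyf_smooth[OF P])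
 have b: "taylor_term \<eta> z \<mu> \<in> borel_measurable borel" for \<mu> by (rule smooth_borel[OF smooth_taylor_term])
 have "(LBI x. v x * taylor_term \<eta> z \<mu> x) = (LBI x. P x * taylor_term \<eta> z \<mu> x) + (LBI x. u x * taylor_term \<eta> z \<mu> x)" for \<mu>
 proof -
  have "(LBI x. v x * taylor_term \<eta> z \<mu> x) = (LBI x. P x * taylor_term \<eta> z \<mu> x + u x * taylor_term \<eta> z \<mu> x)"
  proof (rule integral_cong_AE)
   show "(\<lambda>x. v x * taylor_term \<eta> z \<mu> x) \<in> borel_measurable lborel" using v b by simp
   show "(\<lambda>x. P x * taylor_term \<eta> z \<mu> x + u x * taylor_term \<eta> z \<mu> x) \<in> borel_measurable lborel"
    using smooth_borel[OF sP] b borel_measurable_integrable[OF u] by simp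
   show "AE x in lborel. v x * taylor_term \<eta> z \<mu> x = P x * taylor_term \<eta> z \<mu> x + u x * taylor_term \<eta> z \<mu> x"
    using supp
   proof eventually_elim
    case (elim x) thus ?case using taylor_term_zero[of x \<eta> z \<mu>] by (auto simp: distrib_right)
   qed
  qed
  also have "... = (LBI x. P x * taylor_term \<eta> z \<mu> x) + (LBI x. u x * taylor_term \<eta> z \<mu> x)"
   by (intro Bochner_Integration.integral_add integrable_smooth_taylor_term integrable_taylor_term sP u e)
  finally show ?thesis .
 qed
 hence "qcoef m \<eta> z v = qcoef m \<eta> z P + qcoef m \<eta> z u" unfolding qcoef_def by (simp add: distrib_left sum.distrib)
 also have "qcoef m \<eta> z P = P z" unfolding qcoef_def by (rule taylor_reproduction[OF e P])
 finally show ?thesis unfolding qcoef_integral[OF u e] .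
qed

lemma qker_zero: "x \<notin> fsupport (mker \<eta> z) \<Longrightarrow> qker m \<eta> z x = 0" unfolding qker_def by (simp add: taylor_term_zero)

lemma fsupport_mker:
 assumes e: "0 < \<eta>" shows "fsupport (mker \<eta> z) \<subseteq> cball z (r * \<eta>)" unfolding fsupport_def
proof (rule closure_minimal)
 show "{x. mker \<eta> z x \<noteq> 0} \<subseteq> cball z (r * \<eta>)" using mker_zero[OF e, of z] by (auto simp: not_less[symmetric])
qed simp

end

lemma AE_not_frontier:
 assumes "finite F" "\<And>K. K \<in> F \<Longrightarrow> convex (K :: 'a::euclidean_space set)"
 shows "AE x in lborel. \<forall>K\<in>F. x \<notin> frontier K"
proof -
 have "negligible (frontier K)" if "K \<in> F" for K using assms that by (intro negligible_convex_frontier) auto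
 hence "AE x in lborel. x \<notin> frontier K" if "K \<in> F" for K using that AE_not_in[of "frontier K" lborel]
  by (simp add: null_sets_def negligible_iff_emeasure0 borel_closed)
 thus ?thesis using assms(1) by (simp add: AE_finite_all)
qed

context patch
begin

text \<open>A node of T need not be a vertex, but the intersection of T with an element containing
  the node is spanned by common vertices, and one of them places the element in a star.\<close>

lemma near_node:
 assumes z: "z \<in> T" and K: "K \<in> M" "z \<in> K"
 obtains a where "a \<in> verts T" "K \<in> star a" "dist z a \<le> h"
proof -
 have "verts T \<inter> verts K \<noteq> {}" using inter_hull[OF T_M K(1)] z K(2) by auto
 then obtain a where a: "a \<in> verts T" "a \<in> verts K" by blast
 show thesis
 proof (rule that[OF a(1)])
  show "K \<in> star a" using a verts_subset[OF K(1)] K(1) by (auto simp: star_def)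
  show "dist z a \<le> h" unfolding h_def using dist_le_diameter[OF T_M z verts_T[OF a(1)]] .
 qed
qed

lemma node_size_props:
 assumes z: "z \<in> T"
 shows "0 < node_size M z" "node_size M z \<le> h" "2 \<le> CARD('n) \<Longrightarrow> size_ratio \<beta> * h \<le> node_size M z"
proof -
 let ?F = "{K \<in> M. z \<in> K}"
 have F: "finite (diameter ` ?F)" "diameter ` ?F \<noteq> {}" using finite_M T_M z by auto
 show "0 < node_size M z" unfolding node_size_def using F diameter_pos by (subst Min_gr_iff) auto
 show "node_size M z \<le> h" unfolding node_size_def h_def using F(1) T_M z by (intro Min_le) auto
 assume n: "2 \<le> CARD('n)"
 show "size_ratio \<beta> * h \<le> node_size M z" unfolding node_size_def using F
 proof (intro Min.boundedI)
  fix d assume "d \<in> diameter ` ?F"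
  then obtain K where K: "K \<in> M" "z \<in> K" "d = diameter K" by auto
  obtain a where "a \<in> verts T" "K \<in> star a" using near_node[OF z K(1,2)] by blast
  thus "size_ratio \<beta> * h \<le> d" unfolding K(3) by (rule size_ratio_le[OF n])
 qed
qed

text \<open>From z to the vertex the distance is at most h, and the kernel reaches at most r \<eta>
  \<le> r h, so the cut-off factor r + 2 leaves a strict margin. Points on element boundaries form a
  null set.\<close>

lemma node_support:
 assumes z: "z \<in> T" and e: "0 < \<eta>" "\<eta> \<le> h" and R: "r + 2 \<le> R" and supp: "fsupport (mker \<eta> z) \<subseteq> node_star M z"
 shows "AE x in lborel. x \<in> fsupport (mker \<eta> z) \<longrightarrow> x \<in> X"
 using AE_not_frontier[of M, OF finite_M, OF convex_M, simplified]
proof eventually_elim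
 case (elim x)
 show ?case
 proof
  assume x: "x \<in> fsupport (mker \<eta> z)"
  then obtain K where K: "K \<in> M" "z \<in> K" "x \<in> K" using supp by (auto simp: node_star_def)
  hence xi: "x \<in> interior K" using elim closed_M[OF K(1)] by (auto simp: frontier_def)
  obtain a where a: "a \<in> verts T" "K \<in> star a" "dist z a \<le> h" using near_node[OF z K(1,2)] .
  have "dist z x \<le> r * \<eta>" using fsupport_mker[OF e(1), of z] x by auto
  also have "... \<le> r * h" using e(2) r_pos by simp
  finally have "dist a x \<le> h + r * h" using a(3) dist_triangle[of a x z] by (simp add: dist_commute)
  also have "... < (r + 2) * h" using h_pos by (simp add: distrib_right)
  also have "... \<le> R * h" using R h_pos by simp
  finally have "x \<in> piece a K" using xi by (simp add: piece_def)
  thus "x \<in> X" unfolding X_def pieces_def using a by auto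
 qed
qed

end

context weighted_moll
begin

text \<open>The height argument combines the bound of the profile with the smallest possible scale,
  \<open>size_ratio\<close> times h / (m + 1).\<close>

definition coef_const :: "nat \<Rightarrow> real \<Rightarrow> real \<Rightarrow> real" where
 "coef_const m \<beta> R = kernel_const \<beta> R (qbound m * ((real m + 1) / size_ratio \<beta>) ^ CARD('n)) (qmass m)
   * step_const * tower_const \<beta> R ^ m"

lemma coef_const_nonneg: "0 < \<beta> \<Longrightarrow> 0 \<le> coef_const m \<beta> R"
 unfolding coef_const_def by (intro mult_nonneg_nonneg kernel_const_nonneg step_const_nonneg zero_le_power tower_const_nonneg)

end

context patch
begin

text \<open>The coefficient is paired with the weight of T because it multiplies a basis function on
  T. One factor h^p comes from \<open>patch_kernel\<close> and m more from the tower, matching the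
  order m + 1.\<close>

lemma coefficient_estimate:
 fixes m :: nat
 assumes u: "weak_tower m X u"
  and mz: "\<And>\<nu>. mi_size \<nu> \<le> m \<Longrightarrow> (LBI y. u \<nu> y * indicator (ball cT (\<beta> * h / 2)) y) = 0"
  and z: "z \<in> T" and R: "r + 2 \<le> R"
 defines "\<eta> \<equiv> node_size M z / (real m + 1)"
 assumes supp: "fsupport (mker \<eta> z) \<subseteq> node_star M z"
 shows "ennreal (\<bar>\<integral>x. u (\<lambda>_. 0) x * qker m \<eta> z x \<partial>lborel\<bar> powr p) * wint T (\<lambda>_. 1)
  \<le> ennreal (coef_const m \<beta> R * (h powr p) ^ Suc m) * (\<Sum>\<nu> | mi_size \<nu> = Suc m. wint X (u \<nu>))"
proof -
 let ?S = "\<Sum>\<nu> | mi_size \<nu> = Suc m. wint X (u \<nu>)" and ?u = "u (\<lambda>_. 0)"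
 let ?k1 = "qbound m * ((real m + 1) / size_ratio \<beta>) ^ CARD('n)"
 let ?k = "\<lambda>x. qker m \<eta> z x * indicator X x"
 note ns = node_size_props[OF z]
 have e: "0 < \<eta>" "\<eta> \<le> h" unfolding \<eta>_def using ns using divide_left_mono[of 1 "real m + 1" "node_size M z"] by auto
 have [measurable]: "X \<in> sets borel" using open_X by simp
 have s: "smooth (qker m \<eta> z)" unfolding qker_def[abs_def] by (intro smooth_sum smooth_mult[OF smooth_const] smooth_taylor_term)
 have [measurable]: "qker m \<eta> z \<in> borel_measurable borel" by (rule smooth_borel[OF s])
 have z0: "mi_size (\<lambda>_::'n. 0) = 0" by (simp add: mi_size_eq_0)
 have wg: "weak_grad X ?u (\<lambda>i. u ((\<lambda>_. 0)(i := Suc 0)))" using u z0 unfolding weak_tower_def by fastforce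
 have [measurable]: "?u \<in> borel_measurable borel" by (rule weak_grad_borel(1)[OF wg])
 have sr: "0 < size_ratio \<beta>" by (rule size_ratio)
 have qm: "0 \<le> qmass m" by (simp add: qmass_def)
 have "ennreal \<bar>\<integral>x. ?u x * qker m \<eta> z x \<partial>lborel\<bar> = ennreal \<bar>\<integral>x. ?u x * ?k x \<partial>lborel\<bar>"
 proof -
  have "(LBI x. ?u x * qker m \<eta> z x) = (LBI x. ?u x * ?k x)"
  proof (rule integral_cong_AE)
   show "AE x in lborel. ?u x * qker m \<eta> z x = ?u x * ?k x" using node_support[OF z e R supp]
   proof eventually_elim
    case (elim x) thus ?case using qker_zero[of x \<eta> z m] by (cases "x \<in> X") auto
   qed
  qed auto
  thus ?thesis by simp
 qed
 also have "... \<le> (LBNN x. ennreal \<bar>?u x * ?k x\<bar>)" by (rule integral_norm_le_nn)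
 finally have "epow p (ennreal \<bar>\<integral>x. ?u x * qker m \<eta> z x \<partial>lborel\<bar>) * wint T (\<lambda>_. 1)
  \<le> epow p (LBNN x. ennreal \<bar>?u x * ?k x\<bar>) * wint T (\<lambda>_. 1)" using p_gt_1 by (intro mult_right_mono epow_mono) auto
 also have "... \<le> ennreal (kernel_const \<beta> R ?k1 (qmass m) * h powr p) * wint X (\<lambda>x. \<Sum>i\<in>UNIV. \<bar>u ((\<lambda>_. 0)(i := Suc 0)) x\<bar>)"
 proof (rule patch_kernel[OF wg])
  show "(LBI y. ?u y * indicator (ball cT (\<beta> * h / 2)) y) = 0" by (rule mz) (simp add: z0)
  show "?k x = 0" if "x \<notin> X" for x using that by simp
  show "0 \<le> ?k1" using qbound(1) sr by (intro mult_nonneg_nonneg) (auto intro: less_imp_le)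
  have "(LBNN x. ennreal \<bar>?k x\<bar>) \<le> (LBNN x. ennreal \<bar>qker m \<eta> z x\<bar>)"
   by (intro nn_integral_mono) (auto simp: indicator_def)
  thus "(LBNN x. ennreal \<bar>?k x\<bar>) \<le> ennreal (qmass m)" by (simp add: qker_mass[OF e(1)])
  show "\<forall>x. \<bar>?k x\<bar> \<le> ?k1 / h ^ CARD('n)" if n: "2 \<le> CARD('n)"
  proof
   fix x
   have "\<bar>?k x\<bar> \<le> \<bar>qker m \<eta> z x\<bar>" by (auto simp: indicator_def)
   also have "... \<le> qbound m / \<eta> ^ CARD('n)" by (rule qker_bound[OF e(1)])
   also have "... \<le> qbound m / (size_ratio \<beta> * h / (real m + 1)) ^ CARD('n)"
   proof (intro divide_left_mono power_mono)
    show "size_ratio \<beta> * h / (real m + 1) \<le> \<eta>" unfolding \<eta>_def using ns(3)[OF n] by (intro divide_right_mono) auto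
   qed (use sr h_pos e(1) qbound(1)[of m] in auto)
   also have "... = ?k1 / h ^ CARD('n)" by (simp add: power_divide power_mult_distrib)
   finally show "\<bar>?k x\<bar> \<le> ?k1 / h ^ CARD('n)" .
  qed
 qed (use qm in measurable)
 also have "... \<le> ennreal (kernel_const \<beta> R ?k1 (qmass m) * h powr p) * (ennreal (step_const * (tower_const \<beta> R * h powr p) ^ m) * ?S)"
  using tower_grad_bound[OF u mz, of "\<lambda>_. 0"] z0 by (intro mult_left_mono) auto
 also have "... = ennreal (coef_const m \<beta> R * (h powr p) ^ Suc m) * ?S"
 proof -
  have "ennreal (kernel_const \<beta> R ?k1 (qmass m) * h powr p) * ennreal (step_const * (tower_const \<beta> R * h powr p) ^ m)
   = ennreal (coef_const m \<beta> R * (h powr p) ^ Suc m)"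
   using kernel_const_nonneg[OF beta_pos] step_const_nonneg tower_const_nonneg[OF beta_pos]
   by (subst ennreal_mult[symmetric]) (auto simp: coef_const_def power_mult_distrib mult_ac)
  thus ?thesis by (simp only: mult.assoc[symmetric])
 qed
 finally show ?thesis by (simp add: epow_ennreal)
qed

end

lemma weak_tower_integrable:
 assumes g: "weak_tower m D g" and k: "mi_size \<nu> \<le> Suc m" shows "integrable lborel (g \<nu>)"
proof (cases "mi_size \<nu> \<le> m")
 case True thus ?thesis using g by (simp add: weak_tower_def weak_grad_def)
next
 case False
 hence k: "mi_size \<nu> = Suc m" using k by simp
 then obtain i where i: "0 < \<nu> i" using mi_size_eq_0[of \<nu>] by fastforce
 let ?l = "\<nu>(i := \<nu> i - 1)"
 have l: "\<nu> = ?l(i := Suc (?l i))" using i by auto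
 hence "mi_size ?l \<le> m" using mi_size_Suc[of ?l i] k by simp
 hence "integrable lborel (g (?l(i := Suc (?l i))))" using g unfolding weak_tower_def weak_grad_def by blast
 thus ?thesis using l by simp
qed

context weighted_moll
begin

definition element_const :: "nat \<Rightarrow> real \<Rightarrow> real \<Rightarrow> real" where
 "element_const m \<beta> R = 2 powr p * ((1 + tower_const \<beta> R) ^ Suc m +
   real (Suc m ^ Suc CARD('n)) powr p * real (Suc m ^ Suc CARD('n)) *
   (((2 * real m) ^ m * (1 + real m / (2 * \<beta>)) ^ Suc m) powr p * coef_const m \<beta> R))"

lemma element_const_nonneg: "0 < \<beta> \<Longrightarrow> 0 \<le> element_const m \<beta> R" unfolding element_const_def
 by (intro mult_nonneg_nonneg add_nonneg_nonneg coef_const_nonneg zero_le_power tower_const_nonneg) auto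

end

lemma (in fat_mesh) phi_deriv_bound:
 assumes K: "K \<in> M" and m: "0 < m" and z: "z \<in> lagrange_nodes m K" and x: "x \<in> K" and k: "mi_size \<nu> \<le> Suc m"
 shows "\<bar>mi_deriv \<nu> (phi K m (node_index K m z)) x\<bar>
  \<le> (2 * real m) ^ m * (1 + real m / (2 * \<beta>)) ^ Suc m / diameter K ^ mi_size \<nu>"
proof -
 let ?f = "phi K m (node_index K m z)" and ?k = "mi_size \<nu>"
 have d: "dbound K ((2 * real m) ^ m) (real m / (2 * \<beta> * diameter K)) ?f"
  by (rule dbound_phi[OF K m node_index_sum(1)[OF simp_M[OF K] m z]])
 hence s: "smooth ?f" by (simp add: dbound_def)
 obtain js where js: "length js = ?k" "mi_deriv \<nu> ?f = pderiv_list js ?f" using mi_deriv_list[OF s] by blast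
 have "\<bar>mi_deriv \<nu> ?f x\<bar> \<le> (2 * real m) ^ m * (real m / (2 * \<beta> * diameter K)) ^ ?k"
  using d x unfolding js(2) js(1)[symmetric] dbound_def by blast
 also have "... = (2 * real m) ^ m * (real m / (2 * \<beta>)) ^ ?k / diameter K ^ ?k"
  by (simp add: power_divide power_mult_distrib)
 also have "... \<le> (2 * real m) ^ m * (1 + real m / (2 * \<beta>)) ^ Suc m / diameter K ^ ?k"
 proof (intro divide_right_mono mult_left_mono)
  have "(real m / (2 * \<beta>)) ^ ?k \<le> (1 + real m / (2 * \<beta>)) ^ ?k" using beta_pos by (intro power_mono) auto
  also have "... \<le> (1 + real m / (2 * \<beta>)) ^ Suc m" using k beta_pos by (intro power_increasing) auto
  finally show "(real m / (2 * \<beta>)) ^ ?k \<le> (1 + real m / (2 * \<beta>)) ^ Suc m" .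
 qed (use diameter_pos[OF K] in auto)
 finally show ?thesis .
qed

context patch
begin

text \<open>Derivatives of basis functions cost h^(-k) with k the order of \<nu>, which lowers the
  power m + 1 supplied by the coefficients to m + 1 - k.\<close>

lemma nodal_error_estimate:
 fixes c :: "real^'n \<Rightarrow> real"
 assumes m: "0 < m" and k: "mi_size \<nu> \<le> Suc m"
  and c: "\<And>z. z \<in> lagrange_nodes m T \<Longrightarrow> ennreal (\<bar>c z\<bar> powr p) * wint T (\<lambda>_. 1) \<le> ennreal (C * (h powr p) ^ Suc m) * S"
  and C: "0 \<le> C"
 shows "wint T (\<lambda>x. \<Sum>z\<in>lagrange_nodes m T. c z * mi_deriv \<nu> (phi T m (node_index T m z)) x)
  \<le> ennreal (real (Suc m ^ Suc CARD('n)) powr p * real (Suc m ^ Suc CARD('n)) *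
   (((2 * real m) ^ m * (1 + real m / (2 * \<beta>)) ^ Suc m) powr p * C) * (h powr p) ^ (Suc m - mi_size \<nu>)) * S"
proof -
 let ?N = "lagrange_nodes m T" and ?k = "mi_size \<nu>" and ?D = "(2 * real m) ^ m * (1 + real m / (2 * \<beta>)) ^ Suc m"
 let ?n = "real (Suc m ^ Suc CARD('n))" and ?H = "h powr p" and ?B = "sets borel :: (real^'n) set set"
 have T: "T \<in> ?B" using closed_M[OF T_M] by simp
 have fin: "finite ?N" by (rule finite_nodes[OF simp_M[OF T_M] m])
 have D0: "0 \<le> ?D" using beta_pos by simp
 have card: "real (card ?N) \<le> ?n" using card_nodes[OF T_M m] by (simp only: of_nat_le_iff)
 have one: "wint T (\<lambda>_. c z * (?D / h ^ ?k)) \<le> ennreal (?D powr p * C * ?H ^ (Suc m - ?k)) * S" if z: "z \<in> ?N" for z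
 proof -
  have hp: "(h ^ ?k) powr p = ?H ^ ?k" using h_pos by (simp add: powr_powr powr_realpow[symmetric] mult.commute)
  have "\<bar>c z * (?D / h ^ ?k)\<bar> powr p = ?D powr p / ?H ^ ?k * \<bar>c z\<bar> powr p"
  proof -
   have "\<bar>d / h ^ ?k\<bar> powr p = d powr p / ?H ^ ?k" if "0 \<le> d" for d :: real
    using that h_pos by (simp add: powr_divide hp)
   from this[OF D0] show ?thesis unfolding abs_mult[of "c z"] by (subst powr_mult) (auto simp only: mult.commute abs_ge_zero)
  qed
  hence "wint T (\<lambda>_. c z * (?D / h ^ ?k)) = ennreal (?D powr p / ?H ^ ?k) * ennreal (\<bar>c z\<bar> powr p) * wint T (\<lambda>_. 1)"
   unfolding wint_const[OF T, of "c z * (?D / h ^ ?k)"] using h_pos by (simp add: ennreal_mult[symmetric])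
  also have "... \<le> ennreal (?D powr p / ?H ^ ?k) * (ennreal (C * ?H ^ Suc m) * S)"
   unfolding mult.assoc using c[OF z] by (intro mult_left_mono) auto
  also have "... = ennreal (?D powr p / ?H ^ ?k * (C * ?H ^ Suc m)) * S"
  proof -
   have "0 \<le> C * ?H ^ Suc m" using C by simp
   from ennreal_mult[OF _ this, of "?D powr p / ?H ^ ?k"] show ?thesis by (simp only: mult.assoc zero_le_divide_iff powr_ge_zero zero_le_power simp_thms)
  qed
  also have "?D powr p / ?H ^ ?k * (C * ?H ^ Suc m) = ?D powr p * C * ?H ^ (Suc m - ?k)"
   using k h_pos by (simp add: power_diff del: power_Suc)
  finally show ?thesis .
 qed
 have "wint T (\<lambda>x. \<Sum>z\<in>?N. c z * mi_deriv \<nu> (phi T m (node_index T m z)) x) \<le> wint T (\<lambda>x. \<Sum>z\<in>?N. \<bar>c z * (?D / h ^ ?k)\<bar>)"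
 proof (rule wint_mono[OF subset_refl])
  fix x assume x: "x \<in> T"
  have "\<bar>\<Sum>z\<in>?N. c z * mi_deriv \<nu> (phi T m (node_index T m z)) x\<bar> \<le> (\<Sum>z\<in>?N. \<bar>c z * mi_deriv \<nu> (phi T m (node_index T m z)) x\<bar>)"
   by (rule sum_abs)
  also have "... \<le> (\<Sum>z\<in>?N. \<bar>c z * (?D / h ^ ?k)\<bar>)"
  proof (rule sum_mono)
   fix z assume z: "z \<in> ?N"
   have "\<bar>mi_deriv \<nu> (phi T m (node_index T m z)) x\<bar> \<le> \<bar>?D / h ^ ?k\<bar>"
    using phi_deriv_bound[OF T_M m z x k] unfolding h_def[symmetric] by linarith
   thus "\<bar>c z * mi_deriv \<nu> (phi T m (node_index T m z)) x\<bar> \<le> \<bar>c z * (?D / h ^ ?k)\<bar>"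
    unfolding abs_mult[of "c z"] by (rule mult_left_mono) simp
  qed
  finally show "\<bar>\<Sum>z\<in>?N. c z * mi_deriv \<nu> (phi T m (node_index T m z)) x\<bar> \<le> \<bar>\<Sum>z\<in>?N. \<bar>c z * (?D / h ^ ?k)\<bar>\<bar>" by linarith
 qed
 also have "... \<le> ennreal (real (card ?N) powr p) * (\<Sum>z\<in>?N. wint T (\<lambda>_. c z * (?D / h ^ ?k)))"
  by (rule wint_sum[OF fin _ T]) simp
 also have "... \<le> ennreal (?n powr p) * (ennreal ?n * (ennreal (?D powr p * C * ?H ^ (Suc m - ?k)) * S))"
 proof (intro mult_mono ennreal_leI powr_mono2 card)
  have "(\<Sum>z\<in>?N. wint T (\<lambda>_. c z * (?D / h ^ ?k))) \<le> of_nat (card ?N) * (ennreal (?D powr p * C * ?H ^ (Suc m - ?k)) * S)"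
   by (rule sum_bounded_above[OF one])
  also have "... \<le> ennreal ?n * (ennreal (?D powr p * C * ?H ^ (Suc m - ?k)) * S)"
   unfolding ennreal_of_nat_eq_real_of_nat using card by (intro mult_right_mono ennreal_leI) auto
  finally show "(\<Sum>z\<in>?N. wint T (\<lambda>_. c z * (?D / h ^ ?k))) \<le> ennreal ?n * (ennreal (?D powr p * C * ?H ^ (Suc m - ?k)) * S)" .
 qed (use p_gt_1 in auto)
 also have "... = ennreal (?n powr p * ?n * (?D powr p * C) * ?H ^ (Suc m - ?k)) * S"
 proof -
  have a: "0 \<le> ?D powr p * C * ?H ^ (Suc m - ?k)" using C by simp
  have "?n powr p * ?n * (?D powr p * C) * ?H ^ (Suc m - ?k) = ?n powr p * (?n * (?D powr p * C * ?H ^ (Suc m - ?k)))"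
   by (simp only: mult.assoc)
  thus ?thesis
   using ennreal_mult[of "?n powr p" "?n * (?D powr p * C * ?H ^ (Suc m - ?k))"] ennreal_mult[OF _ a, of ?n] a
   by (simp only: mult.assoc of_nat_0_le_iff powr_ge_zero mult_nonneg_nonneg)
 qed
 finally show ?thesis .
qed

theorem element_estimate:
 fixes m :: nat and g :: "('n \<Rightarrow> nat) \<Rightarrow> real^'n \<Rightarrow> real"
 assumes m: "0 < m" and g: "weak_tower m D g" and D: "X \<subseteq> D" and R: "r + 2 \<le> R"
  and supp: "\<And>z. z \<in> lagrange_nodes m T \<Longrightarrow> fsupport (mker (node_size M z / (real m + 1)) z) \<subseteq> node_star M z"
  and k: "mi_size \<nu> \<le> Suc m"
 defines "Q \<equiv> \<lambda>x. \<Sum>z\<in>lagrange_nodes m T. qcoef m (node_size M z / (real m + 1)) z (g (\<lambda>_. 0)) * phi T m (node_index T m z) x"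
 shows "wint (interior T) (\<lambda>x. g \<nu> x - mi_deriv \<nu> Q x)
  \<le> ennreal (element_const m \<beta> R * (h powr p) ^ (Suc m - mi_size \<nu>)) * (\<Sum>\<nu>' | mi_size \<nu>' = Suc m. wint D (g \<nu>'))"
proof -
 let ?Z = "((2 * real m) ^ m * (1 + real m / (2 * \<beta>)) ^ Suc m) powr p * coef_const m \<beta> R" and ?Y = "1 + tower_const \<beta> R" and ?X = "Suc m ^ Suc CARD('n)"
 let ?N = "lagrange_nodes m T" and ?\<eta> = "\<lambda>z. node_size M z / (real m + 1)" and ?\<phi> = "\<lambda>z. phi T m (node_index T m z)"
 let ?b = "indicator (ball cT (\<beta> * h / 2)) :: real^'n \<Rightarrow> real" and ?j = "Suc m - mi_size \<nu>"
 \<comment> \<open>The means are prescribed on the ball inside T for all orders up to m, so that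
   every level of the difference tower below the top qualifies for
   \<open>patch_estimate\<close>.\<close>
 obtain P where P: "polyf m P" "\<And>\<nu>. mi_size \<nu> \<le> m \<Longrightarrow> (LBI x. mi_deriv \<nu> P x * ?b x) = (LBI x. g \<nu> x * ?b x)"
  using polynomial_prescribed_averages[of "\<beta> * h / 2" m cT "\<lambda>\<nu>. \<integral>x. g \<nu> x * ?b x \<partial>lborel"] beta_pos h_pos by auto
 have sP: "smooth P" by (rule polyf_smooth[OF P(1)])
 define u where "u = (\<lambda>\<nu> x. g \<nu> x * indicator X x - mi_deriv \<nu> P x * indicator X x)"
 have Xb: "X \<in> sets borel" using open_X by simp
 obtain a0 where "a0 \<in> verts T" using full_simplex_verts(2)[OF simp_M[OF T_M]] by fastforce
 hence XB: "X \<subseteq> ball a0 ((R + 1) * h)" by (rule X_ball(1))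
 have u: "weak_tower m X u" unfolding u_def by (rule weak_tower_minus_poly[OF g sP Xb XB D])
 note gk = weak_tower_integrable[OF g]
 have bX: "ball cT (\<beta> * h / 2) \<subseteq> X" using ball_cT interior_T_X subset_ball[of "\<beta> * h / 2" "2 * (\<beta> * h / 2)" cT] beta_pos h_pos by force
 have mz: "(LBI y. u \<nu> y * ?b y) = 0" if k: "mi_size \<nu> \<le> m" for \<nu>
 proof -
  have "(\<lambda>y. u \<nu> y * ?b y) = (\<lambda>y. g \<nu> y * ?b y - mi_deriv \<nu> P y * ?b y)"
   using bX by (auto simp: u_def fun_eq_iff indicator_def)
  moreover have "integrable lborel (\<lambda>y. g \<nu> y * ?b y)"
   by (rule integrable_mult_bounded[OF gk, of _ _ 1]) (use k in \<open>auto simp: indicator_def\<close>)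
  ultimately show ?thesis using P(2)[OF k] smooth_integrable_ball[OF smooth_mi_deriv[OF sP], of \<nu>] by simp
 qed
 \<comment> \<open>At order m + 1 the derivatives of P vanish, so the top level of the difference is
   the original one on the patch.\<close>
 define S where "S = (\<Sum>\<nu> | mi_size \<nu> = Suc m. wint X (u \<nu>))"
 have S: "S \<le> (\<Sum>\<nu> | mi_size \<nu> = Suc m. wint D (g \<nu>))" unfolding S_def
 proof (intro sum_mono wint_mono D)
  fix \<nu> :: "'n \<Rightarrow> nat" and x assume "\<nu> \<in> {\<nu>. mi_size \<nu> = Suc m}" "x \<in> X"
  thus "\<bar>u \<nu> x\<bar> \<le> \<bar>g \<nu> x\<bar>" using mi_deriv_polyf_zero[OF P(1), of \<nu>] by (simp add: u_def)
 qed
 define c where "c z = (LBI x. u (\<lambda>_. 0) x * qker m (?\<eta> z) z x)" for z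
 have NT: "z \<in> T" if "z \<in> ?N" for z using nodes_subset[OF T_M m that] .
 have z0: "mi_size (\<lambda>_::'n. 0) = 0" by (simp add: mi_size_eq_0)
 have u0: "integrable lborel (u (\<lambda>_. 0))" using u z0 by (simp add: weak_tower_def weak_grad_def)
 have q: "qcoef m (?\<eta> z) z (g (\<lambda>_. 0)) = P z + c z" if z: "z \<in> ?N" for z unfolding c_def
 proof (rule qcoef_decompose[OF _ P(1) u0])
  note ns = node_size_props[OF NT[OF z]]
  show e: "0 < ?\<eta> z" using ns by simp
  have "?\<eta> z \<le> h" using ns divide_left_mono[of 1 "real m + 1" "node_size M z"] by auto
  from node_support[OF NT[OF z] e this R supp[OF z]]
  show "AE x in lborel. x \<in> fsupport (mker (?\<eta> z) z) \<longrightarrow> g (\<lambda>_. 0) x = P x + u (\<lambda>_. 0) x"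
   by eventually_elim (simp add: u_def mi_deriv_zero)
  show "g (\<lambda>_. 0) \<in> borel_measurable borel" using borel_measurable_integrable[OF gk[of "\<lambda>_. 0"]] z0 by simp
 qed
 have s\<phi>: "smooth (?\<phi> z)" for z using polyf_smooth[OF polyf_phi[OF finite_verts[OF T_M]]] .
 have Q: "Q = (\<lambda>x. P x + (\<Sum>z\<in>?N. c z * ?\<phi> z x))"
 proof
  fix x
  have "Q x = (\<Sum>z\<in>?N. (P z + c z) * ?\<phi> z x)" unfolding Q_def by (rule sum.cong) (auto simp: q)
  also have "... = (\<Sum>z\<in>?N. P z * ?\<phi> z x) + (\<Sum>z\<in>?N. c z * ?\<phi> z x)" by (simp add: distrib_right sum.distrib)
  also have "(\<Sum>z\<in>?N. P z * ?\<phi> z x) = P x" using lagrange_interpolation[OF simp_M[OF T_M] m P(1), of x] by simp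
  finally show "Q x = P x + (\<Sum>z\<in>?N. c z * ?\<phi> z x)" .
 qed
 have ss: "smooth (\<lambda>x. c z * ?\<phi> z x)" for z by (rule smooth_mult[OF smooth_const s\<phi>])
 have dQ: "mi_deriv \<nu> Q x = mi_deriv \<nu> P x + (\<Sum>z\<in>?N. c z * mi_deriv \<nu> (?\<phi> z) x)" for x
  unfolding Q mi_deriv_add[OF sP smooth_sum[OF ss]] mi_deriv_sum[OF ss] mi_deriv_cmult[OF s\<phi>] ..
 let ?E = "\<lambda>x. \<Sum>z\<in>?N. c z * mi_deriv \<nu> (?\<phi> z) x"
 have Eb: "?E \<in> borel_measurable borel" by (intro borel_measurable_sum borel_measurable_times borel_measurable_const smooth_borel[OF smooth_mi_deriv[OF s\<phi>]])
 have ub: "u \<nu> \<in> borel_measurable borel"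
  using borel_measurable_integrable[OF gk[OF k]] smooth_borel[OF smooth_mi_deriv[OF sP, of \<nu>]] Xb unfolding u_def by simp
 have "wint (interior T) (\<lambda>x. g \<nu> x - mi_deriv \<nu> Q x) \<le> wint (interior T) (\<lambda>x. u \<nu> x + - 1 * ?E x)"
  using interior_T_X by (intro wint_mono) (auto simp: u_def dQ)
 also have "... \<le> ennreal (2 powr p) * (wint (interior T) (u \<nu>) + wint (interior T) (\<lambda>x. - 1 * ?E x))"
  by (rule wint_add) (use ub Eb in auto)
 also have "... \<le> ennreal (2 powr p) * (wint X (u \<nu>) + wint T ?E)"
  using interior_T_X interior_subset[of T] by (intro mult_left_mono add_mono wint_mono) auto
 also have "... \<le> ennreal (2 powr p) * (ennreal (?Y ^ Suc m * (h powr p) ^ ?j) * S + ennreal (real ?X powr p * real ?X *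
   ?Z * (h powr p) ^ ?j) * S)"
 proof (intro mult_left_mono add_mono)
  have t: "0 \<le> tower_const \<beta> R" by (rule tower_const_nonneg[OF beta_pos])
  have "tower_const \<beta> R ^ ?j \<le> ?Y ^ ?j" using t by (intro power_mono) auto
  also have "... \<le> ?Y ^ Suc m" using t by (intro power_increasing) auto
  finally have "(tower_const \<beta> R * h powr p) ^ ?j \<le> ?Y ^ Suc m * (h powr p) ^ ?j"
   unfolding power_mult_distrib by (rule mult_right_mono) simp
  thus "wint X (u \<nu>) \<le> ennreal (?Y ^ Suc m * (h powr p) ^ ?j) * S"
   using order_trans[OF tower_bound[OF u mz k, folded S_def] mult_right_mono[OF ennreal_leI]] by simp
  show "wint T ?E \<le> ennreal (real ?X powr p * real ?X *
   ?Z * (h powr p) ^ ?j) * S"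
  proof (rule nodal_error_estimate[OF m k _ coef_const_nonneg[OF beta_pos]])
   fix z assume z: "z \<in> ?N"
   show "ennreal (\<bar>c z\<bar> powr p) * wint T (\<lambda>_. 1) \<le> ennreal (coef_const m \<beta> R * (h powr p) ^ Suc m) * S"
    unfolding c_def S_def by (rule coefficient_estimate[OF u mz NT[OF z] R supp[OF z]])
  qed
 qed auto
 also have "... = ennreal (element_const m \<beta> R * (h powr p) ^ ?j) * S"
 proof -
  let ?a = "?Y ^ Suc m" and ?c = "real ?X powr p * real ?X *
   ?Z" and ?H = "(h powr p) ^ ?j"
  have n: "0 \<le> ?a" "0 \<le> ?c" "0 \<le> ?H" using tower_const_nonneg[OF beta_pos] coef_const_nonneg[OF beta_pos] by (auto intro!: mult_nonneg_nonneg)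
  have "ennreal (2 powr p) * (ennreal (?a * ?H) * S + ennreal (?c * ?H) * S) = ennreal (2 powr p) * (ennreal (?a * ?H) + ennreal (?c * ?H)) * S"
   by (simp only: distrib_right mult.assoc)
  also have "ennreal (2 powr p) * (ennreal (?a * ?H) + ennreal (?c * ?H)) = ennreal (2 powr p * (?a * ?H + ?c * ?H))"
   using ennreal_mult[of "2 powr p" "?a * ?H + ?c * ?H"] ennreal_plus[of "?a * ?H" "?c * ?H"] n
   by (simp only: mult_nonneg_nonneg add_nonneg_nonneg powr_ge_zero)
  also have "2 powr p * (?a * ?H + ?c * ?H) = element_const m \<beta> R * ?H"
   unfolding element_const_def by (simp only: distrib_right mult.assoc)
  finally show ?thesis .
 qed
 also have "... \<le> ennreal (element_const m \<beta> R * (h powr p) ^ ?j) * (\<Sum>\<nu>' | mi_size \<nu>' = Suc m. wint D (g \<nu>'))"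
  by (rule mult_left_mono[OF S]) simp
 finally show ?thesis .
qed

end

subsection \<open>Weak derivatives and weighted norms in terms of Borel representatives\<close>

text \<open>The notions of the statement live on the completed measure, the estimates on
  \<open>lborel\<close>; a Borel function equal almost everywhere connects the two for
  measurability, integrability and value at once.\<close>

lemma set_integral_bridge:
 fixes f f' :: "'a::euclidean_space \<Rightarrow> real"
 assumes f'[measurable]: "f' \<in> borel_measurable borel" and B[measurable]: "B \<in> sets borel"
  and ae: "AE x\<in>B in lborel. f' x = f x"
 shows set_borel_measurable_bridge: "set_borel_measurable lebesgue B f"
  and set_integrable_bridge: "set_integrable lebesgue B f \<longleftrightarrow> integrable lborel (\<lambda>x. f' x * indicator B x)"
  and set_lebesgue_integral_bridge: "(LINT x:B|lebesgue. f x) = (LBI x. f' x * indicator B x)"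
proof -
 let ?F = "\<lambda>x. indicator B x *\<^sub>R f x" and ?F' = "\<lambda>x. f' x * indicator B x"
 have F'b: "?F' \<in> borel_measurable lborel" by simp
 hence F': "?F' \<in> borel_measurable lebesgue" by (rule measurable_completion)
 have eq: "AE x in lborel. ?F x = ?F' x" using ae by eventually_elim (auto simp: indicator_def)
 have F: "?F \<in> borel_measurable lebesgue" by (rule measurable_completion_AE[OF F' eq])
 show "set_borel_measurable lebesgue B f" unfolding set_borel_measurable_def by (rule F)
 note eq' = AE_completion[OF eq]
 show "set_integrable lebesgue B f \<longleftrightarrow> integrable lborel ?F'"
  unfolding set_integrable_def integrable_cong_AE[OF F F' eq'] by (rule integrable_completion[OF F'b])
 show "(LINT x:B|lebesgue. f x) = (LBI x. ?F' x)"
  unfolding set_lebesgue_integral_def integral_cong_AE[OF F F' eq'] by (rule integral_completion[OF F'b])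
qed

lemma set_nn_integral_bridge:
 fixes f f' :: "'a::euclidean_space \<Rightarrow> real"
 assumes f'[measurable]: "f' \<in> borel_measurable borel" and B[measurable]: "B \<in> sets borel"
  and ae: "AE x\<in>B in lborel. f' x = f x" and nn: "\<And>x. 0 \<le> f' x"
 shows "set_integrable lebesgue B f \<longleftrightarrow> (LBNN x. ennreal (f' x) * indicator B x) < \<infinity>"
  and "set_integrable lebesgue B f \<Longrightarrow>
   (LBNN x. ennreal (f' x) * indicator B x) = ennreal (LINT x:B|lebesgue. f x)"
proof -
 have eq: "ennreal (f' x) * indicator B x = ennreal (f' x * indicator B x)" for x by (simp add: indicator_def)
 show i: "set_integrable lebesgue B f \<longleftrightarrow> (LBNN x. ennreal (f' x) * indicator B x) < \<infinity>"
  unfolding set_integrable_bridge[OF f' B ae] eq using nn by (simp add: integrable_iff_bounded)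
 assume "set_integrable lebesgue B f"
 hence "integrable lborel (\<lambda>x. f' x * indicator B x)" unfolding set_integrable_bridge[OF f' B ae] .
 thus "(LBNN x. ennreal (f' x) * indicator B x) = ennreal (LINT x:B|lebesgue. f x)"
  unfolding set_lebesgue_integral_bridge[OF f' B ae] eq by (rule nn_integral_eq_integral) (simp add: nn)
qed

lemma AE_open_cover:
 fixes U :: "'a::euclidean_space set"
 assumes U: "\<And>x. x \<in> U \<Longrightarrow> \<exists>s>0. AE y\<in>ball x s in lborel. P y"
 shows "AE y\<in>U in lborel. P y"
proof -
 obtain s where s: "\<And>x. x \<in> U \<Longrightarrow> 0 < s x" "\<And>x. x \<in> U \<Longrightarrow> AE y\<in>ball x (s x) in lborel. P y" using U by metis
 obtain F where F: "F \<subseteq> (\<lambda>x. ball x (s x)) ` U" "countable F" "\<Union>F = (\<Union>x\<in>U. ball x (s x))"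
  using Lindelof[of "(\<lambda>x. ball x (s x)) ` U"] by auto
 have "AE y in lborel. \<forall>B\<in>F. y \<in> B \<longrightarrow> P y" using F(1) s(2) by (subst AE_ball_countable[OF F(2)]) auto
 thus ?thesis
 proof eventually_elim
  case (elim y)
  show ?case
  proof
   assume "y \<in> U" hence "y \<in> \<Union>F" using s(1) unfolding F(3) by force
   thus "P y" using elim by blast
  qed
 qed
qed

lemma test_function_integral_bridge:
 fixes f f' :: "real^'n::finite \<Rightarrow> real"
 assumes f': "f' \<in> borel_measurable borel" "AE x\<in>U in lborel. f' x = f x" and \<phi>: "test_function U \<phi>"
 shows "(LINT x:U|lebesgue. f x * mi_deriv \<nu> \<phi> x) = (LBI x. f' x * mi_deriv \<nu> \<phi> x)"
proof -
 have z: "x \<notin> U \<Longrightarrow> mi_deriv \<nu> \<phi> x = 0" for x by (rule test_function_mi_deriv_zero[OF \<phi>])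
 have "smooth \<phi>" using \<phi> by (simp add: test_function_def)
 hence b: "mi_deriv \<nu> \<phi> \<in> borel_measurable borel" by (intro smooth_borel smooth_mi_deriv)
 have "(LINT x:U|lebesgue. f x * mi_deriv \<nu> \<phi> x) = (LINT x|lebesgue. f x * mi_deriv \<nu> \<phi> x)"
  unfolding set_lebesgue_integral_def using z by (intro Bochner_Integration.integral_cong) (auto simp: indicator_def)
 also have "... = (LBI x. f' x * mi_deriv \<nu> \<phi> x)" by (rule integral_representative[OF f' b z])
 finally show ?thesis .
qed

lemma weak_deriv_bridge:
 fixes u g F G :: "real^'n::finite \<Rightarrow> real"
 assumes F: "F \<in> borel_measurable borel" "AE x\<in>interior D in lborel. F x = u x"
  and G: "G \<in> borel_measurable borel" "AE x\<in>interior D in lborel. G x = g x"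
  and \<phi>: "test_function (interior D) \<phi>"
 shows "(LINT x:interior D|lebesgue. u x * mi_deriv \<nu> \<phi> x) = (- 1) ^ mi_size \<nu> * (LINT x:interior D|lebesgue. g x * \<phi> x)
  \<longleftrightarrow> (LBI x. F x * mi_deriv \<nu> \<phi> x) = (- 1) ^ mi_size \<nu> * (LBI x. G x * \<phi> x)"
 using test_function_integral_bridge[OF F \<phi>, of \<nu>] test_function_integral_bridge[OF G \<phi>, of "\<lambda>_. 0"]
 by (simp add: mi_deriv_zero)

lemma locally_integrable_onI:
 fixes u F :: "real^'n::finite \<Rightarrow> real"
 assumes F: "integrable lborel F" "AE x\<in>U in lborel. F x = u x"
 shows "locally_integrable_on U u" unfolding locally_integrable_on_def
proof (intro allI impI)
 fix K assume K: "compact K \<and> K \<subseteq> U"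
 have "AE x\<in>K in lborel. F x = u x" using F(2) K by (auto elim: eventually_mono)
 moreover have "K \<in> sets borel" using K by (simp add: compact_imp_closed)
 moreover have "integrable lborel (\<lambda>x. F x * indicator K x)"
  by (rule integrable_mult_bounded[OF F(1), of _ 1]) (use \<open>K \<in> sets borel\<close> in \<open>auto simp: indicator_def\<close>)
 ultimately show "set_integrable lebesgue K u"
  using set_integrable_bridge[of F K u] borel_measurable_integrable[OF F(1)] by simp
qed

lemma is_weak_derivI:
 fixes u g F G :: "real^'n::finite \<Rightarrow> real"
 assumes F: "integrable lborel F" "AE x\<in>interior D in lborel. F x = u x"
  and G: "integrable lborel G" "AE x\<in>interior D in lborel. G x = g x"
  and eq: "\<And>\<phi>. test_function (interior D) \<phi> \<Longrightarrow> (LBI x. F x * mi_deriv \<nu> \<phi> x) = (- 1) ^ mi_size \<nu> * (LBI x. G x * \<phi> x)"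
 shows "is_weak_deriv D \<nu> u g"
proof -
 have b: "F \<in> borel_measurable borel" "G \<in> borel_measurable borel" using borel_measurable_integrable F(1) G(1) by auto
 show ?thesis unfolding is_weak_deriv_def
  using locally_integrable_onI[OF F] locally_integrable_onI[OF G] weak_deriv_bridge[OF b(1) F(2) b(2) G(2)] eq by blast
qed

text \<open>\<open>weak_deriv\<close> is an arbitrary choice among weak derivatives, so uniqueness
  is what allows seminorms to be computed from any representative. Locally both candidates are
  replaced by integrable Borel functions and the fundamental lemma applies on balls.\<close>

lemma (in mollifier) weak_deriv_unique:
 fixes D :: "(real^'n) set"
 assumes 1: "is_weak_deriv D \<nu> u g1" and 2: "is_weak_deriv D \<nu> u g2"
 shows "AE x\<in>interior D in lborel. g1 x = g2 x"
proof (rule AE_open_cover)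
 fix x assume "x \<in> interior D"
 then obtain t where t: "0 < t" "cball x t \<subseteq> interior D" using open_interior open_contains_cball by blast
 let ?B = "ball x (2 * (t / 2))"
 have B: "?B \<in> sets borel" "?B \<subseteq> interior D" using t ball_subset_cball[of x t] by auto
 have i: "set_integrable lebesgue ?B g" if g: "locally_integrable_on (interior D) g" for g
 proof (rule set_integrable_subset)
  show "set_integrable lebesgue (cball x t) g" using g t by (simp add: locally_integrable_on_def)
 qed (use ball_subset_cball in auto)
 have l1: "locally_integrable_on (interior D) g1" using 1 by (simp add: is_weak_deriv_def)
 obtain f1 where f1: "integrable lborel f1" "AE y\<in>?B in lborel. f1 y = g1 y"
  by (rule borel_representative[OF i[OF l1] B(1)])
 have l2: "locally_integrable_on (interior D) g2" using 2 by (simp add: is_weak_deriv_def)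
 obtain f2 where f2: "integrable lborel f2" "AE y\<in>?B in lborel. f2 y = g2 y"
  by (rule borel_representative[OF i[OF l2] B(1)])
 have "AE y\<in>ball x (t / 2) in lborel. f1 y - f2 y = 0"
 proof (rule fundamental_lemma_ball)
  fix \<phi> assume \<phi>: "test_function ?B \<phi>"
  hence \<phi>D: "test_function (interior D) \<phi>" using B(2) by (auto simp: test_function_def)
  have z: "y \<notin> ?B \<Longrightarrow> \<phi> y = 0" for y by (rule test_function_zero[OF \<phi>])
  have eq: "(LINT y:interior D|lebesgue. g y * \<phi> y) = (LBI y. f y * \<phi> y)"
   if f: "integrable lborel f" "AE y\<in>?B in lborel. f y = g y" for f g
  proof -
   have "(LINT y:interior D|lebesgue. g y * \<phi> y) = (LINT y:?B|lebesgue. g y * \<phi> y)"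
    unfolding set_lebesgue_integral_def using z B(2) by (intro Bochner_Integration.integral_cong) (auto simp: indicator_def)
   also have "... = (LBI y. f y * \<phi> y)"
    using test_function_integral_bridge[OF _ f(2) \<phi>, of "\<lambda>_. 0"] borel_measurable_integrable[OF f(1)] by (simp add: mi_deriv_zero)
   finally show ?thesis .
  qed
  have s: "smooth \<phi>" using \<phi> by (simp add: test_function_def)
  obtain b where b: "\<And>x. b < norm x \<Longrightarrow> \<phi> x = 0" using test_function_zero_outside_ball[OF \<phi>] by blast
  obtain C where C: "\<And>x. \<bar>\<phi> x\<bar> \<le> C" using bounded_support_bound[OF smooth_continuous[OF s] b] by blast
  have im: "integrable lborel (\<lambda>y. f y * \<phi> y)" if "integrable lborel f" for f :: "real^'n \<Rightarrow> real"
   by (rule integrable_mult_bounded[OF that _ C]) (use smooth_borel[OF s] in simp)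
  have "(- 1) ^ mi_size \<nu> * (LINT y:interior D|lebesgue. g1 y * \<phi> y) = (- 1) ^ mi_size \<nu> * (LINT y:interior D|lebesgue. g2 y * \<phi> y)"
   using 1 2 \<phi>D unfolding is_weak_deriv_def by simp
  hence "(LBI y. f1 y * \<phi> y) = (LBI y. f2 y * \<phi> y)" using eq[OF f1] eq[OF f2] by simp
  thus "(LBI y. (f1 y - f2 y) * \<phi> y) = 0" unfolding left_diff_distrib using im[OF f1(1)] im[OF f2(1)] by simp
 qed (use f1 f2 t in auto)
 hence "AE y\<in>ball x (t / 2) in lborel. g1 y = g2 y" using f1(2) f2(2)
 proof eventually_elim
  case (elim y)
  show ?case
  proof
   assume y: "y \<in> ball x (t / 2)"
   hence "y \<in> ?B" using t(1) by simp
   thus "g1 y = g2 y" using elim y by simp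
  qed
 qed
 thus "\<exists>s>0. AE y\<in>ball x s in lborel. g1 y = g2 y" using t(1) by (intro exI[of _ "t / 2"]) simp
qed

lemma weak_tower_integral:
 assumes g: "weak_tower m D g" and k: "mi_size \<nu> \<le> Suc m" and \<phi>: "test_function D \<phi>"
 shows "(LBI x. g (\<lambda>_. 0) x * mi_deriv \<nu> \<phi> x) = (- 1) ^ mi_size \<nu> * (LBI x. g \<nu> x * \<phi> x)" using k \<phi>
proof (induction \<nu> arbitrary: \<phi> rule: mi_induct)
 case zero
 thus ?case by (simp add: mi_deriv_zero mi_size_def)
next
 case (Suc \<nu> i)
 have s: "smooth \<phi>" using Suc.prems(2) by (simp add: test_function_def)
 have k: "mi_size \<nu> \<le> m" using Suc.prems(1) unfolding mi_size_Suc by simp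
 have "(LBI x. g (\<lambda>_. 0) x * mi_deriv (\<nu>(i := Suc (\<nu> i))) \<phi> x) = (- 1) ^ mi_size \<nu> * (LBI x. g \<nu> x * pderiv_dir i \<phi> x)"
  unfolding mi_deriv_Suc(2)[OF s] by (rule Suc.IH) (use k test_function_pderiv[OF Suc.prems(2)] in auto)
 also have "(LBI x. g \<nu> x * pderiv_dir i \<phi> x) = - (LBI x. g (\<nu>(i := Suc (\<nu> i))) x * \<phi> x)"
  using g k Suc.prems(2) unfolding weak_tower_def weak_grad_def by blast
 finally show ?case unfolding mi_size_Suc by (simp del: fun_upd_apply)
qed

section \<open>Weighted Sobolev functions as towers of Borel functions\<close>

locale represented_weight = weighted_moll \<psi> r p A w
 for \<psi> :: "real^'n::finite \<Rightarrow> real" and r p A and w :: "real^'n \<Rightarrow> real" +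
 fixes \<omega> :: "real^'n \<Rightarrow> real"
 assumes w_eq: "AE x in lborel. w x = \<omega> x"
begin

lemma Lp_bridge:
 assumes g[measurable]: "g \<in> borel_measurable borel" and D: "D \<in> sets borel" and ae: "AE x\<in>D in lborel. g x = u x"
 shows "u \<in> Lp_space p \<omega> D \<longleftrightarrow> wint D g < \<infinity>"
  and "wint D g < \<infinity> \<Longrightarrow> wint D g = ennreal (LINT x:D|lebesgue. \<bar>u x\<bar> powr p * \<omega> x)"
proof -
 have eq: "AE x\<in>D in lborel. \<bar>g x\<bar> powr p * w x = \<bar>u x\<bar> powr p * \<omega> x" using ae w_eq by eventually_elim auto
 have b: "(\<lambda>x. \<bar>g x\<bar> powr p * w x) \<in> borel_measurable borel" by measurable
 have nn: "0 \<le> \<bar>g x\<bar> powr p * w x" for x using w_pos[of x] by simp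
 note br = set_nn_integral_bridge[OF b D eq nn, folded wint_def]
 show "u \<in> Lp_space p \<omega> D \<longleftrightarrow> wint D g < \<infinity>"
  unfolding Lp_space_def using br(1) set_borel_measurable_bridge[OF g D ae] by simp
 thus "wint D g < \<infinity> \<Longrightarrow> wint D g = ennreal (LINT x:D|lebesgue. \<bar>u x\<bar> powr p * \<omega> x)" using br by simp
qed

text \<open>Hoelder's inequality with the locally integrable dual weight: on bounded sets the
  weighted space embeds into L1, which is what \<open>weak_grad\<close> asks for.\<close>

lemma wint_finite_integrable:
 assumes g[measurable]: "g \<in> borel_measurable borel" and D: "D \<subseteq> ball c s" "0 < s" and z: "\<And>x. x \<notin> D \<Longrightarrow> g x = 0" and fin: "wint D g < \<infinity>"
 shows "integrable lborel g"
proof -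
 let ?Z = "LBNN x. ennreal \<bar>g x\<bar> * indicator (ball c s) x"
 have w: "(LBNN x. epow p (ennreal \<bar>g x\<bar>) * ennreal (w x) * indicator (ball c s) x) = wint D g" unfolding wint_def
 proof (rule nn_integral_cong)
  fix x
  show "epow p (ennreal \<bar>g x\<bar>) * ennreal (w x) * indicator (ball c s) x = ennreal (\<bar>g x\<bar> powr p * w x) * indicator D x"
   using D(1) z[of x] unfolding ennreal_powr_w by (cases "x \<in> D") auto
 qed
 have "epow p ?Z
  \<le> wint D g * epow (p - 1) (LBNN x. ennreal (dual x) * indicator (ball c s) x)"
  using holder[of "\<lambda>x. ennreal \<bar>g x\<bar>" s c] D(2) unfolding w by simp
 also have "... < \<infinity>" using fin dual_finite[OF D(2), of c] by (simp add: ennreal_mult_less_top epow_def less_top)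
 finally have "?Z < \<infinity>"
  by (auto simp: epow_def less_top split: if_splits)
 also have "?Z = (LBNN x. ennreal \<bar>g x\<bar>)"
 proof (rule nn_integral_cong)
  fix x show "ennreal \<bar>g x\<bar> * indicator (ball c s) x = ennreal \<bar>g x\<bar>" using z[of x] D(1) by (cases "x \<in> D") auto
 qed
 finally show ?thesis by (simp add: integrable_iff_bounded)
qed

lemma Lp_representative:
 assumes u: "u \<in> Lp_space p \<omega> D" and D[measurable]: "D \<in> sets borel" and b: "bounded D"
 obtains g where "integrable lborel g" "AE x\<in>D in lborel. g x = u x" "wint D g < \<infinity>"
proof -
 have "(\<lambda>x. indicator D x *\<^sub>R u x) \<in> borel_measurable (completion lborel)"
  using u by (simp add: Lp_space_def set_borel_measurable_def)
 from completion_ex_borel_measurable_real[OF this]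
 obtain g0 where g0: "g0 \<in> borel_measurable lborel" "AE x in lborel. indicator D x *\<^sub>R u x = g0 x" by blast
 define g where "g x = g0 x * indicator D x" for x
 have g: "g \<in> borel_measurable borel" using g0(1) D unfolding g_def by simp
 have ae: "AE x\<in>D in lborel. g x = u x" using g0(2) by eventually_elim (auto simp: g_def)
 have fin: "wint D g < \<infinity>" using Lp_bridge(1)[OF g D ae] u by simp
 obtain s where s: "0 < s" "D \<subseteq> ball 0 s" using bounded_subset_ballD[OF b, of 0] by auto
 show thesis by (rule that[OF wint_finite_integrable[OF g s(2,1) _ fin] ae fin]) (simp add: g_def)
qed

lemma seminorm_wint:
 assumes wd: "\<And>\<nu>. mi_size \<nu> = k \<Longrightarrow> is_weak_deriv D \<nu> u (u' \<nu>)"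
  and g: "\<And>\<nu>. mi_size \<nu> = k \<Longrightarrow> g \<nu> \<in> borel_measurable borel"
  and ae: "\<And>\<nu>. mi_size \<nu> = k \<Longrightarrow> AE x\<in>interior D in lborel. g \<nu> x = u' \<nu> x"
  and fin: "\<And>\<nu>. mi_size \<nu> = k \<Longrightarrow> wint (interior D) (g \<nu>) < \<infinity>"
 shows "\<exists>I\<ge>0. (\<Sum>\<nu> | mi_size \<nu> = k. wint (interior D) (g \<nu>)) = ennreal I \<and> sobolev_seminorm k p \<omega> D u = I powr (1 / p)"
proof -
 define I where "I \<nu> = (LINT x:interior D|lebesgue. \<bar>weak_deriv D \<nu> u x\<bar> powr p * \<omega> x)" for \<nu>
 have one: "wint (interior D) (g \<nu>) = ennreal (I \<nu>)" if k: "mi_size \<nu> = k" for \<nu> unfolding I_def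
 proof (rule Lp_bridge(2)[OF g[OF k] _ _ fin[OF k]])
  have "is_weak_deriv D \<nu> u (weak_deriv D \<nu> u)" unfolding weak_deriv_def by (rule someI[of "is_weak_deriv D \<nu> u"]) (rule wd[OF k])
  from weak_deriv_unique[OF wd[OF k] this] ae[OF k]
  show "AE x\<in>interior D in lborel. g \<nu> x = weak_deriv D \<nu> u x" by eventually_elim auto
 qed simp
 have "AE x in lebesgue. 0 \<le> \<omega> x" using AE_completion[OF w_eq] by eventually_elim (metis w_pos less_imp_le)
 hence nn: "0 \<le> I \<nu>" for \<nu>
  unfolding I_def set_lebesgue_integral_def by (intro integral_nonneg_AE) (auto elim: eventually_mono)
 have pw: "Lp_norm p \<omega> (interior D) (weak_deriv D \<nu> u) powr p = I \<nu>" for \<nu>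
  unfolding Lp_norm_def I_def[symmetric] using nn p_gt_1 by (simp add: powr_powr)
 show ?thesis
 proof (intro exI[of _ "\<Sum>\<nu> | mi_size \<nu> = k. I \<nu>"] conjI)
  show "0 \<le> (\<Sum>\<nu> | mi_size \<nu> = k. I \<nu>)" by (intro sum_nonneg nn)
  have "(\<Sum>\<nu> | mi_size \<nu> = k. wint (interior D) (g \<nu>)) = (\<Sum>\<nu> | mi_size \<nu> = k. ennreal (I \<nu>))"
   by (rule sum.cong) (auto simp: one)
  thus "(\<Sum>\<nu> | mi_size \<nu> = k. wint (interior D) (g \<nu>)) = ennreal (\<Sum>\<nu> | mi_size \<nu> = k. I \<nu>)"
   using nn by (simp only: sum_ennreal)
  show "sobolev_seminorm k p \<omega> D u = (\<Sum>\<nu> | mi_size \<nu> = k. I \<nu>) powr (1 / p)" unfolding sobolev_seminorm_def pw ..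
 qed
qed

text \<open>Membership gives each derivative of v separately. Testing with a partial derivative of a
  test function shows that consecutive orders are related as function and gradient, which the tower
  demands.\<close>

lemma sobolev_tower:
 assumes v: "v \<in> sobolev (Suc m) p \<omega> D" and b: "bounded (interior D)"
 obtains g where "weak_tower m (interior D) g" "AE x\<in>interior D in lborel. g (\<lambda>_. 0) x = v x"
  "\<And>\<nu>. mi_size \<nu> \<le> Suc m \<Longrightarrow> is_weak_deriv D \<nu> v (g \<nu>)" "\<And>\<nu>. mi_size \<nu> \<le> Suc m \<Longrightarrow> wint (interior D) (g \<nu>) < \<infinity>"
proof -
 let ?U = "interior D"
 have z0: "mi_size (\<lambda>_::'n. 0) = 0" by (simp add: mi_size_eq_0)
 define Rep where "Rep \<nu> f \<longleftrightarrow> integrable lborel f \<and> wint ?U f < \<infinity> \<and> is_weak_deriv D \<nu> v f \<and>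
  (\<nu> = (\<lambda>_. 0) \<longrightarrow> (AE x\<in>?U in lborel. f x = v x))" for \<nu> f
 have ex: "\<exists>f. Rep \<nu> f"
  if k: "mi_size \<nu> \<le> Suc m" for \<nu>
 proof -
  obtain d where d: "d \<in> Lp_space p \<omega> ?U" "is_weak_deriv D \<nu> v d" using v k unfolding sobolev_def by blast
  obtain f where f: "integrable lborel f" "AE x\<in>?U in lborel. f x = d x" "wint ?U f < \<infinity>"
   using Lp_representative[OF d(1) _ b] by auto
  have vL: "v \<in> Lp_space p \<omega> ?U" using v by (simp add: sobolev_def)
  obtain fv where fv: "integrable lborel fv" "AE x\<in>?U in lborel. fv x = v x" "wint ?U fv < \<infinity>"
   using Lp_representative[OF vL _ b] by auto
  show ?thesis
  \<comment> \<open>At order zero v itself is chosen, so that the bottom of the tower represents v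
    and not merely some weak derivative of order zero.\<close>
  proof (cases "\<nu> = (\<lambda>_. 0)")
   case True
   have "is_weak_deriv D \<nu> v fv" by (rule is_weak_derivI[OF fv(1,2) fv(1)]) (auto simp: True mi_deriv_zero z0)
   thus ?thesis unfolding Rep_def using fv by (intro exI[of _ fv]) simp
  next
   case False
   have "is_weak_deriv D \<nu> v f"
   proof (rule is_weak_derivI[OF fv(1,2) f(1)])
    fix \<phi> assume \<phi>: "test_function ?U \<phi>"
    have "(LINT x:?U|lebesgue. v x * mi_deriv \<nu> \<phi> x) = (- 1) ^ mi_size \<nu> * (LINT x:?U|lebesgue. d x * \<phi> x)"
     using d(2) \<phi> by (simp add: is_weak_deriv_def)
    thus "(LBI x. fv x * mi_deriv \<nu> \<phi> x) = (- 1) ^ mi_size \<nu> * (LBI x. f x * \<phi> x)"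
     using weak_deriv_bridge[OF _ fv(2) _ f(2) \<phi>] borel_measurable_integrable[OF f(1)] borel_measurable_integrable[OF fv(1)] by simp
   qed simp
   thus ?thesis unfolding Rep_def using False f by (intro exI[of _ f]) simp
  qed
 qed
 define g where "g \<nu> = (SOME f. Rep \<nu> f)" for \<nu>
 have R: "Rep \<nu> (g \<nu>)" if "mi_size \<nu> \<le> Suc m" for \<nu> unfolding g_def by (rule someI_ex[OF ex[OF that]])
 have g: "\<And>\<nu>. mi_size \<nu> \<le> Suc m \<Longrightarrow> integrable lborel (g \<nu>)" "\<And>\<nu>. mi_size \<nu> \<le> Suc m \<Longrightarrow> wint ?U (g \<nu>) < \<infinity>"
  "\<And>\<nu>. mi_size \<nu> \<le> Suc m \<Longrightarrow> is_weak_deriv D \<nu> v (g \<nu>)" using R unfolding Rep_def by simp_all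
 have g0: "AE x\<in>?U in lborel. g (\<lambda>_. 0) x = v x" using R[of "\<lambda>_. 0"] z0 by (simp add: Rep_def)
 have gb: "g \<nu> \<in> borel_measurable borel" if "mi_size \<nu> \<le> Suc m" for \<nu> using borel_measurable_integrable[OF g(1)[OF that]] by simp
 have eq: "(LBI x. g (\<lambda>_. 0) x * mi_deriv \<nu> \<phi> x) = (- 1) ^ mi_size \<nu> * (LBI x. g \<nu> x * \<phi> x)"
  if k: "mi_size \<nu> \<le> Suc m" and \<phi>: "test_function ?U \<phi>" for \<nu> \<phi>
  using weak_deriv_bridge[OF gb g0 gb[OF k] _ \<phi>, of "g \<nu>" \<nu>] g(3)[OF k] \<phi> z0 by (simp add: is_weak_deriv_def)
 have "weak_tower m ?U g" unfolding weak_tower_def weak_grad_def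
 proof (intro allI impI conjI)
  fix \<nu> :: "'n \<Rightarrow> nat" assume k: "mi_size \<nu> \<le> m"
  hence k': "mi_size (\<nu>(i := Suc (\<nu> i))) \<le> Suc m" for i by (simp add: mi_size_Suc)
  show "integrable lborel (g \<nu>)" "integrable lborel (g (\<nu>(i := Suc (\<nu> i))))" for i using g(1)[OF k'] g(1)[of \<nu>] k by auto
  fix \<phi> i assume \<phi>: "test_function ?U \<phi>"
  have s: "smooth \<phi>" using \<phi> by (simp add: test_function_def)
  have "(- 1) ^ mi_size \<nu> * (LBI x. g \<nu> x * pderiv_dir i \<phi> x) = (- 1) ^ Suc (mi_size \<nu>) * (LBI x. g (\<nu>(i := Suc (\<nu> i))) x * \<phi> x)"
   using eq[OF _ test_function_pderiv[OF \<phi>], of \<nu> i] eq[OF k' \<phi>, of i] k unfolding mi_deriv_Suc(2)[OF s] mi_size_Suc by simp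
  thus "(LBI x. g \<nu> x * pderiv_dir i \<phi> x) = - (LBI x. g (\<nu>(i := Suc (\<nu> i))) x * \<phi> x)"
   by (cases "even (mi_size \<nu>)") simp_all
 qed
 from that[OF this g0 g(3) g(2)] show thesis .
qed

end

subsection \<open>The quasi-interpolation error\<close>

lemma mollifierI:
 fixes \<psi> :: "real^'n::finite \<Rightarrow> real"
 assumes s: "smooth \<psi>" and i: "(LINT x|lebesgue. \<psi> x) = 1" and r: "0 < r" and supp: "fsupport \<psi> \<subseteq> cball 0 r"
 shows "mollifier \<psi> r"
proof
 show "\<psi> u = 0" if "r < norm u" for u
  using that supp closure_subset[of "{x. \<psi> x \<noteq> 0}"] by (auto simp: fsupport_def subset_iff not_le[symmetric])
 show "(LBI u. \<psi> u) = 1" using i integral_completion[of \<psi> lborel] smooth_borel[OF s] by simp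
qed (fact s r)+

text \<open>Shape regularity bounds a supremum of ball diameters below by diameter / \<sigma>. To
  pick an actual ball, half of this value is used; passing from diameters to radii halves once more,
  hence 1 / (4 \<sigma>).\<close>

lemma fat_mesh_shape_regular:
 fixes \<Omega> :: "(real^'n::finite) set"
 assumes sr: "shape_regular_family \<sigma> \<Omega> MM" and M: "M \<in> MM" and \<sigma>: "1 < \<sigma>"
 shows "fat_mesh M (1 / (4 * \<sigma>))"
proof
 have cm: "conforming_mesh \<Omega> M" using sr M by (simp add: shape_regular_family_def)
 show "finite M" using cm by (simp add: conforming_mesh_def triangulation_def)
 show simp: "int CARD('n) simplex K" if "K \<in> M" for K using cm that by (simp add: conforming_mesh_def)
 show "K \<inter> K' face_of K" if "K \<in> M" "K' \<in> M" for K K' using cm that by (simp add: conforming_mesh_def triangulation_def)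
 show "0 < 1 / (4 * \<sigma>)" using \<sigma> by simp
 fix K assume K: "K \<in> M"
 let ?S = "{2 * s | s. 0 \<le> s \<and> (\<exists>c. cball c s \<subseteq> K)}"
 have bK: "bounded K" using compact_simplex[OF simp[OF K]] by (rule compact_imp_bounded)
 \<comment> \<open>With division by zero equal to 0, the ratio condition alone would allow an
   inscribed diameter 0; a full-dimensional simplex has interior points, so it is positive.\<close>
 have "affine hull K = UNIV" using aff_dim_simplex[OF simp[OF K]] aff_dim_eq_full[of K] by simp
 hence "interior K \<noteq> {}"
  using rel_interior_interior[of K] rel_interior_eq_empty[OF convex_simplex[OF simp[OF K]]] simp[OF K] aff_dim_simplex[OF simp[OF K]]
  by auto
 then obtain x where "x \<in> interior K" by blast
 then obtain s where s: "0 < s" "cball x s \<subseteq> K" by (auto simp: mem_interior_cball)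
 have le: "t \<le> diameter K" if t: "t \<in> ?S" for t
 proof -
  obtain s c where sc: "t = 2 * s" "0 \<le> s" "cball c s \<subseteq> K" using t by blast
  thus ?thesis using diameter_subset[OF sc(3) bK] by simp
 qed
 have bdd: "bdd_above ?S" using le by (rule bdd_aboveI)
 have in_S: "2 * s \<in> ?S" using s by fastforce
 have d0: "0 < diameter K" using le[OF in_S] s(1) by simp
 have "2 * s \<le> inball_diameter K" unfolding inball_diameter_def by (rule cSup_upper[OF in_S bdd])
 hence i0: "0 < inball_diameter K" using s(1) by simp
 have "diameter K / inball_diameter K \<le> \<sigma>" using sr M K by (simp add: shape_regular_family_def)
 hence "diameter K \<le> \<sigma> * inball_diameter K" using i0 by (simp add: divide_le_eq)
 hence "diameter K / \<sigma> \<le> inball_diameter K" using \<sigma> by (simp add: divide_le_eq mult.commute)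
 moreover have "diameter K / (2 * \<sigma>) < diameter K / \<sigma>" using d0 \<sigma> by (simp add: field_simps)
 ultimately have "diameter K / (2 * \<sigma>) < Sup ?S" unfolding inball_diameter_def by simp
 then obtain t where t: "t \<in> ?S" "diameter K / (2 * \<sigma>) < t" using less_cSup_iff[OF _ bdd] in_S by blast
 then obtain s c where sc: "t = 2 * s" "cball c s \<subseteq> K" by blast
 have "1 / (4 * \<sigma>) * diameter K \<le> s" using t(2) sc(1) \<sigma> by (simp add: field_simps)
 thus "\<exists>c. cball c (1 / (4 * \<sigma>) * diameter K) \<subseteq> K" using sc(2) subset_cball[of _ s c] by blast
qed

text \<open>The weight is replaced by a Borel version that is positive everywhere, which changes it
  only on a null set; the quotient bound is then multiplied by the volume to the power p.\<close>

lemma muckenhoupt_Ap: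
 fixes \<omega> :: "real^'n::finite \<Rightarrow> real"
 assumes Apw: "Ap_weight p \<omega>" and p: "1 < p"
 obtains w where "muckenhoupt p (Ap_const p \<omega>) w" "AE x in lborel. w x = \<omega> x"
proof -
 have loc: "set_integrable lebesgue K \<omega>" if "compact K" for K
  using Apw that by (simp add: Ap_weight_def weight_def locally_integrable_on_def)
 have "\<omega> \<in> borel_measurable lebesgue"
 proof (rule borel_measurable_LIMSEQ_real)
  show "(\<lambda>x. indicator (cball 0 (real k)) x *\<^sub>R \<omega> x) \<in> borel_measurable lebesgue" for k
   using loc[of "cball 0 (real k)"] unfolding set_integrable_def by (simp add: borel_measurable_integrable)
  fix x :: "real^'n"
  obtain N where N: "norm x \<le> real N" using real_arch_simple by blast
  show "(\<lambda>k. indicator (cball 0 (real k)) x *\<^sub>R \<omega> x) \<longlonglongrightarrow> \<omega> x"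
  proof (rule tendsto_eventually, rule eventually_sequentiallyI[of N])
   fix k assume "N \<le> k"
   hence "norm x \<le> real k" using N by linarith
   thus "indicator (cball 0 (real k)) x *\<^sub>R \<omega> x = \<omega> x" by simp
  qed
 qed
 from completion_ex_borel_measurable_real[OF this]
 obtain w0 where w0: "w0 \<in> borel_measurable lborel" "AE x in lborel. \<omega> x = w0 x" by blast
 have pos: "AE x in lborel. 0 < \<omega> x" using Apw unfolding Ap_weight_def weight_def AE_completion_iff by simp
 define w where "w x = (if 0 < w0 x then w0 x else 1)" for x
 have w[measurable]: "w \<in> borel_measurable borel" using w0(1) unfolding w_def by simp
 have wp: "0 < w x" for x by (simp add: w_def)
 have eq: "AE x in lborel. w x = \<omega> x" using w0(2) pos by eventually_elim (simp add: w_def)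
 have mu: "muckenhoupt p (Ap_const p \<omega>) w"
 proof
  show "1 < p" "w \<in> borel_measurable borel" "\<And>x. 0 < w x" by (fact p w wp)+
  fix c :: "real^'n" and s :: real assume s: "0 < s"
  let ?B = "ball c s" and ?V = "ballvol TYPE('n) s"
  have B: "?B \<in> balls" using s by (auto simp: balls_def)
  have dB: "(\<lambda>x. w x powr (1 / (1 - p))) \<in> borel_measurable borel" by simp
  have aed: "AE x\<in>?B in lborel. w x powr (1 / (1 - p)) = \<omega> x powr (1 / (1 - p))" using eq by eventually_elim simp
  have aew: "AE x\<in>?B in lborel. w x = \<omega> x" using eq by eventually_elim simp
  have id: "set_integrable lebesgue ?B (\<lambda>x. \<omega> x powr (1 / (1 - p)))" using Apw B by (simp add: Ap_weight_def)
  have iw: "set_integrable lebesgue ?B \<omega>" by (rule set_integrable_subset[OF loc[of "cball c s"]]) auto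
  let ?Iw = "LINT x:?B|lebesgue. \<omega> x" and ?Id = "LINT x:?B|lebesgue. \<omega> x powr (1 / (1 - p))"
  note brd = set_nn_integral_bridge[OF dB ball_borel aed powr_ge_zero]
  note brw = set_nn_integral_bridge[OF w ball_borel aew less_imp_le[OF wp]]
  show "(LBNN x. ennreal (w x powr (1 / (1 - p))) * indicator ?B x) < \<infinity>" using brd(1) id by simp
  have "AE x in lebesgue. 0 \<le> \<omega> x" using AE_completion[OF eq] by eventually_elim (metis wp less_imp_le)
  hence Iw0: "0 \<le> ?Iw" unfolding set_lebesgue_integral_def by (intro integral_nonneg_AE) (auto elim: eventually_mono)
  have Id0: "0 \<le> ?Id" unfolding set_lebesgue_integral_def by (intro integral_nonneg_AE) simp
  have V: "measure lebesgue ?B = ?V" using s by (simp add: measure_def emeasure_ball_vec)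
  have Vp: "0 < ?V" by (rule ballvol_pos[OF s])
  have "Ap_quotient p \<omega> ?B \<le> Ap_const p \<omega>" unfolding Ap_const_def
   using Apw B by (intro cSUP_upper) (auto simp: Ap_weight_def)
  hence "?Iw / ?V * (?Id / ?V) powr (p - 1) \<le> Ap_const p \<omega>" unfolding Ap_quotient_def average_on_def V .
  hence "(?Iw / ?V * (?Id / ?V) powr (p - 1)) * ?V powr p \<le> Ap_const p \<omega> * ?V powr p" by (rule mult_right_mono) simp
  \<comment> \<open>The exponents 1 and p - 1 of the volume add up to p.\<close>
  moreover have "(a / V * (b / V) powr (p - 1)) * V powr p = a * b powr (p - 1)" if "0 \<le> b" "0 < V" for a b V :: real
   using that powr_add[of V 1 "p - 1"] by (simp add: powr_divide)
  ultimately have "?Iw * ?Id powr (p - 1) \<le> Ap_const p \<omega> * ?V powr p" using Id0 Vp by (simp only:)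
  thus "(LBNN x. ennreal (w x) * indicator ?B x) *
   epow (p - 1) (LBNN x. ennreal (w x powr (1 / (1 - p))) * indicator ?B x) \<le> ennreal (Ap_const p \<omega> * ?V powr p)"
   unfolding brw(2)[OF iw] brd(2)[OF id] epow_ennreal[OF Id0] using Iw0 by (simp only: ennreal_mult[symmetric] powr_ge_zero ennreal_leI)
 qed
 show thesis by (rule that[OF mu eq])
qed

lemma (in mollifier) scaled_kernel_eq: "scaled_kernel m \<psi> M z = mker (node_size M z / (real m + 1)) z"
 by (rule ext) (simp add: scaled_kernel_def mker_def power_divide add.commute)

locale quasi_interpolation = represented_weight \<psi> r p A w \<omega> + patch \<psi> r p A w M \<beta> T R + domain_mesh M \<beta> \<Omega> m
 for \<psi> :: "real^'n::finite \<Rightarrow> real" and r p A and w \<omega> :: "real^'n \<Rightarrow> real" and M \<beta> T R \<Omega> m +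
 assumes T_Omega: "T \<subseteq> \<Omega>" and reach: "r + 2 \<le> R"
  and kernel_support: "\<And>z. z \<in> interior_nodes m \<Omega> M \<Longrightarrow> fsupport (scaled_kernel m \<psi> M z) \<subseteq> node_star M z"
begin

lemma node_kernel_support:
 assumes "z \<in> lagrange_nodes m T" shows "fsupport (mker (node_size M z / (real m + 1)) z) \<subseteq> node_star M z"
 using kernel_support[of z] element_nodes_interior[OF T_M T_Omega] assms by (auto simp: scaled_kernel_eq)

text \<open>The representative agrees with v almost everywhere in the interior of the patch. The
  kernel at z vanishes off the star of z, whose elements lie in the patch, and element boundaries
  are null sets.\<close>

lemma averaged_taylor_eq:
 assumes z: "z \<in> lagrange_nodes m T" and f: "f \<in> borel_measurable borel"
  and ae: "AE x in lborel. x \<in> interior (element_patch m M T) \<longrightarrow> f x = v x"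
 shows "averaged_taylor m \<psi> M z v z = qcoef m (node_size M z / (real m + 1)) z f"
proof -
 let ?\<eta> = "node_size M z / (real m + 1)"
 have zT: "z \<in> T" using nodes_subset[OF T_M m_pos z] .
 have sub: "node_star M z \<subseteq> element_patch m M T"
  using zT unfolding element_patch_eq[OF T_M m_pos] node_star_def by auto
 have fr: "AE x in lborel. \<forall>K\<in>M. x \<notin> frontier K" using AE_not_frontier[of M, OF finite_M, OF convex_M] by simp
 have ae': "AE x in lborel. x \<in> node_star M z \<longrightarrow> f x = v x" using ae fr
 proof eventually_elim
  case (elim x)
  show ?case
  proof
   assume "x \<in> node_star M z"
   then obtain K where K: "K \<in> M" "z \<in> K" "x \<in> K" by (auto simp: node_star_def)
   hence "x \<in> interior K" using elim closed_M[OF K(1)] by (auto simp: frontier_def)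
   moreover have "interior K \<subseteq> interior (element_patch m M T)"
    using K sub by (intro interior_mono) (auto simp: node_star_def)
   ultimately show "f x = v x" using elim by blast
  qed
 qed
 have "(LINT x|lebesgue. v x * taylor_term ?\<eta> z \<mu> x) = (LBI x. f x * taylor_term ?\<eta> z \<mu> x)" for \<mu>
 proof (rule integral_representative[OF f ae'])
  show "taylor_term ?\<eta> z \<mu> \<in> borel_measurable borel" by (rule smooth_borel[OF smooth_taylor_term])
  show "taylor_term ?\<eta> z \<mu> x = 0" if "x \<notin> node_star M z" for x
   using that node_kernel_support[OF z] by (intro taylor_term_zero) auto
 qed
 thus ?thesis unfolding averaged_taylor_def qcoef_def scaled_kernel_eq taylor_term_def[symmetric] by simp
qed

text \<open>\<open>element_estimate\<close> is summed over the derivatives of order k; their number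
  is replaced by the number of all multi-indices up to order m + 1 to have one constant for every
  k.\<close>

theorem quasi_interpolation_error:
 assumes v: "v \<in> sobolev (Suc m) p \<omega> (element_patch m M T)" and k: "k \<le> Suc m"
 defines "e \<equiv> \<lambda>x. v x - quasi_interpolant m \<psi> \<Omega> M v x"
 shows "e \<in> sobolev k p \<omega> T"
  and "sobolev_seminorm k p \<omega> T e
   \<le> (real (card {\<nu> :: 'n \<Rightarrow> nat. mi_size \<nu> \<le> Suc m}) * element_const m \<beta> R) powr (1 / p) * diameter T ^ (Suc m - k)
    * sobolev_seminorm (Suc m) p \<omega> (element_patch m M T) v"
proof -
 let ?D = "element_patch m M T" and ?N = "real (card {\<nu> :: 'n \<Rightarrow> nat. mi_size \<nu> \<le> Suc m})" and ?E = "element_const m \<beta> R"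
 let ?U = "interior ?D" and ?j = "Suc m - k" and ?H = "h powr p"
 have bU: "bounded ?U" unfolding element_patch_eq[OF T_M m_pos]
  using finite_M compact_M by (intro bounded_interior bounded_Union) (auto intro: compact_imp_bounded)
 obtain g where tower: "weak_tower m ?U g" and g0: "AE x\<in>?U in lborel. g (\<lambda>_. 0) x = v x"
  and gd: "\<And>\<nu>. mi_size \<nu> \<le> Suc m \<Longrightarrow> is_weak_deriv ?D \<nu> v (g \<nu>)" and gfin: "\<And>\<nu>. mi_size \<nu> \<le> Suc m \<Longrightarrow> wint ?U (g \<nu>) < \<infinity>"
  using sobolev_tower[OF v bU] by blast
 have z0: "mi_size (\<lambda>_::'n. 0) = 0" by (simp add: mi_size_eq_0)
 have gb: "g \<nu> \<in> borel_measurable borel" if "mi_size \<nu> \<le> Suc m" for \<nu>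
  using borel_measurable_integrable[OF weak_tower_integrable[OF tower that]] by simp
 have XU: "X \<subseteq> ?U" using X_subset unfolding element_patch_eq[OF T_M m_pos] .
 define Q where "Q = (\<lambda>x. \<Sum>z\<in>lagrange_nodes m T. qcoef m (node_size M z / (real m + 1)) z (g (\<lambda>_. 0)) * phi T m (node_index T m z) x)"
 have sQ: "smooth Q" unfolding Q_def
  by (intro smooth_sum smooth_mult[OF smooth_const] polyf_smooth[OF polyf_phi[OF finite_verts[OF T_M]]])
 have QT: "quasi_interpolant m \<psi> \<Omega> M v x = Q x" if "x \<in> T" for x
  unfolding quasi_interpolant_on_element[OF T_M T_Omega that] Q_def
  by (rule sum.cong[OF refl]) (use averaged_taylor_eq[OF _ gb g0] z0 in simp)
 obtain I' where I': "0 \<le> I'" "(\<Sum>\<nu> | mi_size \<nu> = Suc m. wint ?U (g \<nu>)) = ennreal I'"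
  "sobolev_seminorm (Suc m) p \<omega> ?D v = I' powr (1 / p)" using seminorm_wint[of "Suc m" ?D v g g] gd gb gfin by auto
 define d where "d \<nu> x = g \<nu> x - mi_deriv \<nu> Q x" for \<nu> x
 have db: "d \<nu> \<in> borel_measurable borel" if "mi_size \<nu> \<le> Suc m" for \<nu>
  using gb[OF that] smooth_borel[OF smooth_mi_deriv[OF sQ, of \<nu>]] unfolding d_def by simp
 have est: "wint (interior T) (d \<nu>) \<le> ennreal (?E * ?H ^ (Suc m - mi_size \<nu>) * I')" if "mi_size \<nu> \<le> Suc m" for \<nu>
 proof -
  have "wint (interior T) (d \<nu>) \<le> ennreal (?E * ?H ^ (Suc m - mi_size \<nu>)) * ennreal I'"
   using element_estimate[OF m_pos tower XU reach node_kernel_support that] unfolding d_def Q_def I'(2) .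
  also have "... = ennreal (?E * ?H ^ (Suc m - mi_size \<nu>) * I')"
   using element_const_nonneg[OF beta_pos] I'(1) by (intro ennreal_mult[symmetric] mult_nonneg_nonneg) auto
  finally show ?thesis .
 qed
 have fin: "wint (interior T) (d \<nu>) < \<infinity>" if "mi_size \<nu> \<le> Suc m" for \<nu>
  using le_less_trans[OF est[OF that] ennreal_less_top] by simp
 obtain a0 where "a0 \<in> verts T" using full_simplex_verts(2)[OF simp_M[OF T_M]] by fastforce
 hence TB: "interior T \<subseteq> ball a0 ((R + 1) * h)" using X_ball(2) interior_subset by blast
 have Tb: "interior T \<in> sets borel" and TU: "interior T \<subseteq> ?U" using interior_T_X XU by auto
 \<comment> \<open>Cutting off to the interior of T makes the polynomial part integrable, and the
   tower then supplies the weak derivatives of the error.\<close>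
 define u where "u = (\<lambda>\<nu> x. g \<nu> x * indicator (interior T) x - mi_deriv \<nu> Q x * indicator (interior T) x)"
 have ut: "weak_tower m (interior T) u" unfolding u_def by (rule weak_tower_minus_poly[OF tower sQ Tb TB TU])
 have ud: "x \<in> interior T \<Longrightarrow> u \<nu> x = d \<nu> x" for \<nu> x by (simp add: u_def d_def)
 have d0: "AE x\<in>interior T in lborel. d (\<lambda>_. 0) x = e x" using g0
 proof eventually_elim
  case (elim x)
  thus ?case using TU QT[of x] interior_subset[of T] by (auto simp: d_def e_def mi_deriv_zero)
 qed
 have wd: "is_weak_deriv T \<nu> e (d \<nu>)" if \<nu>: "mi_size \<nu> \<le> Suc m" for \<nu>
 proof (rule is_weak_derivI)
  show "integrable lborel (u (\<lambda>_. 0))" "integrable lborel (u \<nu>)" using weak_tower_integrable[OF ut] \<nu> z0 by auto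
  show "AE x\<in>interior T in lborel. u (\<lambda>_. 0) x = e x" using d0 by eventually_elim (simp add: ud)
  show "AE x\<in>interior T in lborel. u \<nu> x = d \<nu> x" by (simp add: ud)
 qed (rule weak_tower_integral[OF ut \<nu>])
 show "e \<in> sobolev k p \<omega> T" unfolding sobolev_def
 proof (intro CollectI conjI allI impI)
  show "e \<in> Lp_space p \<omega> (interior T)" using Lp_bridge(1)[OF db Tb d0] fin z0 by simp
  fix \<nu> :: "'n \<Rightarrow> nat" assume "mi_size \<nu> \<le> k"
  hence \<nu>: "mi_size \<nu> \<le> Suc m" using k by simp
  show "\<exists>g\<in>Lp_space p \<omega> (interior T). is_weak_deriv T \<nu> e g"
   using Lp_bridge(1)[OF db[OF \<nu>] Tb, of "d \<nu>"] fin[OF \<nu>] wd[OF \<nu>] by (intro bexI[of _ "d \<nu>"]) auto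
 qed
 obtain I where I: "0 \<le> I" "(\<Sum>\<nu> | mi_size \<nu> = k. wint (interior T) (d \<nu>)) = ennreal I" "sobolev_seminorm k p \<omega> T e = I powr (1 / p)"
  using seminorm_wint[of k T e d d] wd db fin k by auto
 have E: "0 \<le> ?E" by (rule element_const_nonneg[OF beta_pos])
 have "ennreal I \<le> of_nat (card {\<nu> :: 'n \<Rightarrow> nat. mi_size \<nu> = k}) * ennreal (?E * ?H ^ ?j * I')"
  unfolding I(2)[symmetric] by (rule sum_bounded_above) (use est k in auto)
 also have "... \<le> ennreal ?N * ennreal (?E * ?H ^ ?j * I')" unfolding ennreal_of_nat_eq_real_of_nat
  by (intro mult_right_mono ennreal_leI of_nat_mono card_mono finite_mi_le) (use k in auto)
 also have "... = ennreal (?N * (?E * ?H ^ ?j * I'))" using E I'(1) by (intro ennreal_mult[symmetric] mult_nonneg_nonneg) auto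
 finally have "I \<le> ?N * (?E * ?H ^ ?j * I')" using E I'(1) by (subst (asm) ennreal_le_iff) (auto intro!: mult_nonneg_nonneg)
 hence "I powr (1 / p) \<le> (?N * ?E * ?H ^ ?j * I') powr (1 / p)"
  using I(1) p_gt_1 by (intro powr_mono2) (auto simp: mult.assoc)
 also have "... = (?N * ?E) powr (1 / p) * (?H ^ ?j) powr (1 / p) * I' powr (1 / p)"
  using E I'(1) by (simp add: powr_mult)
 also have "(?H ^ ?j) powr (1 / p) = h ^ ?j"
  using h_pos p_gt_1 by (simp add: powr_powr powr_realpow[symmetric] mult.commute)
 finally show "sobolev_seminorm k p \<omega> T e \<le> (?N * ?E) powr (1 / p) * diameter T ^ ?j * sobolev_seminorm (Suc m) p \<omega> ?D v"
  unfolding I(3) I'(3) h_def .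
qed

end

theorem theorem5p2:
  fixes m :: nat and p \<sigma> r :: real and \<psi> :: "real^'n \<Rightarrow> real"
  assumes "1 \<le> m" and "1 < p" and "1 < \<sigma>"
    and "smooth \<psi>" and "(LINT x|lebesgue. \<psi> x) = 1"
    and "0 < r" and "fsupport \<psi> \<subseteq> cball 0 r"
  shows "\<exists>C :: real \<Rightarrow> real.
    \<forall>(\<Omega> :: (real^'n) set) (MM :: (real^'n) set set set) (\<omega> :: real^'n \<Rightarrow> real).
      polyhedral_domain \<Omega> \<and> shape_regular_family \<sigma> \<Omega> MM \<and>
      (\<forall>M\<in>MM. \<forall>z\<in>interior_nodes m \<Omega> M. fsupport (scaled_kernel m \<psi> M z) \<subseteq> node_star M z) \<and>
      Ap_weight p \<omega> \<longrightarrow>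
      (\<forall>M\<in>MM. \<forall>T\<in>M. frontier T \<inter> frontier \<Omega> = {} \<longrightarrow>
        (\<forall>v \<in> sobolev (m + 1) p \<omega> (element_patch m M T). \<forall>k \<le> m + 1.
          (\<lambda>x. v x - quasi_interpolant m \<psi> \<Omega> M v x) \<in> sobolev k p \<omega> T \<and>
          sobolev_seminorm k p \<omega> T (\<lambda>x. v x - quasi_interpolant m \<psi> \<Omega> M v x)
            \<le> C (Ap_const p \<omega>) * diameter T ^ (m + 1 - k) *
              sobolev_seminorm (m + 1) p \<omega> (element_patch m M T) v))"
proof -
 let ?\<beta> = "1 / (4 * \<sigma>)"
 \<comment> \<open>Exported from its locale, \<open>element_const\<close> takes \<psi>, r, p, A, m,
   \<beta> and the cut-off factor as its only arguments; the weight enters through A alone, and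
   domain and mesh not at all.\<close>
 let ?C = "\<lambda>A. (real (card {\<nu> :: 'n \<Rightarrow> nat. mi_size \<nu> \<le> Suc m}) * weighted_moll.element_const \<psi> r p A m ?\<beta> (r + 2)) powr (1 / p)"
 have mol: "mollifier \<psi> r" by (rule mollifierI) fact+
 show ?thesis
 proof (intro exI[of _ ?C] allI impI ballI)
  fix \<Omega> :: "(real^'n) set" and MM :: "(real^'n) set set set" and \<omega> :: "real^'n \<Rightarrow> real" and M T v k
  assume hyps: "polyhedral_domain \<Omega> \<and> shape_regular_family \<sigma> \<Omega> MM \<and>
    (\<forall>M\<in>MM. \<forall>z\<in>interior_nodes m \<Omega> M. fsupport (scaled_kernel m \<psi> M z) \<subseteq> node_star M z) \<and> Ap_weight p \<omega>"
   and M: "M \<in> MM" and T: "T \<in> M" and fr: "frontier T \<inter> frontier \<Omega> = {}"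
   and v: "v \<in> sobolev (m + 1) p \<omega> (element_patch m M T)" and k: "k \<le> m + 1"
  obtain w where w: "muckenhoupt p (Ap_const p \<omega>) w" "AE x in lborel. w x = \<omega> x"
   using muckenhoupt_Ap[of p \<omega>] hyps \<open>1 < p\<close> by blast
  have fm: "fat_mesh M ?\<beta>" using fat_mesh_shape_regular[of \<sigma> \<Omega> MM M] hyps M \<open>1 < \<sigma>\<close> by blast
  have "conforming_mesh \<Omega> M" using hyps M by (simp add: shape_regular_family_def)
  then interpret dm: domain_mesh M ?\<beta> \<Omega> m using fm hyps \<open>1 \<le> m\<close>
   by (intro domain_mesh.intro domain_mesh_axioms.intro) (auto simp: conforming_mesh_def polyhedral_domain_def)
  have T\<Omega>: "T \<subseteq> \<Omega>" by (rule dm.element_in_Omega[OF T fr])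
  interpret quasi_interpolation \<psi> r p "Ap_const p \<omega>" w \<omega> M ?\<beta> T "r + 2" \<Omega> m
  proof (intro quasi_interpolation.intro represented_weight.intro patch.intro weighted_moll.intro
    represented_weight_axioms.intro patch_axioms.intro quasi_interpolation_axioms.intro)
   show "?\<beta> < 1 / 2" using \<open>1 < \<sigma>\<close> by (simp add: field_simps)
   show "1 \<le> r + 2" using \<open>0 < r\<close> by simp
   show "a \<in> interior (\<Union>M)" if "a \<in> verts T" for a
    unfolding dm.interior_Un_M using that dm.verts_subset[OF T] T\<Omega> by blast
   show "fsupport (scaled_kernel m \<psi> M z) \<subseteq> node_star M z" if "z \<in> interior_nodes m \<Omega> M" for z
    using hyps M that by blast
  qed (fact mol w fm T T\<Omega> order_refl dm.domain_mesh_axioms)+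
  show "(\<lambda>x. v x - quasi_interpolant m \<psi> \<Omega> M v x) \<in> sobolev k p \<omega> T \<and>
     sobolev_seminorm k p \<omega> T (\<lambda>x. v x - quasi_interpolant m \<psi> \<Omega> M v x)
      \<le> ?C (Ap_const p \<omega>) * diameter T ^ (m + 1 - k) *
       sobolev_seminorm (m + 1) p \<omega> (element_patch m M T) v"
   using quasi_interpolation_error[of v k] v k by simp
 qed
qed

end
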